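(* The problem $d$-$SC1S$-$R$ — given a binary matrix $M$ and an integer $d\ge0$ (the parameter), decide whether there is a set $R'$ of rows of $M$ with $|R'|\le d$ such that deleting the rows of $R'$ from $M$ yields a matrix with the simultaneous consecutive ones property — is fixed-parameter tractable on general binary matrices, solvable in time $O^*(8^d)$.
   Context: A binary matrix has the consecutive ones property (C1P) for rows if its columns can be permuted so that in every row the $1$-entries occur consecutively; it has the C1P for columns if its rows can be permuted so that in every column the $1$-entries occur consecutively. It has the simultaneous consecutive ones property (SC1P) if it has both. $O^*(f(d))$ denotes $f(d)\cdot N^{O(1)}$ where $N$ is the input size. "General" means no restriction on the number of ones per row or column. *)

theory Defs
  imports
    "HOL-Library.Log_Nat"
    "HOL-Combinatorics.Permutations"
    "HOL-Computational_Algebra.Polynomial"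
    "Jordan_Normal_Form.DL_Submatrix"
begin

section \<open>Consecutive ones properties of binary matrices\<close>

text \<open>A binary matrix is a \<^typ>\<open>bool mat\<close>, an entry \<^const>\<open>True\<close> being a 1-entry.\<close>

definition ones_consecutive :: "bool vec \<Rightarrow> bool" where
  "ones_consecutive v \<longleftrightarrow>
    (\<forall>a b c. a < b \<and> b < c \<and> c < dim_vec v \<and> v $ a \<and> v $ c \<longrightarrow> v $ b)"

definition permute_cols :: "(nat \<Rightarrow> nat) \<Rightarrow> 'a mat \<Rightarrow> 'a mat" where
  "permute_cols p M = mat (dim_row M) (dim_col M) (\<lambda>(i, j). M $$ (i, p j))"

definition permute_rows :: "(nat \<Rightarrow> nat) \<Rightarrow> 'a mat \<Rightarrow> 'a mat" where
  "permute_rows p M = mat (dim_row M) (dim_col M) (\<lambda>(i, j). M $$ (p i, j))"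

definition C1P_rows :: "bool mat \<Rightarrow> bool" where
  "C1P_rows M \<longleftrightarrow>
    (\<exists>p. p permutes {..<dim_col M} \<and>
         (\<forall>i < dim_row M. ones_consecutive (row (permute_cols p M) i)))"

definition C1P_cols :: "bool mat \<Rightarrow> bool" where
  "C1P_cols M \<longleftrightarrow>
    (\<exists>p. p permutes {..<dim_row M} \<and>
         (\<forall>j < dim_col M. ones_consecutive (col (permute_rows p M) j)))"

definition SC1P :: "bool mat \<Rightarrow> bool" where
  "SC1P M \<longleftrightarrow> C1P_rows M \<and> C1P_cols M"

definition delete_rows :: "'a mat \<Rightarrow> nat set \<Rightarrow> 'a mat" where
  "delete_rows M R = submatrix M ({..<dim_row M} - R) {..<dim_col M}"


section \<open>Machine model\<close>

text \<open>
  Programs for a successor random access machine: finitely many registers and finitely many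
  unbounded arrays (those named in the program), all holding natural numbers, with indirect
  addressing. Every instruction and every test takes one time unit. As the only arithmetic is
  increment and (truncated) decrement, after \<open>t\<close> steps no number exceeds the largest input number
  or program constant by more than \<open>t\<close>; charging for the bit lengths of the numbers involved
  would therefore only cost a factor logarithmic in \<open>t\<close> and the input numbers, so that unit cost
  is a realistic measure.
\<close>

datatype prog =
    Skip
  | Const nat nat        \<comment> \<open>\<open>Const x k\<close>: \<open>x := k\<close>\<close>
  | Move nat nat         \<comment> \<open>\<open>Move x y\<close>: \<open>x := y\<close>\<close>
  | Inc nat
  | Dec nat
  | Load nat nat nat     \<comment> \<open>\<open>Load x a y\<close>: \<open>x := a[y]\<close>\<close>
  | Store nat nat nat    \<comment> \<open>\<open>Store a x y\<close>: \<open>a[x] := y\<close>\<close>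
  | Seq prog prog
  | IfNZ nat prog prog
  | WhileNZ nat prog

record state =
  reg :: "nat \<Rightarrow> nat"
  arr :: "nat \<Rightarrow> nat \<Rightarrow> nat"

definition set_reg :: "nat \<Rightarrow> nat \<Rightarrow> state \<Rightarrow> state" where
  "set_reg x v s = s\<lparr>reg := (reg s)(x := v)\<rparr>"

definition set_arr :: "nat \<Rightarrow> nat \<Rightarrow> nat \<Rightarrow> state \<Rightarrow> state" where
  "set_arr a i v s = s\<lparr>arr := (arr s)(a := (arr s a)(i := v))\<rparr>"

text \<open>\<open>exec P s t s'\<close>: started in \<open>s\<close>, the program \<open>P\<close> halts in \<open>s'\<close> after \<open>t\<close> time units.\<close>

inductive exec :: "prog \<Rightarrow> state \<Rightarrow> nat \<Rightarrow> state \<Rightarrow> bool" where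
  Skip: "exec Skip s 1 s"
| Const: "exec (Const x k) s 1 (set_reg x k s)"
| Move: "exec (Move x y) s 1 (set_reg x (reg s y) s)"
| Inc: "exec (Inc x) s 1 (set_reg x (reg s x + 1) s)"
| Dec: "exec (Dec x) s 1 (set_reg x (reg s x - 1) s)"
| Load: "exec (Load x a y) s 1 (set_reg x (arr s a (reg s y)) s)"
| Store: "exec (Store a x y) s 1 (set_arr a (reg s x) (reg s y) s)"
| Seq: "exec P s t s' \<Longrightarrow> exec Q s' u s'' \<Longrightarrow> exec (Seq P Q) s (t + u) s''"
| If_nonzero: "reg s x \<noteq> 0 \<Longrightarrow> exec P s t s' \<Longrightarrow> exec (IfNZ x P Q) s (1 + t) s'"
| If_zero: "reg s x = 0 \<Longrightarrow> exec Q s t s' \<Longrightarrow> exec (IfNZ x P Q) s (1 + t) s'"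
| While_zero: "reg s x = 0 \<Longrightarrow> exec (WhileNZ x P) s 1 s"
| While_nonzero: "reg s x \<noteq> 0 \<Longrightarrow> exec P s t s' \<Longrightarrow> exec (WhileNZ x P) s' u s'' \<Longrightarrow>
    exec (WhileNZ x P) s (1 + t + u) s''"

lemma exec_deterministic:
  "exec P s t s' \<Longrightarrow> exec P s u s'' \<Longrightarrow> u = t \<and> s'' = s'"
proof (induction arbitrary: u s'' rule: exec.induct)
  case (Seq P s t s' Q v r)
  from Seq.prems show ?case by cases (auto dest!: Seq.IH)
next
  case (If_nonzero s x P t s' Q)
  from If_nonzero.prems show ?case by cases (auto simp: If_nonzero.hyps dest!: If_nonzero.IH)
next
  case (If_zero s x Q t s' P)
  from If_zero.prems show ?case by cases (auto simp: If_zero.hyps dest!: If_zero.IH)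
next
  case (While_zero s x P)
  from While_zero.prems show ?case by cases (auto simp: While_zero.hyps)
next
  case (While_nonzero s x P t s' v r)
  from While_nonzero.prems show ?case
    by cases (auto simp: While_nonzero.hyps dest!: While_nonzero.IH)
qed (auto elim: exec.cases)


section \<open>Parameterized problems\<close>

record 'a param_problem =
  yes_instance :: "'a \<Rightarrow> bool"
  parameter :: "'a \<Rightarrow> nat"
  input_size :: "'a \<Rightarrow> nat"
  input_state :: "'a \<Rightarrow> state"   \<comment> \<open>the initial machine state presenting the instance\<close>

text \<open>
  Solvable in time \<open>O*(f(d))\<close>: some program halts on every instance of size \<open>N\<close> and parameter \<open>d\<close>
  within \<open>f(d) \<cdot> p(N)\<close> steps, \<open>p\<close> a fixed polynomial, and leaves the answer (1 for yes, 0 for no)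
  in register 0.
\<close>

definition solvable_in_Ostar :: "'a param_problem \<Rightarrow> (nat \<Rightarrow> nat) \<Rightarrow> bool" where
  "solvable_in_Ostar L f \<longleftrightarrow>
    (\<exists>(P :: prog) (p :: nat poly). \<forall>x. \<exists>t s'.
       exec P (input_state L x) t s' \<and>
       reg s' 0 = of_bool (yes_instance L x) \<and>
       t \<le> f (parameter L x) * poly p (input_size L x))"

definition computable :: "(nat \<Rightarrow> nat) \<Rightarrow> bool" where
  "computable f \<longleftrightarrow>
    (\<exists>P. \<forall>d. \<exists>t s'. exec P \<lparr>reg = (\<lambda>_. 0)(0 := d), arr = (\<lambda>_ _. 0)\<rparr> t s' \<and> reg s' 0 = f d)"

definition fixed_parameter_tractable :: "'a param_problem \<Rightarrow> bool" where
  "fixed_parameter_tractable L \<longleftrightarrow> (\<exists>f. computable f \<and> solvable_in_Ostar L f)"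


section \<open>The problem d-SC1S-R\<close>

text \<open>
  An instance \<open>(M, d)\<close> is presented with the number of rows, the number of columns and \<open>d\<close> in
  registers 0, 1, 2, and the entries of \<open>M\<close> in row-major order in array 0; everything else is 0.
  In the input size, \<^term>\<open>floorlog 2 d\<close> is the number of binary digits of \<open>d\<close>.
\<close>

definition SC1S_R :: "(bool mat \<times> nat) param_problem" where
  "SC1S_R = \<lparr>
     yes_instance = (\<lambda>(M, d).
       \<exists>R'. R' \<subseteq> {..<dim_row M} \<and> card R' \<le> d \<and> SC1P (delete_rows M R')),
     parameter = (\<lambda>(M, d). d),
     input_size = (\<lambda>(M, d). dim_row M * dim_col M + dim_row M + dim_col M + floorlog 2 d),
     input_state = (\<lambda>(M, d).
       \<lparr>reg = (\<lambda>_. 0)(0 := dim_row M, 1 := dim_col M, 2 := d),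
        arr = (\<lambda>a k. if a = 0 \<and> k < dim_row M * dim_col M
                     then of_bool (M $$ (k div dim_col M, k mod dim_col M)) else 0)\<rparr>)\<rparr>"

end

theory Submission
  imports Defs
begin

text \<open>
  Call a matrix locally fine if every selection of 8 rows and 8 columns has the simultaneous consecutive
  ones property. A small obstruction to being locally fine has 8 rows, one of which every solution
  must delete; branching on it gives a search tree with at most \<open>8 ^ d\<close> leaves.

  At a leaf the matrix is locally fine. Regard two rows as adjacent if they share a column. By Tucker's
  theorem (a matrix has the property if no three columns form an asteroidal triple), the only remaining
  obstructions are holes, that is, induced cycles of rows, which are then all long. A minimal set of
  rows whose deletion puts a column \<open>v\<close> off all holes turns out to consist of all rows through two
  columns. So a cheapest such cut is found by trying all pairs of columns, and by exchange it is safe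
  to take it and to go on with the next column.

  The machine has no recursion stack. It runs through all strings of at most \<open>d\<close> octal digits
  with an odometer and follows, for each string, one path of the search tree.
\<close>

section \<open>Matrices without asteroidal triples\<close>

text \<open>The number 8 has two sources. The exclusion of asteroidal triples uses windows with up
  to 8 columns (6 rows and 8 columns in \<open>no_cfg\<close>). The comparison of two deleted rows
  in \<open>nosep\<close> uses a hole minus one row that still has 8 rows; this is available because
  a hole with at most 8 rows is itself a small obstruction. The pivot between local and global
  structure is \<open>short_conn\<close>: in a locally fine matrix without holes, a connection
  between two columns of one row can be shortened to two rows, and asteroidal triples then shrink
  until they fit into a window. The recurring contradiction is \<open>four_links\<close>: a row
  through four successive links of a path of rows violates the property for columns. So windows must
  be fine in both directions even where only the property for rows is at stake. The property for
  columns follows by the same theorem, since \<open>short_conn\<close> for the transpose is a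
  consequence of the property for rows. On the machine, \<open>d\<close> may be exponential in the
  input size, so no polynomial loop may run up to \<open>d\<close>; the budget is cut down to the
  number of rows.\<close>

text \<open>Rows are hyperedges on the columns: columns connected by rows of \<open>R\<close>.\<close>

definition conn :: "('r \<Rightarrow> 'c \<Rightarrow> bool) \<Rightarrow> 'r set \<Rightarrow> 'c set \<Rightarrow> 'c \<Rightarrow> 'c \<Rightarrow> bool" where
  "conn E R V a b \<longleftrightarrow> (a, b) \<in> {(x, y). x \<in> V \<and> y \<in> V \<and> (\<exists>r\<in>R. E r x \<and> E r y)}\<^sup>*"

lemma conn_refl [simp]: "conn E R V a a"
  by (simp add: conn_def)

lemma conn_trans: "conn E R V a b \<Longrightarrow> conn E R V b c \<Longrightarrow> conn E R V a c"
  unfolding conn_def by (rule rtrancl_trans)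

lemma conn_sym: "conn E R V a b \<Longrightarrow> conn E R V b a"
  unfolding conn_def by (rule symD[OF sym_rtrancl]) (auto intro!: symI)

lemma conn_row: "x \<in> V \<Longrightarrow> y \<in> V \<Longrightarrow> r \<in> R \<Longrightarrow> E r x \<Longrightarrow> E r y \<Longrightarrow> conn E R V x y"
  unfolding conn_def by (rule r_into_rtrancl) auto

lemma conn_mono: "conn E R V a b \<Longrightarrow> R \<subseteq> R' \<Longrightarrow> V \<subseteq> V' \<Longrightarrow> conn E R' V' a b"
  unfolding conn_def by (erule rtrancl_mono[THEN subsetD, rotated]) blast

lemma conn_induct [consumes 1, case_names base step]:
  assumes "conn E R V a b" "P a"
    and "\<And>x y r. conn E R V a x \<Longrightarrow> P x \<Longrightarrow> x \<in> V \<Longrightarrow> y \<in> V \<Longrightarrow> r \<in> R \<Longrightarrow> E r x \<Longrightarrow> E r y \<Longrightarrow> P y"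
  shows "P b"
  using assms(1) unfolding conn_def
proof (induction rule: rtrancl_induct)
  case base
  then show ?case by (rule assms(2))
next
  case (step y z)
  then show ?case using assms(3) unfolding conn_def by blast
qed

definition linord :: "'c set \<Rightarrow> ('c \<Rightarrow> 'c \<Rightarrow> bool) \<Rightarrow> bool" where
  "linord V lt \<longleftrightarrow> (\<forall>a\<in>V. \<not> lt a a) \<and>
     (\<forall>a\<in>V. \<forall>b\<in>V. \<forall>c\<in>V. lt a b \<longrightarrow> lt b c \<longrightarrow> lt a c) \<and>
     (\<forall>a\<in>V. \<forall>b\<in>V. a \<noteq> b \<longrightarrow> lt a b \<or> lt b a)"

definition cvx :: "('r \<Rightarrow> 'c \<Rightarrow> bool) \<Rightarrow> 'r set \<Rightarrow> 'c set \<Rightarrow> ('c \<Rightarrow> 'c \<Rightarrow> bool) \<Rightarrow> bool" where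
  "cvx E R V lt \<longleftrightarrow>
     (\<forall>r\<in>R. \<forall>a\<in>V. \<forall>b\<in>V. \<forall>c\<in>V. lt a b \<longrightarrow> lt b c \<longrightarrow> E r a \<longrightarrow> E r c \<longrightarrow> E r b)"

definition c1p :: "('r \<Rightarrow> 'c \<Rightarrow> bool) \<Rightarrow> 'r set \<Rightarrow> 'c set \<Rightarrow> bool" where
  "c1p E R V \<longleftrightarrow> (\<exists>lt. linord V lt \<and> cvx E R V lt)"

lemma linord_irrefl: "linord V lt \<Longrightarrow> a \<in> V \<Longrightarrow> \<not> lt a a"
  and linord_trans: "linord V lt \<Longrightarrow> a \<in> V \<Longrightarrow> b \<in> V \<Longrightarrow> c \<in> V \<Longrightarrow> lt a b \<Longrightarrow> lt b c \<Longrightarrow> lt a c"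
  and linord_total: "linord V lt \<Longrightarrow> a \<in> V \<Longrightarrow> b \<in> V \<Longrightarrow> a \<noteq> b \<Longrightarrow> lt a b \<or> lt b a"
  unfolding linord_def by blast+

lemma cvxD: "cvx E R V lt \<Longrightarrow> r \<in> R \<Longrightarrow> a \<in> V \<Longrightarrow> b \<in> V \<Longrightarrow> c \<in> V \<Longrightarrow> lt a b \<Longrightarrow> lt b c \<Longrightarrow>
    E r a \<Longrightarrow> E r c \<Longrightarrow> E r b"
  unfolding cvx_def by blast

lemma linord_rev: "linord V lt \<Longrightarrow> linord V (\<lambda>a b. lt b a)"
  unfolding linord_def by blast

lemma cvx_rev: "cvx E R V lt \<Longrightarrow> cvx E R V (\<lambda>a b. lt b a)"
  unfolding cvx_def by blast

lemma linord_subset: "linord V lt \<Longrightarrow> W \<subseteq> V \<Longrightarrow> linord W lt"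
  unfolding linord_def by blast

lemma linord_min:
  assumes "linord V lt" "finite V" "V \<noteq> {}"
  shows "\<exists>m\<in>V. \<forall>v\<in>V. v \<noteq> m \<longrightarrow> lt m v"
  using assms(2,3,1)
proof (induction V rule: finite_ne_induct)
  case (singleton x)
  then show ?case by auto
next
  case (insert x F)
  then obtain m where m: "m \<in> F" "\<forall>v\<in>F. v \<noteq> m \<longrightarrow> lt m v"
    using linord_subset[of "insert x F" lt F] by blast
  have "x \<noteq> m" using m insert by auto
  then consider "lt x m" | "lt m x"
    using linord_total[OF insert.prems, of x m] m by auto
  then show ?case
  proof cases
    case 1
    then have "lt x v" if "v \<in> F" for v
      using that m linord_trans[OF insert.prems, of x m v] by (cases "v = m") auto
    then show ?thesis by auto
  qed (use m in auto)
qed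

section \<open>Connections that avoid a column, and Tucker's theorem\<close>

abbreviation cav :: "('r \<Rightarrow> 'c \<Rightarrow> bool) \<Rightarrow> 'r set \<Rightarrow> 'c set \<Rightarrow> 'c \<Rightarrow> 'c \<Rightarrow> 'c \<Rightarrow> bool" where
  "cav E R V z \<equiv> conn E {r \<in> R. \<not> E r z} V"

text \<open>The rows used miss \<open>a\<close>, so no column reached along them is
  \<open>a\<close>.\<close>

lemma cav_ne: "cav E R V a z b \<Longrightarrow> z \<noteq> a \<Longrightarrow> b \<noteq> a"
  by (induction rule: conn_induct) auto

definition atfree :: "('r \<Rightarrow> 'c \<Rightarrow> bool) \<Rightarrow> 'r set \<Rightarrow> 'c set \<Rightarrow> bool" where
  "atfree E R V \<longleftrightarrow> (\<forall>a\<in>V. \<forall>b\<in>V. \<forall>c\<in>V. a \<noteq> b \<longrightarrow> b \<noteq> c \<longrightarrow> a \<noteq> c \<longrightarrow>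
     \<not> (cav E R V c a b \<and> cav E R V a b c \<and> cav E R V b a c))"

lemma cav_mono: "cav E R V z a b \<Longrightarrow> R \<subseteq> R' \<Longrightarrow> V \<subseteq> V' \<Longrightarrow> cav E R' V' z a b"
  by (erule conn_mono) auto

lemma atfree_subset: "atfree E R V \<Longrightarrow> S \<subseteq> R \<Longrightarrow> W \<subseteq> V \<Longrightarrow> atfree E S W"
  unfolding atfree_def using cav_mono[of E S _ W _ _ R V] by blast

text \<open>The first column \<open>z\<close> of a consecutive order has this property: if
  \<open>z\<close>, \<open>a\<close>, \<open>b\<close> come in this order, a connection from
  \<open>z\<close> to \<open>b\<close> has to cross \<open>a\<close> and so uses a row through
  \<open>a\<close>. Conversely, it is the condition under which an order starting at
  \<open>z\<close> is constructed.\<close>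

definition is_end :: "('r \<Rightarrow> 'c \<Rightarrow> bool) \<Rightarrow> 'r set \<Rightarrow> 'c set \<Rightarrow> 'c \<Rightarrow> bool" where
  "is_end E R V z \<longleftrightarrow> (\<forall>a\<in>V-{z}. \<forall>b\<in>V-{z}. a \<noteq> b \<longrightarrow> \<not> (cav E R V a z b \<and> cav E R V b z a))"

text \<open>Follow the connection until it uses a row through \<open>b\<close>. In contrapositive
  form this is transitivity of the relation that \<open>a\<close> separates \<open>b\<close> from
  \<open>z\<close>.\<close>

lemma cav_split:
  assumes bV: "b \<in> V"
  shows "cav E R V a z c \<Longrightarrow> cav E R V b z c \<or> cav E R V a z b"
proof (induction rule: conn_induct)
  case base
  then show ?case by simp
next
  case (step x y r)
  show ?case
  proof (cases "E r b")
    case True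
    then have "cav E R V a x b" using step bV by (intro conn_row[where r = r]) auto
    then show ?thesis using conn_trans[OF step.hyps(1)] by blast
  next
    case False
    then have "cav E R V b x y" using step bV by (intro conn_row[where r = r]) auto
    then show ?thesis using step.IH conn_trans[of E _ V z x y] by blast
  qed
qed

text \<open>Columns are compared by whether one separates the other from \<open>z\<close>. As
  \<open>z\<close> is an end, this is a total preorder. Its classes are smaller than
  \<open>V\<close>, are ordered by induction, and are strung together behind
  \<open>z\<close>.\<close>

lemma anchored_step:
  assumes fin: "finite V" and atf: "atfree E R V" and zV: "z \<in> V" and zend: "is_end E R V z"
    and IHu: "\<And>V' R'. finite V' \<Longrightarrow> card V' < card V \<Longrightarrow> atfree E R' V' \<Longrightarrow> c1p E R' V'"
    and IHa: "\<And>V' R' w. finite V' \<Longrightarrow> card V' < card V \<Longrightarrow> atfree E R' V' \<Longrightarrow> w \<in> V' \<Longrightarrow>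
        is_end E R' V' w \<Longrightarrow> \<exists>lt. linord V' lt \<and> cvx E R' V' lt \<and> (\<forall>v\<in>V'-{w}. lt w v)"
  shows "\<exists>lt. linord V lt \<and> cvx E R V lt \<and> (\<forall>v\<in>V-{z}. lt z v)"
proof -
  \<comment> \<open>Every connection from \<open>z\<close> to \<open>b\<close> uses a row through
    \<open>a\<close>, so \<open>a\<close> should be placed no later than \<open>b\<close>.\<close>
  define le where "le a b \<longleftrightarrow> \<not> cav E R V a z b" for a b
  define W where "W = V - {z}"
  have finW: "finite W" using fin by (simp add: W_def)
  have le_refl: "le a a" if "a \<in> W" for a
    using cav_ne[of E R a V z a] that by (auto simp: le_def W_def)
  have le_trans: "le a c" if "le a b" "le b c" "b \<in> W" for a b c
    using that cav_split[of b V E R a z c] by (auto simp: le_def W_def)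
  have le_total: "le a b \<or> le b a" if "a \<in> W" "b \<in> W" for a b
    using zend[unfolded is_end_def, rule_format, of a b] that le_refl[of a] by (cases "a = b") (auto simp: le_def W_def)
  have fact: "le b a" if "a \<in> W" "b \<in> W" "c \<in> W" "r \<in> R" "E r a" "E r c" "\<not> E r b" "le b c" for a b c r
  proof (rule ccontr)
    assume "\<not> le b a"
    then have "cav E R V b z a" by (simp add: le_def)
    moreover have "cav E R V b a c" using that by (intro conn_row[where r = r]) (auto simp: W_def)
    ultimately have "cav E R V b z c" by (rule conn_trans)
    then show False using that by (simp add: le_def)
  qed
  have factz: "E r b" if "b \<in> W" "c \<in> W" "r \<in> R" "E r z" "E r c" "le b c" for b c r
  proof (rule ccontr)
    assume "\<not> E r b"
    then have "cav E R V b z c" using that zV by (intro conn_row[where r = r]) (auto simp: W_def)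
    then show False using that by (simp add: le_def)
  qed
  define Q where "Q a = {b \<in> W. le a b \<and> le b a}" for a
  have Q_eq: "Q a = Q b" if "a \<in> W" "b \<in> W" "le a b" "le b a" for a b
    using that le_trans unfolding Q_def by blast
  \<comment> \<open>A row that reaches a class from an earlier one contains the whole class by
    \<open>fact\<close>. A row that continues to a later class has to occupy a final segment of this
    one, which is the last requirement on \<open>g\<close>.\<close>
  have inner: "\<exists>g. linord (Q q) g \<and>
      (\<forall>r\<in>R. \<forall>a\<in>Q q. \<forall>b\<in>Q q. \<forall>c\<in>Q q. g a b \<longrightarrow> g b c \<longrightarrow> E r a \<longrightarrow> E r c \<longrightarrow> E r b) \<and>
      (\<forall>r\<in>R. \<forall>a\<in>Q q. \<forall>b\<in>Q q. \<forall>c\<in>W. g a b \<longrightarrow> le b c \<longrightarrow> \<not> le c b \<longrightarrow> E r a \<longrightarrow> E r c \<longrightarrow> E r b)"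
    if qW: "q \<in> W" for q
  proof -
    define RQ where "RQ = {r \<in> R. \<exists>b\<in>Q q. \<not> E r b}"
    define L where "L = {c \<in> W. le q c \<and> \<not> le c q}"
    define U where "U = {r \<in> RQ. (\<exists>a\<in>Q q. E r a) \<and> (\<exists>c\<in>L. E r c)}"
    have QW: "Q q \<subseteq> W" by (auto simp: Q_def)
    have L_later: "le b c \<and> \<not> le c b \<longleftrightarrow> c \<in> L" if "b \<in> Q q" "c \<in> W" for b c
      using that qW le_trans unfolding Q_def L_def by blast
    show ?thesis
    proof (cases "U = {}")
      case True
      have "card (Q q) < card V"
        by (rule psubset_card_mono[OF fin]) (use zV in \<open>auto simp: Q_def W_def\<close>)
      then have "c1p E RQ (Q q)"
        using atfree_subset[OF atf, of RQ "Q q"] finite_subset[OF QW finW] QW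
        by (intro IHu) (auto simp: RQ_def W_def)
      then obtain g where g: "linord (Q q) g" "cvx E RQ (Q q) g" unfolding c1p_def by blast
      have "E r b" if "r \<in> R" "a \<in> Q q" "b \<in> Q q" "c \<in> Q q" "g a b" "g b c" "E r a" "E r c" for r a b c
      proof (rule ccontr)
        assume "\<not> E r b"
        then have "r \<in> RQ" using that by (auto simp: RQ_def)
        then show False using cvxD[OF g(2)] that \<open>\<not> E r b\<close> by blast
      qed
      moreover have "E r b" if "r \<in> R" "a \<in> Q q" "b \<in> Q q" "c \<in> W" "le b c" "\<not> le c b" "E r a" "E r c" for r a b c
        using True that L_later by (auto simp: U_def RQ_def)
      ultimately show ?thesis using g(1) by blast
    next
      case False
      define LU where "LU = {c \<in> L. \<exists>r\<in>U. E r c}"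
      have finLU: "finite LU" using finW by (auto simp: LU_def L_def)
      have "LU \<noteq> {}" using False by (auto simp: LU_def U_def)
      have "\<exists>w\<in>LU. \<forall>c\<in>LU. le w c"
      proof -
        have mn: "\<exists>w\<in>A. \<forall>c\<in>A. le w c" if "finite A" "A \<noteq> {}" "A \<subseteq> W" for A
          using that
        proof (induction A rule: finite_ne_induct)
          case (singleton x)
          then show ?case using le_refl by auto
        next
          case (insert x F)
          then obtain w where w: "w \<in> F" "\<forall>c\<in>F. le w c" by auto
          then consider "le x w" | "le w x" using le_total insert.prems by blast
          then show ?case
          proof cases
            case 1
            then have "\<forall>c\<in>insert x F. le x c"
              using w insert.prems le_trans[of x w] le_refl by blast
            then show ?thesis by blast
          qed (use w in auto)
        qed
        show ?thesis by (rule mn[OF finLU \<open>LU \<noteq> {}\<close>]) (auto simp: LU_def L_def)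
      qed
      \<comment> \<open>\<open>w\<close> is an earliest column behind the class on a row of
        \<open>U\<close>. All rows of \<open>U\<close> contain \<open>w\<close>, so they become
        final segments of the class if \<open>w\<close> is ordered together with the class as its
        last column.\<close>
      then obtain w where w: "w \<in> LU" "\<And>c. c \<in> LU \<Longrightarrow> le w c" by blast
      have wL: "w \<in> L" using w(1) by (simp add: LU_def)
      have wW: "w \<in> W" using wL by (simp add: L_def)
      have wQ: "w \<notin> Q q" using wL by (auto simp: L_def Q_def)
      have cw: "cav E R V w z a" if "a \<in> Q q" for a
        using L_later[OF that wW] wL by (simp add: le_def)
      have Uw: "E r w" if r: "r \<in> U" for r
      proof (rule ccontr)
        assume nw: "\<not> E r w"
        obtain a c where ac: "a \<in> Q q" "E r a" "c \<in> L" "E r c" using r by (auto simp: U_def)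
        have "c \<in> LU" using ac r by (auto simp: LU_def)
        have "cav E R V w a c"
          using ac nw r QW by (intro conn_row[where r = r]) (auto simp: U_def RQ_def L_def W_def)
        then have "cav E R V w z c" using conn_trans[OF cw[OF ac(1)]] by blast
        then show False using w(2)[OF \<open>c \<in> LU\<close>] by (simp add: le_def)
      qed
      define V' where "V' = insert w (Q q)"
      have V'V: "V' \<subseteq> V" using wW QW by (auto simp: V'_def W_def)
      have finV': "finite V'" using V'V fin finite_subset by blast
      have zV': "z \<notin> V'" using wW QW by (auto simp: V'_def W_def)
      have "card V' < card V"
        by (rule psubset_card_mono[OF fin]) (use zV V'V zV' in auto)
      moreover have atf': "atfree E RQ V'"
        by (rule atfree_subset[OF atf _ V'V]) (auto simp: RQ_def)
      \<comment> \<open>Two columns of the class are connected to \<open>z\<close>, hence to each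
        other, without rows through \<open>w\<close>. So a violation would be an asteroidal triple
        with \<open>w\<close>.\<close>
      moreover have "is_end E RQ V' w"
        unfolding is_end_def
      proof (intro ballI impI notI, elim conjE)
        fix a b assume a: "a \<in> V' - {w}" and b: "b \<in> V' - {w}" and ne: "a \<noteq> b"
          and c1: "cav E RQ V' a w b" and c2: "cav E RQ V' b w a"
        have aQ: "a \<in> Q q" "b \<in> Q q" using a b by (auto simp: V'_def)
        have RQR: "RQ \<subseteq> R" by (auto simp: RQ_def)
        have "cav E R V w a b" using conn_trans[OF conn_sym[OF cw[OF aQ(1)]] cw[OF aQ(2)]] .
        moreover have "cav E R V a b w" using conn_sym[OF cav_mono[OF c1 RQR V'V]] .
        moreover have "cav E R V b a w" using conn_sym[OF cav_mono[OF c2 RQR V'V]] .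
        ultimately show False
          using atf aQ wW ne a b QW unfolding atfree_def W_def by blast
      qed
      ultimately obtain g where g: "linord V' g" "cvx E RQ V' g" "\<forall>v\<in>V'-{w}. g w v"
        using IHa[OF finV', of RQ w] by (auto simp: V'_def)
      \<comment> \<open>The induction gives an order that starts at \<open>w\<close>; reversed, it
        ends there.\<close>
      define h where "h a b = g b a" for a b
      have lin: "linord (Q q) h"
        unfolding h_def by (rule linord_rev, rule linord_subset[OF g(1)]) (auto simp: V'_def)
      have "E r b" if "r \<in> R" "a \<in> Q q" "b \<in> Q q" "c \<in> Q q" "h a b" "h b c" "E r a" "E r c" for r a b c
      proof (rule ccontr)
        assume "\<not> E r b"
        then have "r \<in> RQ" using that by (auto simp: RQ_def)
        then show False using cvxD[OF g(2), of r c b a] that \<open>\<not> E r b\<close> by (auto simp: h_def V'_def)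
      qed
      moreover have "E r b" if "r \<in> R" "a \<in> Q q" "b \<in> Q q" "c \<in> W" "h a b" "le b c" "\<not> le c b" "E r a" "E r c" for r a b c
      proof (rule ccontr)
        assume nb: "\<not> E r b"
        have "c \<in> L" using that L_later by blast
        then have "r \<in> U" using that nb by (auto simp: U_def RQ_def)
        then have "E r w" by (rule Uw)
        have "r \<in> RQ" using \<open>r \<in> U\<close> by (simp add: U_def)
        have "g w b" using g(3) that wQ by (auto simp: V'_def)
        then show False
          using cvxD[OF g(2) \<open>r \<in> RQ\<close>, of w b a] that nb \<open>E r w\<close> by (auto simp: h_def V'_def)
      qed
      ultimately show ?thesis using lin by blast
    qed
  qed
  define PG where "PG S g \<longleftrightarrow> linord S g \<and>
      (\<forall>r\<in>R. \<forall>a\<in>S. \<forall>b\<in>S. \<forall>c\<in>S. g a b \<longrightarrow> g b c \<longrightarrow> E r a \<longrightarrow> E r c \<longrightarrow> E r b) \<and>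
      (\<forall>r\<in>R. \<forall>a\<in>S. \<forall>b\<in>S. \<forall>c\<in>W. g a b \<longrightarrow> le b c \<longrightarrow> \<not> le c b \<longrightarrow> E r a \<longrightarrow> E r c \<longrightarrow> E r b)" for S g
  have "\<forall>S\<in>Q ` W. \<exists>g. PG S g" using inner unfolding PG_def by blast
  from bchoice[OF this] obtain G where G': "\<forall>S\<in>Q ` W. PG S (G S)" by blast
  have GP: "PG (Q q) (G (Q q))" if "q \<in> W" for q using G' that by blast
  have G1: "linord (Q q) (G (Q q))" if "q \<in> W" for q using GP[OF that] by (simp add: PG_def)
  have G2: "E r b" if "q \<in> W" "r \<in> R" "a \<in> Q q" "b \<in> Q q" "c \<in> Q q" "G (Q q) a b" "G (Q q) b c" "E r a" "E r c"
    for q r a b c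
    using GP[OF that(1), unfolded PG_def, THEN conjunct2, THEN conjunct1, rule_format, OF that(2-)] .
  have G3: "E r b" if "q \<in> W" "r \<in> R" "a \<in> Q q" "b \<in> Q q" "c \<in> W" "G (Q q) a b" "le b c" "\<not> le c b" "E r a" "E r c"
    for q r a b c
    using GP[OF that(1), unfolded PG_def, THEN conjunct2, THEN conjunct2, rule_format, OF that(2-)] .
  define lt' where "lt' a b \<longleftrightarrow> le a b \<and> (le b a \<longrightarrow> G (Q a) a b)" for a b
  define lt where "lt a b \<longleftrightarrow> (a = z \<and> b \<noteq> z) \<or> (a \<noteq> z \<and> b \<noteq> z \<and> lt' a b)" for a b
  have inQ: "b \<in> Q a" if "b \<in> W" "le a b" "le b a" for a b using that by (auto simp: Q_def)
  have irr: "\<not> lt' a a" if "a \<in> W" for a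
    using linord_irrefl[OF G1[OF that], of a] inQ le_refl that by (auto simp: lt'_def)
  have tot: "lt' a b \<or> lt' b a" if "a \<in> W" "b \<in> W" "a \<noteq> b" for a b
  proof (cases "le a b \<and> le b a")
    case True
    then have "G (Q a) a b \<or> G (Q a) b a"
      using linord_total[OF G1[OF that(1)], of a b] inQ le_refl that by auto
    then show ?thesis using True Q_eq[OF that(1,2)] by (auto simp: lt'_def)
  next
    case False
    then show ?thesis using le_total[OF that(1,2)] by (auto simp: lt'_def)
  qed
  have tra: "lt' a c" if abc: "a \<in> W" "b \<in> W" "c \<in> W" and ab: "lt' a b" and bc: "lt' b c" for a b c
  proof -
    have 1: "le a b" "le b c" using ab bc by (auto simp: lt'_def)
    have 2: "le a c" using 1 abc le_trans by blast
    show ?thesis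
    proof (cases "le c a")
      case False
      then show ?thesis using 2 by (simp add: lt'_def)
    next
      case True
      have "le b a" "le c b" using True 1 abc le_trans by blast+
      then have "G (Q a) a b" "G (Q a) b c"
        using ab bc Q_eq[OF abc(1,2)] 1 by (auto simp: lt'_def)
      moreover have "a \<in> Q a" "b \<in> Q a" "c \<in> Q a" using inQ abc le_refl 1 2 True \<open>le b a\<close> by auto
      ultimately have "G (Q a) a c" using linord_trans[OF G1[OF abc(1)], of a b c] by blast
      then show ?thesis using 2 by (simp add: lt'_def)
    qed
  qed
  have cv: "E r b" if abc: "a \<in> W" "b \<in> W" "c \<in> W" and ab: "lt' a b" and bc: "lt' b c"
      and r: "r \<in> R" "E r a" "E r c" for r a b c
  proof (rule ccontr)
    assume nb: "\<not> E r b"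
    have 1: "le a b" "le b c" using ab bc by (auto simp: lt'_def)
    have ba: "le b a" using fact[OF abc r nb 1(2)] .
    have gab: "G (Q a) a b" using ab ba by (simp add: lt'_def)
    have aQ: "a \<in> Q a" "b \<in> Q a" using inQ abc le_refl 1 ba by auto
    show False
    proof (cases "le c b")
      case False
      then show False using G3[OF abc(1) r(1) aQ abc(3) gab 1(2) False r(2,3)] nb by simp
    next
      case True
      then have "G (Q a) b c" using bc Q_eq[OF abc(1,2) 1(1) ba] by (simp add: lt'_def)
      moreover have "c \<in> Q a" using inQ[of c a] abc 1 ba True le_trans by blast
      ultimately show False using G2[OF abc(1) r(1) aQ _ gab] r nb by blast
    qed
  qed
  have "linord V lt"
    unfolding linord_def
  proof (intro conjI ballI impI)
    fix a b c assume "a \<in> V" "b \<in> V" "c \<in> V" "lt a b" "lt b c"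
    then show "lt a c" using tra[of a b c] by (auto simp: lt_def W_def)
  next
    fix a b assume "a \<in> V" "b \<in> V" "a \<noteq> b"
    then show "lt a b \<or> lt b a" using tot[of a b] by (auto simp: lt_def W_def)
  qed (use irr in \<open>auto simp: lt_def W_def\<close>)
  moreover have "cvx E R V lt"
    unfolding cvx_def
  proof (intro ballI impI)
    fix r a b c assume r: "r \<in> R" and abc: "a \<in> V" "b \<in> V" "c \<in> V" and lt: "lt a b" "lt b c"
      and E: "E r a" "E r c"
    have bc: "b \<in> W" "c \<in> W" "lt' b c" using lt abc by (auto simp: lt_def W_def)
    show "E r b"
    proof (cases "a = z")
      case True
      then show ?thesis using factz[OF bc(1,2) r] E bc(3) by (simp add: lt'_def)
    next
      case False
      then show ?thesis using cv[of a b c r] abc lt bc r E by (auto simp: lt_def W_def)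
    qed
  qed
  moreover have "\<forall>v\<in>V-{z}. lt z v" by (simp add: lt_def)
  ultimately show ?thesis by blast
qed

text \<open>Among the components left after dropping the rows through one column, \<open>D\<close>
  is a largest one. Maximality forces any two columns that keep a candidate from being an end into
  \<open>Z\<close>, the columns contained in all rows that leave \<open>D\<close>. The first column
  of \<open>Z\<close> in a consecutive order of the complement of \<open>D\<close> is then an
  end.\<close>

lemma ex_end:
  assumes fin: "finite V" and ne: "V \<noteq> {}" and atf: "atfree E R V"
    and IHu: "\<And>V' R'. finite V' \<Longrightarrow> card V' < card V \<Longrightarrow> atfree E R' V' \<Longrightarrow> c1p E R' V'"
  shows "\<exists>z\<in>V. is_end E R V z"
proof (cases "\<exists>z\<in>V. \<exists>x\<in>V. x \<noteq> z")
  case False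
  then have "is_end E R V z" if "z \<in> V" for z using that by (auto simp: is_end_def)
  then show ?thesis using ne by blast
next
  case True
  define C where "C z x = {y \<in> V. cav E R V z x y}" for z x
  define P where "P = {(z, x). z \<in> V \<and> x \<in> V \<and> x \<noteq> z}"
  have "finite P" by (rule finite_subset[of _ "V \<times> V"]) (auto simp: P_def fin)
  moreover have "P \<noteq> {}" using True by (auto simp: P_def)
  ultimately obtain p where p: "p \<in> P" "card (C (fst p) (snd p)) = Max ((\<lambda>p. card (C (fst p) (snd p))) ` P)"
    by (metis (mono_tags, lifting) Max_in finite_imageI image_iff image_is_empty)
  have "card (C (fst q) (snd q)) \<le> card (C (fst p) (snd p))" if "q \<in> P" for q
    unfolding p(2) using \<open>finite P\<close> that by (intro Max_ge) auto
  with p(1) obtain zx where "zx \<in> P"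
    and "\<And>p. p \<in> P \<Longrightarrow> card (C (fst p) (snd p)) \<le> card (C (fst zx) (snd zx))"
    by blast
  then obtain z x where zx: "z \<in> V" "x \<in> V" "x \<noteq> z"
    and mx: "\<And>u v. u \<in> V \<Longrightarrow> v \<in> V \<Longrightarrow> v \<noteq> u \<Longrightarrow> card (C u v) \<le> card (C z x)"
    by (cases zx) (auto simp: P_def)
  define D where "D = C z x"
  have D: "D \<subseteq> V" "x \<in> D" "z \<notin> D"
    using zx cav_ne[of E R z V x z] by (auto simp: D_def C_def)
  have leave: "E r z" if "r \<in> R" "y \<in> D" "E r y" "v \<in> V - D" "E r v" for r y v
  proof (rule ccontr)
    assume "\<not> E r z"
    then have "cav E R V z y v" using that D by (intro conn_row[where r = r]) auto
    then have "v \<in> D" using that conn_trans[of E "{r \<in> R. \<not> E r z}" V x y v] by (simp add: D_def C_def)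
    then show False using that by simp
  qed
  define Z where "Z = {v \<in> V - D. \<forall>r\<in>R. \<forall>y\<in>D. \<forall>u\<in>V-D. E r y \<longrightarrow> E r u \<longrightarrow> E r v}"
  have zZ: "z \<in> Z" using zx D leave by (auto simp: Z_def)
  \<comment> \<open>A row of the component that avoids \<open>u\<close> cannot contain
    \<open>a\<close>: it would leave \<open>D\<close> and therefore contain
    \<open>u\<close>.\<close>
  have within: "cav E R V a x y" if "a \<in> V - D" "y \<in> D" "u \<in> Z" "C u x = D" for a y u
  proof -
    have "cav E R V u x y" using that by (auto simp: C_def)
    then have "cav E R V a x y \<and> y \<in> D"
    proof (induction rule: conn_induct)
      case base
      then show ?case using D by simp
    next
      case (step p q r)
      have "q \<in> D"
      proof -
        have "cav E R V u p q" using step by (intro conn_row[where r = r]) auto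
        then show ?thesis using step that conn_trans[of E "{r \<in> R. \<not> E r u}" V x p q] by (auto simp: C_def)
      qed
      moreover have "\<not> E r a"
        using that step unfolding Z_def by blast
      then have "cav E R V a p q" using step by (intro conn_row[where r = r]) auto
      ultimately show ?case using step.IH conn_trans[of E "{r \<in> R. \<not> E r a}" V x p q] by blast
    qed
    then show ?thesis by simp
  qed
  \<comment> \<open>Otherwise some row leaving \<open>D\<close> misses \<open>a\<close> but contains
    \<open>u\<close>, and the component of \<open>u\<close> avoiding \<open>a\<close> contains
    \<open>D\<close> and \<open>u\<close>, which is too large.\<close>
  have on_hole: "a \<in> Z" if uZ: "u \<in> Z" "C u x = D" and a: "a \<in> V - {u}" and b: "b \<in> V - {u}" and ab: "a \<noteq> b"
      and c1: "cav E R V a u b" and c2: "cav E R V b u a" and nD: "a \<notin> D" for u a b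
  proof (rule ccontr)
    assume nZ: "a \<notin> Z"
    then obtain r y v where r: "r \<in> R" "y \<in> D" "v \<in> V - D" "E r y" "E r v" "\<not> E r a"
      using a nD by (auto simp: Z_def)
    have "E r u" using uZ r unfolding Z_def by blast
    have uD: "u \<notin> D" "u \<in> V" using uZ by (auto simp: Z_def)
    have f1: "cav E R V a y u" using r uD D \<open>E r u\<close> by (intro conn_row[where r = r]) auto
    have f2: "cav E R V a x p" if "p \<in> D" for p using within[of a p u] that uZ a nD by blast
    have "cav E R V a u p" if "p \<in> D" for p
      by (rule conn_trans[OF conn_sym[OF f1] conn_trans[OF conn_sym[OF f2[OF r(2)]] f2[OF that]]])
    then have "insert u D \<subseteq> C a u" using uD D by (auto simp: C_def)
    moreover have "finite (C a u)" using fin by (simp add: C_def)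
    ultimately have "card (insert u D) \<le> card (C a u)" by (rule card_mono[rotated])
    moreover have "card (insert u D) = Suc (card D)"
      using uD finite_subset[OF D(1) fin] by simp
    ultimately show False using mx[of a u] a uD by (auto simp: D_def)
  qed
  have bad2: "a \<in> Z \<and> b \<in> Z" if uZ: "u \<in> Z" "C u x = D" and a: "a \<in> V - {u}" and b: "b \<in> V - {u}" and ab: "a \<noteq> b"
      and c1: "cav E R V a u b" and c2: "cav E R V b u a" for u a b
  proof -
    have uV: "u \<in> V" "u \<notin> D" using uZ by (auto simp: Z_def)
    have nab: "\<not> cav E R V u a b"
      using atf[unfolded atfree_def, rule_format, of a b u] conn_sym[OF c1] conn_sym[OF c2] a b ab uV by auto
    have nboth: "\<not> (p \<in> D \<and> q \<in> D)" if "\<not> cav E R V u p q" for p q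
    proof
      assume "p \<in> D \<and> q \<in> D"
      then have pq: "cav E R V u x p" "cav E R V u x q" using uZ(2) by (auto simp: C_def)
      show False using that conn_trans[OF conn_sym[OF pq(1)] pq(2)] by simp
    qed
    \<comment> \<open>Here \<open>u\<close> is connected into \<open>D\<close> without rows through
      \<open>q\<close>, so the component of \<open>u\<close> avoiding \<open>q\<close> is again too
      large.\<close>
    have one: "p \<notin> D" if p: "p \<in> V - {u}" and q: "q \<in> V - {u}" and pq: "p \<noteq> q" and cq: "cav E R V q u p"
      and qD: "q \<notin> D" for p q
    proof
      assume pD: "p \<in> D"
      have f2: "cav E R V q x v" if "v \<in> D" for v using within[of q v u] that uZ q qD by blast
      have "cav E R V q u v" if "v \<in> D" for v
        by (rule conn_trans[OF cq conn_trans[OF conn_sym[OF f2[OF pD]] f2[OF that]]])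
      then have "insert u D \<subseteq> C q u" using uV D by (auto simp: C_def)
      moreover have "finite (C q u)" using fin by (simp add: C_def)
      ultimately have "card (insert u D) \<le> card (C q u)" by (rule card_mono[rotated])
      moreover have "card (insert u D) = Suc (card D)"
        using uV finite_subset[OF D(1) fin] by simp
      ultimately show False using mx[of q u] q uV by (auto simp: D_def)
    qed
    have "a \<notin> D \<or> b \<notin> D" using nboth[OF nab] by blast
    then have nD: "a \<notin> D" "b \<notin> D" using one[OF a b ab c2] one[OF b a ab[symmetric] c1] by blast+
    show ?thesis using on_hole[OF uZ a b ab c1 c2 nD(1)] on_hole[OF uZ b a ab[symmetric] c2 c1 nD(2)] by simp
  qed
  have "card (V - D) < card V"
    by (rule psubset_card_mono[OF fin]) (use D in auto)
  then have "c1p E R (V - D)"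
    using atfree_subset[OF atf, of R "V - D"] fin by (intro IHu) auto
  then obtain g where g: "linord (V - D) g" "cvx E R (V - D) g" unfolding c1p_def by blast
  have "Z \<subseteq> V - D" by (auto simp: Z_def)
  then have Z: "linord Z g" "finite Z" "Z \<noteq> {}"
    using linord_subset[OF g(1)] finite_subset[of Z V] fin zZ by auto
  obtain u where u: "u \<in> Z" "\<And>v. v \<in> Z \<Longrightarrow> v \<noteq> u \<Longrightarrow> g u v"
    using linord_min[OF Z] by blast
  have uD: "u \<in> V" "u \<notin> D" using u by (auto simp: Z_def)
  have CuD: "C u x = D"
  proof
    show "C u x \<subseteq> D"
    proof
      fix y assume "y \<in> C u x"
      then have "cav E R V u x y" by (simp add: C_def)
      then show "y \<in> D"
      proof (induction rule: conn_induct)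
        case base
        then show ?case using D by simp
      next
        case (step p q r)
        then show ?case using u(1) unfolding Z_def by blast
      qed
    qed
    have "C z x = D" by (simp add: D_def)
    then have "cav E R V u x y" if "y \<in> D" for y using within[of u y z] zZ uD that by blast
    then show "D \<subseteq> C u x" using D by (auto simp: C_def)
  qed
  have "is_end E R V u"
    unfolding is_end_def
  proof (intro ballI impI notI, elim conjE)
    fix a b assume ab: "a \<in> V - {u}" "b \<in> V - {u}" "a \<noteq> b" and c: "cav E R V a u b" "cav E R V b u a"
    have Zab: "a \<in> Z" "b \<in> Z" using bad2[OF u(1) CuD ab c] by auto
    \<comment> \<open>The connection cannot enter \<open>D\<close>, since every row leaving
      \<open>D\<close> contains \<open>p\<close>, and it cannot jump over \<open>p\<close> in the
      order \<open>g\<close>. So it stays before \<open>p\<close> and never reaches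
      \<open>q\<close>.\<close>
    have key: False if pq: "p \<in> Z" "q \<in> Z" "p \<noteq> u" "q \<noteq> u" "g p q" and cp: "cav E R V p u q" for p q
    proof -
      have "q \<in> V - D \<and> g q p"
        using cp
      proof (induction rule: conn_induct)
        case base
        then show ?case using uD u(2) pq by auto
      next
        case (step s t r)
        have "t \<notin> D" using step pq(1) unfolding Z_def by blast
        have "t \<noteq> p" using step by auto
        moreover have "\<not> g p t"
        proof
          assume "g p t"
          then have "E r p"
            using cvxD[OF g(2), of r s p t] step \<open>t \<notin> D\<close> pq(1) by (auto simp: Z_def)
          then show False using step by simp
        qed
        ultimately show ?case
          using linord_total[OF g(1), of p t] step \<open>t \<notin> D\<close> pq(1) by (auto simp: Z_def)
      qed
      then show False
        using pq linord_trans[OF g(1), of p q p] linord_irrefl[OF g(1), of p] by (auto simp: Z_def)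
    qed
    have "g a b \<or> g b a" using linord_total[OF g(1), of a b] Zab ab by (auto simp: Z_def)
    then show False using key[of a b] key[of b a] Zab ab c by auto
  qed
  then show ?thesis using uD by blast
qed

text \<open>The plain and the anchored statement need a common induction on the number of columns:
  the anchored step uses both for fewer columns, and the plain statement is the anchored one at an
  end.\<close>

theorem tucker:
  assumes "finite V" "atfree E R V"
  shows "c1p E R V"
proof -
  have "(\<forall>R. atfree E R V \<longrightarrow> c1p E R V) \<and>
        (\<forall>R z. atfree E R V \<longrightarrow> z \<in> V \<longrightarrow> is_end E R V z \<longrightarrow>
           (\<exists>lt. linord V lt \<and> cvx E R V lt \<and> (\<forall>v\<in>V-{z}. lt z v)))"
    using assms(1)
  proof (induction "card V" arbitrary: V rule: less_induct)
    case less
    have IHu: "c1p E R' V'" if "finite V'" "card V' < card V" "atfree E R' V'" for V' R'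
      using less.hyps[OF that(2,1)] that(3) by blast
    have IHa: "\<exists>lt. linord V' lt \<and> cvx E R' V' lt \<and> (\<forall>v\<in>V'-{w}. lt w v)"
      if "finite V'" "card V' < card V" "atfree E R' V'" "w \<in> V'" "is_end E R' V' w" for V' R' w
      using less.hyps[OF that(2,1)] that(3-) by blast
    have anch: "\<exists>lt. linord V lt \<and> cvx E R V lt \<and> (\<forall>v\<in>V-{z}. lt z v)"
      if z: "atfree E R V" "z \<in> V" "is_end E R V z" for R z
      by (rule anchored_step[OF less.prems z IHu IHa])
    moreover have "c1p E R V" if atf: "atfree E R V" for R
    proof (cases "V = {}")
      case True
      then show ?thesis by (auto simp: c1p_def linord_def cvx_def)
    next
      case False
      then obtain z where "z \<in> V" "is_end E R V z" using ex_end[OF less.prems False atf IHu] by blast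
      from anch[OF atf this] show ?thesis unfolding c1p_def by blast
    qed
    ultimately show ?case by blast
  qed
  then show ?thesis using assms(2) by blast
qed

section \<open>Local structure\<close>

definition meets :: "('r \<Rightarrow> 'c \<Rightarrow> bool) \<Rightarrow> 'c set \<Rightarrow> 'r \<Rightarrow> 'r \<Rightarrow> bool" where
  "meets E V r s \<longleftrightarrow> (\<exists>c\<in>V. E r c \<and> E s c)"

lemma meet_sym: "meets E V r s \<longleftrightarrow> meets E V s r"
  unfolding meets_def by blast

lemma meetI: "c \<in> V \<Longrightarrow> E r c \<Longrightarrow> E s c \<Longrightarrow> meets E V r s"
  unfolding meets_def by blast

text \<open>Selections may repeat rows and columns, so that smaller submatrices are covered too.\<close>

definition loc8 :: "('r \<Rightarrow> 'c \<Rightarrow> bool) \<Rightarrow> 'r set \<Rightarrow> 'c set \<Rightarrow> bool" where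
  "loc8 E R V \<longleftrightarrow> (\<forall>\<rho> \<kappa>. (\<forall>i<8. \<rho> i \<in> R) \<longrightarrow> (\<forall>j<8. \<kappa> j \<in> V) \<longrightarrow>
     c1p (\<lambda>i j. E (\<rho> i) (\<kappa> j)) {..<8::nat} {..<8::nat} \<and>
     c1p (\<lambda>j i. E (\<rho> i) (\<kappa> j)) {..<8::nat} {..<8::nat})"

lemma loc8_transpose: "loc8 E R V \<Longrightarrow> loc8 (\<lambda>c r. E r c) V R"
  unfolding loc8_def by blast

lemma loc8_subset: "loc8 E R V \<Longrightarrow> S \<subseteq> R \<Longrightarrow> loc8 E S V"
  unfolding loc8_def by blast

text \<open>A consecutive order of a small set of columns, given by integer positions so that linear arithmetic applies.\<close>

definition cord :: "('r \<Rightarrow> 'c \<Rightarrow> bool) \<Rightarrow> 'r set \<Rightarrow> 'c set \<Rightarrow> ('c \<Rightarrow> int) \<Rightarrow> bool" where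
  "cord E S T f \<longleftrightarrow> inj_on f T \<and>
     (\<forall>r\<in>S. \<forall>x\<in>T. \<forall>y\<in>T. \<forall>z\<in>T. f x < f y \<longrightarrow> f y < f z \<longrightarrow> E r x \<longrightarrow> E r z \<longrightarrow> E r y)"

lemma cord_neg: "cord E S T f \<Longrightarrow> cord E S T (\<lambda>x. - f x)"
  unfolding cord_def inj_on_def by simp

lemma cordD: "cord E S T f \<Longrightarrow> r \<in> S \<Longrightarrow> x \<in> T \<Longrightarrow> y \<in> T \<Longrightarrow> z \<in> T \<Longrightarrow> E r x \<Longrightarrow> E r z \<Longrightarrow> \<not> E r y \<Longrightarrow>
    \<not> (f x < f y \<and> f y < f z) \<and> \<not> (f z < f y \<and> f y < f x)"
  unfolding cord_def by blast

lemma cord_neq: "cord E S T f \<Longrightarrow> x \<in> T \<Longrightarrow> y \<in> T \<Longrightarrow> x \<noteq> y \<Longrightarrow> f x \<noteq> f y"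
  unfolding cord_def inj_on_def by blast

lemma cord_cases:
  assumes "cord E S T f" "x \<in> T" "y \<in> T" "x \<noteq> y"
  obtains g where "cord E S T g" "g x < g y"
proof (cases "f x < f y")
  case False
  then have "- f x < - f y" using cord_neq[OF assms] by simp
  then show ?thesis using that cord_neg[OF assms(1)] by blast
qed (use that assms(1) in blast)

lemma linord_rank:
  assumes "finite T" "linord T lt" "x \<in> T" "y \<in> T"
  shows "card {z \<in> T. lt z x} < card {z \<in> T. lt z y} \<longleftrightarrow> lt x y"
proof -
  have *: "card {z \<in> T. lt z x} < card {z \<in> T. lt z y}" if "lt x y" "x \<in> T" "y \<in> T" for x y
  proof (rule psubset_card_mono)
    show "{z \<in> T. lt z x} \<subset> {z \<in> T. lt z y}"
      using that linord_trans[OF assms(2)] linord_irrefl[OF assms(2)] by blast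
  qed (use assms(1) in auto)
  show ?thesis
    using *[of x y] *[of y x] assms linord_total[OF assms(2), of x y] by (cases "x = y") auto
qed

lemma c1p_cord:
  assumes "c1p E S T" "finite T"
  shows "\<exists>f. cord E S T f"
proof -
  obtain lt where lt: "linord T lt" "cvx E S T lt" using assms(1) unfolding c1p_def by blast
  define f where "f x = int (card {z \<in> T. lt z x})" for x
  have f: "f x < f y \<longleftrightarrow> lt x y" if "x \<in> T" "y \<in> T" for x y
    using linord_rank[OF assms(2) lt(1) that] by (simp add: f_def)
  have "inj_on f T"
  proof (rule inj_onI, rule ccontr)
    fix x y assume xy: "x \<in> T" "y \<in> T" "f x = f y" "x \<noteq> y"
    then show False using linord_total[OF lt(1), of x y] f[of x y] f[of y x] by auto
  qed
  moreover have "E r y" if "r \<in> S" "x \<in> T" "y \<in> T" "z \<in> T" "f x < f y" "f y < f z" "E r x" "E r z" for r x y z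
    using cvxD[OF lt(2), of r x y z] that f by blast
  ultimately show ?thesis unfolding cord_def by blast
qed

lemma enum8:
  assumes "length xs \<le> 8" "xs \<noteq> []"
  obtains \<kappa> :: "nat \<Rightarrow> 'a" and \<sigma> where "\<And>i. \<kappa> i \<in> set xs" "\<And>x. x \<in> set xs \<Longrightarrow> \<sigma> x < 8 \<and> \<kappa> (\<sigma> x) = x"
proof
  define \<kappa> where "\<kappa> i = (if i < length xs then xs ! i else xs ! 0)" for i
  define \<sigma> where "\<sigma> x = (SOME i. i < length xs \<and> xs ! i = x)" for x
  show "\<kappa> i \<in> set xs" for i using assms(2) by (simp add: \<kappa>_def)
  show "\<sigma> x < 8 \<and> \<kappa> (\<sigma> x) = x" if "x \<in> set xs" for x
  proof -
    have "\<exists>i. i < length xs \<and> xs ! i = x" using that by (simp add: in_set_conv_nth)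
    then have "\<sigma> x < length xs \<and> xs ! \<sigma> x = x" unfolding \<sigma>_def by (rule someI_ex)
    then show ?thesis using assms(1) by (simp add: \<kappa>_def)
  qed
qed

text \<open>Shorter lists are padded to 8 entries by repeating their first one, and the order of the
  padded window is pulled back to the chosen positions.\<close>

lemma loc8_cord:
  assumes L: "loc8 E R V" and rs: "set rs \<subseteq> R" "length rs \<le> 8" and vs: "set vs \<subseteq> V" "length vs \<le> 8"
  shows "\<exists>f. cord E (set rs) (set vs) f"
proof (cases "rs = [] \<or> vs = []")
  case True
  have "\<exists>f :: _ \<Rightarrow> nat. inj_on f (set vs)" using finite_imp_inj_to_nat_seg[of "set vs"] by blast
  then obtain f :: "_ \<Rightarrow> nat" where "inj_on f (set vs)" by blast
  then have "cord E (set rs) (set vs) (\<lambda>x. int (f x))"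
    using True unfolding cord_def inj_on_def by auto
  then show ?thesis by blast
next
  case False
  obtain \<rho> :: "nat \<Rightarrow> _" and \<sigma> where r: "\<And>i. \<rho> i \<in> set rs" "\<And>x. x \<in> set rs \<Longrightarrow> \<sigma> x < 8 \<and> \<rho> (\<sigma> x) = x"
    using enum8[OF rs(2)] False by blast
  obtain \<kappa> :: "nat \<Rightarrow> _" and \<tau> where k: "\<And>i. \<kappa> i \<in> set vs" "\<And>x. x \<in> set vs \<Longrightarrow> \<tau> x < 8 \<and> \<kappa> (\<tau> x) = x"
    using enum8[OF vs(2)] False by blast
  have "c1p (\<lambda>i j. E (\<rho> i) (\<kappa> j)) {..<8::nat} {..<8::nat}"
    using L r(1) k(1) rs(1) vs(1) unfolding loc8_def by blast
  then obtain f where f: "cord (\<lambda>i j. E (\<rho> i) (\<kappa> j)) {..<8::nat} {..<8::nat} f"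
    using c1p_cord by blast
  have "inj_on (f \<circ> \<tau>) (set vs)"
  proof (rule inj_onI)
    fix x y assume xy: "x \<in> set vs" "y \<in> set vs" "(f \<circ> \<tau>) x = (f \<circ> \<tau>) y"
    then have "\<tau> x = \<tau> y" using f k(2)[of x] k(2)[of y] unfolding cord_def inj_on_def by simp
    then show "x = y" using k(2) xy by metis
  qed
  moreover have "E r y" if "r \<in> set rs" "x \<in> set vs" "y \<in> set vs" "z \<in> set vs"
    "(f \<circ> \<tau>) x < (f \<circ> \<tau>) y" "(f \<circ> \<tau>) y < (f \<circ> \<tau>) z" "E r x" "E r z" for r x y z
    using cordD[OF f, of "\<sigma> r" "\<tau> x" "\<tau> y" "\<tau> z"] r(2)[of r] k(2)[of x] k(2)[of y] k(2)[of z] that by auto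
  ultimately show ?thesis unfolding cord_def by blast
qed

text \<open>In an order of \<open>A\<close>, \<open>B\<close>, \<open>C\<close>, \<open>q\<close>
  that makes the columns consecutive, \<open>g0\<close> puts \<open>A\<close> next to
  \<open>q\<close>, and \<open>g3\<close> puts \<open>C\<close> next to \<open>q\<close> on the
  other side. Then \<open>B\<close> lies beyond one of them, and \<open>g2\<close> or
  \<open>g1\<close> skips that row.\<close>

lemma four_links:
  assumes L: "loc8 E R V" and R: "A \<in> R" "B \<in> R" "C \<in> R" "q \<in> R"
    and V: "g0 \<in> V" "g1 \<in> V" "g2 \<in> V" "g3 \<in> V"
    and q: "E q g0" "E q g1" "E q g2" "E q g3"
    and g0: "E A g0" "\<not> E B g0" "\<not> E C g0"
    and g1: "E A g1" "E B g1" "\<not> E C g1"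
    and g2: "\<not> E A g2" "E B g2" "E C g2"
    and g3: "\<not> E A g3" "\<not> E B g3" "E C g3"
  shows False
proof -
  obtain f where f: "cord (\<lambda>c r. E r c) (set [g0, g1, g2, g3]) (set [A, B, C, q]) f"
    using loc8_cord[OF loc8_transpose[OF L], of "[g0, g1, g2, g3]" "[A, B, C, q]"] R V by auto
  note D = cordD[OF f]
  note N = cord_neq[OF f]
  have "f A \<noteq> f B" "f A \<noteq> f C" "f B \<noteq> f C" "f A \<noteq> f q" "f B \<noteq> f q" "f C \<noteq> f q"
    using N[of A B] N[of A C] N[of B C] N[of A q] N[of B q] N[of C q] q g0 g1 g2 g3 by auto
  moreover have "\<not> (f A < f B \<and> f B < f q) \<and> \<not> (f q < f B \<and> f B < f A)"
    using D[of g0 A B q] g0 q by simp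
  moreover have "\<not> (f A < f C \<and> f C < f q) \<and> \<not> (f q < f C \<and> f C < f A)"
    using D[of g0 A C q] g0 q by simp
  moreover have "\<not> (f B < f C \<and> f C < f q) \<and> \<not> (f q < f C \<and> f C < f B)"
    using D[of g1 B C q] g1 q by simp
  moreover have "\<not> (f B < f A \<and> f A < f q) \<and> \<not> (f q < f A \<and> f A < f B)"
    using D[of g2 B A q] g2 q by simp
  moreover have "\<not> (f C < f A \<and> f A < f q) \<and> \<not> (f q < f A \<and> f A < f C)"
    using D[of g3 C A q] g3 q by simp
  moreover have "\<not> (f C < f B \<and> f B < f q) \<and> \<not> (f q < f B \<and> f B < f C)"
    using D[of g3 C B q] g3 q by simp
  moreover have "\<not> (f A < f C \<and> f C < f B) \<and> \<not> (f B < f C \<and> f C < f A)"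
    using D[of g1 A C B] g1 q by simp
  moreover have "\<not> (f B < f A \<and> f A < f C) \<and> \<not> (f C < f A \<and> f A < f B)"
    using D[of g2 B A C] g2 q by simp
  ultimately show False by (smt (verit))
qed

text \<open>Such a chain of rows determines the order of its ends and links up to reversal, and
  \<open>f a < f b\<close> selects one of the two.\<close>

lemma path4_order:
  assumes f: "cord E S T f" and mm: "p1 \<in> S" "p2 \<in> S" "p3 \<in> S" "p4 \<in> S" "a \<in> T" "b \<in> T" "l1 \<in> T" "l2 \<in> T" "lk \<in> T"
    and p1: "E p1 a" "E p1 l1" "\<not> E p1 l2" "\<not> E p1 lk" "\<not> E p1 b"
    and p2: "\<not> E p2 a" "E p2 l1" "E p2 l2" "\<not> E p2 lk" "\<not> E p2 b"
    and p3: "\<not> E p3 a" "\<not> E p3 l1" "E p3 l2" "E p3 lk" "\<not> E p3 b"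
    and p4: "\<not> E p4 a" "\<not> E p4 l1" "\<not> E p4 l2" "E p4 lk" "E p4 b"
    and ab: "f a < f b"
  shows "f a < f l1 \<and> f l1 < f l2 \<and> f l2 < f lk \<and> f lk < f b"
proof -
  note D = cordD[OF f]
  have n: "f a \<noteq> f l1" "f a \<noteq> f l2" "f a \<noteq> f lk" "f b \<noteq> f l1" "f b \<noteq> f l2" "f b \<noteq> f lk"
    "f l1 \<noteq> f l2" "f l1 \<noteq> f lk" "f l2 \<noteq> f lk"
    using cord_neq[OF f, of a l1] cord_neq[OF f, of a l2] cord_neq[OF f, of a lk]
      cord_neq[OF f, of b l1] cord_neq[OF f, of b l2] cord_neq[OF f, of b lk]
      cord_neq[OF f, of l1 l2] cord_neq[OF f, of l1 lk] cord_neq[OF f, of l2 lk] mm p1 p2 p3 p4 by auto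
  have "\<not> (f a < f b \<and> f b < f l1) \<and> \<not> (f l1 < f b \<and> f b < f a)" using D[of p1 a b l1] mm p1 by simp
  then have 1: "f l1 < f b" using ab n by linarith
  have "\<not> (f l1 < f b \<and> f b < f l2) \<and> \<not> (f l2 < f b \<and> f b < f l1)" using D[of p2 l1 b l2] mm p2 by simp
  then have 2: "f l2 < f b" using 1 n by linarith
  have "\<not> (f l2 < f b \<and> f b < f lk) \<and> \<not> (f lk < f b \<and> f b < f l2)" using D[of p3 l2 b lk] mm p3 by simp
  then have 3: "f lk < f b" using 2 n by linarith
  have "\<not> (f lk < f a \<and> f a < f b) \<and> \<not> (f b < f a \<and> f a < f lk)" using D[of p4 lk a b] mm p4 by simp
  then have 4: "f a < f lk" using 3 n ab by linarith
  have "\<not> (f l2 < f a \<and> f a < f lk) \<and> \<not> (f lk < f a \<and> f a < f l2)" using D[of p3 l2 a lk] mm p3 by simp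
  then have 5: "f a < f l2" using 4 n by linarith
  have "\<not> (f l1 < f a \<and> f a < f l2) \<and> \<not> (f l2 < f a \<and> f a < f l1)" using D[of p2 l1 a l2] mm p2 by simp
  then have 6: "f a < f l1" using 5 n by linarith
  have "\<not> (f a < f l2 \<and> f l2 < f l1) \<and> \<not> (f l1 < f l2 \<and> f l2 < f a)" using D[of p1 a l2 l1] mm p1 by simp
  then have 7: "f l1 < f l2" using 5 n by linarith
  have "\<not> (f lk < f l2 \<and> f l2 < f b) \<and> \<not> (f b < f l2 \<and> f l2 < f lk)" using D[of p4 lk l2 b] mm p4 by simp
  then have 8: "f l2 < f lk" using 2 n by linarith
  show ?thesis using 3 6 7 8 by simp
qed

text \<open>The four rows cover the stretch from \<open>a\<close> to \<open>b\<close> without a gap,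
  so a column that they all miss is outside of it.\<close>

lemma path4_out:
  assumes f: "cord E S T f" and mm: "p1 \<in> S" "p2 \<in> S" "p3 \<in> S" "p4 \<in> S" "a \<in> T" "b \<in> T" "l1 \<in> T" "l2 \<in> T" "lk \<in> T" "e \<in> T"
    and p: "E p1 a" "E p1 l1" "E p2 l1" "E p2 l2" "E p3 l2" "E p3 lk" "E p4 lk" "E p4 b"
    and e: "\<not> E p1 e" "\<not> E p2 e" "\<not> E p3 e" "\<not> E p4 e"
    and o: "f a < f l1 \<and> f l1 < f l2 \<and> f l2 < f lk \<and> f lk < f b"
  shows "f e < f a \<or> f b < f e"
proof (rule ccontr)
  note D = cordD[OF f]
  have n: "f e \<noteq> f a" "f e \<noteq> f b" "f e \<noteq> f l1" "f e \<noteq> f l2" "f e \<noteq> f lk"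
    using cord_neq[OF f, of e a] cord_neq[OF f, of e b] cord_neq[OF f, of e l1]
      cord_neq[OF f, of e l2] cord_neq[OF f, of e lk] mm p e by auto
  assume "\<not> ?thesis"
  then have b: "f a < f e" "f e < f b" using n by linarith+
  have "\<not> (f a < f e \<and> f e < f l1)" using D[of p1 a e l1] mm e p by simp
  moreover have "\<not> (f l1 < f e \<and> f e < f l2)" using D[of p2 l1 e l2] mm e p by simp
  moreover have "\<not> (f l2 < f e \<and> f e < f lk)" using D[of p3 l2 e lk] mm e p by simp
  moreover have "\<not> (f lk < f e \<and> f e < f b)" using D[of p4 lk e b] mm e p by simp
  ultimately show False using b n by linarith
qed

text \<open>Otherwise three columns are shared by one pair of rows each. In any order of them, the
  row that holds the outer two misses the middle one.\<close>

lemma helly3: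
  assumes L: "loc8 E R V" and R: "p \<in> R" "q \<in> R" "r \<in> R"
    and m: "meets E V p q" "meets E V q r" "meets E V p r"
  shows "\<exists>x\<in>V. E p x \<and> E q x \<and> E r x"
proof (rule ccontr)
  assume no: "\<not> ?thesis"
  obtain x y z where x: "x \<in> V" "E p x" "E q x" and y: "y \<in> V" "E q y" "E r y" and z: "z \<in> V" "E p z" "E r z"
    using m unfolding meets_def by blast
  then have n: "\<not> E r x" "\<not> E p y" "\<not> E q z" using no by blast+
  obtain f where f: "cord E (set [p, q, r]) (set [x, y, z]) f"
    using loc8_cord[OF L, of "[p, q, r]" "[x, y, z]"] R x y z by auto
  have "f x \<noteq> f y" "f y \<noteq> f z" "f x \<noteq> f z"
    using cord_neq[OF f, of x y] cord_neq[OF f, of y z] cord_neq[OF f, of x z] x y z n by auto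
  moreover note cordD[OF f, of p x y z] cordD[OF f, of q x z y] cordD[OF f, of r z x y]
  ultimately show False using x y z n by simp linarith
qed

section \<open>Shortest paths of rows between two columns\<close>

definition fpath :: "('r \<Rightarrow> 'c \<Rightarrow> bool) \<Rightarrow> 'c set \<Rightarrow> 'r set \<Rightarrow> 'c \<Rightarrow> 'c \<Rightarrow> nat \<Rightarrow> (nat \<Rightarrow> 'r) \<Rightarrow> bool" where
  "fpath E V S a b n P \<longleftrightarrow> n \<ge> 1 \<and> (\<forall>i<n. P i \<in> S) \<and> E (P 0) a \<and> E (P (n - 1)) b \<and>
     (\<forall>i. Suc i < n \<longrightarrow> meets E V (P i) (P (Suc i)))"

definition spath :: "('r \<Rightarrow> 'c \<Rightarrow> bool) \<Rightarrow> 'c set \<Rightarrow> 'r set \<Rightarrow> 'c \<Rightarrow> 'c \<Rightarrow> nat \<Rightarrow> (nat \<Rightarrow> 'r) \<Rightarrow> bool" where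
  "spath E V S a b n P \<longleftrightarrow> fpath E V S a b n P \<and> (\<forall>m Q. fpath E V S a b m Q \<longrightarrow> n \<le> m)"

lemma conn_fpath: "conn E S V a b \<Longrightarrow> a = b \<or> (\<exists>n P. fpath E V S a b n P)"
proof (induction rule: conn_induct)
  case base
  then show ?case by simp
next
  case (step x y r)
  from step.IH show ?case
  proof
    assume "a = x"
    then have "fpath E V S a y 1 (\<lambda>_. r)" using step by (simp add: fpath_def)
    then show ?thesis by blast
  next
    assume "\<exists>n P. fpath E V S a x n P"
    then obtain n P where P: "fpath E V S a x n P" by blast
    have "fpath E V S a y (Suc n) (P(n := r))"
      unfolding fpath_def
    proof (intro conjI allI impI)
      fix i assume i: "Suc i < Suc n"
      show "meets E V ((P(n := r)) i) ((P(n := r)) (Suc i))"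
      proof (cases "Suc i = n")
        case True
        then have "i = n - 1" by simp
        then have "meets E V (P i) r" using P step by (intro meetI[where c = x]) (auto simp: fpath_def)
        then show ?thesis using True by simp
      qed (use i P in \<open>simp add: fpath_def\<close>)
    qed (use P step in \<open>auto simp: fpath_def less_Suc_eq\<close>)
    then show ?thesis by blast
  qed
qed

lemma fpath_conn:
  assumes "fpath E V S a b n P" "a \<in> V" "b \<in> V"
  shows "conn E S V a b"
proof -
  have reach: "conn E S V a x" if "i < n" "x \<in> V" "E (P i) x" for i x
    using that
  proof (induction i arbitrary: x)
    case 0
    then show ?case using assms by (intro conn_row[where r = "P 0"]) (auto simp: fpath_def)
  next
    case (Suc i)
    then obtain y where y: "y \<in> V" "E (P i) y" "E (P (Suc i)) y"
      using assms unfolding fpath_def meets_def by blast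
    then have "conn E S V a y" using Suc by simp
    moreover have "conn E S V y x" using Suc y assms by (intro conn_row[where r = "P (Suc i)"]) (auto simp: fpath_def)
    ultimately show ?case by (rule conn_trans)
  qed
  show ?thesis by (rule reach[of "n - 1"]) (use assms in \<open>auto simp: fpath_def\<close>)
qed

lemma ex_spath:
  assumes "conn E S V a b" "a \<noteq> b"
  obtains n P where "spath E V S a b n P"
proof -
  have ex: "\<exists>n. \<exists>P. fpath E V S a b n P" using conn_fpath[OF assms(1)] assms(2) by blast
  define n where "n = (LEAST n. \<exists>P. fpath E V S a b n P)"
  have "\<exists>P. fpath E V S a b n P" unfolding n_def by (rule LeastI_ex[OF ex])
  then obtain P where "fpath E V S a b n P" by blast
  moreover have "n \<le> m" if "fpath E V S a b m Q" for m Q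
    unfolding n_def by (rule Least_le) (use that in blast)
  ultimately show ?thesis using that unfolding spath_def by blast
qed

lemma spath_first: "i = 0" if P: "spath E V S a b n P" and i: "i < n" "E (P i) a"
proof (rule ccontr)
  assume "i \<noteq> 0"
  have "fpath E V S a b (n - i) (\<lambda>k. P (k + i))"
    using P i unfolding spath_def fpath_def by auto
  then have "n \<le> n - i" using P unfolding spath_def by blast
  then show False using \<open>i \<noteq> 0\<close> i by simp
qed

lemma spath_last: "Suc i = n" if P: "spath E V S a b n P" and i: "i < n" "E (P i) b"
proof (rule ccontr)
  assume "Suc i \<noteq> n"
  have "fpath E V S a b (Suc i) P"
    using P i unfolding spath_def fpath_def by auto
  then have "n \<le> Suc i" using P unfolding spath_def by blast
  then show False using \<open>Suc i \<noteq> n\<close> i by simp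
qed

text \<open>A meeting of rows further apart would be a shortcut.\<close>

lemma spath_meet: "j \<le> Suc i" if P: "spath E V S a b n P" and ij: "j < n" "meets E V (P i) (P j)"
proof (rule ccontr)
  assume j: "\<not> j \<le> Suc i"
  define k where "k = j - i - 1"
  have k: "k > 0" "j = i + k + 1" using j by (auto simp: k_def)
  have "fpath E V S a b (n - k) (\<lambda>l. if l \<le> i then P l else P (l + k))"
    unfolding fpath_def
  proof (intro conjI allI impI)
    fix l assume l: "Suc l < n - k"
    consider "Suc l \<le> i" | "l = i" | "l > i" by linarith
    then show "meets E V (if l \<le> i then P l else P (l + k)) (if Suc l \<le> i then P (Suc l) else P (Suc l + k))"
    proof cases
      case 2
      then show ?thesis using ij k by (simp add: add.commute)
    qed (use P l in \<open>auto simp: spath_def fpath_def\<close>)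
  qed (use P ij k in \<open>auto simp: spath_def fpath_def\<close>)
  then have "n \<le> n - k" using P unfolding spath_def by blast
  then show False using k ij by simp
qed

lemma spath_disj: "\<not> meets E V (P i) (P j)" if "spath E V S a b n P" "j < n" "i + 2 \<le> j"
  using spath_meet[OF that(1,2)] that(3) by fastforce

text \<open>Helly-type condition: if two columns of a row are connected by rows of \<open>S\<close>, then already by two of them.\<close>

definition short_conn :: "('r \<Rightarrow> 'c \<Rightarrow> bool) \<Rightarrow> 'r set \<Rightarrow> 'c set \<Rightarrow> bool" where
  "short_conn E R V \<longleftrightarrow> (\<forall>p\<in>R. \<forall>x\<in>V. \<forall>y\<in>V. \<forall>S\<subseteq>R. E p x \<longrightarrow> E p y \<longrightarrow> conn E S V x y \<longrightarrow> x \<noteq> y \<longrightarrow>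
     (\<exists>s1\<in>S. \<exists>s2\<in>S. E s1 x \<and> E s2 y \<and> meets E V s1 s2))"

text \<open>\<open>q\<close> is the first row of the connection that fails \<open>ok\<close>. This
  isolates the place where a connection first touches a given structure.\<close>

lemma conn_first:
  "conn E S V c a \<Longrightarrow> conn E {r \<in> S. ok r} V c a \<or>
     (\<exists>q\<in>S. \<not> ok q \<and> (\<exists>e\<in>V. E q e \<and> conn E {r \<in> S. ok r} V c e))"
proof (induction rule: conn_induct)
  case base
  then show ?case by simp
next
  case (step x y r)
  show ?case
  proof (cases "conn E {r \<in> S. ok r} V c x")
    case True
    then show ?thesis
    proof (cases "ok r")
      case ok: True
      have "conn E {r \<in> S. ok r} V x y" using step ok by (intro conn_row[where r = r]) auto
      from conn_trans[OF True this] show ?thesis by blast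
    qed (use step in blast)
  qed (use step.IH in blast)
qed

section \<open>Excluding asteroidal triples\<close>

definition asteroidal :: "('r \<Rightarrow> 'c \<Rightarrow> bool) \<Rightarrow> 'r set \<Rightarrow> 'c set \<Rightarrow> 'c \<Rightarrow> 'c \<Rightarrow> 'c \<Rightarrow> bool" where
  "asteroidal E R V a b c \<longleftrightarrow> a \<in> V \<and> b \<in> V \<and> c \<in> V \<and> a \<noteq> b \<and> b \<noteq> c \<and> a \<noteq> c \<and>
     cav E R V c a b \<and> cav E R V a b c \<and> cav E R V b a c"

lemma at_rot: "asteroidal E R V a b c \<Longrightarrow> asteroidal E R V b c a"
  unfolding asteroidal_def using conn_sym[of E "{r \<in> R. \<not> E r b}" V a c] conn_sym[of E "{r \<in> R. \<not> E r c}" V a b] by blast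

definition short2 :: "('r \<Rightarrow> 'c \<Rightarrow> bool) \<Rightarrow> 'r set \<Rightarrow> 'c set \<Rightarrow> 'c \<Rightarrow> 'c \<Rightarrow> bool" where
  "short2 E S V a b \<longleftrightarrow> (\<exists>s1\<in>S. \<exists>s2\<in>S. E s1 a \<and> E s2 b \<and> meets E V s1 s2)"

lemma fpath_short2:
  assumes P: "fpath E V S a b n P" and n: "n \<le> 2" and a: "a \<in> V"
  shows "short2 E S V a b"
proof (cases "n = 1")
  case True
  then have "P 0 \<in> S" "E (P 0) a" "E (P 0) b" using P by (auto simp: fpath_def)
  then show ?thesis unfolding short2_def by (intro bexI[of _ "P 0"]) (auto intro: meetI[OF a])
next
  case False
  then have "n = 2" using P n by (auto simp: fpath_def)
  then show ?thesis using P unfolding short2_def fpath_def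
    by (intro bexI[of _ "P 0"] bexI[of _ "P 1"]) auto
qed

lemma between_trans:
  fixes x y z w :: int
  assumes "\<not> (x < y \<and> y < w) \<and> \<not> (w < y \<and> y < x)" "\<not> (w < y \<and> y < z) \<and> \<not> (z < y \<and> y < w)" "w \<noteq> y"
  shows "\<not> (x < y \<and> y < z) \<and> \<not> (z < y \<and> y < x)"
  using assms by linarith

text \<open>The whole triple fits into 6 rows and 6 columns. In their consecutive order one of
  \<open>a\<close>, \<open>b\<close>, \<open>c\<close> lies between the other two, although the two
  rows that join these avoid it.\<close>

lemma at_long:
  assumes L: "loc8 E R V" and asteroidal: "asteroidal E R V a b c"
    and s: "short2 E {r \<in> R. \<not> E r c} V a b" "short2 E {r \<in> R. \<not> E r a} V b c" "short2 E {r \<in> R. \<not> E r b} V a c"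
  shows False
proof -
  obtain p1 p2 g where p: "p1 \<in> R" "p2 \<in> R" "\<not> E p1 c" "\<not> E p2 c" "E p1 a" "E p2 b" "E p1 g" "E p2 g" "g \<in> V"
    using s(1) unfolding short2_def meets_def by blast
  obtain q1 q2 h where q: "q1 \<in> R" "q2 \<in> R" "\<not> E q1 a" "\<not> E q2 a" "E q1 b" "E q2 c" "E q1 h" "E q2 h" "h \<in> V"
    using s(2) unfolding short2_def meets_def by blast
  obtain r1 r2 k where r: "r1 \<in> R" "r2 \<in> R" "\<not> E r1 b" "\<not> E r2 b" "E r1 a" "E r2 c" "E r1 k" "E r2 k" "k \<in> V"
    using s(3) unfolding short2_def meets_def by blast
  have abc: "a \<in> V" "b \<in> V" "c \<in> V" "a \<noteq> b" "b \<noteq> c" "a \<noteq> c" using asteroidal by (auto simp: asteroidal_def)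
  obtain f where f: "cord E (set [p1, p2, q1, q2, r1, r2]) (set [a, b, c, g, h, k]) f"
    using loc8_cord[OF L, of "[p1, p2, q1, q2, r1, r2]" "[a, b, c, g, h, k]"] p q r abc by auto
  note D = cordD[OF f]
  have "f a \<noteq> f b" "f b \<noteq> f c" "f a \<noteq> f c"
    using cord_neq[OF f, of a b] cord_neq[OF f, of b c] cord_neq[OF f, of a c] abc by auto
  moreover have "f g \<noteq> f c" using cord_neq[OF f, of g c] p by auto
  moreover have "f h \<noteq> f a" using cord_neq[OF f, of h a] q by auto
  moreover have "f k \<noteq> f b" using cord_neq[OF f, of k b] r by auto
  moreover have "\<not> (f a < f c \<and> f c < f b) \<and> \<not> (f b < f c \<and> f c < f a)"
    using between_trans[OF D[of p1 a c g] D[of p2 g c b] \<open>f g \<noteq> f c\<close>] p by simp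
  moreover have "\<not> (f b < f a \<and> f a < f c) \<and> \<not> (f c < f a \<and> f a < f b)"
    using between_trans[OF D[of q1 b a h] D[of q2 h a c] \<open>f h \<noteq> f a\<close>] q by simp
  moreover have "\<not> (f a < f b \<and> f b < f c) \<and> \<not> (f c < f b \<and> f b < f a)"
    using between_trans[OF D[of r1 a b k] D[of r2 k b c] \<open>f k \<noteq> f b\<close>] r by simp
  ultimately show False by linarith
qed

text \<open>An asteroidal triple whose connection from \<open>a\<close> to \<open>b\<close> avoiding \<open>c\<close> is the path \<open>p1, p2, p3\<close> with links \<open>l1, l2\<close>.\<close>

definition triple_path :: "('r \<Rightarrow> 'c \<Rightarrow> bool) \<Rightarrow> 'r set \<Rightarrow> 'c set \<Rightarrow> 'c \<Rightarrow> 'c \<Rightarrow> 'c \<Rightarrow> 'r \<Rightarrow> 'r \<Rightarrow> 'r \<Rightarrow> 'c \<Rightarrow> 'c \<Rightarrow> bool" where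
  "triple_path E R V a b c p1 p2 p3 l1 l2 \<longleftrightarrow> asteroidal E R V a b c \<and> {p1, p2, p3} \<subseteq> R \<and> {l1, l2} \<subseteq> V \<and>
     \<not> E p1 c \<and> \<not> E p2 c \<and> \<not> E p3 c \<and> E p1 a \<and> \<not> E p2 a \<and> \<not> E p3 a \<and>
     E p3 b \<and> \<not> E p2 b \<and> \<not> E p1 b \<and> E p1 l1 \<and> E p2 l1 \<and> \<not> E p3 l1 \<and> E p3 l2 \<and> E p2 l2 \<and> \<not> E p1 l2"

lemma triple_path_sym:
  assumes "triple_path E R V a b c p1 p2 p3 l1 l2"
  shows "triple_path E R V b a c p3 p2 p1 l2 l1"
proof -
  have "asteroidal E R V a b c" using assms by (simp add: triple_path_def)
  then have "asteroidal E R V b a c"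
    unfolding asteroidal_def using conn_sym[of E "{r \<in> R. \<not> E r c}" V a b] by blast
  then show ?thesis using assms by (auto simp: triple_path_def)
qed

lemma cfg_order:
  assumes C: "triple_path E R V a b c p1 p2 p3 l1 l2" and f: "cord E S T f"
    and S: "{p1, p2, p3} \<subseteq> S" and T: "{a, b, l1, l2} \<subseteq> T" and ab: "f a < f b"
  shows "f a < f l1 \<and> f l1 < f l2 \<and> f l2 < f b"
proof -
  note c = C[unfolded triple_path_def asteroidal_def]
  note D = cordD[OF f]
  have "f a \<noteq> f l1" "f a \<noteq> f l2" "f l1 \<noteq> f l2" "f b \<noteq> f l1" "f b \<noteq> f l2"
    using cord_neq[OF f, of a l1] cord_neq[OF f, of a l2] cord_neq[OF f, of l1 l2] cord_neq[OF f, of b l1]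
      cord_neq[OF f, of b l2] c T by auto
  moreover note D[of p1 a l2 l1] D[of p1 a b l1] D[of p2 l1 a l2] D[of p2 l1 b l2] D[of p3 l2 a b] D[of p3 l2 l1 b]
  ultimately show ?thesis using c S T ab by (simp; linarith)
qed

text \<open>With \<open>l1\<close> before \<open>l2\<close>, the order is forced to be
  \<open>l1\<close>, \<open>l2\<close>, \<open>b\<close>, \<open>x\<close>, with \<open>e\<close>
  beyond \<open>b\<close>. The connection from \<open>x\<close> to \<open>l2\<close>, cut down to
  two rows by \<open>short_conn\<close>, would have to jump over \<open>b\<close>.\<close>

lemma fan:
  assumes L: "loc8 E R V" and H: "short_conn E R V"
    and R: "p2 \<in> R" "p3 \<in> R" "q \<in> R" and V: "l1 \<in> V" "l2 \<in> V" "b \<in> V" "x \<in> V" "e \<in> V"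
    and p2: "E p2 l1" "E p2 l2" "\<not> E p2 b" "\<not> E p2 x" "\<not> E p2 e"
    and p3: "E p3 l2" "E p3 b" "E p3 x" "\<not> E p3 l1" "\<not> E p3 e"
    and q: "E q x" "E q e" "\<not> E q b" "\<not> E q l2"
    and conn: "cav E R V b x l2"
  shows False
proof -
  have "x \<noteq> l2" using p2 by auto
  then obtain s1 s2 where s: "s1 \<in> R" "\<not> E s1 b" "s2 \<in> R" "\<not> E s2 b" "E s1 x" "E s2 l2" "meets E V s1 s2"
    using H[unfolded short_conn_def, rule_format, OF R(2) V(4) V(2) _ p3(3) p3(1) conn] by blast
  then obtain g where g: "g \<in> V" "E s1 g" "E s2 g" unfolding meets_def by blast
  obtain f where f: "cord E (set [p2, p3, q, s1, s2]) (set [l1, l2, b, x, e, g]) f"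
    using loc8_cord[OF L, of "[p2, p3, q, s1, s2]" "[l1, l2, b, x, e, g]"] R V s g by auto
  have "l1 \<noteq> l2" using p3 by auto
  obtain f where f: "cord E (set [p2, p3, q, s1, s2]) (set [l1, l2, b, x, e, g]) f" "f l1 < f l2"
    by (rule cord_cases[OF f, of l1 l2]) (use \<open>l1 \<noteq> l2\<close> in auto)
  note D = cordD[OF f(1)]
  note N = cord_neq[OF f(1)]
  have ne: "f b \<noteq> f x" "f b \<noteq> f l2" "f b \<noteq> f l1" "f x \<noteq> f l2" "f x \<noteq> f l1" "f e \<noteq> f l2" "f e \<noteq> f b" "f e \<noteq> f x" "f b \<noteq> f g"
    using N[of b x] N[of b l2] N[of b l1] N[of x l2] N[of x l1] N[of e l2] N[of e b] N[of e x] N[of b g]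
      p2 p3 q s g by auto
  have "f l2 < f b"
    using D[of p2 l1 b l2] D[of p3 l2 l1 b] ne f(2) p2 p3 by (simp; linarith)
  moreover have "f l2 < f x"
    using D[of p2 l1 x l2] D[of p3 l2 l1 x] ne f(2) p2 p3 by (simp; linarith)
  moreover have "f e > f l2"
    using D[of q e l2 x] ne q \<open>f l2 < f x\<close> by (simp; linarith)
  moreover from this have "f e > f b" using D[of p3 l2 e b] ne p3 by (simp; linarith)
  ultimately have "f b < f x"
    using D[of q e b x] ne(1) q by (simp; linarith)
  then show False
    using \<open>f l2 < f b\<close> D[of s1 x b g] D[of s2 l2 b g] ne s g by (simp; linarith)
qed

section \<open>Connections of exactly three rows\<close>

definition onpath :: "('r \<Rightarrow> 'c \<Rightarrow> bool) \<Rightarrow> 'r \<Rightarrow> 'r \<Rightarrow> 'r \<Rightarrow> 'c \<Rightarrow> bool" where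
  "onpath E p1 p2 p3 v \<longleftrightarrow> E p1 v \<or> E p2 v \<or> E p3 v"

definition off :: "('r \<Rightarrow> 'c \<Rightarrow> bool) \<Rightarrow> 'c set \<Rightarrow> ('c \<Rightarrow> bool) \<Rightarrow> 'r \<Rightarrow> bool" where
  "off E V U r \<longleftrightarrow> (\<forall>u\<in>V. U u \<longrightarrow> \<not> E r u)"

lemma off_conn:
  assumes "conn E {r \<in> R. off E V U r} V c e" "\<not> U c"
  shows "\<not> U e"
  using assms
proof (induction rule: conn_induct)
  case (step x y r)
  then show ?case unfolding off_def by blast
qed simp

lemma off_cav:
  assumes "conn E {r \<in> R. off E V U r} V c e" "U u" "u \<in> V"
  shows "cav E R V u c e"
  by (rule conn_mono[OF assms(1)]) (use assms(2,3) in \<open>auto simp: off_def\<close>)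

text \<open>\<open>q\<close> is the first row of the connection that touches \<open>U\<close>, and
  it does so at \<open>x\<close>.\<close>

lemma off_entry:
  assumes "conn E S V c a" "\<not> U c" "U a" "S \<subseteq> R"
  obtains q e x where "q \<in> S" "e \<in> V" "x \<in> V" "U x" "E q e" "E q x" "conn E {r \<in> R. off E V U r} V c e"
proof -
  have sub: "{r \<in> S. off E V U r} \<subseteq> {r \<in> R. off E V U r}" using assms(4) by auto
  from conn_first[OF assms(1), of "off E V U"] show ?thesis
  proof
    assume "conn E {r \<in> S. off E V U r} V c a"
    from off_conn[OF this assms(2)] show ?thesis using assms(3) by simp
  next
    assume "\<exists>q\<in>S. \<not> off E V U q \<and> (\<exists>e\<in>V. E q e \<and> conn E {r \<in> S. off E V U r} V c e)"
    then obtain q e where q: "q \<in> S" "\<not> off E V U q" "e \<in> V" "E q e" "conn E {r \<in> S. off E V U r} V c e" by blast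
    then obtain x where "x \<in> V" "U x" "E q x" unfolding off_def by blast
    then show ?thesis using that q conn_mono[OF q(5) sub subset_refl] by blast
  qed
qed

text \<open>\<open>e\<close> is on none of the three rows, so it lies outside the stretch from
  \<open>a\<close> to \<open>b\<close>. If it were beyond \<open>b\<close>, then so would be
  \<open>x\<close>, because \<open>q\<close> misses \<open>b\<close>; hence \<open>x\<close> would
  be on \<open>p3\<close> only. As \<open>x\<close> is connected to \<open>l2\<close> by way of
  \<open>c\<close> and \<open>a\<close> without rows through \<open>b\<close>, \<open>fan\<close>
  would apply.\<close>

lemma cfg_left:
  assumes L: "loc8 E R V" and H: "short_conn E R V" and C: "triple_path E R V a b c p1 p2 p3 l1 l2"
    and q: "q \<in> R" "\<not> E q b" "E q e" "E q x"
    and x: "x \<in> V" "onpath E p1 p2 p3 x"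
    and e: "e \<in> V" "conn E {r \<in> R. off E V (onpath E p1 p2 p3) r} V c e"
    and f: "cord E S T f" "{p1, p2, p3, q} \<subseteq> S" "{a, b, l1, l2, x, e} \<subseteq> T" and ab: "f a < f b"
  shows "f e < f a"
proof (rule ccontr)
  assume na: "\<not> f e < f a"
  note c = C[unfolded triple_path_def asteroidal_def]
  have nUc: "\<not> onpath E p1 p2 p3 c" using c by (simp add: onpath_def)
  have nUe: "\<not> E p1 e" "\<not> E p2 e" "\<not> E p3 e" using off_conn[OF e(2) nUc] by (auto simp: onpath_def)
  note D = cordD[OF f(1)]
  note N = cord_neq[OF f(1)]
  have ord: "f a < f l1" "f l1 < f l2" "f l2 < f b" using cfg_order[OF C f(1) _ _ ab] f by auto
  have ne: "f e \<noteq> f a" "f e \<noteq> f l1" "f e \<noteq> f l2" "f e \<noteq> f b" "f x \<noteq> f b"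
    using N[of e a] N[of e l1] N[of e l2] N[of e b] N[of x b] nUe c f q by auto
  have m: "p1 \<in> S" "p2 \<in> S" "p3 \<in> S" "q \<in> S" "a \<in> T" "b \<in> T" "l1 \<in> T" "l2 \<in> T" "x \<in> T" "e \<in> T"
    using f by auto
  have "f l1 < f e" using D[of p1 a e l1] nUe c m na ne(1,2) ord(1) by (simp; linarith)
  then have "f l2 < f e" using D[of p2 l1 e l2] nUe c m ne(3) ord(2) by (simp; linarith)
  then have "f b < f e" using D[of p3 l2 e b] nUe c m ne(4) ord(3) by (simp; linarith)
  then have xb: "f x > f b"
    using D[of q x b e] q m ne(5) by (simp; linarith)
  have nx: "\<not> E p1 x" "\<not> E p2 x"
    using D[of p1 a b x] D[of p2 l1 b x] c m ord xb by auto
  then have px: "E p3 x" using x by (simp add: onpath_def)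
  have nl: "\<not> E q l2" using D[of q l2 b x] q m ord xb by auto
  have "cav E R V b c x"
  proof -
    have "cav E R V b c e" using off_cav[OF e(2), of b] c by (simp add: onpath_def)
    moreover have "cav E R V b e x" using q x e by (intro conn_row[where r = q]) auto
    ultimately show ?thesis by (rule conn_trans)
  qed
  then have c1: "cav E R V b x c" by (rule conn_sym)
  have c2: "cav E R V b a l2"
  proof -
    have "cav E R V b a l1" using c by (intro conn_row[where r = p1]) auto
    moreover have "cav E R V b l1 l2" using c by (intro conn_row[where r = p2]) auto
    ultimately show ?thesis by (rule conn_trans)
  qed
  have c3: "cav E R V b a c" using c by blast
  have "cav E R V b x l2" by (rule conn_trans[OF c1 conn_trans[OF conn_sym[OF c3] c2]])
  then show False
    using fan[OF L H, of p2 p3 q l1 l2 b x e] c q x e nUe nx px nl by auto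
qed

lemma cfg_right:
  assumes L: "loc8 E R V" and H: "short_conn E R V" and C: "triple_path E R V a b c p1 p2 p3 l1 l2"
    and q: "q \<in> R" "\<not> E q a" "E q e" "E q x"
    and x: "x \<in> V" "onpath E p1 p2 p3 x"
    and e: "e \<in> V" "conn E {r \<in> R. off E V (onpath E p1 p2 p3) r} V c e"
    and f: "cord E S T f" "{p1, p2, p3, q} \<subseteq> S" "{a, b, l1, l2, x, e} \<subseteq> T" and ab: "f a < f b"
  shows "f b < f e"
proof -
  have U: "onpath E p3 p2 p1 = onpath E p1 p2 p3" by (auto simp: onpath_def fun_eq_iff)
  have "- f e < - f b"
    using cfg_left[OF L H triple_path_sym[OF C], of q e x S T "\<lambda>v. - f v"] q x e cord_neg[OF f(1)] f ab
    by (auto simp: U)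
  then show ?thesis by simp
qed

text \<open>The connection from \<open>c\<close> that avoids \<open>b\<close> enters the path from a
  column \<open>e\<close> before \<open>a\<close>; the one that avoids \<open>a\<close> enters it
  from a column beyond \<open>b\<close>. Applied to \<open>q\<close>, \<open>short_conn\<close>
  brings the two together: it leads to a row that misses \<open>a\<close> but has columns before
  \<open>a\<close> and beyond \<open>b\<close>.\<close>

lemma no_cfg:
  assumes L: "loc8 E R V" and H: "short_conn E R V" and C: "triple_path E R V a b c p1 p2 p3 l1 l2"
  shows False
proof -
  note c = C[unfolded triple_path_def asteroidal_def]
  let ?U = "onpath E p1 p2 p3"
  let ?D = "conn E {r \<in> R. off E V ?U r} V c"
  have nUc: "\<not> ?U c" using c by (simp add: onpath_def)
  have ca: "cav E R V b c a" and cb: "cav E R V a c b" using c by (auto intro: conn_sym)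
  obtain q e x where q0: "q \<in> {r \<in> R. \<not> E r b}" "e \<in> V" "x \<in> V" "?U x" "E q e" "E q x" "?D e"
    by (rule off_entry[where U = ?U and R = R, OF ca nUc]) (use c in \<open>auto simp: onpath_def\<close>)
  then have q: "q \<in> R" "\<not> E q b" "E q e" "E q x" "e \<in> V" "x \<in> V" "?U x" "?D e" by auto
  obtain q' e' x' where q0': "q' \<in> {r \<in> R. \<not> E r a}" "e' \<in> V" "x' \<in> V" "?U x'" "E q' e'" "E q' x'" "?D e'"
    by (rule off_entry[where U = ?U and R = R, OF cb nUc]) (use c in \<open>auto simp: onpath_def\<close>)
  then have q': "q' \<in> R" "\<not> E q' a" "E q' e'" "E q' x'" "e' \<in> V" "x' \<in> V" "?U x'" "?D e'" by auto
  have nU: "\<not> ?U v" if "?D v" for v using off_conn[OF that nUc] .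
  \<comment> \<open>These rows connect \<open>x\<close> to \<open>e\<close> by way of the path,
    \<open>q'\<close> and the part of \<open>c\<close> off the path.\<close>
  define S where "S = {p1, p2, p3, q'} \<union> {r \<in> R. off E V ?U r}"
  have SR: "S \<subseteq> R" using c q' by (auto simp: S_def)
  have l1U: "conn E S V l1 v" if "?U v" "v \<in> V" for v
  proof -
    have 1: "conn E S V l1 l2" using c by (intro conn_row[where r = p2]) (auto simp: S_def)
    consider "E p1 v" | "E p2 v" | "E p3 v" using \<open>?U v\<close> by (auto simp: onpath_def)
    then show ?thesis
    proof cases
      case 1
      then show ?thesis using c that by (intro conn_row[where r = p1]) (auto simp: S_def)
    next
      case 2
      then show ?thesis using c that by (intro conn_row[where r = p2]) (auto simp: S_def)
    next
      case 3
      have "conn E S V l2 v" using c that 3 by (intro conn_row[where r = p3]) (auto simp: S_def)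
      then show ?thesis by (rule conn_trans[OF 1])
    qed
  qed
  have "conn E S V x e"
  proof -
    have 1: "conn E S V x x'" by (rule conn_trans[OF conn_sym[OF l1U] l1U]) (use q q' in auto)
    have 2: "conn E S V x' e'" using q' by (intro conn_row[where r = q']) (auto simp: S_def)
    have 3: "conn E S V c e'" by (rule conn_mono[OF q'(8)]) (auto simp: S_def)
    have 4: "conn E S V c e" by (rule conn_mono[OF q(8)]) (auto simp: S_def)
    show ?thesis by (rule conn_trans[OF 1 conn_trans[OF 2 conn_trans[OF conn_sym[OF 3] 4]]])
  qed
  moreover have "x \<noteq> e" using nU[OF q(8)] q(7) by auto
  ultimately obtain s1 s2 where s: "s1 \<in> S" "s2 \<in> S" "E s1 x" "E s2 e" "meets E V s1 s2"
    using H[unfolded short_conn_def, rule_format, OF q(1) q(6) q(5) SR q(4) q(3)] by blast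
  then obtain g where g: "g \<in> V" "E s1 g" "E s2 g" unfolding meets_def by blast
  \<comment> \<open>With 6 rows and 8 columns this is the widest window in the exclusion of
    asteroidal triples.\<close>
  have fin: False if y: "E q' y" "E q' w" "w \<in> V" "?U w" "y \<in> V" "?D y" and d: "d \<in> R" "E d e" "E d y" "\<not> E d a" for y w d
  proof -
    have ab: "a \<noteq> b" "a \<noteq> e" using c nU[OF q(8)] by (auto simp: onpath_def)
    obtain f where f: "cord E (set [p1, p2, p3, q, q', d]) (set [a, b, l1, l2, x, e, w, y]) f"
      using loc8_cord[OF L, of "[p1, p2, p3, q, q', d]" "[a, b, l1, l2, x, e, w, y]"] c q q' y d by auto
    obtain f where f: "cord E (set [p1, p2, p3, q, q', d]) (set [a, b, l1, l2, x, e, w, y]) f" "f a < f b"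
      by (rule cord_cases[OF f, of a b]) (use ab in auto)
    have "f e < f a"
      by (rule cfg_left[OF L H C q(1-4) q(6,7) q(5,8) f(1) _ _ f(2)]) auto
    moreover have "f b < f y"
      by (rule cfg_right[OF L H C q'(1,2) y(1,2) y(3,4) y(5,6) f(1) _ _ f(2)]) auto
    ultimately show False using cordD[OF f(1), of d e a y] d f(2) by auto
  qed
  have ne: "\<not> E p1 e" "\<not> E p2 e" "\<not> E p3 e" using nU[OF q(8)] by (auto simp: onpath_def)
  show False
  proof (cases "s2 = q'")
    case True
    then show False using fin[of e x' q'] s q' q by auto
  next
    case False
    then have s2: "s2 \<in> R" "off E V ?U s2" using s(2,4) ne by (auto simp: S_def)
    then have nUg: "\<not> ?U g" using g by (auto simp: off_def)
    have "\<not> off E V ?U s1" using s(3) q(6,7) by (auto simp: off_def)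
    \<comment> \<open>\<open>s1\<close> contains \<open>x\<close> on the path and \<open>g\<close>
      off it, which among the rows of \<open>S\<close> only \<open>q'\<close> can do.\<close>
    then have "s1 = q'" using s(1) g nUg by (auto simp: S_def onpath_def)
    have "conn E {r \<in> R. off E V ?U r} V e g" using s2 s g q by (intro conn_row[where r = s2]) auto
    then have "?D g" using conn_trans[OF q(8)] by blast
    moreover have "\<not> E s2 a" using s2(2) c by (auto simp: off_def onpath_def)
    ultimately show False using fin[of g x s2] \<open>s1 = q'\<close> s g q s2 by auto
  qed
qed

lemma no_at3:
  assumes L: "loc8 E R V" and H: "short_conn E R V" and asteroidal: "asteroidal E R V a b c"
    and P: "spath E V {r \<in> R. \<not> E r c} a b 3 P"
  shows False
proof -
  have f: "\<forall>i<3. P i \<in> R \<and> \<not> E (P i) c" "E (P 0) a" "E (P 2) b"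
      "\<And>i. Suc i < 3 \<Longrightarrow> meets E V (P i) (P (Suc i))"
    using P unfolding spath_def fpath_def by auto
  obtain l1 where l1: "l1 \<in> V" "E (P 0) l1" "E (P 1) l1" using f(4)[of 0] by (auto simp: meets_def)
  obtain l2 where l2: "l2 \<in> V" "E (P 1) l2" "E (P 2) l2" using f(4)[of 1] by (auto simp: meets_def numeral_2_eq_2)
  have "\<not> meets E V (P 0) (P 2)" using spath_disj[OF P, of 2 0] by simp
  then have d: "\<not> E (P 2) l1" "\<not> E (P 0) l2"
    using l1 l2 meetI[of l1 V E "P 0" "P 2"] meetI[of l2 V E "P 0" "P 2"] by blast+
  have "\<not> E (P 1) a" "\<not> E (P 2) a" "\<not> E (P 0) b" "\<not> E (P 1) b"
    using spath_first[OF P, of 1] spath_first[OF P, of 2] spath_last[OF P, of 0] spath_last[OF P, of 1] by auto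
  moreover have "P 0 \<in> R" "P 1 \<in> R" "P 2 \<in> R" "\<not> E (P 0) c" "\<not> E (P 1) c" "\<not> E (P 2) c"
    using f(1) by auto
  ultimately have "triple_path E R V a b c (P 0) (P 1) (P 2) l1 l2"
    unfolding triple_path_def using asteroidal f(2,3) l1 l2 d by simp
  then show False by (rule no_cfg[OF L H])
qed

text \<open>The triples \<open>l1\<close>, \<open>b\<close>, \<open>c\<close> and \<open>a\<close>,
  \<open>lk\<close>, \<open>c\<close> have connecting paths that are shorter by one row but still
  have at least three rows. By minimality they are not asteroidal, so \<open>b\<close> reaches
  \<open>c\<close> only with rows through \<open>l1\<close>, and \<open>a\<close> reaches
  \<open>c\<close> only with rows through \<open>lk\<close>. This yields a row \<open>q\<close>
  through \<open>l1\<close> and \<open>lk\<close>, for which \<open>short_conn\<close> leaves only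
  paths of four rows; these are refuted in a window.\<close>

lemma no_at_4:
  assumes L: "loc8 E R V" and H: "short_conn E R V" and asteroidal: "asteroidal E R V a b c"
    and P: "spath E V {r \<in> R. \<not> E r c} a b m P" and m: "m \<ge> 4"
    and min: "\<And>a b c n Q. asteroidal E R V a b c \<Longrightarrow> spath E V {r \<in> R. \<not> E r c} a b n Q \<Longrightarrow> n \<ge> 3 \<Longrightarrow> n \<ge> m"
  shows False
proof -
  obtain k where mk: "m = Suc (Suc (Suc (Suc k)))"
    using m by (auto simp: le_iff_add numeral_eq_Suc)
  have PR: "P i \<in> R" "\<not> E (P i) c" if "i < m" for i using P that unfolding spath_def fpath_def by auto
  have Pa: "E (P 0) a" and Pb: "E (P (m - 1)) b" using P unfolding spath_def fpath_def by auto
  have Pm: "meets E V (P i) (P (Suc i))" if "Suc i < m" for i using P that unfolding spath_def fpath_def by auto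
  have far: "\<not> (E (P i) v \<and> E (P j) v)" if "i + 2 \<le> j" "j < m" "v \<in> V" for i j v
    using spath_disj[OF P that(2,1)] that(3) by (auto simp: meets_def)
  have Pa': "\<not> E (P i) a" if "0 < i" "i < m" for i using spath_first[OF P that(2)] that by auto
  have Pb': "\<not> E (P i) b" if "Suc i < m" for i using spath_last[OF P, of i] that by auto
  have V: "a \<in> V" "b \<in> V" "c \<in> V" "a \<noteq> b" "b \<noteq> c" "a \<noteq> c" using asteroidal by (auto simp: asteroidal_def)
  have cab: "cav E R V b a c" and cbc: "cav E R V a b c" and ccab: "cav E R V c a b" using asteroidal by (auto simp: asteroidal_def)
  have cca: "cav E R V b c a" using conn_sym[OF cab] .
  obtain l1 where l1: "l1 \<in> V" "E (P 0) l1" "E (P 1) l1" using Pm[of 0] m by (auto simp: meets_def)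
  have sm: "Suc (m - 2) = m - 1" using m by simp
  have "meets E V (P (m - 2)) (P (m - 1))" using Pm[of "m - 2"] m unfolding sm by simp
  then obtain lk where lk: "lk \<in> V" "E (P (m - 2)) lk" "E (P (m - 1)) lk" by (auto simp: meets_def)
  have l1n: "\<not> E (P j) l1" if "2 \<le> j" "j < m" for j using far[of 0 j l1] that l1 by auto
  have lkn: "\<not> E (P j) lk" if "j + 3 \<le> m" for j using far[of j "m - 1" lk] that lk m by auto
  have ne: "l1 \<noteq> b" "l1 \<noteq> c" "lk \<noteq> a" "lk \<noteq> c" "l1 \<noteq> lk"
    using l1(2) Pb'[of 0] PR[of 0] lk(3) Pa'[of "m - 1"] PR[of "m - 1"] l1n[of "m - 1"] m by auto
  let ?Sc = "{r \<in> R. \<not> E r c}"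
  have f1: "fpath E V ?Sc l1 b (m - 1) (\<lambda>i. P (Suc i))"
    using P l1 unfolding spath_def fpath_def mk by auto
  have f2: "fpath E V ?Sc a lk (m - 1) P"
    using P lk unfolding spath_def fpath_def mk by (auto simp: numeral_2_eq_2)
  \<comment> \<open>A shorter path from \<open>l1\<close> could be prolonged by \<open>P 0\<close>
    to a shorter path from \<open>a\<close>.\<close>
  have s1: "spath E V ?Sc l1 b (m - 1) (\<lambda>i. P (Suc i))"
    unfolding spath_def
  proof (intro conjI allI impI f1)
    fix n Q assume Q: "fpath E V ?Sc l1 b n Q"
    have "fpath E V ?Sc a b (Suc n) (\<lambda>i. if i = 0 then P 0 else Q (i - 1))"
      unfolding fpath_def
    proof (intro conjI allI impI)
      fix i assume i: "Suc i < Suc n"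
      show "meets E V (if i = 0 then P 0 else Q (i - 1)) (if Suc i = 0 then P 0 else Q (Suc i - 1))"
      proof (cases i)
        case 0
        then show ?thesis using Q l1 by (auto simp: fpath_def intro: meetI[OF l1(1)])
      next
        case (Suc k)
        then show ?thesis using Q i by (auto simp: fpath_def)
      qed
    qed (use Q Pa PR m in \<open>auto simp: fpath_def\<close>)
    then have "m \<le> Suc n" using P unfolding spath_def by blast
    then show "m - 1 \<le> n" by simp
  qed
  have s2: "spath E V ?Sc a lk (m - 1) P"
    unfolding spath_def
  proof (intro conjI allI impI f2)
    fix n Q assume Q: "fpath E V ?Sc a lk n Q"
    have "fpath E V ?Sc a b (Suc n) (\<lambda>i. if i < n then Q i else P (m - 1))"
      unfolding fpath_def
    proof (intro conjI allI impI)
      fix i assume i: "Suc i < Suc n"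
      show "meets E V (if i < n then Q i else P (m - 1)) (if Suc i < n then Q (Suc i) else P (m - 1))"
      proof (cases "Suc i < n")
        case True
        then show ?thesis using Q i by (auto simp: fpath_def)
      next
        case False
        then have "i = n - 1" "i < n" using i by auto
        then show ?thesis using Q lk False by (auto simp: fpath_def intro: meetI[OF lk(1)])
      qed
    qed (use Q Pb PR m in \<open>auto simp: fpath_def\<close>)
    then have "m \<le> Suc n" using P unfolding spath_def by blast
    then show "m - 1 \<le> n" by simp
  qed
  have n1: "\<not> cav E R V l1 b c"
  proof
    assume "cav E R V l1 b c"
    moreover have "cav E R V b l1 a" using Pa Pb'[of 0] m PR[of 0] l1 V by (intro conn_row[where r = "P 0"]) auto
    then have "cav E R V b l1 c" using cab by (rule conn_trans)
    moreover have "cav E R V c l1 b" by (rule fpath_conn[OF f1 l1(1) V(2)])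
    ultimately have "asteroidal E R V l1 b c" using V ne l1 by (simp add: asteroidal_def)
    from min[OF this s1] m show False by linarith
  qed
  have n2: "\<not> cav E R V lk a c"
  proof
    assume "cav E R V lk a c"
    moreover have "cav E R V a lk b" using Pb Pa'[of "m - 1"] m PR[of "m - 1"] lk V by (intro conn_row[where r = "P (m - 1)"]) auto
    then have "cav E R V a lk c" using cbc by (rule conn_trans)
    moreover have "cav E R V c a lk" by (rule fpath_conn[OF f2 V(1) lk(1)])
    ultimately have "asteroidal E R V a lk c" using V ne lk by (simp add: asteroidal_def)
    from min[OF this s2] m show False by linarith
  qed
  let ?ok = "\<lambda>r. \<not> E r l1 \<and> \<not> E r lk"
  let ?D = "conn E {r \<in> R. ?ok r} V c"
  have D1: "cav E R V l1 c v" if "?D v" for v by (rule conn_mono[OF that]) auto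
  have Dk: "cav E R V lk c v" if "?D v" for v by (rule conn_mono[OF that]) auto
  have la: "cav E R V lk l1 a" using Pa lkn[of 0] m PR[of 0] l1 V by (intro conn_row[where r = "P 0"]) auto
  have nk: "\<not> cav E R V lk c l1" using n2 conn_sym[OF conn_trans[OF _ la]] by blast
  have lb: "cav E R V l1 lk b" using Pb l1n[of "m - 1"] m PR[of "m - 1"] lk V by (intro conn_row[where r = "P (m - 1)"]) auto
  have nl: "\<not> cav E R V l1 c lk" using n1 conn_sym[OF conn_trans[OF _ lb]] by blast
  \<comment> \<open>\<open>q\<close> is the first row on the way from \<open>c\<close> to
    \<open>a\<close> that contains \<open>l1\<close> or \<open>lk\<close>. If it contained only one
    of them, it would complete a connection that \<open>n1\<close> or \<open>n2\<close>
    excludes.\<close>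
  obtain q e where q: "q \<in> R" "E q l1" "E q lk" "e \<in> V" "E q e" "?D e"
  proof -
    have sub: "{r \<in> {r \<in> R. \<not> E r b}. ?ok r} \<subseteq> {r \<in> R. ?ok r}" by auto
    from conn_first[OF cca, of ?ok] show ?thesis
    proof
      assume "conn E {r \<in> {r \<in> R. \<not> E r b}. ?ok r} V c a"
      from conn_mono[OF this sub subset_refl] have "cav E R V lk c a" by (rule Dk)
      from conn_sym[OF this] show ?thesis using n2 by simp
    next
      assume "\<exists>q\<in>{r \<in> R. \<not> E r b}. \<not> ?ok q \<and> (\<exists>e\<in>V. E q e \<and> conn E {r \<in> {r \<in> R. \<not> E r b}. ?ok r} V c e)"
      then obtain q e where q: "q \<in> R" "\<not> ?ok q" "e \<in> V" "E q e" "conn E {r \<in> {r \<in> R. \<not> E r b}. ?ok r} V c e" by blast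
      have De: "?D e" using conn_mono[OF q(5) sub subset_refl] .
      have "E q lk" if "E q l1"
      proof (rule ccontr)
        assume "\<not> E q lk"
        then have "cav E R V lk e l1" using q l1 that by (intro conn_row[where r = q]) auto
        from conn_trans[OF Dk[OF De] this] show False using nk by simp
      qed
      moreover have "E q l1" if "E q lk"
      proof (rule ccontr)
        assume "\<not> E q l1"
        then have "cav E R V l1 e lk" using q lk that by (intro conn_row[where r = q]) auto
        from conn_trans[OF D1[OF De] this] show False using nl by simp
      qed
      ultimately show ?thesis using that q De by blast
    qed
  qed
  \<comment> \<open>Of the inner rows only the first contains \<open>l1\<close> and only the last
    contains \<open>lk\<close>. By \<open>short_conn\<close> these two meet, which bounds their
    distance on a shortest path.\<close>
  have m4: "m = 4"
  proof -
    let ?S = "P ` {1..m-2}"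
    have "fpath E V ?S l1 lk (m - 2) (\<lambda>i. P (Suc i))"
      using P l1 lk unfolding spath_def fpath_def mk by (auto simp: numeral_2_eq_2)
    then have cS: "conn E ?S V l1 lk" using l1(1) lk(1) by (rule fpath_conn)
    have SR: "?S \<subseteq> R" using PR m by auto
    obtain t1 t2 where t: "t1 \<in> ?S" "t2 \<in> ?S" "E t1 l1" "E t2 lk" "meets E V t1 t2"
      using H[unfolded short_conn_def, rule_format, OF q(1) l1(1) lk(1) SR q(2,3) cS ne(5)] by blast
    from t(1,2) obtain i j where ij: "t1 = P i" "t2 = P j" "1 \<le> i" "i \<le> m - 2" "1 \<le> j" "j \<le> m - 2" by auto
    have "i = 1" using l1n[of i] t(3) ij m by force
    moreover have "j = m - 2" using lkn[of j] t(4) ij m by force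
    ultimately have "m - 2 \<le> Suc 1" using spath_meet[OF P, of "m - 2" 1] t(5) ij m by simp
    then show ?thesis using m by simp
  qed
  define p1 p2 p3 p4 where p: "p1 = P 0" "p2 = P 1" "p3 = P 2" "p4 = P 3"
  have pR: "p1 \<in> R" "p2 \<in> R" "p3 \<in> R" "p4 \<in> R" using PR m4 by (auto simp: p)
  have pc: "\<not> E p1 c" "\<not> E p2 c" "\<not> E p3 c" "\<not> E p4 c" using PR m4 by (auto simp: p)
  obtain l2 where l2: "l2 \<in> V" "E p2 l2" "E p3 l2" using Pm[of 1] m4 by (auto simp: meets_def p numeral_2_eq_2)
  have pl: "E p1 l1" "E p2 l1" "\<not> E p3 l1" "\<not> E p4 l1" "\<not> E p1 l2" "\<not> E p4 l2"
    "\<not> E p1 lk" "\<not> E p2 lk" "E p3 lk" "E p4 lk"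
    using l1 lk m4 l1n[of 2] l1n[of 3] lkn[of 0] lkn[of 1] far[of 0 2 l2] far[of 1 3 l2] l2 by (auto simp: p)
  have pa: "E p1 a" "\<not> E p2 a" "\<not> E p3 a" "\<not> E p4 a" using Pa Pa' m4 by (auto simp: p)
  have pb: "\<not> E p1 b" "\<not> E p2 b" "\<not> E p3 b" "E p4 b" using Pb Pb'[of 0] Pb'[of 1] Pb'[of 2] m4 by (auto simp: p numeral_2_eq_2 numeral_3_eq_3)
  let ?U = "\<lambda>v. E p1 v \<or> E p2 v \<or> E p3 v \<or> E p4 v"
  have order: "f a < f l1 \<and> f l1 < f l2 \<and> f l2 < f lk \<and> f lk < f b"
    if f: "cord E S T f" "{p1, p2, p3, p4} \<subseteq> S" "{a, b, l1, l2, lk} \<subseteq> T" and ab: "f a < f b" for S T f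
  by (rule path4_order[OF f(1), of p1 p2 p3 p4]) (use f(2,3) ab pa pb pl l2 in auto)
  \<comment> \<open>Off the path, \<open>e\<close> would lie outside the stretch from
    \<open>a\<close> to \<open>b\<close>, and \<open>q\<close> would contain \<open>a\<close> or
    \<open>b\<close> besides \<open>l1\<close>, \<open>l2\<close>, \<open>lk\<close>, against
    \<open>four_links\<close>.\<close>
  have Ue: "?U e"
  proof (rule ccontr)
    assume ne: "\<not> ?U e"
    obtain f where f: "cord E (set [p1, p2, p3, p4, q]) (set [a, b, l1, l2, lk, e]) f"
      using loc8_cord[OF L, of "[p1, p2, p3, p4, q]" "[a, b, l1, l2, lk, e]"] pR q V l1 l2 lk by auto
    obtain f where f: "cord E (set [p1, p2, p3, p4, q]) (set [a, b, l1, l2, lk, e]) f" "f a < f b"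
      by (rule cord_cases[OF f, of a b]) (use V in auto)
    note D = cordD[OF f(1)]
    have o: "f a < f l1" "f l1 < f l2" "f l2 < f lk" "f lk < f b" using order[OF f(1) _ _ f(2)] by auto
    have q2: "E q l2" using D[of q l1 l2 lk] q o by auto
    have qa: "\<not> E q a"
      using four_links[OF L pR(1,2,3) q(1) V(1) l1(1) l2(1) lk(1)] pa pl l2 q q2 by blast
    have qb: "\<not> E q b"
      using four_links[OF L pR(2,3,4) q(1) l1(1) l2(1) lk(1) V(2)] pb pl l2 q q2 by blast
    have "f e < f a \<or> f b < f e"
      by (rule path4_out[OF f(1), of p1 p2 p3 p4 _ _ l1 l2 lk]) (use ne pa pb pl l2 o in auto)
    then have "E q a \<or> E q b" using D[of q e a l1] D[of q lk b e] q o by auto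
    then show False using qa qb by simp
  qed
  have nUc: "\<not> ?U c" using pc by simp
  \<comment> \<open>So the part of \<open>c\<close> avoiding \<open>l1\<close> and \<open>lk\<close>
    enters the path, through \<open>d\<close>. By \<open>n1\<close> and \<open>n2\<close> it does so
    strictly between \<open>l1\<close> and \<open>lk\<close>. As \<open>e'\<close> lies outside the
    path, \<open>d\<close> would have to contain \<open>l1\<close> or \<open>lk\<close>.\<close>
  obtain d e' x where d0: "d \<in> {r \<in> R. ?ok r}" "e' \<in> V" "x \<in> V" "?U x" "E d e'" "E d x" "conn E {r \<in> {r \<in> R. ?ok r}. off E V ?U r} V c e'"
    by (rule off_entry[where U = ?U, OF q(6) nUc Ue subset_refl])
  have d: "d \<in> R" "\<not> E d l1" "\<not> E d lk" using d0 by auto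
  have De': "?D e'" by (rule conn_mono[OF d0(7)]) auto
  have nUe': "\<not> ?U e'" using off_conn[OF d0(7) nUc] .
  obtain f where f: "cord E (set [p1, p2, p3, p4, d]) (set [a, b, l1, l2, lk, e', x]) f"
    using loc8_cord[OF L, of "[p1, p2, p3, p4, d]" "[a, b, l1, l2, lk, e', x]"] pR d d0 V l1 l2 lk by auto
  obtain f where f: "cord E (set [p1, p2, p3, p4, d]) (set [a, b, l1, l2, lk, e', x]) f" "f a < f b"
    by (rule cord_cases[OF f, of a b]) (use V in auto)
  note D = cordD[OF f(1)]
  have o: "f a < f l1" "f l1 < f l2" "f l2 < f lk" "f lk < f b" using order[OF f(1) _ _ f(2)] by auto
  have nx: "f x \<noteq> f l1" "f x \<noteq> f lk"
    using cord_neq[OF f(1), of x l1] cord_neq[OF f(1), of x lk] d0(6) d by auto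
  have cx1: "cav E R V l1 c x"
    using conn_trans[OF D1[OF De'] conn_row[of e' V x d]] d d0 by auto
  have cxk: "cav E R V lk c x"
    using conn_trans[OF Dk[OF De'] conn_row[of e' V x d]] d d0 by auto
  have np4: "\<not> E p4 x"
  proof
    assume "E p4 x"
    then have "cav E R V l1 x b" using pR pb pl V d0 by (intro conn_row[where r = p4]) auto
    from conn_trans[OF cx1 this] have "cav E R V l1 b c" by (rule conn_sym)
    then show False using n1 by simp
  qed
  have np1: "\<not> E p1 x"
  proof
    assume "E p1 x"
    then have "cav E R V lk x a" using pR pa pl V d0 by (intro conn_row[where r = p1]) auto
    from conn_trans[OF cxk this] have "cav E R V lk a c" by (rule conn_sym)
    then show False using n2 by simp
  qed
  have p23: "E p2 x \<or> E p3 x" using d0(4) np1 np4 by blast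
  have out: "f e' < f a \<or> f b < f e'"
    by (rule path4_out[OF f(1), of p1 p2 p3 p4 _ _ l1 l2 lk]) (use nUe' pa pb pl l2 o in auto)
  have nxa: "f x \<noteq> f a" "f x \<noteq> f b"
    using cord_neq[OF f(1), of x a] cord_neq[OF f(1), of x b] np1 np4 pa pb by auto
  have "f a < f x"
  proof (rule ccontr)
    assume "\<not> f a < f x"
    then have "f x < f a" using nxa by linarith
    then show False using D[of p2 x a l1] D[of p3 x a l2] pa pl l2 p23 o by auto
  qed
  moreover have "f x < f b"
  proof (rule ccontr)
    assume "\<not> f x < f b"
    then have "f b < f x" using nxa by linarith
    then show False using D[of p2 l2 b x] D[of p3 lk b x] pb pl l2 p23 o by auto
  qed
  moreover have "\<not> f x < f l1" using D[of p1 a x l1] np1 pa pl \<open>f a < f x\<close> by simp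
  moreover have "\<not> f x > f lk" using D[of p4 lk x b] np4 pb pl \<open>f x < f b\<close> by simp
  ultimately have xl: "f l1 < f x" "f x < f lk" using nx by linarith+
  from out show False
  proof
    assume "f e' < f a"
    then show False using D[of d e' l1 x] d d0 xl o by simp
  next
    assume "f b < f e'"
    then show False using D[of d e' lk x] d d0 xl o by simp
  qed
qed

text \<open>Induction on the length supplies the minimality for \<open>no_at_4\<close>. It leaves
  connecting paths of at most two rows, where \<open>at_long\<close> applies.\<close>

theorem no_at:
  assumes L: "loc8 E R V" and H: "short_conn E R V"
  shows "\<not> asteroidal E R V a b c"
proof
  assume at0: "asteroidal E R V a b c"
  have short: "m \<le> 2" if "asteroidal E R V a b c" "spath E V {r \<in> R. \<not> E r c} a b m P" for a b c m P
    using that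
  proof (induction m arbitrary: a b c P rule: less_induct)
    case (less m)
    show ?case
    proof (rule ccontr)
      assume "\<not> m \<le> 2"
      then consider "m = 3" | "m \<ge> 4" by linarith
      then show False
      proof cases
        case 1
        then show False using no_at3[OF L H less.prems(1)] less.prems(2) by simp
      next
        case 2
        show False
        proof (rule no_at_4[OF L H less.prems 2])
          fix a' b' c' n Q
          assume "asteroidal E R V a' b' c'" "spath E V {r \<in> R. \<not> E r c'} a' b' n Q" "3 \<le> n"
          then show "m \<le> n" using less.IH[of n a' b' c' Q] by fastforce
        qed
      qed
    qed
  qed
  have sh: "short2 E {r \<in> R. \<not> E r c} V a b" if asteroidal: "asteroidal E R V a b c" for a b c
  proof -
    have "cav E R V c a b" "a \<noteq> b" "a \<in> V" using asteroidal by (auto simp: asteroidal_def)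
    from ex_spath[OF this(1,2)] obtain n P where P: "spath E V {r \<in> R. \<not> E r c} a b n P" by blast
    then have "fpath E V {r \<in> R. \<not> E r c} a b n P" by (simp add: spath_def)
    then show ?thesis using short[OF asteroidal P] \<open>a \<in> V\<close> by (rule fpath_short2)
  qed
  have 1: "short2 E {r \<in> R. \<not> E r c} V a b" by (rule sh[OF at0])
  have 2: "short2 E {r \<in> R. \<not> E r a} V b c" by (rule sh[OF at_rot[OF at0]])
  have "short2 E {r \<in> R. \<not> E r b} V c a" by (rule sh[OF at_rot[OF at_rot[OF at0]]])
  then have 3: "short2 E {r \<in> R. \<not> E r b} V a c" unfolding short2_def meets_def by blast
  show False by (rule at_long[OF L at0 1 2 3])
qed

lemma short_conn_c1p:
  assumes "loc8 E R V" "short_conn E R V" "finite V"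
  shows "c1p E R V"
proof (rule tucker[OF assms(3)])
  show "atfree E R V"
    unfolding atfree_def using no_at[OF assms(1,2)] by (auto simp: asteroidal_def)
qed

section \<open>Detours\<close>

definition step :: "('r \<Rightarrow> 'c \<Rightarrow> bool) \<Rightarrow> 'c set \<Rightarrow> 'r set \<Rightarrow> 'r rel" where
  "step E V U = {(u, w). u \<in> U \<and> w \<in> U \<and> meets E V u w}"

text \<open>Two disjoint neighbours of \<open>p\<close> joined by a path away from \<open>p\<close>; a shortest such path closes a hole through \<open>p\<close>, and unlike holes detours are easy to search for.\<close>

definition detour :: "('r \<Rightarrow> 'c \<Rightarrow> bool) \<Rightarrow> 'r set \<Rightarrow> 'c set \<Rightarrow> 'r \<Rightarrow> 'r \<Rightarrow> 'r \<Rightarrow> bool" where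
  "detour E R V p s t \<longleftrightarrow> p \<in> R \<and> s \<in> R \<and> t \<in> R \<and> meets E V s p \<and> meets E V t p \<and> \<not> meets E V s t \<and>
     (\<exists>u w. u \<in> R \<and> \<not> meets E V u p \<and> meets E V s u \<and> meets E V w t \<and>
        (u, w) \<in> (step E V {r \<in> R. \<not> meets E V r p})\<^sup>*)"

definition no_detour :: "('r \<Rightarrow> 'c \<Rightarrow> bool) \<Rightarrow> 'r set \<Rightarrow> 'c set \<Rightarrow> bool" where
  "no_detour E R V \<longleftrightarrow> (\<forall>p s t. \<not> detour E R V p s t)"

lemma step_chain:
  assumes "\<And>l. i \<le> l \<Longrightarrow> l \<le> j \<Longrightarrow> P l \<in> U" "\<And>l. i \<le> l \<Longrightarrow> l < j \<Longrightarrow> meets E V (P l) (P (Suc l))" "i \<le> j"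
  shows "(P i, P j) \<in> (step E V U)\<^sup>*"
  using assms(3,1,2)
proof (induction j rule: dec_induct)
  case (step n)
  have "(P i, P n) \<in> (step E V U)\<^sup>*" using step by simp
  moreover have "(P n, P (Suc n)) \<in> step E V U" using step by (simp add: step_def)
  ultimately show ?case by (rule rtrancl_into_rtrancl)
qed simp

text \<open>If a shortest path between two columns of \<open>p\<close> has at least three rows, all
  of them meet \<open>p\<close>, since leaving \<open>p\<close> and returning would be a detour. By
  \<open>helly3\<close> the links can then be chosen in \<open>p\<close>, against
  \<open>four_links\<close>.\<close>

lemma short_conn_no_detour:
  assumes L: "loc8 E R V" and N: "no_detour E R V"
  shows "short_conn E R V"
  unfolding short_conn_def
proof (intro ballI allI impI)
  fix p x y S
  assume p: "p \<in> R" and xV: "x \<in> V" and yV: "y \<in> V" and S: "S \<subseteq> R" and px: "E p x" and py: "E p y"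
    and c: "conn E S V x y" and ne: "x \<noteq> y"
  obtain n P where P: "spath E V S x y n P" using ex_spath[OF c ne] by blast
  then have P0: "n \<ge> 1" "\<And>i. i < n \<Longrightarrow> P i \<in> S" "E (P 0) x" "E (P (n - 1)) y"
    and Pm: "\<And>i. Suc i < n \<Longrightarrow> meets E V (P i) (P (Suc i))"
    by (auto simp: spath_def fpath_def)
  have PR: "P i \<in> R" if "i < n" for i using P0(2)[OF that] S by auto
  have "n \<le> 2"
  proof (rule ccontr)
    assume "\<not> n \<le> 2"
    then have n3: "n \<ge> 3" by simp
    have all: "meets E V (P j) p" if j: "j < n" for j
    proof (rule ccontr)
      assume nj: "\<not> meets E V (P j) p"
      have m0: "meets E V (P 0) p" using P0(3) px xV by (auto intro: meetI)
      have mn: "meets E V (P (n - 1)) p" using P0(4) py yV by (auto intro: meetI)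
      \<comment> \<open>\<open>i\<close> is the last index before \<open>j\<close>, and
        \<open>k\<close> the first one after it, whose row meets \<open>p\<close>; in between the
        path stays away from \<open>p\<close>.\<close>
      define I where "I = {i. i < j \<and> meets E V (P i) p}"
      have "finite I" "0 \<in> I" using m0 nj by (auto simp: I_def intro!: gr0I)
      then have iI: "Max I \<in> I" by (intro Max_in) auto
      define i where "i = Max I"
      have i: "i < j" "meets E V (P i) p" using iI by (auto simp: I_def i_def)
      have imax: "\<not> meets E V (P l) p" if "i < l" "l < j" for l
      proof
        assume "meets E V (P l) p"
        then have "l \<in> I" using that by (simp add: I_def)
        from Max_ge[OF \<open>finite I\<close> this] that show False by (simp add: i_def)
      qed
      define k where "k = (LEAST k. j < k \<and> meets E V (P k) p)"
      have kex: "j < n - 1 \<and> meets E V (P (n - 1)) p" using mn nj j by (cases "j = n - 1") auto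
      then have k: "j < k" "meets E V (P k) p" "k \<le> n - 1"
        using LeastI[of "\<lambda>k. j < k \<and> meets E V (P k) p" "n - 1"] Least_le[of "\<lambda>k. j < k \<and> meets E V (P k) p" "n - 1"]
        unfolding k_def by auto
      have kmin: "\<not> meets E V (P l) p" if "j < l" "l < k" for l
        using not_less_Least[of l "\<lambda>k. j < k \<and> meets E V (P k) p"] that unfolding k_def by auto
      have off: "\<not> meets E V (P l) p" if "i < l" "l < k" for l
        using imax[of l] kmin[of l] nj that by (cases l j rule: linorder_cases) auto
      have kn: "k < n" using k j by simp
      have "detour E R V p (P i) (P k)"
        unfolding detour_def
      proof (intro conjI)
        show "\<not> meets E V (P i) (P k)" using spath_disj[OF P kn, of i] i k by simp
        have "(P (Suc i), P (k - 1)) \<in> (step E V {r \<in> R. \<not> meets E V r p})\<^sup>*"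
          using off PR Pm i k kn by (intro step_chain) auto
        moreover have "meets E V (P (k - 1)) (P k)" using Pm[of "k - 1"] i k kn by simp
        moreover have "P (Suc i) \<in> R" "meets E V (P i) (P (Suc i))" using PR Pm i k kn by auto
        moreover have "\<not> meets E V (P (Suc i)) p" using off i k by auto
        ultimately show "\<exists>u w. u \<in> R \<and> \<not> meets E V u p \<and> meets E V (P i) u \<and> meets E V w (P k) \<and>
          (u, w) \<in> (step E V {r \<in> R. \<not> meets E V r p})\<^sup>*" by blast
      qed (use p i k kn PR in auto)
      then show False using N by (simp add: no_detour_def)
    qed
    have R3: "P 0 \<in> R" "P 1 \<in> R" "P 2 \<in> R" using PR n3 by auto
    have m01: "meets E V (P 0) (P 1)" and m12: "meets E V (P 1) (P 2)"
      using Pm[of 0] Pm[of 1] n3 by (auto simp: numeral_2_eq_2)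
    have n02: "\<not> meets E V (P 0) (P 2)" using spath_disj[OF P, of 2 0] n3 by simp
    obtain g1 where g1: "g1 \<in> V" "E (P 0) g1" "E (P 1) g1" "E p g1"
      using helly3[OF L R3(1,2) p m01 all[of 1] all[of 0]] n3 by auto
    obtain g2 where g2: "g2 \<in> V" "E (P 1) g2" "E (P 2) g2" "E p g2"
      using helly3[OF L R3(2,3) p m12 all[of 2] all[of 1]] n3 by auto
    \<comment> \<open>The fourth column on \<open>p\<close> is the end \<open>y\<close> if the path
      has three rows, and otherwise a column common to \<open>p\<close>, \<open>P 2\<close> and
      \<open>P 3\<close>.\<close>
    obtain g3 where g3: "g3 \<in> V" "E (P 2) g3" "\<not> E (P 1) g3" "E p g3"
    proof (cases "n = 3")
      case True
      then show ?thesis using that[of y] yV P0(4) py spath_last[OF P, of 1] by auto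
    next
      case False
      then have n4: "3 < n" using n3 by simp
      then have m23: "meets E V (P 2) (P 3)" using Pm[of 2] by (simp add: numeral_3_eq_3 numeral_2_eq_2)
      obtain g where g: "g \<in> V" "E (P 2) g" "E (P 3) g" "E p g"
        using helly3[OF L R3(3) PR[OF n4] p m23 all[of 3] all[of 2]] n4 by auto
      moreover have "\<not> meets E V (P 1) (P 3)" using spath_disj[OF P n4, of 1] by simp
      ultimately show ?thesis using that[of g] by (auto simp: meets_def)
    qed
    have nx: "\<not> E (P 1) x" "\<not> E (P 2) x" using spath_first[OF P, of 1] spath_first[OF P, of 2] n3 by auto
    have nm: "\<not> E (P 2) g1" "\<not> E (P 0) g2" "\<not> E (P 0) g3"
      using n02 g1 g2 g3 by (auto simp: meets_def)
    show False
      using four_links[OF L R3 p xV g1(1) g2(1) g3(1)] px g1 g2 g3 P0(3) nx nm by blast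
  qed
  then have "short2 E S V x y" using P xV by (intro fpath_short2[of E V S x y n P]) (auto simp: spath_def)
  then show "\<exists>s1\<in>S. \<exists>s2\<in>S. E s1 x \<and> E s2 y \<and> meets E V s1 s2" by (simp add: short2_def)
qed

text \<open>In the transpose a path is a sequence of columns linked by rows. If it has at least
  three columns, \<open>p\<close> lies between its two ends, while no column of the path does. So
  some link leads across both ends, and its row contains them both.\<close>

lemma short_conn_transpose:
  assumes C: "c1p E R V"
  shows "short_conn (\<lambda>c r. E r c) V R"
  unfolding short_conn_def
proof (intro ballI allI impI)
  fix p x y S
  assume p: "p \<in> V" and x: "x \<in> R" and y: "y \<in> R" and S: "S \<subseteq> V" and px: "E x p" and py: "E y p"
    and c: "conn (\<lambda>c r. E r c) S R x y" and ne: "x \<noteq> y"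
  obtain lt where lt: "linord V lt" "cvx E R V lt" using C unfolding c1p_def by blast
  let ?good = "\<exists>s1\<in>S. \<exists>s2\<in>S. E x s1 \<and> E y s2 \<and> meets (\<lambda>c r. E r c) R s1 s2"
  obtain n P where P: "spath (\<lambda>c r. E r c) R S x y n P" using ex_spath[OF c ne] by blast
  then have P0: "n \<ge> 1" "\<And>i. i < n \<Longrightarrow> P i \<in> S" "E x (P 0)" "E y (P (n - 1))"
    and Pm: "\<And>i. Suc i < n \<Longrightarrow> meets (\<lambda>c r. E r c) R (P i) (P (Suc i))"
    by (auto simp: spath_def fpath_def)
  have PV: "P i \<in> V" if "i < n" for i using P0(2)[OF that] S by auto
  show ?good
  proof (cases "n \<le> 2")
    case True
    have "short2 (\<lambda>c r. E r c) S R x y"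
      by (rule fpath_short2[OF _ True x]) (use P in \<open>auto simp: spath_def\<close>)
    then show ?thesis by (simp add: short2_def)
  next
    case False
    then have n3: "n \<ge> 3" by simp
    define k where "k = n - 1"
    have k: "k < n" "0 < k" "n = Suc k" using n3 by (auto simp: k_def)
    have key: ?good
      if lt: "linord V lt" "cvx E R V lt" and cp: "lt (P 0) p" for lt
    proof -
      note T = linord_total[OF lt(1)]
      note I = linord_irrefl[OF lt(1)]
      note Tr = linord_trans[OF lt(1)]
      note D = cvxD[OF lt(2)]
      have nx: "\<not> E x (P i)" if "0 < i" "i < n" for i using spath_first[OF P that(2)] that by auto
      have ny: "\<not> E y (P i)" if "i < k" for i using spath_last[OF P, of i] that k by auto
      have yk: "E y (P k)" using P0(4) by (simp add: k_def)
      have "lt p (P k)"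
      proof (rule ccontr)
        assume "\<not> lt p (P k)"
        moreover have "P k \<noteq> p" using nx[of k] k px by auto
        ultimately have kp: "lt (P k) p" using T[of p "P k"] p PV k by auto
        have "P 0 \<noteq> P k" using ny[of 0] yk k by auto
        then consider "lt (P 0) (P k)" | "lt (P k) (P 0)" using T[of "P 0" "P k"] PV k by auto
        then show False
        proof cases
          case 1
          then show False using D[of x "P 0" "P k" p] x PV k p kp P0(3) px nx[of k] by auto
        next
          case 2
          then show False using D[of y "P k" "P 0" p] y PV k p cp yk py ny[of 0] by auto
        qed
      qed
      note pk = this
      define side where "side i \<longleftrightarrow> i = 0 \<or> lt (P i) (P 0)" for i
      have right: "i = k \<or> lt (P k) (P i)" if i: "i < n" "\<not> side i" for i
      proof (rule ccontr)
        assume c: "\<not> ?thesis"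
        have i0: "0 < i" "i < k" using i c by (auto simp: side_def k)
        have "P i \<noteq> P 0" using nx[of i] P0(3) i0 k by auto
        then have 1: "lt (P 0) (P i)" using T[of "P 0" "P i"] PV i i0 k by (auto simp: side_def)
        have "P i \<noteq> P k" using ny[of i] yk i0 by auto
        then have 2: "lt (P i) (P k)" using T[of "P i" "P k"] PV i0 k c by auto
        have "P i \<noteq> p" using nx[of i] px i0 k by auto
        then consider "lt (P i) p" | "lt p (P i)" using T[of "P i" p] PV p i by auto
        then show False
        proof cases
          case 1
          then show False using D[of x "P 0" "P i" p] \<open>lt (P 0) (P i)\<close> x PV p i i0 k P0(3) px nx[of i] by auto
        next
          case 2
          then show False using D[of y p "P i" "P k"] \<open>lt (P i) (P k)\<close> y PV p i i0 k py yk ny[of i] by auto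
        qed
      qed
      have "lt (P 0) (P k)" using Tr[of "P 0" p "P k"] cp pk PV p k by auto
      then have nsk: "\<not> side k" using I[of "P 0"] Tr[of "P 0" "P k" "P 0"] PV k by (auto simp: side_def)
      have "\<exists>i. Suc i < n \<and> side i \<and> \<not> side (Suc i)"
      proof (rule ccontr)
        assume a: "\<not> ?thesis"
        have "side i" if "i \<le> k" for i using that
        proof (induction i)
          case 0
          then show ?case by (simp add: side_def)
        next
          case (Suc i)
          then show ?case using a k by auto
        qed
        then show False using nsk by simp
      qed
      then obtain i where i: "Suc i < n" "side i" "\<not> side (Suc i)" by blast
      obtain r where r: "r \<in> R" "E r (P i)" "E r (P (Suc i))" using Pm[OF i(1)] by (auto simp: meets_def)
      have R: "Suc i = k \<or> lt (P k) (P (Suc i))" using right[OF i(1,3)] .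
      have PVs: "P 0 \<in> V" "P k \<in> V" "P i \<in> V" "P (Suc i) \<in> V" using PV i k by auto
      have 0: "lt (P 0) (P (Suc i))"
        using R \<open>lt (P 0) (P k)\<close> Tr[of "P 0" "P k" "P (Suc i)"] PVs by auto
      have r0: "E r (P 0)"
        using i(2) r D[of r "P i" "P 0" "P (Suc i)"] 0 PVs by (auto simp: side_def)
      have rk: "E r (P k)"
        using R r r0 D[of r "P 0" "P k" "P (Suc i)"] \<open>lt (P 0) (P k)\<close> PVs by auto
      show ?good
        using P0(2)[of 0] P0(2)[of k] k P0(3) yk r0 rk r(1) by (auto simp: meets_def)
    qed
    have "P 0 \<noteq> p" using spath_last[OF P, of 0] py k n3 by auto
    then consider "lt (P 0) p" | "lt p (P 0)" using linord_total[OF lt(1), of "P 0" p] PV k p by auto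
    then show ?thesis
      using key[OF lt] key[OF linord_rev[OF lt(1)] cvx_rev[OF lt(2)]] by cases auto
  qed
qed

text \<open>For the transpose, \<open>short_conn\<close> comes from the order of the columns already
  found and not from the absence of detours.\<close>

theorem no_detour_sc1p:
  assumes "loc8 E R V" "no_detour E R V" "finite V" "finite R"
  shows "c1p E R V \<and> c1p (\<lambda>c r. E r c) V R"
proof -
  have 1: "c1p E R V" by (rule short_conn_c1p[OF assms(1) short_conn_no_detour[OF assms(1,2)] assms(3)])
  have "c1p (\<lambda>c r. E r c) V R"
    by (rule short_conn_c1p[OF loc8_transpose[OF assms(1)] short_conn_transpose[OF 1] assms(4)])
  with 1 show ?thesis by simp
qed

text \<open>Let \<open>p\<close> share \<open>a\<close> with \<open>s\<close> and \<open>b\<close>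
  with \<open>t\<close>, where \<open>a\<close> comes before \<open>b\<close>. Rows disjoint from
  \<open>p\<close> cannot cross \<open>b\<close>, so the search from \<open>s\<close> stays before
  \<open>b\<close>. Where it meets \<open>t\<close>, it is between \<open>a\<close> and
  \<open>b\<close>, hence in \<open>p\<close>.\<close>

lemma c1p_no_detour:
  assumes C: "c1p E R V"
  shows "no_detour E R V"
  unfolding no_detour_def
proof (intro allI notI)
  fix p s t assume w: "detour E R V p s t"
  obtain lt0 where lt0: "linord V lt0" "cvx E R V lt0" using C unfolding c1p_def by blast
  obtain a b where a: "a \<in> V" "E s a" "E p a" and b: "b \<in> V" "E t b" "E p b"
    using w unfolding detour_def meets_def by blast
  have st: "\<not> (E s v \<and> E t v)" if "v \<in> V" for v using w that by (auto simp: detour_def meets_def)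
  obtain u w' where u: "u \<in> R" "\<not> meets E V u p" "meets E V s u" "meets E V w' t"
    and chain: "(u, w') \<in> (step E V {r \<in> R. \<not> meets E V r p})\<^sup>*" using w unfolding detour_def by blast
  have R: "p \<in> R" "s \<in> R" "t \<in> R" using w by (auto simp: detour_def)
  have ab: "a \<noteq> b" using st a b by blast
  have key: False if lt: "linord V lt" "cvx E R V lt" and le: "lt a b" for lt
  proof -
    note T = linord_total[OF lt(1)]
    note I = linord_irrefl[OF lt(1)]
    note Tr = linord_trans[OF lt(1)]
    note D = cvxD[OF lt(2)]
    define lf where "lf r \<longleftrightarrow> (\<forall>v\<in>V. E r v \<longrightarrow> lt v b)" for r
    have inv: "lf r \<and> r \<in> R \<and> \<not> meets E V r p" if "(u, r) \<in> (step E V {r \<in> R. \<not> meets E V r p})\<^sup>*" for r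
      using that
    proof (induction rule: rtrancl_induct)
      case base
      obtain x where x: "x \<in> V" "E s x" "E u x" using u(3) by (auto simp: meets_def)
      have "x \<noteq> b" using st x b by blast
      moreover have "\<not> lt b x" using D[of s a b x] le R a b x st by blast
      ultimately have xb: "lt x b" using T[of x b] x b by auto
      have "lt v b" if v: "v \<in> V" "E u v" for v
      proof (rule ccontr)
        assume "\<not> lt v b"
        moreover have "v \<noteq> b" using u(2) v b by (auto simp: meets_def)
        ultimately have "lt b v" using T[of b v] v b by auto
        then have "E u b" using D[of u x b v] xb u x b v by auto
        then show False using u(2) b by (auto simp: meets_def)
      qed
      then show ?case using u by (simp add: lf_def)
    next
      case (step r r')
      then have r': "r' \<in> R" "\<not> meets E V r' p" "meets E V r r'" by (auto simp: step_def)
      obtain x where x: "x \<in> V" "E r x" "E r' x" using r'(3) by (auto simp: meets_def)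
      have xb: "lt x b" using step.IH x by (auto simp: lf_def)
      have "lt v b" if v: "v \<in> V" "E r' v" for v
      proof (rule ccontr)
        assume "\<not> lt v b"
        moreover have "v \<noteq> b" using r'(2) v b by (auto simp: meets_def)
        ultimately have "lt b v" using T[of b v] v b by auto
        then have "E r' b" using D[of r' x b v] xb r' x b v by auto
        then show False using r'(2) b by (auto simp: meets_def)
      qed
      then show ?case using r' by (simp add: lf_def)
    qed
    have w': "lf w'" "w' \<in> R" "\<not> meets E V w' p" using inv[OF chain] by auto
    obtain y where y: "y \<in> V" "E w' y" "E t y" using u(4) by (auto simp: meets_def)
    have yb: "lt y b" using w'(1) y by (auto simp: lf_def)
    have "y \<noteq> a" using st y a by blast
    moreover have "\<not> lt y a" using D[of t y a b] le R y a b st by blast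
    ultimately have "lt a y" using T[of a y] a y by auto
    then have "E p y" using D[of p a y b] yb R a b y by auto
    then show False using w'(3) y by (auto simp: meets_def)
  qed
  from linord_total[OF lt0(1) a(1) b(1) ab] show False
    using key[OF lt0] key[OF linord_rev[OF lt0(1)] cvx_rev[OF lt0(2)]] by auto
qed

section \<open>Holes\<close>

text \<open>Holes are indexed periodically by all natural numbers.\<close>

definition hole :: "('r \<Rightarrow> 'c \<Rightarrow> bool) \<Rightarrow> 'r set \<Rightarrow> 'c set \<Rightarrow> nat \<Rightarrow> (nat \<Rightarrow> 'r) \<Rightarrow> bool" where
  "hole E R V n h \<longleftrightarrow> n \<ge> 4 \<and> (\<forall>i. h i \<in> R) \<and> (\<forall>i. h (i + n) = h i) \<and>
     (\<forall>i. meets E V (h i) (h (Suc i))) \<and>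
     (\<forall>i j. i + 2 \<le> j \<longrightarrow> j + 2 \<le> i + n \<longrightarrow> \<not> meets E V (h i) (h j))"

lemma hole_shift: "hole E R V n h \<Longrightarrow> hole E R V n (\<lambda>i. h (i + k))"
  unfolding hole_def
proof (intro conjI allI impI; (elim conjE)?)
  fix i assume "\<forall>i. h (i + n) = h i"
  then have "h (i + k + n) = h (i + k)" by blast
  then show "h (i + n + k) = h (i + k)" by (simp add: ac_simps)
qed auto

lemma hole_per: "hole E R V n h \<Longrightarrow> h (i + n * k) = h i"
proof (induction k)
  case (Suc k)
  have "h (i + n * k + n) = h (i + n * k)" using Suc.prems unfolding hole_def by blast
  then show ?case using Suc by (simp add: ac_simps)
qed simp

lemma hole_mod: "hole E R V n h \<Longrightarrow> h (i mod n) = h i"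
  using hole_per[of E R V n h "i mod n" "i div n"] by simp

lemma hole_mono: "hole E R V n h \<Longrightarrow> (\<And>i. h i \<in> S) \<Longrightarrow> hole E S V n h"
  unfolding hole_def by blast

lemma hole_detour:
  assumes "hole E R V n h"
  shows "detour E R V (h 0) (h 1) (h (n - 1))"
proof -
  have n: "n \<ge> 4" and R: "\<And>i. h i \<in> R" and m: "\<And>i. meets E V (h i) (h (Suc i))"
    and d: "\<And>i j. i + 2 \<le> j \<Longrightarrow> j + 2 \<le> i + n \<Longrightarrow> \<not> meets E V (h i) (h j)"
    and per: "h (0 + n) = h 0"
    using assms unfolding hole_def by blast+
  let ?U = "{r \<in> R. \<not> meets E V r (h 0)}"
  have U: "h i \<in> ?U" if "2 \<le> i" "i + 2 \<le> n" for i
    using d[of 0 i] that R meet_sym[of E V "h i" "h 0"] by auto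
  have "(h 2, h (n - 2)) \<in> (step E V ?U)\<^sup>*"
    by (rule step_chain) (use U m n in auto)
  moreover have "meets E V (h (n - 1)) (h 0)" using m[of "n - 1"] per n by simp
  moreover have "meets E V (h (n - 2)) (h (n - 1))" using m[of "n - 2"] n by (simp add: Suc_diff_Suc numeral_2_eq_2)
  moreover have "meets E V (h 1) (h 0)" using m[of 0] meet_sym[of E V "h 1" "h 0"] by simp
  moreover have "meets E V (h 1) (h 2)" using m[of 1] by (simp add: numeral_2_eq_2)
  moreover have "\<not> meets E V (h 1) (h (n - 1))" using d[of 1 "n - 1"] n by simp
  moreover have "h 2 \<in> R" "\<not> meets E V (h 2) (h 0)" using U[of 2] n by auto
  ultimately show ?thesis unfolding detour_def using R by blast
qed

lemma hole_make:
  assumes n: "N \<ge> 4" and R: "\<And>i. i < N \<Longrightarrow> c i \<in> R"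
    and m: "\<And>i. Suc i < N \<Longrightarrow> meets E V (c i) (c (Suc i))" and m0: "meets E V (c (N - 1)) (c 0)"
    and d: "\<And>i j. i + 2 \<le> j \<Longrightarrow> j < N \<Longrightarrow> \<not> (i = 0 \<and> j = N - 1) \<Longrightarrow> \<not> meets E V (c i) (c j)"
  shows "hole E R V N (\<lambda>i. c (i mod N))"
  unfolding hole_def
proof (intro conjI allI impI)
  fix i show "c (i mod N) \<in> R" using n by (intro R) simp
next
  fix i show "c ((i + N) mod N) = c (i mod N)" by simp
next
  fix i show "meets E V (c (i mod N)) (c (Suc i mod N))"
  proof (cases "Suc (i mod N) = N")
    case True
    then have "i mod N = N - 1" by simp
    then show ?thesis using m0 True by (simp add: mod_Suc)
  next
    case False
    moreover have "i mod N < N" using n by simp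
    ultimately have "Suc (i mod N) < N" by linarith
    then show ?thesis using m[of "i mod N"] False by (simp add: mod_Suc)
  qed
next
  fix i j assume ij: "i + 2 \<le> j" "j + 2 \<le> i + N"
  define a where "a = i mod N"
  define \<delta> where "\<delta> = j - i"
  have \<delta>: "2 \<le> \<delta>" "\<delta> + 2 \<le> N" "j = i + \<delta>" using ij by (auto simp: \<delta>_def)
  have aN: "a < N" using n by (simp add: a_def)
  have jm: "j mod N = (a + \<delta>) mod N" by (simp add: \<delta>(3) a_def mod_add_left_eq)
  show "\<not> meets E V (c (i mod N)) (c (j mod N))"
  proof (cases "a + \<delta> < N")
    case True
    then have "(a + \<delta>) mod N = a + \<delta>" by simp
    moreover have "\<not> (a = 0 \<and> a + \<delta> = N - 1)" using \<delta>(1,2) by arith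
    ultimately show ?thesis using d[of a "a + \<delta>"] True \<delta>(1) unfolding jm a_def[symmetric] by auto
  next
    case False
    then have "(a + \<delta>) mod N = a + \<delta> - N" using aN \<delta> by (simp add: mod_if)
    moreover have "\<not> (a + \<delta> - N = 0 \<and> a = N - 1)" "a + \<delta> - N + 2 \<le> a" using \<delta>(1,2) aN False by arith+
    ultimately show ?thesis using d[of "a + \<delta> - N" a] aN meet_sym[of E V "c a"]
      unfolding jm a_def[symmetric] by auto
  qed
qed (use n in auto)

text \<open>Take a shortest path between the columns that \<open>p\<close> shares with
  \<open>s\<close> and \<open>t\<close>, using \<open>s\<close>, \<open>t\<close> and rows disjoint
  from \<open>p\<close>. Its end rows meet \<open>p\<close>, so they are \<open>s\<close> and
  \<open>t\<close>, and \<open>p\<close> closes it to an induced cycle.\<close>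

lemma detour_hole:
  assumes "detour E R V p s t"
  shows "\<exists>n h. hole E R V n h \<and> h 0 = p"
proof -
  let ?U = "{r \<in> R. \<not> meets E V r p}"
  obtain u w where R: "p \<in> R" "s \<in> R" "t \<in> R" and sp: "meets E V s p" and tp: "meets E V t p"
    and st: "\<not> meets E V s t" and u: "u \<in> ?U" "meets E V s u" "meets E V w t" "(u, w) \<in> (step E V ?U)\<^sup>*"
    using assms unfolding detour_def by blast
  obtain x y where x: "x \<in> V" "E s x" "E p x" and y: "y \<in> V" "E t y" "E p y"
    using sp tp unfolding meets_def by blast
  define S where "S = insert s (insert t ?U)"
  obtain x1 where x1: "x1 \<in> V" "E s x1" "E u x1" using u(2) unfolding meets_def by blast
  obtain y1 where y1: "y1 \<in> V" "E w y1" "E t y1" using u(3) unfolding meets_def by blast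
  have ch: "r \<in> ?U \<and> (\<forall>v\<in>V. E r v \<longrightarrow> conn E S V x v)" if "(u, r) \<in> (step E V ?U)\<^sup>*" for r
    using that
  proof (induction rule: rtrancl_induct)
    case base
    have "conn E S V x x1" using x x1 by (intro conn_row[where r = s]) (auto simp: S_def)
    moreover have "conn E S V x1 v" if "v \<in> V" "E u v" for v
      using x1 u that by (intro conn_row[where r = u]) (auto simp: S_def)
    ultimately show ?case using conn_trans[of E S V x x1] u by blast
  next
    case (step r r')
    then have r': "r' \<in> ?U" "meets E V r r'" by (auto simp: step_def)
    then obtain z where z: "z \<in> V" "E r z" "E r' z" unfolding meets_def by blast
    have "conn E S V x z" using step.IH z by blast
    moreover have "conn E S V z v" if "v \<in> V" "E r' v" for v
      using z r' that by (intro conn_row[where r = r']) (auto simp: S_def)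
    ultimately show ?case using conn_trans[of E S V x z] r' by blast
  qed
  have "conn E S V x y1" using ch[OF u(4)] y1 by blast
  moreover have "conn E S V y1 y" using y y1 by (intro conn_row[where r = t]) (auto simp: S_def)
  ultimately have c: "conn E S V x y" by (rule conn_trans)
  have xt: "\<not> E t x" and ys: "\<not> E s y" using st x y by (auto simp: meets_def)
  then have "x \<noteq> y" using x by auto
  from ex_spath[OF c this] obtain n P where P: "spath E V S x y n P" by blast
  then have P0: "n \<ge> 1" "\<And>i. i < n \<Longrightarrow> P i \<in> S" "E (P 0) x" "E (P (n - 1)) y"
    and Pm: "\<And>i. Suc i < n \<Longrightarrow> meets E V (P i) (P (Suc i))"
    by (auto simp: spath_def fpath_def)
  have s0: "P 0 = s"
    using P0(2)[of 0] P0(1,3) xt x(1,3) by (auto simp: S_def meets_def)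
  have t0: "P (n - 1) = t"
    using P0(2)[of "n - 1"] P0(1,4) ys y(1,3) by (auto simp: S_def meets_def)
  have n3: "n \<ge> 3"
  proof (rule ccontr)
    assume "\<not> n \<ge> 3"
    then have "n = 1 \<or> n = 2" using P0(1) by linarith
    then show False using s0 t0 st Pm[of 0] x by (auto simp: meets_def)
  qed
  have mid: "P i \<in> ?U" if "0 < i" "Suc i < n" for i
  proof -
    have "P i \<noteq> s" using spath_first[OF P, of i] that x by auto
    moreover have "P i \<noteq> t" using spath_last[OF P, of i] that y by auto
    ultimately show ?thesis using P0(2)[of i] that by (auto simp: S_def)
  qed
  define c where "c i = (if i = 0 then p else P (i - 1))" for i
  have "hole E R V (Suc n) (\<lambda>i. c (i mod Suc n))"
  proof (rule hole_make)
    fix i assume "i < Suc n"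
    then have "i \<noteq> 0 \<Longrightarrow> P (i - 1) \<in> S" using P0(2)[of "i - 1"] by auto
    then show "c i \<in> R" using R by (auto simp: c_def S_def)
  next
    fix i assume i: "Suc i < Suc n"
    show "meets E V (c i) (c (Suc i))"
    proof (cases i)
      case 0
      then show ?thesis using sp meet_sym[of E V s p] by (simp add: c_def s0)
    next
      case (Suc k)
      then show ?thesis using Pm[of k] i by (simp add: c_def)
    qed
  next
    show "meets E V (c (Suc n - 1)) (c 0)" using tp t0 n3 by (simp add: c_def)
  next
    fix i j assume ij: "i + 2 \<le> j" "j < Suc n" "\<not> (i = 0 \<and> j = Suc n - 1)"
    show "\<not> meets E V (c i) (c j)"
    proof (cases i)
      case 0
      then show ?thesis using mid[of "j - 1"] ij meet_sym[of E V p] by (auto simp: c_def)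
    next
      case (Suc k)
      then show ?thesis using spath_disj[OF P, of "j - 1" k] ij by (simp add: c_def)
    qed
  qed (use n3 in auto)
  moreover have "c (0 mod Suc n) = p" by (simp add: c_def)
  ultimately show ?thesis by blast
qed

lemma cord_c1p:
  assumes "cord E S T f"
  shows "c1p E S T"
proof -
  have "linord T (\<lambda>x y. f x < f y)"
    unfolding linord_def using cord_neq[OF assms] by (auto simp: neq_iff)
  moreover have "cvx E S T (\<lambda>x y. f x < f y)"
    using assms unfolding cvx_def cord_def by blast
  ultimately show ?thesis unfolding c1p_def by blast
qed

text \<open>A hole with at most 8 rows fits into a window together with one link per row, and a
  consecutive order there excludes detours.\<close>

lemma hole_len:
  assumes L: "loc8 E R V" and H: "hole E R V n h"
  shows "n \<ge> 9"
proof (rule ccontr)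
  assume "\<not> n \<ge> 9"
  then have n8: "n \<le> 8" by simp
  have n4: "n \<ge> 4" using H by (simp add: hole_def)
  define l where "l r s = (SOME c. c \<in> V \<and> E r c \<and> E s c)" for r s
  have l: "l (h i) (h (Suc i)) \<in> V \<and> E (h i) (l (h i) (h (Suc i))) \<and> E (h (Suc i)) (l (h i) (h (Suc i)))" for i
    unfolding l_def by (rule someI_ex) (use H in \<open>auto simp: hole_def meets_def\<close>)
  define rs where "rs = map h [0..<n]"
  define vs where "vs = map (\<lambda>i. l (h i) (h (Suc i))) [0..<n]"
  obtain f where "cord E (set rs) (set vs) f"
    using loc8_cord[OF L, of rs vs] H l n8 by (auto simp: rs_def vs_def hole_def)
  then have "no_detour E (set rs) (set vs)" by (intro c1p_no_detour cord_c1p)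
  moreover have "hole E (set rs) (set vs) n h"
    unfolding hole_def
  proof (intro conjI allI impI)
    fix i
    have i: "i mod n < n" using n4 by simp
    have hS: "h (Suc (i mod n)) = h (Suc i)"
      using hole_mod[OF H, of "Suc i"] hole_mod[OF H, of "Suc (i mod n)"] by (simp add: mod_Suc_eq)
    show "h i \<in> set rs" using i hole_mod[OF H, of i] by (auto simp: rs_def intro!: image_eqI[of _ _ "i mod n"])
    have "l (h i) (h (Suc i)) \<in> set vs"
      using i hole_mod[OF H, of i] hS by (auto simp: vs_def intro!: image_eqI[of _ _ "i mod n"])
    then show "meets E (set vs) (h i) (h (Suc i))" using l[of i] by (intro meetI) auto
  next
    fix i j assume "i + 2 \<le> j" "j + 2 \<le> i + n"
    then have "\<not> meets E V (h i) (h j)" using H by (simp add: hole_def)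
    moreover have "set vs \<subseteq> V" using l by (auto simp: vs_def)
    ultimately show "\<not> meets E (set vs) (h i) (h j)" by (auto simp: meets_def)
  qed (use H in \<open>auto simp: hole_def\<close>)
  ultimately show False using hole_detour unfolding no_detour_def by blast
qed

text \<open>If \<open>e\<close> is on no row of the hole, it lies outside the stretch of any four
  successive rows. So from a place where it touches the hole, \<open>q\<close> runs past an end of
  the window. Repeating this collects four successive links in \<open>q\<close>, against
  \<open>four_links\<close>.\<close>

lemma hole_closed:
  assumes L: "loc8 E R V" and H: "hole E R V n h" and q: "q \<in> R" "x \<in> V" "E q x" "E (h i) x" and e: "e \<in> V" "E q e"
  shows "\<exists>j. E (h j) e"
proof (rule ccontr)
  assume ne: "\<not> ?thesis"
  have n9: "n \<ge> 9" by (rule hole_len[OF L H])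
  have R: "\<And>i. h i \<in> R" and d: "\<And>i j. i + 2 \<le> j \<Longrightarrow> j + 2 \<le> i + n \<Longrightarrow> \<not> meets E V (h i) (h j)"
    using H unfolding hole_def by blast+
  have "\<forall>i. \<exists>c. c \<in> V \<and> E (h i) c \<and> E (h (Suc i)) c" using H by (auto simp: hole_def meets_def)
  from choice[OF this] obtain l where l: "\<And>i. l i \<in> V" "\<And>i. E (h i) (l i)" "\<And>i. E (h (Suc i)) (l i)" by blast
  have up: "\<not> E (h j) (l i)" if "i + 2 \<le> j" "j \<le> i + 7" for i j
    using d[of i j] that n9 l[of i] by (auto simp: meets_def)
  have dn: "\<not> E (h j) (l i)" if "j < i" "i \<le> j + 6" for i j
    using d[of j "Suc i"] that n9 l[of i] by (auto simp: meets_def)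
  define p where "p k j = h (k + j)" for k j
  have ord: "\<exists>f. cord E (set [p k 1, p k 2, p k 3, p k 4, q]) (set [l k, l (k+1), l (k+2), l (k+3), l (k+4), e, y]) f \<and>
      f (l k) < f (l (k+1)) \<and> f (l (k+1)) < f (l (k+2)) \<and> f (l (k+2)) < f (l (k+3)) \<and> f (l (k+3)) < f (l (k+4)) \<and>
      (f e < f (l k) \<or> f (l (k+4)) < f e)" if y: "y \<in> V" for k y
  proof -
    obtain f where f: "cord E (set [p k 1, p k 2, p k 3, p k 4, q]) (set [l k, l (k+1), l (k+2), l (k+3), l (k+4), e, y]) f"
      using loc8_cord[OF L, of "[p k 1, p k 2, p k 3, p k 4, q]" "[l k, l (k+1), l (k+2), l (k+3), l (k+4), e, y]"]
        R q e l(1) y by (auto simp: p_def)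
    have "l k \<noteq> l (k+4)" using up[of k "k+4"] l(2)[of "k+4"] by auto
    then obtain f where f: "cord E (set [p k 1, p k 2, p k 3, p k 4, q]) (set [l k, l (k+1), l (k+2), l (k+3), l (k+4), e, y]) f"
      "f (l k) < f (l (k+4))"
      by (rule cord_cases[OF f, rotated 2]) auto
    have in1: "E (p k 1) (l k)" "E (p k 1) (l (k+1))" "E (p k 2) (l (k+1))" "E (p k 2) (l (k+2))"
      "E (p k 3) (l (k+2))" "E (p k 3) (l (k+3))" "E (p k 4) (l (k+3))" "E (p k 4) (l (k+4))"
      using l(3)[of k] l(2)[of "k+1"] l(3)[of "k+1"] l(2)[of "k+2"] l(3)[of "k+2"] l(2)[of "k+3"] l(3)[of "k+3"] l(2)[of "k+4"]
      by (simp_all add: p_def eval_nat_numeral)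
    have no1: "\<not> E (p k 1) (l (k+2))" "\<not> E (p k 1) (l (k+3))" "\<not> E (p k 1) (l (k+4))"
      "\<not> E (p k 2) (l k)" "\<not> E (p k 2) (l (k+3))" "\<not> E (p k 2) (l (k+4))"
      "\<not> E (p k 3) (l k)" "\<not> E (p k 3) (l (k+1))" "\<not> E (p k 3) (l (k+4))"
      "\<not> E (p k 4) (l k)" "\<not> E (p k 4) (l (k+1))" "\<not> E (p k 4) (l (k+2))"
      unfolding p_def by ((rule dn, simp, simp) | (rule up, simp, simp))+
    have o: "f (l k) < f (l (k+1)) \<and> f (l (k+1)) < f (l (k+2)) \<and> f (l (k+2)) < f (l (k+3)) \<and> f (l (k+3)) < f (l (k+4))"
      by (rule path4_order[OF f(1), of "p k 1" "p k 2" "p k 3" "p k 4"]) (use in1 no1 f(2) in simp_all)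
    have "f e < f (l k) \<or> f (l (k+4)) < f e"
      by (rule path4_out[OF f(1), of "p k 1" "p k 2" "p k 3" "p k 4" _ _ "l (k+1)" "l (k+2)" "l (k+3)"])
        (use in1 ne o in \<open>auto simp: p_def\<close>)
    then show ?thesis using f(1) o by blast
  qed
  have hx: "E (p (i + n - 2) 2) x"
  proof -
    have "i + n - 2 + 2 = i + n" using n9 by simp
    moreover have "h (i + n) = h i" using H unfolding hole_def by blast
    ultimately show ?thesis using q(4) unfolding p_def by metis
  qed
  have "\<exists>j\<ge>5. E q (l j)"
  proof -
    \<comment> \<open>\<open>h i\<close> becomes the second row of the window; adding the period
      \<open>n\<close> keeps the subtractions below from being truncated.\<close>
    define k where "k = i + n - 2"
    have k5: "k \<ge> 5" using n9 by (simp add: k_def)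
    obtain f where f: "cord E (set [p k 1, p k 2, p k 3, p k 4, q]) (set [l k, l (k+1), l (k+2), l (k+3), l (k+4), e, x]) f"
      and o: "f (l k) < f (l (k+1))" "f (l (k+1)) < f (l (k+2))" "f (l (k+2)) < f (l (k+3))" "f (l (k+3)) < f (l (k+4))"
      and out: "f e < f (l k) \<or> f (l (k+4)) < f e" using ord[OF q(2)] by blast
    note D = cordD[OF f]
    have p2: "E (p k 2) x" "E (p k 2) (l (k+1))" "E (p k 2) (l (k+2))" "\<not> E (p k 2) (l k)" "\<not> E (p k 2) (l (k+4))"
      using hx[folded k_def] l(3)[of "k+1"] l(2)[of "k+2"] up[of k "k+2"] dn[of "k+2" "k+4"]
      unfolding p_def by simp_all
    have ne1: "f x \<noteq> f (l k)" "f x \<noteq> f (l (k+4))"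
      using cord_neq[OF f, of x "l k"] cord_neq[OF f, of x "l (k+4)"] p2 by auto
    have 1: "f (l k) < f x" using D[of "p k 2" x "l k" "l (k+1)"] p2 ne1 o by (simp; linarith)
    have 2: "f x < f (l (k+4))" using D[of "p k 2" "l (k+2)" "l (k+4)" x] p2 ne1 o by (simp; linarith)
    from out show ?thesis
    proof
      assume "f e < f (l k)"
      then have "E q (l k)" using D[of q e "l k" x] q e 1 by auto
      then show ?thesis using k5 by auto
    next
      assume "f (l (k+4)) < f e"
      then have "E q (l (k+4))" using D[of q x "l (k+4)" e] q e 2 by auto
      then show ?thesis using k5 by (intro exI[of _ "k+4"]) auto
    qed
  qed
  then obtain j where j: "j \<ge> 5" "E q (l j)" by blast
  \<comment> \<open>If the middle link of a window is in \<open>q\<close>, then so are the two links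
    on the side towards \<open>e\<close>.\<close>
  have W: "E q (l (k+3)) \<and> E q (l (k+4)) \<or> E q (l (k+1)) \<and> E q (l k)" if k: "E q (l (k+2))" for k
  proof -
    obtain f where f: "cord E (set [p k 1, p k 2, p k 3, p k 4, q]) (set [l k, l (k+1), l (k+2), l (k+3), l (k+4), e, x]) f"
      and o: "f (l k) < f (l (k+1))" "f (l (k+1)) < f (l (k+2))" "f (l (k+2)) < f (l (k+3))" "f (l (k+3)) < f (l (k+4))"
      and out: "f e < f (l k) \<or> f (l (k+4)) < f e" using ord[OF q(2)] by blast
    note D = cordD[OF f]
    from out show ?thesis
    proof
      assume "f e < f (l k)"
      then have "E q (l k)" "E q (l (k+1))" using D[of q e "l k" "l (k+2)"] D[of q e "l (k+1)" "l (k+2)"] q e k o by auto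
      then show ?thesis by simp
    next
      assume "f (l (k+4)) < f e"
      then have "E q (l (k+3))" "E q (l (k+4))"
        using D[of q "l (k+2)" "l (k+4)" e] D[of q "l (k+2)" "l (k+3)" e] q e k o by auto
      then show ?thesis by simp
    qed
  qed
  have FL: False if "E q (l m)" "E q (l (m+1))" "E q (l (m+2))" "E q (l (m+3))" for m
  proof (rule four_links[OF L, of "h (m+1)" "h (m+2)" "h (m+3)" q "l m" "l (m+1)" "l (m+2)" "l (m+3)"])
    show "E (h (m+1)) (l m)" "E (h (m+2)) (l (m+1))" "E (h (m+3)) (l (m+2))"
      using l(3)[of m] l(3)[of "m+1"] l(3)[of "m+2"] by (simp_all add: eval_nat_numeral)
  qed (use that q R l up dn in auto)
  obtain m where m: "m \<ge> 1" "E q (l m)" "E q (l (m+1))" "E q (l (m+2))"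
  proof -
    have "j = j - 2 + 2" using j by simp
    then have "E q (l (j - 2 + 2))" using j by simp
    from W[OF this] show ?thesis
    proof
      assume a: "E q (l (j - 2 + 3)) \<and> E q (l (j - 2 + 4))"
      have "j - 2 + 3 = j + 1" "j - 2 + 4 = j + 2" using j by auto
      then show ?thesis using that[of j] j a by simp
    next
      assume a: "E q (l (j - 2 + 1)) \<and> E q (l (j - 2))"
      have "j - 2 + 2 = j" using j by auto
      then show ?thesis using that[of "j - 2"] j a by simp
    qed
  qed
  have "m - 1 + 2 = m + 1" using m by simp
  then have "E q (l (m - 1 + 2))" using m by simp
  from W[OF this] show False
  proof
    assume a: "E q (l (m - 1 + 3)) \<and> E q (l (m - 1 + 4))"
    have "m - 1 + 3 = m + 2" "m - 1 + 4 = m + 3" using m by auto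
    then have "E q (l (m + 3))" using a by metis
    then show False using FL[OF m(2-4)] by simp
  next
    assume a: "E q (l (m - 1 + 1)) \<and> E q (l (m - 1))"
    have "m - 1 + 1 = m" "m - 1 + 2 = m + 1" "m - 1 + 3 = m + 2" using m by auto
    then have "E q (l (m - 1))" "E q (l (m - 1 + 1))" "E q (l (m - 1 + 2))" "E q (l (m - 1 + 3))" using a m by metis+
    then show False by (rule FL)
  qed
qed

text \<open>Walking along the first hole from \<open>v\<close>, \<open>hole_closed\<close> keeps
  every row within the columns of the second. Used in both directions, it shows that holes with a
  common column occupy the same columns.\<close>

lemma hole_union:
  assumes L: "loc8 E R V" and H: "hole E R V n h" and H': "hole E R V n' h'"
    and v: "v \<in> V" "E (h i) v" "E (h' i') v" and x: "x \<in> V" "E (h j) x"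
  shows "\<exists>j'. E (h' j') x"
proof -
  have R: "\<And>i. h i \<in> R" "\<And>i. meets E V (h i) (h (Suc i))" and n: "n \<ge> 4" using H unfolding hole_def by blast+
  have all: "\<forall>u\<in>V. E (h (i + d)) u \<longrightarrow> (\<exists>j'. E (h' j') u)" for d
  proof (induction d)
    case 0
    then show ?case using hole_closed[OF L H' R(1) v(1) _ v(3)] v(2) by auto
  next
    case (Suc d)
    obtain w where w: "w \<in> V" "E (h (i + d)) w" "E (h (Suc (i + d))) w" using R(2) unfolding meets_def by blast
    then obtain j' where "E (h' j') w" using Suc by blast
    then show ?case using hole_closed[OF L H' R(1) w(1) w(3)] by auto
  qed
  have "i \<le> j + n * i" using n by (simp add: trans_le_add2)
  then obtain d where "j + n * i = i + d" using le_iff_add by auto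
  then have "h (i + d) = h j" using hole_per[OF H, of j i] by simp
  then show ?thesis using all[of d] x by auto
qed

section \<open>Cheapest cuts\<close>

text \<open>\<open>X\<close> is a minimal set of deleted rows, \<open>R0\<close> the remaining rows of the component in their consecutive order, and each \<open>y \<in> X\<close> would close a hole with the path \<open>k y 1, \<dots>, k y (m y)\<close>.\<close>

locale cuts =
  fixes E :: "'r \<Rightarrow> 'c \<Rightarrow> bool" and R :: "'r set" and V :: "'c set" and X R0 :: "'r set" and V0 :: "'c set"
    and lt :: "'c \<Rightarrow> 'c \<Rightarrow> bool" and k :: "'r \<Rightarrow> nat \<Rightarrow> 'r" and m :: "'r \<Rightarrow> nat"
  assumes L: "loc8 E R V" and XR: "X \<subseteq> R" and R0R: "R0 \<subseteq> R" and lin: "linord V lt" and cv: "cvx E R0 V lt"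
    and m8: "\<And>y. y \<in> X \<Longrightarrow> m y \<ge> 8"
    and kR: "\<And>y i. y \<in> X \<Longrightarrow> 1 \<le> i \<Longrightarrow> i \<le> m y \<Longrightarrow> k y i \<in> R0"
    and kk: "\<And>y i. y \<in> X \<Longrightarrow> 1 \<le> i \<Longrightarrow> i < m y \<Longrightarrow> meets E V (k y i) (k y (Suc i))"
    and yk1: "\<And>y. y \<in> X \<Longrightarrow> meets E V y (k y 1)" and ykm: "\<And>y. y \<in> X \<Longrightarrow> meets E V y (k y (m y))"
    and yk: "\<And>y i. y \<in> X \<Longrightarrow> 1 < i \<Longrightarrow> i < m y \<Longrightarrow> \<not> meets E V y (k y i)"
    and inc: "\<And>y i j u v. y \<in> X \<Longrightarrow> 1 \<le> i \<Longrightarrow> i + 2 \<le> j \<Longrightarrow> j \<le> m y \<Longrightarrow> u \<in> V \<Longrightarrow> v \<in> V \<Longrightarrow>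
        E (k y i) u \<Longrightarrow> E (k y j) v \<Longrightarrow> lt u v"
    and V0V: "V0 \<subseteq> V"
    and cover: "\<And>y u. y \<in> X \<Longrightarrow> u \<in> V0 \<Longrightarrow> E y u \<or> (\<exists>i. 1 \<le> i \<and> i \<le> m y \<and> E (k y i) u)"
    and inV0: "\<And>r u. r \<in> X \<union> R0 \<Longrightarrow> u \<in> V \<Longrightarrow> E r u \<Longrightarrow> u \<in> V0"
begin

text \<open>The first and the last row of the path are left out, because they share columns with
  \<open>y\<close>.\<close>

definition above :: "'r \<Rightarrow> 'c \<Rightarrow> bool" where
  "above y c \<longleftrightarrow> (\<forall>i u. 2 \<le> i \<longrightarrow> i < m y \<longrightarrow> u \<in> V \<longrightarrow> E (k y i) u \<longrightarrow> lt u c)"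

definition below :: "'r \<Rightarrow> 'c \<Rightarrow> bool" where
  "below y c \<longleftrightarrow> (\<forall>i u. 2 \<le> i \<longrightarrow> i < m y \<longrightarrow> u \<in> V \<longrightarrow> E (k y i) u \<longrightarrow> lt c u)"

lemma aboveD: "above y c \<Longrightarrow> 2 \<le> i \<Longrightarrow> i < m y \<Longrightarrow> u \<in> V \<Longrightarrow> E (k y i) u \<Longrightarrow> lt u c"
  and belowD: "below y c \<Longrightarrow> 2 \<le> i \<Longrightarrow> i < m y \<Longrightarrow> u \<in> V \<Longrightarrow> E (k y i) u \<Longrightarrow> lt c u"
  unfolding above_def below_def by blast+

lemmas tot = linord_total[OF lin]
lemmas irr = linord_irrefl[OF lin]
lemmas tra = linord_trans[OF lin]
lemmas con = cvxD[OF cv]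

text \<open>Reversing the order together with all paths is a symmetry, so what is shown for the
  right side also holds on the left.\<close>

lemma rev: "cuts E R V X R0 V0 (\<lambda>a b. lt b a) (\<lambda>y i. k y (m y + 1 - i)) m"
proof
  show "linord V (\<lambda>a b. lt b a)" "cvx E R0 V (\<lambda>a b. lt b a)" using linord_rev[OF lin] cvx_rev[OF cv] by auto
  fix y assume y: "y \<in> X"
  show "meets E V y (k y (m y + 1 - 1))" "meets E V y (k y (m y + 1 - m y))" using yk1[OF y] ykm[OF y] by simp_all
  fix i
  show "k y (m y + 1 - i) \<in> R0" if "1 \<le> i" "i \<le> m y" using kR[OF y, of "m y + 1 - i"] that by simp
  show "meets E V (k y (m y + 1 - i)) (k y (m y + 1 - Suc i))" if "1 \<le> i" "i < m y"
  proof -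
    have "Suc (m y - i) = m y + 1 - i" using that by simp
    then show ?thesis using kk[OF y, of "m y - i"] that meet_sym[of E V "k y (m y - i)"] by simp
  qed
  show "\<not> meets E V y (k y (m y + 1 - i))" if "1 < i" "i < m y" using yk[OF y, of "m y + 1 - i"] that by simp
  show "lt v u" if "1 \<le> i" "i + 2 \<le> j" "j \<le> m y" "u \<in> V" "v \<in> V" "E (k y (m y + 1 - i)) u" "E (k y (m y + 1 - j)) v" for j u v
    using inc[OF y, of "m y + 1 - j" "m y + 1 - i" v u] that by simp
  show "E y u \<or> (\<exists>i. 1 \<le> i \<and> i \<le> m y \<and> E (k y (m y + 1 - i)) u)" if "u \<in> V0" for u
  proof -
    from cover[OF y that] show ?thesis
    proof
      assume "\<exists>i. 1 \<le> i \<and> i \<le> m y \<and> E (k y i) u"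
      then obtain i where "1 \<le> i" "i \<le> m y" "E (k y i) u" by blast
      then show ?thesis by (intro disjI2 exI[of _ "m y + 1 - i"]) (simp; arith)
    qed simp
  qed
qed (use L XR R0R m8 V0V inV0 in auto)

text \<open>The inner rows are linked intervals that miss \<open>c\<close>, so they are all on the
  same side of it.\<close>

lemma side:
  assumes y: "y \<in> X" and c: "c \<in> V" and n: "\<And>i. 2 \<le> i \<Longrightarrow> i < m y \<Longrightarrow> \<not> E (k y i) c"
  shows "above y c \<or> below y c"
proof -
  define A where "A i \<longleftrightarrow> (\<forall>u\<in>V. E (k y i) u \<longrightarrow> lt u c)" for i
  define B where "B i \<longleftrightarrow> (\<forall>u\<in>V. E (k y i) u \<longrightarrow> lt c u)" for i
  have AB: "A i \<or> B i" if i: "2 \<le> i" "i < m y" for i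
  proof (rule ccontr)
    assume "\<not> ?thesis"
    then obtain u v where u: "u \<in> V" "E (k y i) u" "\<not> lt u c" and v: "v \<in> V" "E (k y i) v" "\<not> lt c v"
      unfolding A_def B_def by blast
    have "u \<noteq> c" "v \<noteq> c" using n[OF i] u v by auto
    then have "lt c u" "lt v c" using tot[of c u] tot[of c v] c u v by auto
    then show False using con[of "k y i" v c u] kR[OF y, of i] i n[OF i] u v c by auto
  qed
  have link: "\<exists>u\<in>V. E (k y i) u \<and> E (k y (Suc i)) u" if "2 \<le> i" "Suc i < m y" for i
    using kk[OF y, of i] that by (auto simp: meets_def)
  have up: "A i" if "A 2" "2 \<le> i" "i < m y" for i
    using that(2,3)
  proof (induction i rule: dec_induct)
    case (step i)
    then obtain u where u: "u \<in> V" "E (k y i) u" "E (k y (Suc i)) u" using link by auto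
    have "lt u c" using step u by (simp add: A_def)
    then have "\<not> B (Suc i)" using u tra[of u c u] irr[of u] c by (auto simp: B_def)
    then show ?case using AB[of "Suc i"] step by auto
  qed (rule that(1))
  have dn: "B i" if "B 2" "2 \<le> i" "i < m y" for i
    using that(2,3)
  proof (induction i rule: dec_induct)
    case (step i)
    then obtain u where u: "u \<in> V" "E (k y i) u" "E (k y (Suc i)) u" using link by auto
    have "lt c u" using step u by (simp add: B_def)
    then have "\<not> A (Suc i)" using u tra[of u c u] irr[of u] c by (auto simp: A_def)
    then show ?case using AB[of "Suc i"] step by auto
  qed (rule that(1))
  have "A 2 \<or> B 2" using AB[of 2] m8[OF y] by simp
  then show ?thesis using up dn unfolding above_def below_def A_def B_def by blast
qed

lemma mid_nonempty: "y \<in> X \<Longrightarrow> 1 \<le> i \<Longrightarrow> i < m y \<Longrightarrow> \<exists>u\<in>V. E (k y i) u \<and> E (k y (Suc i)) u"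
  using kk[of y i] by (auto simp: meets_def)

lemma last_link: "y \<in> X \<Longrightarrow> \<exists>u\<in>V. E (k y (m y - 1)) u \<and> E (k y (m y)) u"
  using mid_nonempty[of y "m y - 1"] m8[of y] by simp

lemma outside: "y \<in> X \<Longrightarrow> c \<in> V \<Longrightarrow> E y c \<Longrightarrow> above y c \<or> below y c"
  by (rule side) (use yk in \<open>auto simp: meets_def\<close>)

lemma lam:
  assumes y: "y \<in> X"
  obtains c where "c \<in> V" "E y c" "E (k y 1) c" "below y c"
proof -
  have m: "m y \<ge> 8" by (rule m8[OF y])
  obtain c where c: "c \<in> V" "E y c" "E (k y 1) c" using yk1[OF y] by (auto simp: meets_def)
  have "\<not> above y c"
  proof
    assume a: "above y c"
    obtain u where u: "u \<in> V" "E (k y 3) u" using mid_nonempty[OF y, of 3] m by auto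
    have "lt u c" using aboveD[OF a, of 3 u] u m by auto
    moreover have "lt c u" using inc[OF y, of 1 3 c u] c u m by auto
    ultimately show False using tra[of u c u] irr[of u] u c by auto
  qed
  then show ?thesis using outside[OF y c(1,2)] that c by blast
qed

lemma rho:
  assumes y: "y \<in> X"
  obtains c where "c \<in> V" "E y c" "E (k y (m y)) c" "above y c"
proof -
  have m: "m y \<ge> 8" by (rule m8[OF y])
  obtain c where c: "c \<in> V" "E y c" "E (k y (m y)) c" using ykm[OF y] by (auto simp: meets_def)
  have "\<not> below y c"
  proof
    assume a: "below y c"
    obtain u where u: "u \<in> V" "E (k y 3) u" using mid_nonempty[OF y, of 3] m by auto
    have "lt c u" using belowD[OF a, of 3 u] u m by auto
    moreover have "lt u c" using inc[OF y, of 3 "m y" u c] c u m by auto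
    ultimately show False using tra[of u c u] irr[of u] u c by auto
  qed
  then show ?thesis using outside[OF y c(1,2)] that c by blast
qed

text \<open>Row 1 of the path lies before row 3, so the last row is the only one of the path that
  can contain a column behind all inner rows.\<close>

lemma cov_above:
  assumes y: "y \<in> X" and u: "u \<in> V0" and a: "above y u"
  shows "E y u \<or> E (k y (m y)) u"
proof -
  have m: "m y \<ge> 8" by (rule m8[OF y])
  have uV: "u \<in> V" using u V0V by auto
  from cover[OF y u] show ?thesis
  proof
    assume "\<exists>i. 1 \<le> i \<and> i \<le> m y \<and> E (k y i) u"
    then obtain i where i: "1 \<le> i" "i \<le> m y" "E (k y i) u" by blast
    consider "i = 1" | "2 \<le> i \<and> i < m y" | "i = m y" using i by linarith
    then show ?thesis
    proof cases
      case 1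
      obtain v where v: "v \<in> V" "E (k y 3) v" using mid_nonempty[OF y, of 3] m by auto
      have "lt v u" using aboveD[OF a, of 3 v] v m by auto
      moreover have "lt u v" using inc[OF y, of 1 3 u v] i 1 v m uV by auto
      ultimately show ?thesis using tra[of u v u] irr[of u] v uV by auto
    next
      case 2
      then show ?thesis using aboveD[OF a, of i u] i uV irr[of u] by auto
    qed (use i in simp)
  qed simp
qed

lemma cov_below:
  assumes y: "y \<in> X" and u: "u \<in> V0" and a: "below y u"
  shows "E y u \<or> E (k y 1) u"
proof -
  have m: "m y \<ge> 8" by (rule m8[OF y])
  have uV: "u \<in> V" using u V0V by auto
  from cover[OF y u] show ?thesis
  proof
    assume "\<exists>i. 1 \<le> i \<and> i \<le> m y \<and> E (k y i) u"
    then obtain i where i: "1 \<le> i" "i \<le> m y" "E (k y i) u" by blast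
    consider "i = 1" | "2 \<le> i \<and> i < m y" | "i = m y" using i by linarith
    then show ?thesis
    proof cases
      case 3
      obtain v where v: "v \<in> V" "E (k y 3) v" using mid_nonempty[OF y, of 3] m by auto
      have "lt u v" using belowD[OF a, of 3 v] v m by auto
      moreover have "lt v u" using inc[OF y, of 3 "m y" v u] i 3 v m uV by auto
      ultimately show ?thesis using tra[of u v u] irr[of u] v uV by auto
    next
      case 2
      then show ?thesis using belowD[OF a, of i u] i uV irr[of u] by auto
    qed (use i in simp)
  qed simp
qed

definition link :: "'r \<Rightarrow> nat \<Rightarrow> 'c" where
  "link y i = (SOME u. u \<in> V \<and> E (k y i) u \<and> E (k y (Suc i)) u)"

lemma link: "y \<in> X \<Longrightarrow> 1 \<le> i \<Longrightarrow> i < m y \<Longrightarrow> link y i \<in> V \<and> E (k y i) (link y i) \<and> E (k y (Suc i)) (link y i)"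
  unfolding link_def by (rule someI_ex) (use mid_nonempty in blast)

lemma link_less:
  assumes "y \<in> X" "1 \<le> i" "i < j" "j < m y"
  shows "lt (link y i) (link y j)"
  using inc[OF assms(1,2), of "Suc j" "link y i" "link y j"] link[OF assms(1), of i] link[OF assms(1), of j] assms by auto

lemma k_disj:
  assumes "y \<in> X" "1 \<le> i" "i + 2 \<le> j" "j \<le> m y" "u \<in> V" "E (k y i) u"
  shows "\<not> E (k y j) u"
  using inc[OF assms(1-4), of u u] assms irr[of u] by auto

lemma four:
  assumes y: "y \<in> X" and r: "r \<in> R" and j: "1 \<le> j" "j + 4 \<le> m y"
    and E: "E r (link y j)" "E r (link y (j+1))" "E r (link y (j+2))" "E r (link y (j+3))"
  shows False
proof (rule four_links[OF L, of "k y (j+1)" "k y (j+2)" "k y (j+3)" r "link y j" "link y (j+1)" "link y (j+2)" "link y (j+3)"])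
  note l = link[OF y, of j] link[OF y, of "j+1"] link[OF y, of "j+2"] link[OF y, of "j+3"]
  show "link y j \<in> V" "link y (j+1) \<in> V" "link y (j+2) \<in> V" "link y (j+3) \<in> V" using l j by auto
  show "k y (j+1) \<in> R" "k y (j+2) \<in> R" "k y (j+3) \<in> R"
    using kR[OF y, of "j+1"] kR[OF y, of "j+2"] kR[OF y, of "j+3"] R0R j by auto
  show "E (k y (j+1)) (link y j)" "E (k y (j+1)) (link y (j+1))" "E (k y (j+2)) (link y (j+1))"
    "E (k y (j+2)) (link y (j+2))" "E (k y (j+3)) (link y (j+2))" "E (k y (j+3)) (link y (j+3))"
    using l j by (auto simp: eval_nat_numeral)
  show "\<not> E (k y (j+2)) (link y j)" "\<not> E (k y (j+3)) (link y j)"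
    using k_disj[OF y, of j "j+2" "link y j"] k_disj[OF y, of j "j+3" "link y j"] l j by auto
  show "\<not> E (k y (j+3)) (link y (j+1))"
    using k_disj[OF y, of "j+1" "j+3" "link y (j+1)"] l j by auto
  show "\<not> E (k y (j+1)) (link y (j+2))"
    using k_disj[OF y, of "j+1" "j+3" "link y (j+2)"] l j by (auto simp: eval_nat_numeral)
  show "\<not> E (k y (j+1)) (link y (j+3))" "\<not> E (k y (j+2)) (link y (j+3))"
    using k_disj[OF y, of "j+1" "j+4" "link y (j+3)"] k_disj[OF y, of "j+2" "j+4" "link y (j+3)"] l j
    by (auto simp: eval_nat_numeral)
qed (use r E in auto)

text \<open>A row of \<open>R0\<close> is convex in the order, so \<open>r\<close> would contain the
  links 2 to 5, against \<open>four\<close>.\<close>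

lemma span:
  assumes y: "y \<in> X" and r: "r \<in> R0" and s: "s \<in> V" "E r s" "below y s" and t: "t \<in> V" "E r t"
    and lt: "\<And>i. 2 \<le> i \<Longrightarrow> i \<le> 5 \<Longrightarrow> lt (link y i) t"
  shows False
proof -
  have m: "m y \<ge> 8" by (rule m8[OF y])
  have "E r (link y i)" if i: "2 \<le> i" "i \<le> 5" for i
  proof -
    have "lt s (link y i)" using belowD[OF s(3), of i "link y i"] link[OF y, of i] i m by auto
    then show ?thesis using con[of r s "link y i" t] r s t lt[OF i] link[OF y, of i] i m by auto
  qed
  then show False using four[OF y, of r 2] r R0R m by auto
qed

text \<open>The links 1 to 7 of \<open>w\<close> would be above \<open>y\<close>, so each would lie
  in \<open>y\<close> or in the last row of the path of \<open>y\<close>. That row contains none of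
  the links 4 to 7, as convexity would give it 1 to 4 as well. So \<open>y\<close> contains 4 to 7,
  against \<open>four\<close>. This step determines the length 8.\<close>

lemma nosep:
  assumes y: "y \<in> X" and w: "w \<in> X"
    and sep: "\<And>i j u v. 2 \<le> i \<Longrightarrow> i < m y \<Longrightarrow> 2 \<le> j \<Longrightarrow> j < m w \<Longrightarrow> u \<in> V \<Longrightarrow> v \<in> V \<Longrightarrow>
      E (k y i) u \<Longrightarrow> E (k w j) v \<Longrightarrow> lt u v"
  shows False
proof -
  have m: "m y \<ge> 8" "m w \<ge> 8" using m8 y w by auto
  have lw: "link w i \<in> V" "\<exists>j. 2 \<le> j \<and> j < m w \<and> E (k w j) (link w i)" if "1 \<le> i" "i \<le> 7" for i
  proof -
    show "link w i \<in> V" using link[OF w, of i] that m by auto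
    show "\<exists>j. 2 \<le> j \<and> j < m w \<and> E (k w j) (link w i)"
    proof (cases "i = 1")
      case True
      then show ?thesis using link[OF w, of 1] m by (intro exI[of _ 2]) (auto simp: eval_nat_numeral)
    next
      case False
      then show ?thesis using link[OF w, of i] that m by (intro exI[of _ i]) auto
    qed
  qed
  have ab: "above y (link w i)" if "1 \<le> i" "i \<le> 7" for i
    unfolding above_def using sep lw[OF that] by blast
  have V0: "link w i \<in> V0" if "1 \<le> i" "i \<le> 7" for i
  proof -
    obtain j where j: "2 \<le> j" "j < m w" "E (k w j) (link w i)" using lw(2)[OF \<open>1 \<le> i\<close> \<open>i \<le> 7\<close>] by blast
    then show ?thesis using inV0[of "k w j" "link w i"] kR[OF w, of j] lw(1)[OF that] by auto
  qed
  have nk: "\<not> E (k y (m y)) (link w i)" if i: "4 \<le> i" "i \<le> 7" for i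
  proof
    assume Ei: "E (k y (m y)) (link w i)"
    have kR0: "k y (m y) \<in> R0" using kR[OF y, of "m y"] m by auto
    obtain e where e: "e \<in> V" "E (k y (m y - 1)) e" "E (k y (m y)) e"
      using last_link[OF y] by blast
    have "E (k y (m y)) (link w j)" if j: "1 \<le> j" "j \<le> 4" for j
    proof (cases "j = i")
      case False
      then have "j < i" using i j by auto
      then have 1: "lt (link w j) (link w i)" using link_less[OF w, of j i] j i m by auto
      have 2: "lt e (link w j)" using aboveD[OF ab[of j], of "m y - 1" e] e j m by auto
      show ?thesis using con[OF kR0 e(1) _ _ 2 1 e(3) Ei] lw(1) i j by auto
    qed (use Ei in simp)
    then show False using four[OF w, of "k y (m y)" 1] kR0 R0R m by (auto simp: eval_nat_numeral)
  qed
  have "E y (link w i)" if i: "4 \<le> i" "i \<le> 7" for i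
    using cov_above[OF y V0[of i] ab[of i]] nk[OF i] i by auto
  then show False using four[OF w, of y 4] y XR m by auto
qed

text \<open>\<open>d\<close> is below both. By \<open>cov_below\<close> it lies in \<open>y\<close>,
  and then the first row of the path of \<open>w\<close> serves, or it lies in the first row of the
  path of \<open>y\<close>, which serves itself.\<close>

lemma left_row1:
  assumes y: "y \<in> X" and w: "w \<in> X" and c: "c \<in> V" "E y c" "E (k y 1) c" "below y c"
    and d: "d \<in> V" "E w d" "E (k w 1) d" "below w d" and le: "d = c \<or> lt d c"
  shows "\<exists>u\<in>R0. \<exists>s\<in>V. E u s \<and> below y s \<and> below w s \<and> meets E V u y \<and> meets E V u w"
proof -
  have by': "below y d"
    using le c(4) tra[of d c] c(1) d(1) unfolding below_def by blast
  have "d \<in> V0" using inV0[of w d] w d by auto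
  from cov_below[OF y this by'] show ?thesis
  proof
    assume "E y d"
    then show ?thesis
      using kR[OF w, of 1] m8[OF w] d by' by (intro bexI[of _ "k w 1"] bexI[of _ d]) (auto simp: meets_def)
  next
    assume "E (k y 1) d"
    then show ?thesis
      using kR[OF y, of 1] m8[OF y] c d by' by (intro bexI[of _ "k y 1"] bexI[of _ d]) (auto simp: meets_def)
  qed
qed

lemma left_row:
  assumes y: "y \<in> X" and w: "w \<in> X"
  shows "\<exists>u\<in>R0. \<exists>s\<in>V. E u s \<and> below y s \<and> below w s \<and> meets E V u y \<and> meets E V u w"
proof -
  obtain c where c: "c \<in> V" "E y c" "E (k y 1) c" "below y c" by (rule lam[OF y])
  obtain d where d: "d \<in> V" "E w d" "E (k w 1) d" "below w d" by (rule lam[OF w])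
  consider "d = c \<or> lt d c" | "lt c d" using tot[of c d] c d by auto
  then show ?thesis
  proof cases
    case 1
    then show ?thesis by (rule left_row1[OF y w c d])
  next
    case 2
    then show ?thesis using left_row1[OF w y d c] by blast
  qed
qed

text \<open>The last row of the path of \<open>y\<close> contains \<open>a\<close> and
  \<open>b\<close>. A row \<open>u\<close> on the left meets \<open>y\<close> and \<open>w\<close>
  in \<open>uy\<close> and \<open>uw\<close> and is disjoint from that last row. These four rows run
  in a circle through \<open>a\<close>, \<open>b\<close>, \<open>uw\<close>, \<open>uy\<close> and
  allow no consecutive order, whether or not \<open>y\<close> and \<open>w\<close> also meet
  directly.\<close>

lemma nested1:
  assumes y: "y \<in> X" and w: "w \<in> X" and a: "a \<in> V" "E y a" "above y a" "\<not> E w a"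
    and b: "b \<in> V" "E w b" "above w b" "\<not> E y b" and ab: "lt a b"
  shows False
proof -
  have m: "m y \<ge> 8" by (rule m8[OF y])
  have yb: "above y b" using a(3) ab tra[of _ a b] a(1) b(1) unfolding above_def by blast
  have "b \<in> V0" using inV0[of w b] w b by auto
  from cov_above[OF y this yb] have kb: "E (k y (m y)) b" using b by simp
  have kR0: "k y (m y) \<in> R0" using kR[OF y, of "m y"] m by auto
  obtain e where e: "e \<in> V" "E (k y (m y - 1)) e" "E (k y (m y)) e"
    using last_link[OF y] by blast
  have "lt e a" using aboveD[OF a(3), of "m y - 1" e] e m by auto
  then have ka: "E (k y (m y)) a" using con[OF kR0 e(1) a(1) b(1) _ ab e(3) kb] by simp
  obtain u s where u: "u \<in> R0" "s \<in> V" "E u s" "below y s" "meets E V u y" "meets E V u w"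
    using left_row[OF y w] by blast
  have disj: "\<not> (E u t \<and> E (k y (m y)) t)" if t: "t \<in> V" for t
  proof
    assume tt: "E u t \<and> E (k y (m y)) t"
    have "lt (link y i) t" if i: "2 \<le> i" "i \<le> 5" for i
      using inc[OF y, of i "m y" "link y i" t] link[OF y, of i] i m t tt by auto
    then show False using span[OF y u(1,2,3,4) t] tt by auto
  qed
  obtain uy where uy: "uy \<in> V" "E u uy" "E y uy" using u(5) by (auto simp: meets_def)
  obtain uw where uw: "uw \<in> V" "E u uw" "E w uw" using u(6) by (auto simp: meets_def)
  let ?k = "k y (m y)"
  have nk: "\<not> E ?k uy" "\<not> E ?k uw" "\<not> E u a" "\<not> E u b" using disj uy uw a b ka kb by blast+
  have "a \<noteq> b" using a b by auto
  obtain f where f: "cord E (set [u, ?k, y, w]) (set [a, b, uy, uw]) f"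
    using loc8_cord[OF L, of "[u, ?k, y, w]" "[a, b, uy, uw]"] u kR0 R0R XR y w a b uy uw by auto
  obtain f where f: "cord E (set [u, ?k, y, w]) (set [a, b, uy, uw]) f" "f a < f b"
    by (rule cord_cases[OF f, of a b]) (use \<open>a \<noteq> b\<close> in auto)
  note D = cordD[OF f(1)]
  have n: "f uy \<noteq> f a" "f uy \<noteq> f b" "f uw \<noteq> f a" "f uw \<noteq> f b"
    using cord_neq[OF f(1), of uy a] cord_neq[OF f(1), of uy b] cord_neq[OF f(1), of uw a] cord_neq[OF f(1), of uw b] uy uw nk by auto
  have 1: "\<not> (f a < f uy \<and> f uy < f b)" using D[of ?k a uy b] ka kb nk by simp
  have 2: "\<not> (f a < f uw \<and> f uw < f b)" using D[of ?k a uw b] ka kb nk by simp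
  have "\<not> (f a < f b \<and> f b < f uy)" using D[of y a b uy] a b uy by simp
  then have 3: "f uy < f a" using 1 n f(2) by linarith
  have "\<not> (f uw < f a \<and> f a < f b)" using D[of w uw a b] a b uw by simp
  then have 4: "f b < f uw" using 2 n f(2) by linarith
  then show False using D[of u uy a uw] uy uw nk 3 f(2) by auto
qed

lemma nested:
  assumes y: "y \<in> X" and w: "w \<in> X" and a: "a \<in> V" "E y a" "above y a" "\<not> E w a"
    and b: "b \<in> V" "E w b" "above w b" "\<not> E y b"
  shows False
proof -
  have "a \<noteq> b" using a b by auto
  then consider "lt a b" | "lt b a" using tot[of a b] a b by auto
  then show False using nested1[OF y w a b] nested1[OF w y b a] by cases auto
qed

lemma side_consistent:
  assumes y: "y \<in> X" and w: "w \<in> X" and c: "c \<in> V" "above y c" "below w c"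
  shows False
proof (rule nosep[OF y w])
  fix i j u v assume "2 \<le> i" "i < m y" "2 \<le> j" "j < m w" "u \<in> V" "v \<in> V" "E (k y i) u" "E (k w j) v"
  then have "lt u c" "lt c v" using aboveD[OF c(2)] belowD[OF c(3)] by blast+
  then show "lt u v" using tra[of u c v] \<open>u \<in> V\<close> \<open>v \<in> V\<close> c by blast
qed

text \<open>By \<open>nested\<close> the right parts \<open>Rt\<close> of the rows of
  \<open>X\<close> form a chain, so a smallest one, nonempty by \<open>rho\<close>, is contained in
  all of them.\<close>

lemma right_common:
  assumes fin: "finite X" "finite V" and ne: "X \<noteq> {}"
  shows "\<exists>c\<in>V. \<forall>w\<in>X. E w c \<and> above w c"
proof -
  define Rt where "Rt y = {c \<in> V. E y c \<and> above y c}" for y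
  have finR: "finite (Rt y)" for y using fin by (simp add: Rt_def)
  obtain y where y: "y \<in> X" "\<And>w. w \<in> X \<Longrightarrow> card (Rt y) \<le> card (Rt w)"
  proof -
    have "Min ((\<lambda>w. card (Rt w)) ` X) \<in> (\<lambda>w. card (Rt w)) ` X" using fin ne by (intro Min_in) auto
    then obtain y where "y \<in> X" "card (Rt y) = Min ((\<lambda>w. card (Rt w)) ` X)" by auto
    moreover have "Min ((\<lambda>w. card (Rt w)) ` X) \<le> card (Rt w)" if "w \<in> X" for w
      using that fin by (intro Min_le) auto
    ultimately show ?thesis using that by auto
  qed
  have sub: "Rt y \<subseteq> Rt w" if w: "w \<in> X" for w
  proof -
    have loc: "c \<in> Rt q" if "p \<in> X" "q \<in> X" "c \<in> Rt p" "E q c" for p q c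
      using outside[of q c] that side_consistent[of p q c] by (auto simp: Rt_def)
    have "Rt y \<subseteq> Rt w \<or> Rt w \<subseteq> Rt y"
    proof (rule ccontr)
      assume "\<not> ?thesis"
      then obtain a b where a: "a \<in> Rt y" "a \<notin> Rt w" and b: "b \<in> Rt w" "b \<notin> Rt y" by blast
      have "\<not> E w a" "\<not> E y b" using loc[OF y(1) w a(1)] loc[OF w y(1) b(1)] a b by blast+
      then show False using nested[OF y(1) w, of a b] a b by (auto simp: Rt_def)
    qed
    then show ?thesis
    proof
      assume s: "Rt w \<subseteq> Rt y"
      have "Rt w = Rt y" by (rule card_seteq[OF finR s y(2)[OF w]])
      then show ?thesis by simp
    qed
  qed
  obtain c where "c \<in> V" "E y c" "E (k y (m y)) c" "above y c" by (rule rho[OF y(1)])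
  then have "c \<in> Rt y" by (simp add: Rt_def)
  then show ?thesis using sub by (auto simp: Rt_def)
qed

text \<open>One common column is on the right and, by reflection, another on the left. A row of
  \<open>R0\<close> through both would run along a whole path, against \<open>span\<close>.\<close>

theorem cut_columns:
  assumes fin: "finite X" "finite V" and ne: "X \<noteq> {}"
  shows "\<exists>c\<in>V. \<exists>d\<in>V. (\<forall>w\<in>X. E w c \<and> E w d) \<and> (\<forall>r\<in>R0. \<not> (E r c \<and> E r d))"
proof -
  obtain c where c: "c \<in> V" "\<And>w. w \<in> X \<Longrightarrow> E w c \<and> above w c" using right_common[OF assms] by blast
  interpret rv: cuts E R V X R0 V0 "\<lambda>a b. lt b a" "\<lambda>y i. k y (m y + 1 - i)" m by (rule rev)
  obtain d where d: "d \<in> V" "\<And>w. w \<in> X \<Longrightarrow> E w d \<and> rv.above w d" using rv.right_common[OF assms] by blast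
  obtain y where y: "y \<in> X" using ne by blast
  have m: "m y \<ge> 8" by (rule m8[OF y])
  have bd: "below y d"
    unfolding below_def
  proof (intro allI impI)
    fix i u assume i: "2 \<le> i" "i < m y" "u \<in> V" "E (k y i) u"
    have e: "m y + 1 - (m y + 1 - i) = i" using i by simp
    show "lt d u"
      by (rule d(2)[OF y, THEN conjunct2, unfolded rv.above_def, rule_format, of "m y + 1 - i" u])
        (use i in \<open>auto simp: e\<close>)
  qed
  have "\<not> (E r c \<and> E r d)" if r: "r \<in> R0" for r
  proof
    assume E: "E r c \<and> E r d"
    have "lt (link y i) c" if "2 \<le> i" "i \<le> 5" for i
      using aboveD[OF c(2)[OF y, THEN conjunct2], of i "link y i"] link[OF y, of i] that m by auto
    then show False using span[OF y r d(1) _ bd c(1)] E by blast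
  qed
  then show ?thesis using c d by blast
qed

end

section \<open>From a minimal deletion set to a pair of columns\<close>

definition left_of :: "('r \<Rightarrow> 'c \<Rightarrow> bool) \<Rightarrow> 'c set \<Rightarrow> ('c \<Rightarrow> 'c \<Rightarrow> bool) \<Rightarrow> 'r \<Rightarrow> 'r \<Rightarrow> bool" where
  "left_of E V lt A B \<longleftrightarrow> (\<forall>u\<in>V. \<forall>v\<in>V. E A u \<longrightarrow> E B v \<longrightarrow> lt u v)"

lemma disj_left_of:
  assumes lt: "linord V lt" "cvx E R0 V lt" and AB: "A \<in> R0" "B \<in> R0" "\<not> meets E V A B"
  shows "left_of E V lt A B \<or> left_of E V lt B A"
proof (rule ccontr)
  assume "\<not> ?thesis"
  then obtain u v u' v' where u: "u \<in> V" "v \<in> V" "E A u" "E B v" "\<not> lt u v"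
    and u': "u' \<in> V" "v' \<in> V" "E A u'" "E B v'" "\<not> lt v' u'"
    unfolding left_of_def by blast
  have d: "\<not> (E A c \<and> E B c)" if "c \<in> V" for c using AB(3) that by (auto simp: meets_def)
  have ne: "u \<noteq> v" "u' \<noteq> v'" "u' \<noteq> v" using d u u' by blast+
  have 1: "lt v u" using linord_total[OF lt(1) u(1,2) ne(1)] u(5) by blast
  have 2: "lt u' v'" using linord_total[OF lt(1) u'(1,2) ne(2)] u'(5) by blast
  from linord_total[OF lt(1) u'(1) u(2) ne(3)] show False
  proof
    assume "lt u' v"
    then show False using cvxD[OF lt(2) AB(1), of u' v u] 1 u u' d by blast
  next
    assume "lt v u'"
    then show False using cvxD[OF lt(2) AB(2), of v u' v'] 2 u u' d by blast
  qed
qed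

text \<open>Rows at distance at least two are disjoint, hence ordered. The links hand the direction
  of the first pair on along the path, and then to larger distances.\<close>

lemma path_orient1:
  assumes lt: "linord V lt" "cvx E R0 V lt"
    and k: "\<And>i. 1 \<le> i \<Longrightarrow> i \<le> m \<Longrightarrow> k i \<in> R0" "\<And>i. 1 \<le> i \<Longrightarrow> i < m \<Longrightarrow> meets E V (k i) (k (Suc i))"
      "\<And>i j. 1 \<le> i \<Longrightarrow> i + 2 \<le> j \<Longrightarrow> j \<le> m \<Longrightarrow> \<not> meets E V (k i) (k j)"
    and s: "left_of E V lt (k 1) (k 3)" and ij: "1 \<le> i" "i + 2 \<le> j" "j \<le> m"
  shows "left_of E V lt (k i) (k j)"
proof -
  have asym: False if "u \<in> V" "v \<in> V" "lt u v" "lt v u" for u v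
    using that linord_trans[OF lt(1), of u v u] linord_irrefl[OF lt(1), of u] by blast
  have two: "left_of E V lt (k i) (k (i + 2))" if "1 \<le> i" "i + 2 \<le> m" for i
    using that
  proof (induction i rule: dec_induct)
    case base
    then show ?case using s by (simp add: numeral_3_eq_3)
  next
    case (step i)
    have IH: "left_of E V lt (k i) (k (i + 2))" using step by simp
    obtain z where z: "z \<in> V" "E (k (i + 2)) z" "E (k (i + 3)) z"
      using k(2)[of "i + 2"] step by (auto simp: meets_def eval_nat_numeral)
    obtain w where w: "w \<in> V" "E (k i) w" "E (k (i + 1)) w"
      using k(2)[of i] step by (auto simp: meets_def)
    have wz: "lt w z" using IH z w by (auto simp: left_of_def)
    have "\<not> meets E V (k (i + 1)) (k (i + 3))" using k(3)[of "i + 1" "i + 3"] step by simp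
    then have "left_of E V lt (k (i + 1)) (k (i + 3)) \<or> left_of E V lt (k (i + 3)) (k (i + 1))"
      using step by (intro disj_left_of[OF lt] k(1)) auto
    moreover have "\<not> left_of E V lt (k (i + 3)) (k (i + 1))"
      using asym[OF w(1) z(1) wz] w z by (auto simp: left_of_def)
    ultimately show ?case by (simp add: eval_nat_numeral)
  qed
  from ij(2,3) show ?thesis
  proof (induction j rule: dec_induct)
    case base
    then show ?case using two ij by simp
  next
    case (step j)
    have IH: "left_of E V lt (k i) (k j)" using step by simp
    obtain z where z: "z \<in> V" "E (k j) z" "E (k (Suc j)) z" using k(2)[of j] step ij by (auto simp: meets_def)
    obtain w where w: "w \<in> V" "E (k i) w" using k(2)[of i] step ij by (auto simp: meets_def)
    have wz: "lt w z" using IH z w by (auto simp: left_of_def)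
    have "\<not> meets E V (k i) (k (Suc j))" using k(3)[of i "Suc j"] step ij by simp
    then have "left_of E V lt (k i) (k (Suc j)) \<or> left_of E V lt (k (Suc j)) (k i)"
      using step ij by (intro disj_left_of[OF lt] k(1)) auto
    moreover have "\<not> left_of E V lt (k (Suc j)) (k i)"
      using asym[OF w(1) z(1) wz] w z by (auto simp: left_of_def)
    ultimately show ?case by simp
  qed
qed

definition on_hole :: "('r \<Rightarrow> 'c \<Rightarrow> bool) \<Rightarrow> 'r set \<Rightarrow> 'c set \<Rightarrow> 'c \<Rightarrow> bool" where
  "on_hole E R V v \<longleftrightarrow> (\<exists>n h. hole E R V n h \<and> E (h 0) v)"

lemma on_hole_detour: "on_hole E R V v \<longleftrightarrow> (\<exists>p s t. detour E R V p s t \<and> E p v)"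
  unfolding on_hole_def using hole_detour detour_hole by metis

lemma hole_in: "hole E R V n h \<Longrightarrow> h i \<in> R"
  unfolding hole_def by blast

lemma hole_row: "hole E R V n h \<Longrightarrow> \<exists>u\<in>V. E (h i) u"
  unfolding hole_def meets_def by blast

lemma hole_sub:
  assumes "hole E S V n h" "S \<subseteq> R"
  shows "hole E R V n h"
proof (rule hole_mono[OF assms(1)])
  fix i show "h i \<in> R" using hole_in[OF assms(1), of i] assms(2) by blast
qed

lemma badI:
  assumes "hole E R V n h" "E (h i) v"
  shows "on_hole E R V v"
  using hole_shift[OF assms(1), of i] assms(2) unfolding on_hole_def by (intro exI[of _ n] exI[of _ "\<lambda>j. h (j + i)"]) simp

lemma no_detour_on_hole: "no_detour E R V \<longleftrightarrow> (\<forall>v\<in>V. \<not> on_hole E R V v)"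
proof
  assume "\<forall>v\<in>V. \<not> on_hole E R V v"
  then show "no_detour E R V" unfolding no_detour_def on_hole_detour detour_def meets_def by blast
qed (auto simp: no_detour_def on_hole_detour)

lemma on_hole_mono:
  assumes "on_hole E S V v" "S \<subseteq> R"
  shows "on_hole E R V v"
proof -
  obtain n h where h: "hole E S V n h" "E (h 0) v" using assms(1) unfolding on_hole_def by blast
  have "hole E R V n h" by (rule hole_sub[OF h(1) assms(2)])
  then show ?thesis using h(2) unfolding on_hole_def by blast
qed

text \<open>By minimality each \<open>y\<close> in \<open>X\<close> closes a hole through
  \<open>v\<close> whose other rows survive. By \<open>hole_union\<close> these holes occupy the
  same columns \<open>V0\<close>. A hole among the surviving rows on \<open>V0\<close> would again
  cover \<open>v\<close>, so those rows have a consecutive order, and the locale \<open>cuts\<close>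
  applies.\<close>

lemma cut_exists_min:
  assumes L: "loc8 E R V" and fin: "finite V" and finX: "finite X" and vV: "v \<in> V" and XR: "X \<subseteq> R" and ne: "X \<noteq> {}"
    and nb: "\<not> on_hole E (R - X) V v" and crit: "\<And>y. y \<in> X \<Longrightarrow> on_hole E (R - (X - {y})) V v"
  shows "\<exists>c\<in>V. \<exists>d\<in>V. X = {r \<in> R. E r c \<and> E r d}"
proof -
  have "\<exists>n h. hole E (insert y (R - X)) V n h \<and> h 0 = y \<and> (\<exists>i. E (h i) v)" if y: "y \<in> X" for y
  proof -
    have eq: "R - (X - {y}) = insert y (R - X)" using y XR by auto
    obtain n h where h: "hole E (insert y (R - X)) V n h" "E (h 0) v"
      using crit[OF y] unfolding on_hole_def eq by blast
    have "\<exists>i. h i = y"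
    proof (rule ccontr)
      assume "\<not> ?thesis"
      then have "h i \<in> R - X" for i using hole_in[OF h(1), of i] by auto
      then have "hole E (R - X) V n h" by (rule hole_mono[OF h(1)])
      then show False using badI[of E "R - X" V n h 0 v] h(2) nb by simp
    qed
    then obtain i where i: "h i = y" by blast
    have n: "n \<ge> 4" using h(1) by (simp add: hole_def)
    \<comment> \<open>The hole is shifted to start at \<open>y\<close>; the index
      \<open>n * i - i\<close> undoes the shift modulo the period.\<close>
    have e: "n * i - i + i = n * i" using n by simp
    have "h (n * i - i + i) = h 0" using hole_per[OF h(1), of 0 i] e by simp
    then have "E (h (n * i - i + i)) v" using h(2) by simp
    then show ?thesis using hole_shift[OF h(1), of i] i
      by (intro exI[of _ n] exI[of _ "\<lambda>j. h (j + i)"]) auto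
  qed
  then obtain n h where h: "\<And>y. y \<in> X \<Longrightarrow> hole E (insert y (R - X)) V (n y) (h y)"
    "\<And>y. y \<in> X \<Longrightarrow> h y 0 = y" "\<And>y. y \<in> X \<Longrightarrow> \<exists>i. E (h y i) v" by metis
  have hR: "hole E R V (n y) (h y)" if "y \<in> X" for y
    by (rule hole_sub[OF h(1)[OF that]]) (use that XR in auto)
  have n9: "n y \<ge> 9" if "y \<in> X" for y by (rule hole_len[OF L hR[OF that]])
  obtain y0 where y0: "y0 \<in> X" using ne by blast
  define V0 where "V0 = {u \<in> V. \<exists>i. E (h y0 i) u}"
  have V0eq: "V0 = {u \<in> V. \<exists>i. E (h y i) u}" if y: "y \<in> X" for y
  proof -
    obtain i j where "E (h y0 i) v" "E (h y j) v" using h(3) y0 y by blast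
    then show ?thesis
      using hole_union[OF L hR[OF y0] hR[OF y] vV] hole_union[OF L hR[OF y] hR[OF y0] vV] unfolding V0_def by blast
  qed
  have closed: "u \<in> V0" if "r \<in> R" "x \<in> V0" "E r x" "u \<in> V" "E r u" for r x u
    using hole_closed[OF L hR[OF y0] that(1) _ that(3) _ that(4,5)] that(2,4) unfolding V0_def by blast
  have vV0: "v \<in> V0" using h(3)[OF y0] vV by (auto simp: V0_def)
  define R0 where "R0 = {r \<in> R - X. \<exists>u\<in>V0. E r u}"
  have "no_detour E R0 V"
    unfolding no_detour_def
  proof (intro allI notI)
    fix p s t assume "detour E R0 V p s t"
    then obtain n' g where g: "hole E R0 V n' g" using detour_hole by metis
    then have gR: "hole E R V n' g" by (rule hole_sub) (auto simp: R0_def)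
    obtain u where u: "u \<in> V0" "E (g 0) u" using hole_in[OF g, of 0] by (auto simp: R0_def)
    obtain i where i: "E (h y0 i) u" using u by (auto simp: V0_def)
    obtain j where j: "E (h y0 j) v" using h(3)[OF y0] by blast
    obtain j' where "E (g j') v"
      using hole_union[OF L hR[OF y0] gR _ i u(2) vV j] u by (auto simp: V0_def)
    moreover have "hole E (R - X) V n' g" by (rule hole_sub[OF g]) (auto simp: R0_def)
    ultimately show False using nb badI by metis
  qed
  moreover have "loc8 E R0 V" by (rule loc8_subset[OF L]) (auto simp: R0_def)
  ultimately have "c1p E R0 V" using short_conn_c1p[OF _ short_conn_no_detour fin] by blast
  then obtain lt where lt: "linord V lt" "cvx E R0 V lt" unfolding c1p_def by blast
  define m where "m y = n y - 1" for y
  define PK where "PK y k \<longleftrightarrow> (\<forall>i. 1 \<le> i \<longrightarrow> i \<le> m y \<longrightarrow> k i \<in> R0) \<and> (\<forall>i. 1 \<le> i \<longrightarrow> i < m y \<longrightarrow> meets E V (k i) (k (Suc i))) \<and>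
     meets E V y (k 1) \<and> meets E V y (k (m y)) \<and> (\<forall>i. 1 < i \<longrightarrow> i < m y \<longrightarrow> \<not> meets E V y (k i)) \<and>
     (\<forall>i j. 1 \<le> i \<longrightarrow> i + 2 \<le> j \<longrightarrow> j \<le> m y \<longrightarrow> left_of E V lt (k i) (k j)) \<and>
     (\<forall>u. (\<exists>i. E (h y i) u) \<longrightarrow> E y u \<or> (\<exists>i. 1 \<le> i \<and> i \<le> m y \<and> E (k i) u))" for y k
  have path: "\<exists>k. PK y k" if y: "y \<in> X" for y
  proof -
    note H = hR[OF y] and H1 = h(1)[OF y] and h0 = h(2)[OF y]
    have n: "n y \<ge> 9" "m y \<ge> 8" "n y = Suc (m y)" using n9[OF y] by (auto simp: m_def)
    have M: "meets E V (h y i) (h y (Suc i))" for i using H by (simp add: hole_def)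
    have D: "\<not> meets E V (h y i) (h y j)" if "i + 2 \<le> j" "j + 2 \<le> i + n y" for i j using H that by (simp add: hole_def)
    have per: "h y (n y) = y" using H h0 unfolding hole_def by (metis add_0)
    have self: "meets E V (h y i) (h y i)" for i using M[of i] by (auto simp: meets_def)
    have hR0: "h y i \<in> R0" if i: "1 \<le> i" "i \<le> m y" for i
    proof -
      have "h y i \<noteq> y"
      proof
        assume e: "h y i = y"
        consider "i = 1" | "2 \<le> i" "i + 2 \<le> n y" | "i = m y" using i n by linarith
        then show False
        proof cases
          case 1
          have "meets E V (h y 1) (h y 2)" using M[of 1] by (simp add: numeral_2_eq_2)
          then show False using D[of 0 2] e 1 h0 n by simp
        next
          case 2
          then show False using D[of 0 i] e h0 self[of 0] by simp
        next
          case 3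
          have "Suc (m y - 1) = m y" using n by simp
          then have "meets E V (h y (m y - 1)) (h y (m y))" using M[of "m y - 1"] by simp
          then show False using D[of "m y - 1" "n y"] e 3 per n by simp
        qed
      qed
      moreover have "h y i \<in> insert y (R - X)" by (rule hole_in[OF H1])
      moreover obtain u where "u \<in> V" "E (h y i) u" using M[of i] by (auto simp: meets_def)
      ultimately show ?thesis using V0eq[OF y] by (auto simp: R0_def)
    qed
    have cov: "E y u \<or> (\<exists>i. 1 \<le> i \<and> i \<le> m y \<and> E (h y i) u)" if "E (h y i) u" for u i
    proof -
      have "E (h y (i mod n y)) u" using hole_mod[OF H, of i] that by simp
      moreover have "i mod n y < n y" using n by simp
      ultimately show ?thesis using h0 n by (cases "i mod n y = 0") (auto simp: less_Suc_eq_le)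
    qed
    have y1: "meets E V y (h y 1)" using M[of 0] h0 by simp
    have ym: "meets E V y (h y (m y))" using M[of "m y"] per n meet_sym[of E V y] by simp
    have ymid: "\<not> meets E V y (h y i)" if "1 < i" "i < m y" for i using D[of 0 i] that h0 n by simp
    have D': "\<not> meets E V (h y i) (h y j)" if "1 \<le> i" "i + 2 \<le> j" "j \<le> m y" for i j using D[of i j] that n by simp
    have "\<not> meets E V (h y 1) (h y 3)" using D'[of 1 3] n by simp
    then consider "left_of E V lt (h y 1) (h y 3)" | "left_of E V lt (h y 3) (h y 1)"
      using disj_left_of[OF lt hR0[of 1] hR0[of 3]] n by auto
    then show ?thesis
    proof cases
      case 1
      have "left_of E V lt (h y i) (h y j)" if "1 \<le> i" "i + 2 \<le> j" "j \<le> m y" for i j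
        by (rule path_orient1[OF lt hR0 M D' 1 that])
      then show ?thesis unfolding PK_def using hR0 M y1 ym ymid cov by (intro exI[of _ "h y"]) blast
    next
      case 2
      define lt' where "lt' a b = lt b a" for a b
      have lt': "linord V lt'" "cvx E R0 V lt'" using linord_rev[OF lt(1)] cvx_rev[OF lt(2)] unfolding lt'_def by auto
      have s: "left_of E V lt' (h y 1) (h y 3)" using 2 by (auto simp: left_of_def lt'_def)
      have o: "left_of E V lt' (h y i) (h y j)" if "1 \<le> i" "i + 2 \<le> j" "j \<le> m y" for i j
        by (rule path_orient1[OF lt' hR0 M D' s that])
      define k where "k i = h y (m y + 1 - i)" for i
      have "left_of E V lt (k i) (k j)" if "1 \<le> i" "i + 2 \<le> j" "j \<le> m y" for i j
        using o[of "m y + 1 - j" "m y + 1 - i"] that by (auto simp: k_def left_of_def lt'_def)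
      moreover have "k i \<in> R0" if "1 \<le> i" "i \<le> m y" for i using hR0[of "m y + 1 - i"] that by (simp add: k_def)
      moreover have "meets E V (k i) (k (Suc i))" if "1 \<le> i" "i < m y" for i
      proof -
        have "Suc (m y - i) = m y + 1 - i" using that by simp
        then show ?thesis using M[of "m y - i"] that meet_sym[of E V "h y (m y - i)"] by (simp add: k_def)
      qed
      moreover have "meets E V y (k 1)" "meets E V y (k (m y))" using y1 ym by (simp_all add: k_def)
      moreover have "\<not> meets E V y (k i)" if "1 < i" "i < m y" for i using ymid[of "m y + 1 - i"] that by (simp add: k_def)
      moreover have "E y u \<or> (\<exists>i. 1 \<le> i \<and> i \<le> m y \<and> E (k i) u)" if u: "E (h y i) u" for u i
      proof -
        from cov[OF u] show ?thesis
        proof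
          assume "\<exists>i. 1 \<le> i \<and> i \<le> m y \<and> E (h y i) u"
          then obtain i where i: "1 \<le> i" "i \<le> m y" "E (h y i) u" by blast
          then have "1 \<le> m y + 1 - i" "m y + 1 - i \<le> m y" "E (k (m y + 1 - i)) u" by (auto simp: k_def)
          then show ?thesis by blast
        qed simp
      qed
      ultimately show ?thesis unfolding PK_def by (intro exI[of _ k]) blast
    qed
  qed
  then have "\<forall>y\<in>X. \<exists>k. PK y k" by blast
  from bchoice[OF this] obtain k where "\<forall>y\<in>X. PK y (k y)" by blast
  then have k: "PK y (k y)" if "y \<in> X" for y using that by blast
  have "cuts E R V X R0 V0 lt k m"
  proof
    show "R0 \<subseteq> R" by (auto simp: R0_def)
    show "V0 \<subseteq> V" by (auto simp: V0_def)
    fix y assume y: "y \<in> X"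
    show "8 \<le> m y" using n9[OF y] by (simp add: m_def)
    show "lt u v" if "1 \<le> i" "i + 2 \<le> j" "j \<le> m y" "u \<in> V" "v \<in> V" "E (k y i) u" "E (k y j) v" for i j u v
      using k[OF y] that unfolding PK_def left_of_def by blast
    show "E y u \<or> (\<exists>i. 1 \<le> i \<and> i \<le> m y \<and> E (k y i) u)" if "u \<in> V0" for u
      using k[OF y] that V0eq[OF y] unfolding PK_def by blast
  next
    fix r u assume r: "r \<in> X \<union> R0" "u \<in> V" "E r u"
    show "u \<in> V0"
    proof (cases "r \<in> X")
      case True
      then have "h r 0 = r" by (rule h(2))
      then show ?thesis using V0eq[OF True] r by (metis (mono_tags, lifting) mem_Collect_eq)
    next
      case False
      then show ?thesis using r closed[of r _ u] by (auto simp: R0_def)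
    qed
  qed (use L XR lt k in \<open>auto simp: PK_def\<close>)
  then interpret cuts E R V X R0 V0 lt k m .
  obtain c d where cd: "c \<in> V" "d \<in> V" "\<forall>w\<in>X. E w c \<and> E w d" "\<forall>r\<in>R0. \<not> (E r c \<and> E r d)"
    using cut_columns[OF finX fin ne] by blast
  have cV0: "c \<in> V0" using inV0[of y0 c] y0 cd by auto
  \<comment> \<open>\<open>c\<close> lies in \<open>V0\<close>, so a surviving row through
    \<open>c\<close> and \<open>d\<close> would belong to \<open>R0\<close>.\<close>
  have "r \<in> X" if r: "r \<in> R" "E r c" "E r d" for r
  proof (rule ccontr)
    assume "r \<notin> X"
    then have "r \<in> R0" using r cV0 by (auto simp: R0_def)
    then show False using cd r by blast
  qed
  then have "X = {r \<in> R. E r c \<and> E r d}" using cd XR by blast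
  then show ?thesis using cd by blast
qed

definition cut :: "('r \<Rightarrow> 'c \<Rightarrow> bool) \<Rightarrow> 'r set \<Rightarrow> 'c \<Rightarrow> 'c \<Rightarrow> 'r set" where
  "cut E R c d = {r \<in> R. E r c \<and> E r d}"

text \<open>An inclusion-minimal part of \<open>X\<close> that still takes \<open>v\<close> off all
  holes is itself a cut.\<close>

theorem cut_exists:
  assumes L: "loc8 E R V" and fin: "finite V" "finite R" and v: "v \<in> V" "on_hole E R V v"
    and X: "X \<subseteq> R" "\<not> on_hole E (R - X) V v"
  shows "\<exists>c\<in>V. \<exists>d\<in>V. \<not> on_hole E (R - cut E R c d) V v \<and> card (cut E R c d) \<le> card X"
proof -
  define \<A> where "\<A> = {Y. Y \<subseteq> X \<and> \<not> on_hole E (R - Y) V v}"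
  have finX: "finite X" using X fin finite_subset by auto
  have "finite \<A>" "X \<in> \<A>" using finX X by (auto simp: \<A>_def)
  then obtain Y where Y: "Y \<in> \<A>" "\<And>Z. Z \<in> \<A> \<Longrightarrow> Z \<subseteq> Y \<Longrightarrow> Z = Y"
    using finite_has_minimal[of \<A>] by blast
  have YX: "Y \<subseteq> X" "\<not> on_hole E (R - Y) V v" using Y(1) by (auto simp: \<A>_def)
  have "Y \<noteq> {}" using YX(2) v(2) by auto
  have crit: "on_hole E (R - (Y - {y})) V v" if "y \<in> Y" for y
    using Y(2)[of "Y - {y}"] that YX by (auto simp: \<A>_def)
  obtain c d where "c \<in> V" "d \<in> V" "Y = cut E R c d"
    using cut_exists_min[OF L fin(1) finite_subset[OF YX(1) finX] v(1) _ \<open>Y \<noteq> {}\<close> YX(2) crit] YX(1) X(1)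
    unfolding cut_def by blast
  then show ?thesis using YX card_mono[OF finX YX(1)] by blast
qed

text \<open>The rows of a solution that meet the columns of a hole through \<open>v\<close> can be exchanged for \<open>C\<close>:
  every hole that meets these columns passes through \<open>v\<close>.\<close>

theorem greedy_cut:
  assumes L: "loc8 E R V" and fin: "finite V" "finite R" and v: "v \<in> V" "on_hole E R V v"
    and c: "\<not> on_hole E (R - C) V v" "C \<subseteq> R"
    and opt: "\<And>c d. c \<in> V \<Longrightarrow> d \<in> V \<Longrightarrow> \<not> on_hole E (R - cut E R c d) V v \<Longrightarrow> card C \<le> card (cut E R c d)"
  shows "(\<exists>X\<subseteq>R. card X \<le> b \<and> no_detour E (R - X) V) \<longleftrightarrow>
    card C \<le> b \<and> (\<exists>X\<subseteq>R - C. card X \<le> b - card C \<and> no_detour E (R - C - X) V)"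
proof
  assume "card C \<le> b \<and> (\<exists>X\<subseteq>R - C. card X \<le> b - card C \<and> no_detour E (R - C - X) V)"
  then obtain X where X: "card C \<le> b" "X \<subseteq> R - C" "card X \<le> b - card C" "no_detour E (R - C - X) V" by blast
  have "card (C \<union> X) \<le> b" using card_Un_le[of C X] X by linarith
  moreover have "R - (C \<union> X) = R - C - X" by auto
  ultimately show "\<exists>X\<subseteq>R. card X \<le> b \<and> no_detour E (R - X) V" using X c by (intro exI[of _ "C \<union> X"]) auto
next
  assume "\<exists>X\<subseteq>R. card X \<le> b \<and> no_detour E (R - X) V"
  then obtain X where X: "X \<subseteq> R" "card X \<le> b" "no_detour E (R - X) V" by blast
  obtain n h where H: "hole E R V n h" "E (h 0) v" using v(2) unfolding on_hole_def by blast
  define V0 where "V0 = {u \<in> V. \<exists>i. E (h i) u}"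
  have vV0: "v \<in> V0" using H v by (auto simp: V0_def)
  have inV0: "u \<in> V0" if "hole E R V n' g" "E (g i) x" "x \<in> V0" "E (g j) u" "u \<in> V" for n' g i x j u
    using hole_union[OF L that(1) H(1), of x i] that unfolding V0_def by blast
  have through: "\<exists>j. E (g j) v" if g: "hole E R V n' g" "E (g i) x" "x \<in> V0" for n' g i x
    using hole_union[OF L H(1) g(1), of x _ i v 0] g H v unfolding V0_def by blast
  define X0 where "X0 = {r \<in> X. \<exists>u\<in>V0. E r u}"
  have finX: "finite X" using X fin finite_subset by auto
  have nb0: "\<not> on_hole E (R - X0) V v"
  proof
    assume "on_hole E (R - X0) V v"
    then obtain n' g where g: "hole E (R - X0) V n' g" "E (g 0) v" unfolding on_hole_def by blast
    have gR: "hole E R V n' g" by (rule hole_sub[OF g(1)]) auto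
    have "g i \<in> R - X" for i
    proof -
      obtain u where u: "u \<in> V" "E (g i) u" using hole_row[OF gR] by blast
      have "u \<in> V0" by (rule inV0[OF gR g(2) vV0 u(2,1)])
      then show ?thesis using hole_in[OF g(1), of i] u by (auto simp: X0_def)
    qed
    then have "on_hole E (R - X) V v" using hole_mono[OF g(1)] g(2) unfolding on_hole_def by blast
    then show False using X(3) v(1) by (simp add: no_detour_on_hole)
  qed
  obtain c' d' where cd: "c' \<in> V" "d' \<in> V" "\<not> on_hole E (R - cut E R c' d') V v" "card (cut E R c' d') \<le> card X0"
    using cut_exists[OF L fin v _ nb0] X(1) by (auto simp: X0_def)
  have CX0: "card C \<le> card X0" using opt[OF cd(1,2,3)] cd(4) by simp
  have X0X: "X0 \<subseteq> X" by (auto simp: X0_def)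
  \<comment> \<open>The exchange: \<open>C\<close> takes the place of \<open>X0\<close>, and rows
    that are in \<open>C\<close> anyway are not deleted a second time.\<close>
  define X1 where "X1 = X - X0 - C"
  have "card X1 \<le> card (X - X0)" unfolding X1_def by (rule card_mono) (use finX in auto)
  also have "\<dots> = card X - card X0" using finX X0X by (simp add: card_Diff_subset finite_subset)
  also have "\<dots> \<le> b - card C" using CX0 X(2) by simp
  finally have "card X1 \<le> b - card C" .
  moreover have "card C \<le> b" using CX0 card_mono[OF finX X0X] X(2) by simp
  moreover have "no_detour E (R - C - X1) V"
    unfolding no_detour_def
  proof (intro allI notI)
    fix p s t assume "detour E (R - C - X1) V p s t"
    then obtain n' g where g: "hole E (R - C - X1) V n' g" using detour_hole by metis
    have gi: "g i \<in> R" "g i \<notin> C" "g i \<notin> X1" for i using hole_in[OF g, of i] by auto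
    have gR: "hole E R V n' g" by (rule hole_mono[OF g]) (use gi in auto)
    show False
    proof (cases "\<exists>i. \<exists>x\<in>V0. E (g i) x")
      case True
      then obtain j where "E (g j) v" using through[OF gR] by blast
      moreover have "hole E (R - C) V n' g" by (rule hole_mono[OF g]) (use gi in auto)
      ultimately show False using badI c(1) by metis
    next
      case False
      have "hole E (R - X) V n' g"
        by (rule hole_mono[OF g]) (use gi False in \<open>auto simp: X1_def X0_def\<close>)
      then show False using hole_detour X(3) unfolding no_detour_def by metis
    qed
  qed
  ultimately show "card C \<le> b \<and> (\<exists>X\<subseteq>R - C. card X \<le> b - card C \<and> no_detour E (R - C - X) V)"
    using X(1) by (intro conjI exI[of _ X1]) (auto simp: X1_def)
qed

section \<open>Structured programs\<close>

datatype com =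
    CSkip
  | CConst nat nat
  | CMove nat nat
  | CInc nat
  | CDec nat
  | CLoad nat nat nat
  | CStore nat nat nat
  | CSeq com com
  | CIf nat com com
  | CFor nat nat nat com

text \<open>\<open>CFor i j n c\<close> runs \<open>c\<close> for \<open>i = 0, 1, \<dots>\<close> below the value of register \<open>n\<close>;
  register \<open>j\<close> counts the remaining rounds.\<close>

fun compile :: "com \<Rightarrow> prog" where
  "compile CSkip = Skip"
| "compile (CConst x v) = Const x v"
| "compile (CMove x y) = Move x y"
| "compile (CInc x) = Inc x"
| "compile (CDec x) = Dec x"
| "compile (CLoad x a y) = Load x a y"
| "compile (CStore a x y) = Store a x y"
| "compile (CSeq c d) = Seq (compile c) (compile d)"
| "compile (CIf x c d) = IfNZ x (compile c) (compile d)"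
| "compile (CFor i j n c) = Seq (Move j n) (Seq (Const i 0)
     (WhileNZ j (Seq (compile c) (Seq (Inc i) (Dec j)))))"

fun sem :: "com \<Rightarrow> state \<Rightarrow> state" where
  "sem CSkip s = s"
| "sem (CConst x v) s = set_reg x v s"
| "sem (CMove x y) s = set_reg x (reg s y) s"
| "sem (CInc x) s = set_reg x (reg s x + 1) s"
| "sem (CDec x) s = set_reg x (reg s x - 1) s"
| "sem (CLoad x a y) s = set_reg x (arr s a (reg s y)) s"
| "sem (CStore a x y) s = set_arr a (reg s x) (reg s y) s"
| "sem (CSeq c d) s = sem d (sem c s)"
| "sem (CIf x c d) s = (if reg s x \<noteq> 0 then sem c s else sem d s)"
| "sem (CFor i j n c) s =
     ((\<lambda>s. let s1 = sem c s; s2 = set_reg i (reg s1 i + 1) s1 in set_reg j (reg s2 j - 1) s2) ^^ reg s n)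
       (set_reg i 0 (set_reg j (reg s n) s))"

fun wr :: "com \<Rightarrow> nat set" where
  "wr CSkip = {}"
| "wr (CConst x v) = {x}"
| "wr (CMove x y) = {x}"
| "wr (CInc x) = {x}"
| "wr (CDec x) = {x}"
| "wr (CLoad x a y) = {x}"
| "wr (CStore a x y) = {}"
| "wr (CSeq c d) = wr c \<union> wr d"
| "wr (CIf x c d) = wr c \<union> wr d"
| "wr (CFor i j n c) = {i, j} \<union> wr c"

fun aw :: "com \<Rightarrow> nat set" where
  "aw (CStore a x y) = {a}"
| "aw (CSeq c d) = aw c \<union> aw d"
| "aw (CIf x c d) = aw c \<union> aw d"
| "aw (CFor i j n c) = aw c"
| "aw _ = {}"

text \<open>Registers that may bound a loop; they never exceed the largest of the initial values.\<close>

definition bnd :: "nat \<Rightarrow> bool" where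
  "bnd x \<longleftrightarrow> x = 0 \<or> x = 1 \<or> (4 \<le> x \<and> even x)"

text \<open>A register that may bound a loop is only cleared, decremented, copied from another such
  register, or used as index or counter of a loop, where its value stays within the bound of that
  loop.\<close>

fun ok :: "com \<Rightarrow> bool" where
  "ok (CConst x v) \<longleftrightarrow> (bnd x \<longrightarrow> v = 0)"
| "ok (CMove x y) \<longleftrightarrow> (bnd x \<longrightarrow> bnd y)"
| "ok (CInc x) \<longleftrightarrow> \<not> bnd x"
| "ok (CLoad x a y) \<longleftrightarrow> \<not> bnd x"
| "ok (CSeq c d) \<longleftrightarrow> ok c \<and> ok d"
| "ok (CIf x c d) \<longleftrightarrow> ok c \<and> ok d"
| "ok (CFor i j n c) \<longleftrightarrow> bnd n \<and> i \<noteq> j \<and> i \<notin> wr c \<and> j \<notin> wr c \<and> ok c"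
| "ok _ \<longleftrightarrow> True"

fun tm :: "com \<Rightarrow> nat \<Rightarrow> nat" where
  "tm (CSeq c d) B = tm c B + tm d B"
| "tm (CIf x c d) B = 1 + tm c B + tm d B"
| "tm (CFor i j n c) B = 3 + B * (tm c B + 3)"
| "tm _ B = 1"

lemma reg_set_reg [simp]: "reg (set_reg x v s) = (reg s)(x := v)"
  and arr_set_reg [simp]: "arr (set_reg x v s) = arr s"
  and reg_set_arr [simp]: "reg (set_arr a i v s) = reg s"
  and arr_set_arr [simp]: "arr (set_arr a i v s) = (arr s)(a := (arr s a)(i := v))"
  by (simp_all add: set_reg_def set_arr_def)

lemma sem_frame:
  "x \<notin> wr c \<Longrightarrow> reg (sem c s) x = reg s x"
proof (induction c arbitrary: s)
  case (CFor i j n c)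
  have "reg ((f ^^ k) t) x = reg t x" if "\<And>u. reg (f u) x = reg u x" for f :: "state \<Rightarrow> state" and k t
    by (induction k) (auto simp: that)
  then show ?case using CFor by (simp add: Let_def)
qed auto

lemma sem_aframe:
  "a \<notin> aw c \<Longrightarrow> arr (sem c s) a = arr s a"
proof (induction c arbitrary: s)
  case (CFor i j n c)
  have "arr ((f ^^ k) t) a = arr t a" if "\<And>u. arr (f u) a = arr u a" for f :: "state \<Rightarrow> state" and k t
    by (induction k) (auto simp: that)
  then show ?case using CFor by (simp add: Let_def)
qed auto

text \<open>The invariant must be insensitive to \<open>i\<close> and \<open>j\<close>, which the
  loop updates itself after the body. The frame facts for the step spare every invariant the
  registers and arrays that the body leaves alone.\<close>

lemma for_rule:
  assumes ij: "i \<noteq> j" "i \<notin> wr c" "j \<notin> wr c"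
    and ins: "\<And>k s v. P k s \<Longrightarrow> P k (set_reg i v s)" "\<And>k s v. P k s \<Longrightarrow> P k (set_reg j v s)"
    and init: "P 0 s"
    and step: "\<And>k s'. k < reg s n \<Longrightarrow> P k s' \<Longrightarrow> reg s' i = k \<Longrightarrow>
        (\<And>x. x \<notin> wr c \<Longrightarrow> x \<noteq> i \<Longrightarrow> x \<noteq> j \<Longrightarrow> reg s' x = reg s x) \<Longrightarrow>
        (\<And>a. a \<notin> aw c \<Longrightarrow> arr s' a = arr s a) \<Longrightarrow> P (Suc k) (sem c s')"
  shows "P (reg s n) (sem (CFor i j n c) s)"
proof -
  define f where "f = (\<lambda>s. let s1 = sem c s; s2 = set_reg i (reg s1 i + 1) s1 in set_reg j (reg s2 j - 1) s2)"
  define t where "t = set_reg i 0 (set_reg j (reg s n) s)"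
  have "P k ((f ^^ k) t) \<and> reg ((f ^^ k) t) i = k \<and>
      (\<forall>x. x \<notin> wr c \<longrightarrow> x \<noteq> i \<longrightarrow> x \<noteq> j \<longrightarrow> reg ((f ^^ k) t) x = reg s x) \<and>
      (\<forall>a. a \<notin> aw c \<longrightarrow> arr ((f ^^ k) t) a = arr s a)" if "k \<le> reg s n" for k
    using that
  proof (induction k)
    case 0
    then show ?case using ij ins init by (simp add: t_def)
  next
    case (Suc k)
    then have "P (Suc k) (sem c ((f ^^ k) t))" by (intro step) auto
    then show ?case using Suc ij ins by (simp add: f_def Let_def sem_frame sem_aframe)
  qed
  then show ?thesis by (simp add: f_def t_def)
qed

lemma exec_one: "exec p s 1 s' \<Longrightarrow> \<exists>t\<le>1. exec p s t s'"
  by blast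

text \<open>That \<open>B\<close> bounds all registers with \<open>bnd\<close> is preserved by every
  \<open>ok\<close> program, so each loop makes at most \<open>B\<close> rounds. This gives the time
  \<open>tm\<close>.\<close>

theorem sem_exec:
  assumes "ok c" "\<And>x. bnd x \<Longrightarrow> reg s x \<le> B"
  shows "(\<exists>t\<le>tm c B. exec (compile c) s t (sem c s)) \<and> (\<forall>x. bnd x \<longrightarrow> reg (sem c s) x \<le> B)"
  using assms
proof (induction c arbitrary: s)
  case CSkip
  then show ?case using exec_one[OF exec.Skip[of s]] by auto
next
  case (CConst x v)
  then show ?case using exec_one[OF exec.Const[of x v s]] by auto
next
  case (CMove x y)
  then show ?case using exec_one[OF exec.Move[of x y s]] by auto
next
  case (CInc x)
  then show ?case using exec_one[OF exec.Inc[of x s]] by auto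
next
  case (CDec x)
  then have "bnd y \<longrightarrow> reg (sem (CDec x) s) y \<le> B" for y
    using CDec.prems(2)[of y] le_trans[OF diff_le_self, of "reg s x" B 1] by (cases "y = x") auto
  then show ?case using exec_one[OF exec.Dec[of x s]] by auto
next
  case (CLoad x a y)
  then show ?case using exec_one[OF exec.Load[of x a y s]] by auto
next
  case (CStore a x y)
  then show ?case using exec_one[OF exec.Store[of a x y s]] by auto
next
  case (CSeq c d)
  obtain t where t: "t \<le> tm c B" "exec (compile c) s t (sem c s)" and b: "\<forall>x. bnd x \<longrightarrow> reg (sem c s) x \<le> B"
    using CSeq.IH(1)[of s] CSeq.prems by auto
  obtain u where u: "u \<le> tm d B" "exec (compile d) (sem c s) u (sem d (sem c s))"
    and b': "\<forall>x. bnd x \<longrightarrow> reg (sem d (sem c s)) x \<le> B"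
    using CSeq.IH(2)[of "sem c s"] CSeq.prems b by auto
  then show ?case using exec.Seq[OF t(2) u(2)] t(1) by (auto intro!: exI[of _ "t + u"])
next
  case (CIf x c d)
  show ?case
  proof (cases "reg s x = 0")
    case True
    obtain u where "u \<le> tm d B" "exec (compile d) s u (sem d s)" "\<forall>x. bnd x \<longrightarrow> reg (sem d s) x \<le> B"
      using CIf.IH(2)[of s] CIf.prems by auto
    then show ?thesis using exec.If_zero[OF True] True by (auto intro!: exI[of _ "1 + u"])
  next
    case False
    obtain u where "u \<le> tm c B" "exec (compile c) s u (sem c s)" "\<forall>x. bnd x \<longrightarrow> reg (sem c s) x \<le> B"
      using CIf.IH(1)[of s] CIf.prems by auto
    then show ?thesis using exec.If_nonzero[OF False] False by (auto intro!: exI[of _ "1 + u"])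
  qed
next
  case (CFor i j n c)
  define f where "f = (\<lambda>s. let s1 = sem c s; s2 = set_reg i (reg s1 i + 1) s1 in set_reg j (reg s2 j - 1) s2)"
  define N where "N = reg s n"
  have NB: "N \<le> B" using CFor.prems by (auto simp: N_def)
  let ?w = "WhileNZ j (Seq (compile c) (Seq (Inc i) (Dec j)))"
  \<comment> \<open>\<open>reg u i + k = N\<close> keeps the index within \<open>B\<close>, so that
    the index may bound loops itself.\<close>
  have loop: "(\<exists>t\<le>k * (tm c B + 3) + 1. exec ?w u t ((f ^^ k) u)) \<and> (\<forall>x. bnd x \<longrightarrow> reg ((f ^^ k) u) x \<le> B)"
    if "reg u j = k" "reg u i + k = N" "\<And>x. bnd x \<Longrightarrow> reg u x \<le> B" for k u
    using that
  proof (induction k arbitrary: u)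
    case 0
    then show ?case using exec.While_zero[of u j] by auto
  next
    case (Suc k)
    obtain t where t: "t \<le> tm c B" "exec (compile c) u t (sem c u)" and b: "\<forall>x. bnd x \<longrightarrow> reg (sem c u) x \<le> B"
      using CFor.IH[of u] CFor.prems Suc.prems by auto
    have ij: "reg (sem c u) i = reg u i" "reg (sem c u) j = reg u j" "i \<noteq> j"
      using CFor.prems by (auto simp: sem_frame)
    have 1: "exec (Seq (compile c) (Seq (Inc i) (Dec j))) u (t + (1 + 1)) (f u)"
      unfolding f_def Let_def
      by (rule exec.Seq[OF t(2)], rule exec.Seq[OF exec.Inc], rule exec.Dec)
    have "(\<exists>t\<le>k * (tm c B + 3) + 1. exec ?w (f u) t ((f ^^ k) (f u))) \<and> (\<forall>x. bnd x \<longrightarrow> reg ((f ^^ k) (f u)) x \<le> B)"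
      by (rule Suc.IH) (use Suc.prems ij b NB in \<open>auto simp: f_def Let_def\<close>)
    then obtain v where v: "v \<le> k * (tm c B + 3) + 1" "exec ?w (f u) v ((f ^^ k) (f u))"
      and b': "\<forall>x. bnd x \<longrightarrow> reg ((f ^^ k) (f u)) x \<le> B" by blast
    have "reg u j \<noteq> 0" using Suc.prems by simp
    from exec.While_nonzero[OF this 1 v(2)] have "exec ?w u (1 + (t + (1 + 1)) + v) ((f ^^ Suc k) u)"
      by (simp add: funpow_swap1)
    moreover have "1 + (t + (1 + 1)) + v \<le> Suc k * (tm c B + 3) + 1" using t(1) v(1) by simp
    ultimately have "\<exists>t\<le>Suc k * (tm c B + 3) + 1. exec ?w u t ((f ^^ Suc k) u)" by blast
    moreover have "(f ^^ k) (f u) = (f ^^ Suc k) u" by (simp add: funpow_swap1)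
    ultimately show ?case using b' by simp
  qed
  define u where "u = set_reg i 0 (set_reg j N s)"
  have "(\<exists>t\<le>N * (tm c B + 3) + 1. exec ?w u t ((f ^^ N) u)) \<and> (\<forall>x. bnd x \<longrightarrow> reg ((f ^^ N) u) x \<le> B)"
    by (rule loop) (use CFor.prems NB in \<open>auto simp: u_def\<close>)
  then obtain t where t: "t \<le> N * (tm c B + 3) + 1" "exec ?w u t ((f ^^ N) u)"
    and b: "\<forall>x. bnd x \<longrightarrow> reg ((f ^^ N) u) x \<le> B" by blast
  have eq: "sem (CFor i j n c) s = (f ^^ N) u" by (simp add: f_def u_def N_def)
  have "exec (compile (CFor i j n c)) s (1 + (1 + t)) ((f ^^ N) u)"
    using exec.Seq[OF exec.Move[of j n s] exec.Seq[OF exec.Const t(2)[unfolded u_def N_def]]]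
    unfolding compile.simps u_def N_def .
  moreover have "1 + (1 + t) \<le> tm (CFor i j n c) B"
  proof -
    have "N * (tm c B + 3) \<le> B * (tm c B + 3)" using NB by (rule mult_le_mono1)
    then have "t \<le> B * (tm c B + 3) + 1" using t(1) by linarith
    then show ?thesis by simp
  qed
  ultimately show ?case using b unfolding eq by blast
qed

lemma tm_poly: "\<exists>p :: nat poly. \<forall>B. tm c B = poly p B"
proof (induction c)
  case (CSeq c d)
  then obtain p q where "\<forall>B. tm c B = poly p B" "\<forall>B. tm d B = poly q B" by blast
  then show ?case by (intro exI[of _ "p + q"]) simp
next
  case (CIf x c d)
  then obtain p q where "\<forall>B. tm c B = poly p B" "\<forall>B. tm d B = poly q B" by blast
  then show ?case by (intro exI[of _ "1 + p + q"]) simp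
next
  case (CFor i j n c)
  then obtain p where "\<forall>B. tm c B = poly p B" by blast
  then show ?case by (intro exI[of _ "[:3:] + [:0, 1:] * (p + [:3:])"]) (simp add: algebra_simps)
qed (auto intro!: exI[of _ 1])

lemma finite_wr: "finite (wr c)"
  by (induction c) auto

text \<open>A predicate of the registers and arrays is evaluated into register 3. Registers from 60 on
  serve for quantifiers (even numbers) and as scratch (odd numbers).\<close>

definition dep :: "nat \<Rightarrow> nat set" where
  "dep k = {x. x < k \<and> x \<noteq> 3 \<and> (x < 60 \<or> even x)}"

definition cpc :: "nat \<Rightarrow> ((nat \<Rightarrow> nat) \<Rightarrow> (nat \<Rightarrow> nat \<Rightarrow> nat) \<Rightarrow> bool) \<Rightarrow> com \<Rightarrow> bool" where
  "cpc k \<phi> c \<longleftrightarrow> ok c \<and> aw c = {} \<and> wr c \<subseteq> insert 3 {k..} \<and>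
     (\<forall>s. reg (sem c s) 3 = of_bool (\<phi> (reg s) (arr s))) \<and>
     (\<forall>e e' A. (\<forall>x\<in>dep k. e x = e' x) \<longrightarrow> \<phi> e A = \<phi> e' A)"

definition cp :: "nat \<Rightarrow> ((nat \<Rightarrow> nat) \<Rightarrow> (nat \<Rightarrow> nat \<Rightarrow> nat) \<Rightarrow> bool) \<Rightarrow> bool" where
  "cp k \<phi> \<longleftrightarrow> 60 \<le> k \<and> even k \<and> (\<exists>c. cpc k \<phi> c)"

lemma bnd3 [simp]: "\<not> bnd 3" "bnd 0" "bnd 1" "bnd (Suc 0)"
  by (auto simp: bnd_def)

lemma cpE:
  assumes "cp k \<phi>"
  obtains c where "60 \<le> k" "even k" "ok c" "aw c = {}" "wr c \<subseteq> insert 3 {k..}"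
    "\<And>s. reg (sem c s) 3 = of_bool (\<phi> (reg s) (arr s))"
    "\<And>s x. x < k \<Longrightarrow> x \<noteq> 3 \<Longrightarrow> reg (sem c s) x = reg s x" "\<And>s. arr (sem c s) = arr s"
    "\<And>e e' A. (\<And>x. x \<in> dep k \<Longrightarrow> e x = e' x) \<Longrightarrow> \<phi> e A = \<phi> e' A"
proof -
  obtain c where c: "cpc k \<phi> c" and k: "60 \<le> k" "even k" using assms unfolding cp_def by blast
  note c' = c[unfolded cpc_def]
  have 1: "reg (sem c s) x = reg s x" if "x < k" "x \<noteq> 3" for s x
    by (rule sem_frame) (use c' that in auto)
  have 2: "arr (sem c s) = arr s" for s
  proof
    fix a show "arr (sem c s) a = arr s a" by (rule sem_aframe) (use c' in simp)
  qed
  show ?thesis by (rule that[of c]) (use c' k 1 2 in auto)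
qed

lemma cpI:
  assumes "60 \<le> k" "even k" "ok c" "aw c = {}" "wr c \<subseteq> insert 3 {k..}"
    "\<And>s. reg (sem c s) 3 = of_bool (\<phi> (reg s) (arr s))"
    "\<And>e e' A. (\<And>x. x \<in> dep k \<Longrightarrow> e x = e' x) \<Longrightarrow> \<phi> e A = \<phi> e' A"
  shows "cp k \<phi>"
proof -
  have "cpc k \<phi> c"
    unfolding cpc_def
  proof (intro conjI allI impI)
    fix e e' :: "nat \<Rightarrow> nat" and A assume "\<forall>x\<in>dep k. e x = e' x"
    then show "\<phi> e A = \<phi> e' A" by (intro assms(7)) blast
  qed (use assms(3-6) in simp_all)
  then show ?thesis using assms(1,2) unfolding cp_def by blast
qed

section \<open>Closure properties of the testable predicates\<close>

lemma cp_True: "60 \<le> k \<Longrightarrow> even k \<Longrightarrow> cp k (\<lambda>e A. True)"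
  by (rule cpI[where c = "CConst 3 1"]) auto

lemma cp_not:
  assumes "cp k \<phi>"
  shows "cp k (\<lambda>e A. \<not> \<phi> e A)"
proof -
  obtain c where c: "60 \<le> k" "even k" "ok c" "aw c = {}" "wr c \<subseteq> insert 3 {k..}"
    "\<And>s. reg (sem c s) 3 = of_bool (\<phi> (reg s) (arr s))"
    "\<And>s x. x < k \<Longrightarrow> x \<noteq> 3 \<Longrightarrow> reg (sem c s) x = reg s x" "\<And>s. arr (sem c s) = arr s"
    "\<And>e e' A. (\<And>x. x \<in> dep k \<Longrightarrow> e x = e' x) \<Longrightarrow> \<phi> e A = \<phi> e' A"
    by (fact cpE[OF assms])
  show ?thesis
  proof (rule cpI[where c = "CSeq c (CIf 3 (CConst 3 0) (CConst 3 1))"])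
    fix e e' :: "nat \<Rightarrow> nat" and A assume a: "\<And>x. x \<in> dep k \<Longrightarrow> e x = e' x"
    from c(9)[OF a] show "(\<not> \<phi> e A) = (\<not> \<phi> e' A)" by simp
  qed (use c(1-6) in auto)
qed

lemma cp_and:
  assumes "cp k \<phi>" "cp k \<psi>"
  shows "cp k (\<lambda>e A. \<phi> e A \<and> \<psi> e A)"
proof -
  obtain c where c: "60 \<le> k" "even k" "ok c" "aw c = {}" "wr c \<subseteq> insert 3 {k..}"
    "\<And>s. reg (sem c s) 3 = of_bool (\<phi> (reg s) (arr s))"
    "\<And>s x. x < k \<Longrightarrow> x \<noteq> 3 \<Longrightarrow> reg (sem c s) x = reg s x" "\<And>s. arr (sem c s) = arr s"
    "\<And>e e' A. (\<And>x. x \<in> dep k \<Longrightarrow> e x = e' x) \<Longrightarrow> \<phi> e A = \<phi> e' A"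
    by (fact cpE[OF assms(1)])
  obtain d where d: "60 \<le> k" "even k" "ok d" "aw d = {}" "wr d \<subseteq> insert 3 {k..}"
    "\<And>s. reg (sem d s) 3 = of_bool (\<psi> (reg s) (arr s))"
    "\<And>s x. x < k \<Longrightarrow> x \<noteq> 3 \<Longrightarrow> reg (sem d s) x = reg s x" "\<And>s. arr (sem d s) = arr s"
    "\<And>e e' A. (\<And>x. x \<in> dep k \<Longrightarrow> e x = e' x) \<Longrightarrow> \<psi> e A = \<psi> e' A"
    by (fact cpE[OF assms(2)])
  have \<psi>: "\<psi> (reg (sem c s)) A = \<psi> (reg s) A" for s A
    by (rule d(9)) (auto simp: dep_def c(7))
  show ?thesis
  proof (rule cpI[where c = "CSeq c (CIf 3 d CSkip)"])
    fix e e' :: "nat \<Rightarrow> nat" and A assume a: "\<And>x. x \<in> dep k \<Longrightarrow> e x = e' x"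
    show "(\<phi> e A \<and> \<psi> e A) = (\<phi> e' A \<and> \<psi> e' A)" using c(9)[OF a] d(9)[OF a] by simp
  qed (use c(1-6,8) d(3-6) \<psi> in auto)
qed

lemma cp_or: "cp k \<phi> \<Longrightarrow> cp k \<psi> \<Longrightarrow> cp k (\<lambda>e A. \<phi> e A \<or> \<psi> e A)"
  using cp_not[OF cp_and[OF cp_not cp_not], of k \<phi> \<psi>] by simp

text \<open>\<open>ind\<close> separates the quantified value from register \<open>k\<close>, where
  the loop puts it. The result is collected in an odd register \<open>m\<close> that the test does
  not write, because each round overwrites register 3.\<close>

lemma cp_ex:
  assumes C: "cp (k + 2) (\<lambda>e A. \<psi> e (e k) A)" and k: "60 \<le> k" "even k" and n: "bnd n" "n < k"
    and ind: "\<And>e v w A. \<psi> (e(k := w)) v A = \<psi> e v A"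
  shows "cp k (\<lambda>e A. \<exists>v<e n. \<psi> e v A)"
proof -
  obtain c where c0: "60 \<le> k + 2" "even (k + 2)" "ok c" "aw c = {}" "wr c \<subseteq> insert 3 {k+2..}"
    "\<And>s. reg (sem c s) 3 = of_bool (\<psi> (reg s) (reg s k) (arr s))"
    "\<And>s x. x < k + 2 \<Longrightarrow> x \<noteq> 3 \<Longrightarrow> reg (sem c s) x = reg s x" "\<And>s. arr (sem c s) = arr s"
    "\<And>e e' A. (\<And>x. x \<in> dep (k+2) \<Longrightarrow> e x = e' x) \<Longrightarrow> \<psi> e (e k) A = \<psi> e' (e' k) A"
    by (fact cpE[OF C])
  note c = c0(3-9)
  obtain M where M: "\<And>x. x \<in> wr c \<Longrightarrow> x < M" using finite_nat_set_iff_bounded finite_wr by metis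
  define m where "m = 2 * (M + k) + 1"
  have m: "m \<notin> wr c" "m + 2 \<notin> wr c" "odd m" "k + 2 < m" using M[of m] M[of "m+2"] k by (auto simp: m_def)
  have nb: "\<not> bnd m" using m by (auto simp: bnd_def)
  have n3: "n \<noteq> 3" using n by auto
  let ?b = "CSeq c (CIf 3 (CConst m 1) CSkip)"
  let ?f = "CFor k (m + 2) n ?b"
  have wrb: "wr ?b \<subseteq> insert 3 (insert m {k+2..})" using c(3) by auto
  have dep: "\<psi> e v A = \<psi> e' v A" if "\<And>x. x \<in> dep k \<Longrightarrow> e x = e' x" for e e' v A
  proof -
    have "\<psi> (e(k := v)) ((e(k := v)) k) A = \<psi> (e'(k := v)) ((e'(k := v)) k) A"
    proof (rule c(7))
      fix x assume "x \<in> dep (k + 2)"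
      then have "x = k \<or> x \<in> dep k" using k unfolding dep_def by auto presburger
      then show "(e(k := v)) x = (e'(k := v)) x" using that by auto
    qed
    then show ?thesis by (simp add: ind)
  qed
  have loop: "reg (sem ?f s) m = of_bool (\<exists>v<reg s n. \<psi> (reg s) v (arr s))" if m0: "reg s m = 0" for s
  proof -
    have "reg (sem ?f s) m = of_bool (\<exists>v<reg s n. \<psi> (reg s) v (arr s)) \<and> arr (sem ?f s) = arr s"
    proof (rule for_rule[where P = "\<lambda>q t. reg t m = of_bool (\<exists>v<q. \<psi> (reg s) v (arr s)) \<and> arr t = arr s"])
      fix q and t :: state
      assume q: "q < reg s n" and P: "reg t m = of_bool (\<exists>v<q. \<psi> (reg s) v (arr s)) \<and> arr t = arr s" and tk: "reg t k = q"
        and fr: "\<And>x. x \<notin> wr ?b \<Longrightarrow> x \<noteq> k \<Longrightarrow> x \<noteq> m + 2 \<Longrightarrow> reg t x = reg s x"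
      have "\<psi> (reg t) (reg t k) (arr s) = \<psi> (reg s) (reg t k) (arr s)"
      proof (rule dep)
        fix x assume x: "x \<in> dep k"
        then have "x \<notin> wr ?b" using wrb m k by (auto simp: dep_def)
        then show "reg t x = reg s x" using fr[of x] x m by (auto simp: dep_def)
      qed
      then have r3: "reg (sem c t) 3 = of_bool (\<psi> (reg s) q (arr s))" using c(4)[of t] P tk by simp
      have rm: "reg (sem c t) m = reg t m" by (rule sem_frame[OF m(1)])
      have "(\<exists>v<Suc q. \<psi> (reg s) v (arr s)) \<longleftrightarrow> (\<exists>v<q. \<psi> (reg s) v (arr s)) \<or> \<psi> (reg s) q (arr s)"
        by (auto simp: less_Suc_eq)
      then show "reg (sem ?b t) m = of_bool (\<exists>v<Suc q. \<psi> (reg s) v (arr s)) \<and> arr (sem ?b t) = arr s"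
        using r3 rm P c(6) by auto
    qed (use m k c(3) m0 in auto)
    then show ?thesis by simp
  qed
  show ?thesis
  proof (rule cpI[where c = "CSeq (CConst m 0) (CSeq ?f (CMove 3 m))"])
    fix s
    have "\<psi> (reg (set_reg m 0 s)) v (arr s) = \<psi> (reg s) v (arr s)" for v
      by (rule dep) (use m in \<open>auto simp: dep_def\<close>)
    then show "reg (sem (CSeq (CConst m 0) (CSeq ?f (CMove 3 m))) s) 3 = of_bool (\<exists>v<reg s n. \<psi> (reg s) v (arr s))"
      using loop[of "set_reg m 0 s"] m n by (simp del: sem.simps(10))
  next
    fix e e' :: "nat \<Rightarrow> nat" and A assume a: "\<And>x. x \<in> dep k \<Longrightarrow> e x = e' x"
    have "n \<in> dep k" using n n3 k by (auto simp: dep_def bnd_def)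
    then show "(\<exists>v<e n. \<psi> e v A) = (\<exists>v<e' n. \<psi> e' v A)" using a dep[OF a] by auto
  qed (use k c(1-3) m n nb in \<open>auto simp: bnd_def\<close>)
qed

text \<open>The machine cannot multiply, so the row-major index is reached by counting in nested
  loops.\<close>

lemma cp_entry:
  assumes k: "60 \<le> k" "even k" and r: "bnd r" "r < k" and c: "bnd c" "c < k"
  shows "cp k (\<lambda>e A. A 0 (e r * e 1 + e c) \<noteq> 0)"
proof -
  define x where "x = k + 1"
  let ?in = "CFor (k+4) (k+5) 1 (CInc x)"
  let ?f1 = "CFor (k+2) (k+3) r ?in"
  let ?f2 = "CFor (k+2) (k+3) c (CInc x)"
  have nb: "\<not> bnd x" using k by (auto simp: x_def bnd_def)
  have f0: "reg (sem (CFor i j n (CInc x)) s) x = reg s x + reg s n" if "i \<noteq> j" "i \<noteq> x" "j \<noteq> x" for i j n s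
    by (rule for_rule[where P = "\<lambda>q t. reg t x = reg s x + q"]) (use that in auto)
  have f1: "reg (sem ?f1 s) x = reg s x + reg s r * reg s 1" for s
  proof (rule for_rule[where P = "\<lambda>q t. reg t x = reg s x + q * reg s 1"])
    fix q and t :: state
    assume P: "reg t x = reg s x + q * reg s 1" and fr: "\<And>y. y \<notin> wr ?in \<Longrightarrow> y \<noteq> k+2 \<Longrightarrow> y \<noteq> k+3 \<Longrightarrow> reg t y = reg s y"
    have "reg t 1 = reg s 1" by (rule fr) (use k in \<open>auto simp: x_def\<close>)
    then show "reg (sem ?in t) x = reg s x + Suc q * reg s 1"
      using f0[of "k+4" "k+5" 1 t] P by (simp add: x_def del: sem.simps(10))
  qed (auto simp: x_def)
  let ?c = "CSeq (CConst x 0) (CSeq ?f1 (CSeq ?f2 (CSeq (CLoad 3 0 x) (CIf 3 (CConst 3 1) CSkip))))"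
  have d: "r \<noteq> 3" "c \<noteq> 3" using r c by auto
  have fr1: "reg (sem ?f1 s) y = reg s y" if "y < k" for y s by (rule sem_frame) (use that in \<open>auto simp: x_def\<close>)
  have a1: "arr (sem ?f1 s) 0 = arr s 0" "arr (sem ?f2 s) 0 = arr s 0" for s by (rule sem_aframe, simp)+
  show ?thesis
  proof (rule cpI[where c = ?c])
    fix s
    show "reg (sem ?c s) 3 = of_bool (arr s 0 (reg s r * reg s 1 + reg s c) \<noteq> 0)"
      using f1[of "set_reg x 0 s"] f0[of "k+2" "k+3" c "sem ?f1 (set_reg x 0 s)"] fr1[of c] a1 r c k
      by (simp add: x_def del: sem.simps(10))
  next
    fix e e' :: "nat \<Rightarrow> nat" and A :: "nat \<Rightarrow> nat \<Rightarrow> nat"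
    assume a: "\<And>x. x \<in> dep k \<Longrightarrow> e x = e' x"
    have "r \<in> dep k" "c \<in> dep k" "1 \<in> dep k" using r c d k by (auto simp: dep_def bnd_def)
    then show "(A 0 (e r * e 1 + e c) \<noteq> 0) = (A 0 (e' r * e' 1 + e' c) \<noteq> 0)" using a by simp
  qed (use k r c nb in \<open>auto simp: x_def bnd_def\<close>)
qed

lemma cp_arr:
  assumes k: "60 \<le> k" "even k" and r: "r < k" "r \<noteq> 3" "r < 60 \<or> even r"
  shows "cp k (\<lambda>e A. A a (e r) \<noteq> 0)"
proof (rule cpI[where c = "CSeq (CLoad 3 a r) (CIf 3 (CConst 3 1) CSkip)"])
  fix e e' :: "nat \<Rightarrow> nat" and A :: "nat \<Rightarrow> nat \<Rightarrow> nat"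
  assume a: "\<And>x. x \<in> dep k \<Longrightarrow> e x = e' x"
  have "r \<in> dep k" using r by (auto simp: dep_def)
  then show "(A a (e r) \<noteq> 0) = (A a (e' r) \<noteq> 0)" using a by simp
qed (use k in auto)

text \<open>A decision tree on the answers: any Boolean function \<open>P\<close> of a fixed list of
  tests can be tested, without an algorithm for \<open>P\<close>. This is how the property of a
  window, which depends on 64 bits, enters the program.\<close>

lemma cp_list:
  assumes "\<And>f. f \<in> set fs \<Longrightarrow> cp k f" "60 \<le> k" "even k"
  shows "cp k (\<lambda>e A. P (map (\<lambda>f. f e A) fs))"
  using assms(1)
proof (induction fs arbitrary: P)
  case Nil
  show ?case
  proof (cases "P []")
    case True
    then show ?thesis using cp_True[OF assms(2,3)] by simp
  next
    case False
    then show ?thesis using cp_not[OF cp_True[OF assms(2,3)]] by simp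
  qed
next
  case (Cons f fs)
  have f: "cp k f" using Cons.prems by simp
  have 1: "cp k (\<lambda>e A. P (True # map (\<lambda>f. f e A) fs))" using Cons.IH[of "\<lambda>bs. P (True # bs)"] Cons.prems by simp
  have 2: "cp k (\<lambda>e A. P (False # map (\<lambda>f. f e A) fs))" using Cons.IH[of "\<lambda>bs. P (False # bs)"] Cons.prems by simp
  have "cp k (\<lambda>e A. (f e A \<and> P (True # map (\<lambda>f. f e A) fs)) \<or> (\<not> f e A \<and> P (False # map (\<lambda>f. f e A) fs)))"
    by (intro cp_or cp_and f cp_not[OF f] 1 2)
  moreover have "(\<lambda>e A. (f e A \<and> P (True # map (\<lambda>f. f e A) fs)) \<or> (\<not> f e A \<and> P (False # map (\<lambda>f. f e A) fs))) =
      (\<lambda>e A. P (map (\<lambda>f. f e A) (f # fs)))"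
  proof (intro ext)
    fix e A show "((f e A \<and> P (True # map (\<lambda>f. f e A) fs)) \<or> (\<not> f e A \<and> P (False # map (\<lambda>f. f e A) fs))) =
      P (map (\<lambda>f. f e A) (f # fs))" by (cases "f e A") auto
  qed
  ultimately show ?case by simp
qed

lemma ex_list_Suc:
  "(\<exists>vs. length vs = Suc N \<and> (\<forall>v\<in>set vs. v < m) \<and> Q vs) \<longleftrightarrow>
   (\<exists>v<m. \<exists>vs. length vs = N \<and> (\<forall>v\<in>set vs. v < m) \<and> Q (v # vs))" for m :: nat
proof
  assume "\<exists>vs. length vs = Suc N \<and> (\<forall>v\<in>set vs. v < m) \<and> Q vs"
  then obtain vs where vs: "length vs = Suc N" "\<forall>v\<in>set vs. v < m" "Q vs" by blast
  then obtain v us where "vs = v # us" "length us = N" by (auto simp: length_Suc_conv)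
  then show "\<exists>v<m. \<exists>vs. length vs = N \<and> (\<forall>v\<in>set vs. v < m) \<and> Q (v # vs)" using vs by auto
next
  assume "\<exists>v<m. \<exists>vs. length vs = N \<and> (\<forall>v\<in>set vs. v < m) \<and> Q (v # vs)"
  then obtain v vs where "v < m" "length vs = N" "\<forall>v\<in>set vs. v < m" "Q (v # vs)" by blast
  then show "\<exists>vs. length vs = Suc N \<and> (\<forall>v\<in>set vs. v < m) \<and> Q vs" by (intro exI[of _ "v # vs"]) auto
qed

lemma cp_exlist:
  assumes "cp (k + 2 * N) (\<lambda>e A. \<Phi> e (map (\<lambda>i. e (k + 2 * i)) [0..<N]) A)" "60 \<le> k" "even k" "bnd n" "n < k"
    and "\<And>e e' vs A. (\<And>x. x < k \<Longrightarrow> e x = e' x) \<Longrightarrow> \<Phi> e vs A = \<Phi> e' vs A"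
  shows "cp k (\<lambda>e A. \<exists>vs. length vs = N \<and> (\<forall>v\<in>set vs. v < e n) \<and> \<Phi> e vs A)"
  using assms
proof (induction N arbitrary: k \<Phi>)
  case 0
  from "0"(1) show ?case by simp
next
  case (Suc N)
  let ?\<psi> = "\<lambda>e v A. \<exists>vs. length vs = N \<and> (\<forall>v\<in>set vs. v < e n) \<and> \<Phi> e (v # vs) A"
  have m: "map (\<lambda>i. e (k + 2 * i)) [0..<Suc N] = e k # map (\<lambda>i. e (k + 2 + 2 * i)) [0..<N]" for e :: "nat \<Rightarrow> nat"
    by (simp add: upt_conv_Cons map_Suc_upt[symmetric] del: upt_Suc)
  have "cp (k + 2) (\<lambda>e A. \<exists>vs. length vs = N \<and> (\<forall>v\<in>set vs. v < e n) \<and> \<Phi> e (e k # vs) A)"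
  proof (rule Suc.IH[of "k + 2" "\<lambda>e vs A. \<Phi> e (e k # vs) A"])
    show "cp (k + 2 + 2 * N) (\<lambda>e A. \<Phi> e (e k # map (\<lambda>i. e (k + 2 + 2 * i)) [0..<N]) A)"
      using Suc.prems(1) unfolding m by (simp add: algebra_simps)
  next
    fix e e' :: "nat \<Rightarrow> nat" and vs A assume "\<And>x. x < k + 2 \<Longrightarrow> e x = e' x"
    then show "\<Phi> e (e k # vs) A = \<Phi> e' (e' k # vs) A" using Suc.prems(6)[of e e' "e k # vs"] by simp
  qed (use Suc.prems(2-5) in auto)
  then have "cp k (\<lambda>e A. \<exists>v<e n. ?\<psi> e v A)"
  proof (rule cp_ex)
    fix e v w A
    have "\<Phi> (e(k := w)) vs A = \<Phi> e vs A" for vs by (rule Suc.prems(6)) simp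
    then show "?\<psi> (e(k := w)) v A = ?\<psi> e v A" using Suc.prems(5) by simp
  qed (use Suc.prems(2-5) in auto)
  then show ?case unfolding ex_list_Suc .
qed

section \<open>Finding columns on holes\<close>

text \<open>Registers 0, 1, 2 hold the numbers of rows and columns and \<open>d\<close>; 3 receives test results. Even
  registers from 4 on are loop indices or rows and columns found, and odd ones counters: 4 is the current
  column \<open>v\<close>, 6 and 8 the candidates for \<open>p\<close> and \<open>s\<close> in a detour, 20 and 22 the columns of a
  candidate cut, 24 and 26 those of the best one, of size 41; 28, 30, \<open>\<dots>\<close>, 42 are the rows of an
  obstruction, 47 is the remaining budget, 49 flags its overrun, 37 is the initial budget, 33 the answer,
  39 the loop condition and 35 the borrow of the odometer. Array 0 is the matrix, 1 marks the deleted rows, 2 the deleted rows during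
  a trial, 3 the rows reached by a search, 4 holds the digits, and 5 marks the digits in use.\<close>

definition cf :: "((nat \<Rightarrow> nat) \<Rightarrow> (nat \<Rightarrow> nat \<Rightarrow> nat) \<Rightarrow> bool) \<Rightarrow> com" where
  "cf \<phi> = (SOME c. cpc 60 \<phi> c)"

definition IFF :: "((nat \<Rightarrow> nat) \<Rightarrow> (nat \<Rightarrow> nat \<Rightarrow> nat) \<Rightarrow> bool) \<Rightarrow> com \<Rightarrow> com \<Rightarrow> com" where
  "IFF \<phi> c d = CSeq (cf \<phi>) (CIf 3 c d)"

lemma cpc_cf: "cp 60 \<phi> \<Longrightarrow> cpc 60 \<phi> (cf \<phi>)"
  unfolding cf_def cp_def by (rule someI_ex) blast

lemma cf_props:
  assumes "cp 60 \<phi>"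
  shows ok_cf: "ok (cf \<phi>)" and aw_cf: "aw (cf \<phi>) = {}" and wr_cf: "wr (cf \<phi>) \<subseteq> insert 3 {60..}"
    and res_cf: "reg (sem (cf \<phi>) s) 3 = of_bool (\<phi> (reg s) (arr s))"
  using cpc_cf[OF assms] unfolding cpc_def by blast+

lemma reg_cf [simp]: "cp 60 \<phi> \<Longrightarrow> x < 60 \<Longrightarrow> x \<noteq> 3 \<Longrightarrow> reg (sem (cf \<phi>) s) x = reg s x"
  using wr_cf[of \<phi>] by (intro sem_frame) auto

lemma arr_cf [simp]: "cp 60 \<phi> \<Longrightarrow> arr (sem (cf \<phi>) s) = arr s"
  by (intro ext, rule sem_aframe[THEN fun_cong]) (simp add: aw_cf)

lemma sem_IFF [simp]: "cp 60 \<phi> \<Longrightarrow> sem (IFF \<phi> c d) s =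
    (if \<phi> (reg s) (arr s) then sem c (sem (cf \<phi>) s) else sem d (sem (cf \<phi>) s))"
  by (simp add: IFF_def res_cf)

lemma wr_IFF [simp]: "cp 60 \<phi> \<Longrightarrow> x < 60 \<Longrightarrow> x \<noteq> 3 \<Longrightarrow> x \<in> wr (IFF \<phi> c d) \<longleftrightarrow> x \<in> wr c \<or> x \<in> wr d"
  using wr_cf[of \<phi>] by (auto simp: IFF_def)

lemma aw_IFF [simp]: "cp 60 \<phi> \<Longrightarrow> aw (IFF \<phi> c d) = aw c \<union> aw d"
  by (simp add: IFF_def aw_cf)

lemma ok_IFF [simp]: "cp 60 \<phi> \<Longrightarrow> ok (IFF \<phi> c d) \<longleftrightarrow> ok c \<and> ok d"
  by (simp add: IFF_def ok_cf)

declare sem.simps(10) [simp del] One_nat_def [simp del]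

definition EM :: "(nat \<Rightarrow> nat) \<Rightarrow> nat \<Rightarrow> nat \<Rightarrow> nat \<Rightarrow> bool" where
  "EM a C r c \<longleftrightarrow> a (r * C + c) \<noteq> 0"

lemma cp_EM: "60 \<le> k \<Longrightarrow> even k \<Longrightarrow> bnd r \<Longrightarrow> r < k \<Longrightarrow> bnd c \<Longrightarrow> c < k \<Longrightarrow>
    cp k (\<lambda>e A. EM (A 0) (e 1) (e r) (e c))"
  unfolding EM_def by (rule cp_entry)

lemma bnd_even [simp]: "even k \<Longrightarrow> 4 \<le> k \<Longrightarrow> bnd k"
  by (simp add: bnd_def)

lemma cp_meet:
  assumes k: "60 \<le> k" "even k" and u: "bnd u" "u < k" and w: "bnd w" "w < k"
  shows "cp k (\<lambda>e A. meets (EM (A 0) (e 1)) {..<e 1} (e u) (e w))"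
proof -
  have "cp k (\<lambda>e A. \<exists>v<e 1. EM (A 0) (e 1) (e u) v \<and> EM (A 0) (e 1) (e w) v)"
  proof (rule cp_ex)
    show "cp (k + 2) (\<lambda>e A. EM (A 0) (e 1) (e u) (e k) \<and> EM (A 0) (e 1) (e w) (e k))"
      by (intro cp_and cp_EM) (use assms in simp_all)
  qed (use assms in auto)
  then show ?thesis by (simp add: meets_def Bex_def)
qed

definition SET :: "nat \<Rightarrow> nat \<Rightarrow> com" where
  "SET a r = CSeq (CConst 59 1) (CStore a r 59)"

definition CLR :: "nat \<Rightarrow> nat \<Rightarrow> com" where
  "CLR a r = CSeq (CConst 59 0) (CStore a r 59)"

lemma SET_simps [simp]:
  "r \<noteq> 59 \<Longrightarrow> sem (SET a r) s = set_arr a (reg s r) 1 (set_reg 59 1 s)"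
  "wr (SET a r) = {59}" "aw (SET a r) = {a}" "ok (SET a r)"
  by (auto simp: SET_def bnd_def)

lemma CLR_simps [simp]:
  "r \<noteq> 59 \<Longrightarrow> sem (CLR a r) s = set_arr a (reg s r) 0 (set_reg 59 0 s)"
  "wr (CLR a r) = {59}" "aw (CLR a r) = {a}" "ok (CLR a r)"
  by (auto simp: CLR_def bnd_def)

abbreviation MT :: "(nat \<Rightarrow> nat) \<Rightarrow> (nat \<Rightarrow> nat \<Rightarrow> nat) \<Rightarrow> nat \<Rightarrow> nat \<Rightarrow> bool" where
  "MT e A u w \<equiv> meets (EM (A 0) (e 1)) {..<e 1} (e u) (e w)"

text \<open>\<open>f_init\<close>, \<open>f_step\<close> and \<open>f_test\<close> spell out
  \<open>detour\<close> for \<open>p\<close> and \<open>s\<close> in registers 6 and 8: the start of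
  the search, a single step of it, and the existence of \<open>t\<close>.\<close>

definition f_init where
  "f_init e A \<longleftrightarrow> A 2 (e 10) = 0 \<and> \<not> MT e A 10 6 \<and> MT e A 8 10"

definition f_step where
  "f_step e A \<longleftrightarrow> A 3 (e 10) \<noteq> 0 \<and> A 2 (e 16) = 0 \<and> \<not> MT e A 16 6 \<and> MT e A 10 16"

definition f_test where
  "f_test e A \<longleftrightarrow> A 2 (e 6) = 0 \<and> A 2 (e 8) = 0 \<and> EM (A 0) (e 1) (e 6) (e 4) \<and> MT e A 8 6 \<and>
     (\<exists>t<e 0. A 2 t = 0 \<and> meets (EM (A 0) (e 1)) {..<e 1} t (e 6) \<and> \<not> meets (EM (A 0) (e 1)) {..<e 1} (e 8) t \<and>
       (\<exists>u<e 0. A 3 u \<noteq> 0 \<and> meets (EM (A 0) (e 1)) {..<e 1} u t))"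

lemma cp_arr0: "60 \<le> k \<Longrightarrow> even k \<Longrightarrow> r < k \<Longrightarrow> r \<noteq> 3 \<Longrightarrow> r < 60 \<or> even r \<Longrightarrow> cp k (\<lambda>e A. A a (e r) = 0)"
  using cp_not[OF cp_arr, of k r a] by simp

lemma cp_f [simp]: "cp 60 f_init" "cp 60 f_step" "cp 60 f_test"
proof -
  show "cp 60 f_init" "cp 60 f_step"
    unfolding f_init_def[abs_def] f_step_def[abs_def] by (intro cp_and cp_not cp_meet cp_arr0 cp_arr; simp)+
  show "cp 60 f_test"
    unfolding f_test_def[abs_def]
    apply (intro cp_and cp_arr0 cp_EM cp_meet; (simp; fail)?)
    apply (rule cp_ex; (simp; fail)?)
    apply (intro cp_and cp_not cp_arr0 cp_EM cp_meet; (simp; fail)?)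
    apply (rule cp_ex; (simp; fail)?)
    apply (intro cp_and cp_arr cp_meet; (simp; fail)?)
    done
qed

definition INIT where "INIT = CFor 10 11 0 (IFF f_init (SET 3 10) (CLR 3 10))"
definition ROUND where "ROUND = CFor 10 11 0 (CFor 16 17 0 (IFF f_step (SET 3 16) CSkip))"
definition CLOS where "CLOS = CFor 12 13 0 (CFor 14 15 0 ROUND)"
definition TEST where "TEST = IFF f_test (CConst 57 1) CSkip"
definition CHK where "CHK = CSeq (CConst 57 0) (CFor 6 7 0 (CFor 8 9 0 (CSeq INIT (CSeq CLOS TEST))))"

lemma chk_frames:
  "aw INIT = {3}" "aw ROUND = {3}" "aw CLOS = {3}" "aw TEST = {}" "aw CHK = {3}"
  "ok INIT" "ok ROUND" "ok CLOS" "ok TEST" "ok CHK"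
  "x < 60 \<Longrightarrow> x \<noteq> 3 \<Longrightarrow> x \<in> wr INIT \<longleftrightarrow> x \<in> {10, 11, 59}"
  "x < 60 \<Longrightarrow> x \<noteq> 3 \<Longrightarrow> x \<in> wr ROUND \<longleftrightarrow> x \<in> {10, 11, 16, 17, 59}"
  "x < 60 \<Longrightarrow> x \<noteq> 3 \<Longrightarrow> x \<in> wr CLOS \<longleftrightarrow> x \<in> {10, 11, 12, 13, 14, 15, 16, 17, 59}"
  "x < 60 \<Longrightarrow> x \<noteq> 3 \<Longrightarrow> x \<in> wr TEST \<longleftrightarrow> x = 57"
  "x < 60 \<Longrightarrow> x \<noteq> 3 \<Longrightarrow> x \<in> wr CHK \<longleftrightarrow> x \<in> {6, 7, 8, 9, 10, 11, 12, 13, 14, 15, 16, 17, 57, 59}"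
  by (auto simp: INIT_def ROUND_def CLOS_def TEST_def CHK_def bnd_def)

abbreviation EE :: "state \<Rightarrow> nat \<Rightarrow> nat \<Rightarrow> bool" where "EE s \<equiv> EM (arr s 0) (reg s 1)"
abbreviation VV :: "state \<Rightarrow> nat set" where "VV s \<equiv> {..<reg s 1}"
definition alive :: "nat \<Rightarrow> state \<Rightarrow> nat set" where "alive a s = {r. r < reg s 0 \<and> arr s a r = 0}"
definition on :: "nat \<Rightarrow> state \<Rightarrow> nat set" where "on a s = {r. r < reg s 0 \<and> arr s a r \<noteq> 0}"

abbreviation UU :: "state \<Rightarrow> nat set" where
  "UU s \<equiv> {r \<in> alive 2 s. \<not> meets (EE s) (VV s) r (reg s 6)}"

lemma INIT_spec: "on 3 (sem INIT s) = {u \<in> UU s. meets (EE s) (VV s) (reg s 8) u}"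
proof -
  let ?c = "IFF f_init (SET 3 10) (CLR 3 10)"
  have "\<forall>u<reg s 0. arr (sem INIT s) 3 u \<noteq> 0 \<longleftrightarrow> u \<in> UU s \<and> meets (EE s) (VV s) (reg s 8) u"
    unfolding INIT_def
  proof (rule for_rule[where P = "\<lambda>k t. \<forall>u<k. arr t 3 u \<noteq> 0 \<longleftrightarrow> u \<in> UU s \<and> meets (EE s) (VV s) (reg s 8) u"])
    fix k and t :: state
    assume k: "k < reg s 0" and P: "\<forall>u<k. arr t 3 u \<noteq> 0 \<longleftrightarrow> u \<in> UU s \<and> meets (EE s) (VV s) (reg s 8) u"
      and ti: "reg t 10 = k"
      and fr: "\<And>x. x \<notin> wr ?c \<Longrightarrow> x \<noteq> 10 \<Longrightarrow> x \<noteq> 11 \<Longrightarrow> reg t x = reg s x"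
      and af: "\<And>a. a \<notin> aw ?c \<Longrightarrow> arr t a = arr s a"
    have r: "reg t 1 = reg s 1" "reg t 6 = reg s 6" "reg t 8 = reg s 8" using fr[of 1] fr[of 6] fr[of 8] by simp_all
    have a: "arr t 0 = arr s 0" "arr t 2 = arr s 2" using af[of 0] af[of 2] by simp_all
    show "\<forall>u<Suc k. arr (sem ?c t) 3 u \<noteq> 0 \<longleftrightarrow> u \<in> UU s \<and> meets (EE s) (VV s) (reg s 8) u"
      using P k by (auto simp: f_init_def ti r a less_Suc_eq alive_def)
  qed auto
  then show ?thesis by (auto simp: on_def alive_def sem_frame chk_frames)
qed

text \<open>A row marked during a round may serve as a starting point in the same round. So the
  result is only enclosed between one step from the old marks and everything reachable from
  them.\<close>

lemma ROUND_spec: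
  shows "on 3 s \<subseteq> on 3 (sem ROUND s)"
    and "step (EE s) (VV s) (UU s) `` (on 3 s \<inter> UU s) \<subseteq> on 3 (sem ROUND s)"
    and "on 3 s \<subseteq> UU s \<Longrightarrow> on 3 (sem ROUND s) \<subseteq> (step (EE s) (VV s) (UU s))\<^sup>* `` on 3 s"
proof -
  let ?c = "IFF f_step (SET 3 16) CSkip"
  let ?S = "step (EE s) (VV s) (UU s)"
  let ?f = "CFor 16 17 0 ?c"
  define ON where "ON t = {r. r < reg s 0 \<and> arr t 3 r \<noteq> 0}" for t :: state
  define Q where "Q t \<longleftrightarrow> on 3 s \<subseteq> ON t \<and> (on 3 s \<subseteq> UU s \<longrightarrow> ON t \<subseteq> ?S\<^sup>* `` on 3 s)" for t
  have Qi: "Q (set_reg i v t) = Q t" for i v t by (simp add: Q_def ON_def)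
  have inner: "Q (sem ?f t) \<and> (\<forall>w<reg t 0. reg t 10 \<in> ON t \<longrightarrow> (reg t 10, w) \<in> ?S \<longrightarrow> w \<in> ON (sem ?f t)) \<and> ON t \<subseteq> ON (sem ?f t)"
    if Qt: "Q t" and u: "reg t 10 < reg s 0" and fr: "reg t 0 = reg s 0" "reg t 1 = reg s 1" "reg t 6 = reg s 6"
      and a: "arr t 0 = arr s 0" "arr t 2 = arr s 2" for t
  proof (rule for_rule[where P = "\<lambda>k q. Q q \<and> (\<forall>w<k. reg t 10 \<in> ON t \<longrightarrow> (reg t 10, w) \<in> ?S \<longrightarrow> w \<in> ON q) \<and> ON t \<subseteq> ON q"])
    fix k q
    assume k: "k < reg t 0" and P: "Q q \<and> (\<forall>w<k. reg t 10 \<in> ON t \<longrightarrow> (reg t 10, w) \<in> ?S \<longrightarrow> w \<in> ON q) \<and> ON t \<subseteq> ON q"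
      and qi: "reg q 16 = k"
      and fr': "\<And>x. x \<notin> wr ?c \<Longrightarrow> x \<noteq> 16 \<Longrightarrow> x \<noteq> 17 \<Longrightarrow> reg q x = reg t x"
      and af': "\<And>a. a \<notin> aw ?c \<Longrightarrow> arr q a = arr t a"
    have r: "reg q 1 = reg s 1" "reg q 6 = reg s 6" "reg q 10 = reg t 10"
      using fr'[of 1] fr'[of 6] fr'[of 10] fr by simp_all
    have a': "arr q 0 = arr s 0" "arr q 2 = arr s 2" using af'[of 0] af'[of 2] a by simp_all
    have kR: "k < reg s 0" using k fr by simp
    show "Q (sem ?c q) \<and> (\<forall>w<Suc k. reg t 10 \<in> ON t \<longrightarrow> (reg t 10, w) \<in> ?S \<longrightarrow> w \<in> ON (sem ?c q)) \<and> ON t \<subseteq> ON (sem ?c q)"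
    proof (cases "f_step (reg q) (arr q)")
      case True
      then have on': "ON (sem ?c q) = insert k (ON q)" using kR by (auto simp: ON_def qi)
      have uq: "reg t 10 \<in> ON q" and kU: "k \<in> UU s" and m: "meets (EE s) (VV s) (reg t 10) k"
        using True u kR by (auto simp: f_step_def r a' qi ON_def alive_def)
      have "k \<in> ?S\<^sup>* `` on 3 s" if sub: "on 3 s \<subseteq> UU s"
      proof -
        have "reg t 10 \<in> ?S\<^sup>* `` on 3 s" using P uq sub by (auto simp: Q_def)
        then obtain x where x: "x \<in> on 3 s" "(x, reg t 10) \<in> ?S\<^sup>*" by blast
        have "reg t 10 \<in> UU s" using x(2,1) sub by (cases rule: rtranclE) (auto simp: step_def)
        then have "(reg t 10, k) \<in> ?S" using kU m by (auto simp: step_def)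
        then show ?thesis using x rtrancl_into_rtrancl[of x "reg t 10" ?S k] by blast
      qed
      then show ?thesis using P unfolding on' Q_def by (auto simp: less_Suc_eq)
    next
      case False
      then have on': "ON (sem ?c q) = ON q" by (simp add: ON_def)
      have "\<not> (reg t 10 \<in> ON t \<and> (reg t 10, k) \<in> ?S)"
        using False P by (auto simp: f_step_def r a' qi ON_def alive_def step_def)
      moreover have "Q (sem ?c q)" using P on' by (simp add: Q_def)
      ultimately show ?thesis using P unfolding on' by (auto simp: less_Suc_eq)
    qed
  qed (use Qt Qi in \<open>auto simp: ON_def\<close>)
  have "Q (sem ROUND s) \<and> (\<forall>u<reg s 0. \<forall>w. u \<in> on 3 s \<longrightarrow> (u, w) \<in> ?S \<longrightarrow> w \<in> ON (sem ROUND s))"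
    unfolding ROUND_def
  proof (rule for_rule[where P = "\<lambda>k t. Q t \<and> (\<forall>u<k. \<forall>w. u \<in> on 3 s \<longrightarrow> (u, w) \<in> ?S \<longrightarrow> w \<in> ON t)"])
    fix k and t :: state
    assume k: "k < reg s 0" and P: "Q t \<and> (\<forall>u<k. \<forall>w. u \<in> on 3 s \<longrightarrow> (u, w) \<in> ?S \<longrightarrow> w \<in> ON t)"
      and ti: "reg t 10 = k"
      and fr: "\<And>x. x \<notin> wr ?f \<Longrightarrow> x \<noteq> 10 \<Longrightarrow> x \<noteq> 11 \<Longrightarrow> reg t x = reg s x"
      and af: "\<And>a. a \<notin> aw ?f \<Longrightarrow> arr t a = arr s a"
    have I: "Q (sem ?f t) \<and> (\<forall>w<reg t 0. k \<in> ON t \<longrightarrow> (k, w) \<in> ?S \<longrightarrow> w \<in> ON (sem ?f t)) \<and> ON t \<subseteq> ON (sem ?f t)"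
      using inner[of t] P ti k fr[of 0] fr[of 1] fr[of 6] af[of 0] af[of 2] by simp
    have "w \<in> ON (sem ?f t)" if "k \<in> on 3 s" "(k, w) \<in> ?S" for w
    proof -
      have "w < reg t 0" using that(2) fr[of 0] by (auto simp: step_def alive_def)
      moreover have "k \<in> ON t" using P that(1) by (auto simp: Q_def)
      ultimately show ?thesis using I that(2) by blast
    qed
    then show "Q (sem ?f t) \<and> (\<forall>u<Suc k. \<forall>w. u \<in> on 3 s \<longrightarrow> (u, w) \<in> ?S \<longrightarrow> w \<in> ON (sem ?f t))"
      using I P by (auto simp: less_Suc_eq)
  qed (auto simp: Qi Q_def ON_def on_def)
  moreover have "on 3 (sem ROUND s) = ON (sem ROUND s)" by (simp add: on_def ON_def sem_frame chk_frames)
  ultimately show "on 3 s \<subseteq> on 3 (sem ROUND s)"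
    "?S `` (on 3 s \<inter> UU s) \<subseteq> on 3 (sem ROUND s)"
    "on 3 s \<subseteq> UU s \<Longrightarrow> on 3 (sem ROUND s) \<subseteq> ?S\<^sup>* `` on 3 s"
    unfolding Q_def by (auto simp: on_def)
qed

lemma UU_step: "on 3 s \<subseteq> UU s \<Longrightarrow> (step (EE s) (VV s) (UU s))\<^sup>* `` on 3 s \<subseteq> UU s"
proof (rule subsetI)
  fix x assume a: "on 3 s \<subseteq> UU s" "x \<in> (step (EE s) (VV s) (UU s))\<^sup>* `` on 3 s"
  then obtain y where y: "y \<in> on 3 s" "(y, x) \<in> (step (EE s) (VV s) (UU s))\<^sup>*" by blast
  from y(2) show "x \<in> UU s" by (cases rule: rtranclE) (use a y in \<open>auto simp: step_def\<close>)
qed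

text \<open>After \<open>m\<close> rounds everything reachable in at most \<open>m\<close> steps is marked; a path never needs
  more steps than there are pairs of rows.\<close>

lemma CLOS_spec:
  assumes "on 3 s \<subseteq> UU s"
  shows "on 3 (sem CLOS s) = (step (EE s) (VV s) (UU s))\<^sup>* `` on 3 s"
proof -
  let ?S = "step (EE s) (VV s) (UU s)"
  let ?R = "reg s 0"
  define ON where "ON t = {r. r < reg s 0 \<and> arr t 3 r \<noteq> 0}" for t :: state
  let ?P = "\<lambda>m t. (\<forall>j\<le>m. (?S ^^ j) `` on 3 s \<subseteq> ON t) \<and> ON t \<subseteq> ?S\<^sup>* `` on 3 s"
  have Pi: "?P m (set_reg i v t) = ?P m t" for m i v t by (simp add: ON_def)
  have round: "?P (Suc m) (sem ROUND t)" if P: "?P m t" and fr: "reg t 0 = reg s 0" "reg t 1 = reg s 1" "reg t 6 = reg s 6"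
    and a: "arr t 0 = arr s 0" "arr t 2 = arr s 2" for m t
  proof -
    have U: "UU t = UU s" by (simp add: alive_def fr a)
    have o: "on 3 t = ON t" by (simp add: on_def ON_def fr)
    have o': "on 3 (sem ROUND t) = ON (sem ROUND t)" by (simp add: on_def ON_def fr sem_frame chk_frames)
    have sub: "ON t \<subseteq> UU s" using P UU_step[OF assms] by blast
    note R = ROUND_spec[of t, unfolded U o o', unfolded fr a]
    have up: "ON (sem ROUND t) \<subseteq> ?S\<^sup>* `` on 3 s"
    proof
      fix x assume "x \<in> ON (sem ROUND t)"
      then obtain y where y: "y \<in> ON t" "(y, x) \<in> ?S\<^sup>*" using R(3)[OF sub] by blast
      then obtain z where "z \<in> on 3 s" "(z, y) \<in> ?S\<^sup>*" using P by blast
      then show "x \<in> ?S\<^sup>* `` on 3 s" using y rtrancl_trans[of z y ?S x] by blast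
    qed
    have "(?S ^^ j) `` on 3 s \<subseteq> ON (sem ROUND t)" if "j \<le> Suc m" for j
    proof (cases "j \<le> m")
      case True
      then have "(?S ^^ j) `` on 3 s \<subseteq> ON t" using P by blast
      then show ?thesis using R(1) by (rule subset_trans)
    next
      case False
      then have j: "j = Suc m" using that by simp
      have "(?S ^^ m) `` on 3 s \<subseteq> ON t" using P by blast
      then have "?S `` ((?S ^^ m) `` on 3 s) \<subseteq> ON (sem ROUND t)" using R(2) sub by blast
      then show ?thesis by (simp add: j relcomp_Image)
    qed
    then show ?thesis using up by blast
  qed
  let ?f = "CFor 14 15 0 ROUND"
  have "?P (?R * ?R) (sem CLOS s)"
    unfolding CLOS_def
  proof (rule for_rule[where P = "\<lambda>k t. ?P (k * ?R) t"])
    fix k and t :: state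
    assume k: "k < ?R" and P: "?P (k * ?R) t"
      and fr: "\<And>x. x \<notin> wr ?f \<Longrightarrow> x \<noteq> 12 \<Longrightarrow> x \<noteq> 13 \<Longrightarrow> reg t x = reg s x"
      and af: "\<And>a. a \<notin> aw ?f \<Longrightarrow> arr t a = arr s a"
    have r: "reg t 0 = reg s 0" "reg t 1 = reg s 1" "reg t 6 = reg s 6"
      using fr[of 0] fr[of 1] fr[of 6] by (simp_all add: chk_frames)
    have a: "arr t 0 = arr s 0" "arr t 2 = arr s 2" using af[of 0] af[of 2] by (simp_all add: chk_frames)
    have "?P (k * ?R + reg t 0) (sem ?f t)"
    proof (rule for_rule[where P = "\<lambda>i q. ?P (k * ?R + i) q"])
      fix i and q :: state
      assume P: "?P (k * ?R + i) q"
        and fr: "\<And>x. x \<notin> wr ROUND \<Longrightarrow> x \<noteq> 14 \<Longrightarrow> x \<noteq> 15 \<Longrightarrow> reg q x = reg t x"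
        and af: "\<And>a. a \<notin> aw ROUND \<Longrightarrow> arr q a = arr t a"
      show "?P (k * ?R + Suc i) (sem ROUND q)"
        using round[OF P] fr[of 0] fr[of 1] fr[of 6] af[of 0] af[of 2] r a by (simp add: chk_frames)
    qed (use P Pi in \<open>simp_all add: chk_frames\<close>)
    then show "?P (Suc k * ?R) (sem ?f t)" by (simp add: r add.commute)
  next
    show "?P (0 * ?R) s" by (auto simp: ON_def on_def)
  qed (use Pi in \<open>simp_all add: chk_frames\<close>)
  then have P: "?P (?R * ?R) (sem CLOS s)" .
  have o: "on 3 (sem CLOS s) = ON (sem CLOS s)" by (simp add: on_def ON_def sem_frame chk_frames)
  have "?S\<^sup>* `` on 3 s \<subseteq> ON (sem CLOS s)"
  proof
    fix x assume "x \<in> ?S\<^sup>* `` on 3 s"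
    then obtain y where y: "y \<in> on 3 s" "(y, x) \<in> ?S\<^sup>*" by blast
    have sub: "?S \<subseteq> {..<?R} \<times> {..<?R}" by (auto simp: step_def alive_def)
    have fin: "finite ?S" by (rule finite_subset[OF sub]) simp
    have "card ?S \<le> ?R * ?R" using card_mono[OF _ sub] by (simp add: card_cartesian_product)
    moreover obtain j where "j \<le> card ?S" "(y, x) \<in> ?S ^^ j"
      using y(2) rtrancl_finite_eq_relpow[OF fin] by auto
    ultimately have "j \<le> ?R * ?R" "x \<in> (?S ^^ j) `` on 3 s" using y(1) by auto
    then show "x \<in> ON (sem CLOS s)" using P by blast
  qed
  then show ?thesis using P o by blast
qed

text \<open>After the search exactly those rows are marked that can serve as \<open>w\<close> in a
  detour, up to the meeting with \<open>t\<close>.\<close>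

lemma body_spec:
  assumes "reg s 6 < reg s 0" "reg s 8 < reg s 0"
  shows "reg (sem (CSeq INIT (CSeq CLOS TEST)) s) 57 =
    (if EE s (reg s 6) (reg s 4) \<and> (\<exists>t. detour (EE s) (alive 2 s) (VV s) (reg s 6) (reg s 8) t) then 1 else reg s 57)"
proof -
  let ?S = "step (EE s) (VV s) (UU s)"
  define s1 where "s1 = sem INIT s"
  define s2 where "s2 = sem CLOS s1"
  have fr: "reg s2 0 = reg s 0" "reg s2 1 = reg s 1" "reg s2 4 = reg s 4" "reg s2 6 = reg s 6" "reg s2 8 = reg s 8"
    "reg s2 57 = reg s 57"
    and fr1: "reg s1 0 = reg s 0" "reg s1 1 = reg s 1" "reg s1 6 = reg s 6"
    by (simp_all add: s2_def s1_def sem_frame chk_frames)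
  have a: "arr s2 0 = arr s 0" "arr s2 2 = arr s 2" "arr s1 0 = arr s 0" "arr s1 2 = arr s 2"
    by (simp_all add: s2_def s1_def sem_aframe chk_frames)
  have U: "UU s1 = UU s" by (simp add: alive_def fr1 a)
  have o1: "on 3 s1 = {u \<in> UU s. meets (EE s) (VV s) (reg s 8) u}" unfolding s1_def by (rule INIT_spec)
  have "on 3 s2 = (step (EE s1) (VV s1) (UU s1))\<^sup>* `` on 3 s1"
    unfolding s2_def by (rule CLOS_spec) (use o1 U in auto)
  then have o2: "on 3 s2 = ?S\<^sup>* `` {u \<in> UU s. meets (EE s) (VV s) (reg s 8) u}" unfolding U o1 unfolding fr1 a .
  have on2: "u < reg s 0 \<and> arr s2 3 u \<noteq> 0 \<longleftrightarrow> u \<in> on 3 s2" for u by (simp add: on_def fr)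
  have "f_test (reg s2) (arr s2) \<longleftrightarrow> EE s (reg s 6) (reg s 4) \<and> (\<exists>t. detour (EE s) (alive 2 s) (VV s) (reg s 6) (reg s 8) t)"
    (is "?L \<longleftrightarrow> ?Q")
  proof
    assume ?L
    then obtain t u where tu: "reg s 6 \<in> alive 2 s" "reg s 8 \<in> alive 2 s" "EE s (reg s 6) (reg s 4)"
      "meets (EE s) (VV s) (reg s 8) (reg s 6)" "t \<in> alive 2 s" "meets (EE s) (VV s) t (reg s 6)"
      "\<not> meets (EE s) (VV s) (reg s 8) t" "u < reg s 0" "arr s2 3 u \<noteq> 0" "meets (EE s) (VV s) u t"
      using assms by (auto simp: f_test_def fr a alive_def)
    then obtain u0 where u0: "u0 \<in> UU s" "meets (EE s) (VV s) (reg s 8) u0" "(u0, u) \<in> ?S\<^sup>*" using on2[of u] o2 by auto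
    have "detour (EE s) (alive 2 s) (VV s) (reg s 6) (reg s 8) t"
      unfolding detour_def using tu(1-7) u0 meet_sym[of "EE s" "VV s" t u] tu(10)
      by (intro conjI exI[of _ u0] exI[of _ u]) auto
    then show ?Q using tu(3) by blast
  next
    assume ?Q
    then obtain t u w where w: "EE s (reg s 6) (reg s 4)" "reg s 6 \<in> alive 2 s" "reg s 8 \<in> alive 2 s" "t \<in> alive 2 s"
      "meets (EE s) (VV s) (reg s 8) (reg s 6)" "meets (EE s) (VV s) t (reg s 6)" "\<not> meets (EE s) (VV s) (reg s 8) t"
      "u \<in> alive 2 s" "\<not> meets (EE s) (VV s) u (reg s 6)" "meets (EE s) (VV s) (reg s 8) u" "meets (EE s) (VV s) w t"
      "(u, w) \<in> ?S\<^sup>*"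
      using meet_sym[of "EE s" "VV s"] unfolding detour_def by blast
    have "w \<in> on 3 s2" unfolding o2 using w(8-10,12) by blast
    then have "w < reg s 0 \<and> arr s2 3 w \<noteq> 0" using on2 by blast
    then show ?L using w unfolding f_test_def fr a by (auto simp: alive_def)
  qed
  then show ?thesis by (auto simp add: TEST_def s1_def[symmetric] s2_def[symmetric] fr)
qed

lemma CHK_spec: "reg (sem CHK s) 57 = of_bool (on_hole (EE s) (alive 2 s) (VV s) (reg s 4))"
proof -
  let ?b = "CSeq INIT (CSeq CLOS TEST)"
  let ?in = "CFor 8 9 0 ?b"
  let ?H = "\<lambda>p q. EE s p (reg s 4) \<and> (\<exists>t. detour (EE s) (alive 2 s) (VV s) p q t)"
  define s0 where "s0 = set_reg 57 0 s"
  have s0: "reg s0 0 = reg s 0" "reg s0 1 = reg s 1" "reg s0 4 = reg s 4" "arr s0 = arr s" "reg s0 57 = 0" by (simp_all add: s0_def)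
  have "reg (sem (CFor 6 7 0 ?in) s0) 57 = of_bool (\<exists>p<reg s0 0. \<exists>q<reg s 0. ?H p q)"
  proof (rule for_rule[where P = "\<lambda>k t. reg t 57 = of_bool (\<exists>p<k. \<exists>q<reg s 0. ?H p q)"])
    fix k and t :: state
    assume k: "k < reg s0 0" and P: "reg t 57 = of_bool (\<exists>p<k. \<exists>q<reg s 0. ?H p q)" and ti: "reg t 6 = k"
      and fr: "\<And>x. x \<notin> wr ?in \<Longrightarrow> x \<noteq> 6 \<Longrightarrow> x \<noteq> 7 \<Longrightarrow> reg t x = reg s0 x"
      and af: "\<And>a. a \<notin> aw ?in \<Longrightarrow> arr t a = arr s0 a"
    have r: "reg t 0 = reg s 0" "reg t 1 = reg s 1" "reg t 4 = reg s 4"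
      using fr[of 0] fr[of 1] fr[of 4] by (simp_all add: chk_frames s0)
    have a: "arr t 0 = arr s 0" "arr t 2 = arr s 2" using af[of 0] af[of 2] by (simp_all add: chk_frames s0)
    have "reg (sem ?in t) 57 = of_bool ((\<exists>p<k. \<exists>q<reg s 0. ?H p q) \<or> (\<exists>q<reg t 0. ?H k q))"
    proof (rule for_rule[where P = "\<lambda>i q. reg q 57 = of_bool ((\<exists>p<k. \<exists>q<reg s 0. ?H p q) \<or> (\<exists>q<i. ?H k q))"])
      fix i and q :: state
      assume i: "i < reg t 0" and P: "reg q 57 = of_bool ((\<exists>p<k. \<exists>q<reg s 0. ?H p q) \<or> (\<exists>q<i. ?H k q))" and qi: "reg q 8 = i"
        and fr': "\<And>x. x \<notin> wr ?b \<Longrightarrow> x \<noteq> 8 \<Longrightarrow> x \<noteq> 9 \<Longrightarrow> reg q x = reg t x"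
        and af': "\<And>a. a \<notin> aw ?b \<Longrightarrow> arr q a = arr t a"
      have r': "reg q 0 = reg s 0" "reg q 1 = reg s 1" "reg q 4 = reg s 4" "reg q 6 = k"
        using fr'[of 0] fr'[of 1] fr'[of 4] fr'[of 6] ti r by (simp_all add: chk_frames)
      have a': "arr q 0 = arr s 0" "arr q 2 = arr s 2" using af'[of 0] af'[of 2] a by (simp_all add: chk_frames)
      have al: "alive 2 q = alive 2 s" by (simp add: alive_def r' a')
      have "reg (sem ?b q) 57 = (if ?H k i then 1 else reg q 57)"
        using body_spec[of q] i k r s0 unfolding r' a' al qi by simp
      then show "reg (sem ?b q) 57 = of_bool ((\<exists>p<k. \<exists>q<reg s 0. ?H p q) \<or> (\<exists>q<Suc i. ?H k q))"
        unfolding P less_Suc_eq by auto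
    qed (use P in \<open>simp_all add: chk_frames\<close>)
    then show "reg (sem ?in t) 57 = of_bool (\<exists>p<Suc k. \<exists>q<reg s 0. ?H p q)"
      unfolding r less_Suc_eq by auto
  qed (simp_all add: chk_frames s0)
  moreover have "(\<exists>p<reg s 0. \<exists>q<reg s 0. ?H p q) \<longleftrightarrow> on_hole (EE s) (alive 2 s) (VV s) (reg s 4)"
  proof -
    have "p < reg s 0 \<and> q < reg s 0" if "detour (EE s) (alive 2 s) (VV s) p q t" for p q t
      using that by (simp add: detour_def alive_def)
    then show ?thesis unfolding on_hole_detour by blast
  qed
  ultimately show ?thesis by (simp add: CHK_def s0_def[symmetric] s0)
qed

section \<open>Greedy cutting\<close>

definition f_cut where
  "f_cut e A \<longleftrightarrow> A 1 (e 46) = 0 \<and> EM (A 0) (e 1) (e 46) (e 20) \<and> EM (A 0) (e 1) (e 46) (e 22)"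

definition f_del where
  "f_del e A \<longleftrightarrow> A 1 (e 46) = 0 \<and> EM (A 0) (e 1) (e 46) (e 24) \<and> EM (A 0) (e 1) (e 46) (e 26)"

lemma cp_f_cut [simp]: "cp 60 f_cut" "cp 60 f_del"
  unfolding f_cut_def[abs_def] f_del_def[abs_def] by (intro cp_and cp_arr0 cp_EM; simp)+

definition COPYB where "COPYB = CSeq (CLoad 19 1 46) (CStore 2 46 19)"
definition COPY where "COPY = CFor 46 55 0 COPYB"
text \<open>Register 43 counts the rows of the candidate cut, while 45 is decremented from the best
  size so far. As decrement is truncated, 45 ends nonzero exactly if the candidate is
  smaller.\<close>

definition CANDB where "CANDB = CSeq COPYB (IFF f_cut (CSeq (SET 2 46) (CSeq (CInc 43) (CDec 45))) CSkip)"
definition CAND where "CAND = CSeq (CConst 43 0) (CSeq (CMove 45 41) (CFor 46 55 0 CANDB))"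
definition PICK where "PICK = CSeq CAND (CSeq CHK
  (CIf 57 CSkip (CIf 45 (CSeq (CMove 41 43) (CSeq (CMove 24 20) (CMove 26 22))) CSkip)))"
text \<open>The best size starts at one more than the number of rows, which serves as
  infinity.\<close>

definition CSRCH where "CSRCH = CSeq (CMove 41 0) (CSeq (CInc 41) (CFor 20 21 1 (CFor 22 23 1 PICK)))"
text \<open>A deletion without remaining budget raises the flag 49; a truncated decrement would hide
  it.\<close>

definition APPLYB where "APPLYB = IFF f_del (CSeq (SET 1 46) (CIf 47 (CDec 47) (CConst 49 1))) CSkip"
definition APPLY where "APPLY = CFor 46 55 0 APPLYB"
definition VSTEP where "VSTEP = CSeq COPY (CSeq CHK (CIf 57 (CSeq CSRCH APPLY) CSkip))"
definition LEAF where "LEAF = CFor 4 5 1 VSTEP"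

lemma leaf_frames:
  "aw COPYB = {2}" "aw COPY = {2}" "aw CANDB = {2}" "aw CAND = {2}" "aw PICK = {2, 3}" "aw CSRCH = {2, 3}"
  "aw APPLYB = {1}" "aw APPLY = {1}" "aw VSTEP = {1, 2, 3}" "aw LEAF = {1, 2, 3}"
  "ok COPYB" "ok COPY" "ok CANDB" "ok CAND" "ok PICK" "ok CSRCH" "ok APPLYB" "ok APPLY" "ok VSTEP" "ok LEAF"
  "x < 60 \<Longrightarrow> x \<noteq> 3 \<Longrightarrow> x \<in> wr COPYB \<longleftrightarrow> x = 19"
  "x < 60 \<Longrightarrow> x \<noteq> 3 \<Longrightarrow> x \<in> wr COPY \<longleftrightarrow> x \<in> {19, 46, 55}"
  "x < 60 \<Longrightarrow> x \<noteq> 3 \<Longrightarrow> x \<in> wr CANDB \<longleftrightarrow> x \<in> {19, 43, 45, 59}"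
  "x < 60 \<Longrightarrow> x \<noteq> 3 \<Longrightarrow> x \<in> wr CAND \<longleftrightarrow> x \<in> {19, 43, 45, 46, 55, 59}"
  "x < 60 \<Longrightarrow> x \<noteq> 3 \<Longrightarrow> x \<in> wr PICK \<longleftrightarrow> x \<in> {6, 7, 8, 9, 10, 11, 12, 13, 14, 15, 16, 17, 19, 24, 26, 41, 43, 45, 46, 55, 57, 59}"
  "x < 60 \<Longrightarrow> x \<noteq> 3 \<Longrightarrow> x \<in> wr CSRCH \<longleftrightarrow>
     x \<in> {6, 7, 8, 9, 10, 11, 12, 13, 14, 15, 16, 17, 19, 20, 21, 22, 23, 24, 26, 41, 43, 45, 46, 55, 57, 59}"
  "x < 60 \<Longrightarrow> x \<noteq> 3 \<Longrightarrow> x \<in> wr APPLYB \<longleftrightarrow> x \<in> {47, 49, 59}"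
  "x < 60 \<Longrightarrow> x \<noteq> 3 \<Longrightarrow> x \<in> wr APPLY \<longleftrightarrow> x \<in> {46, 47, 49, 55, 59}"
  "x < 60 \<Longrightarrow> x \<noteq> 3 \<Longrightarrow> x \<in> wr VSTEP \<longleftrightarrow>
     x \<in> {6, 7, 8, 9, 10, 11, 12, 13, 14, 15, 16, 17, 19, 20, 21, 22, 23, 24, 26, 41, 43, 45, 46, 47, 49, 55, 57, 59}"
  "x < 60 \<Longrightarrow> x \<noteq> 3 \<Longrightarrow> x \<in> wr LEAF \<longleftrightarrow>
     x \<in> {4, 5, 6, 7, 8, 9, 10, 11, 12, 13, 14, 15, 16, 17, 19, 20, 21, 22, 23, 24, 26, 41, 43, 45, 46, 47, 49, 55, 57, 59}"
  unfolding LEAF_def VSTEP_def CSRCH_def PICK_def CAND_def APPLY_def COPY_def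
  by (auto simp: COPYB_def CANDB_def APPLYB_def bnd_def chk_frames)

lemma COPY_spec: "alive 2 (sem COPY s) = alive 1 s"
proof -
  have "\<forall>r<reg s 0. arr (sem COPY s) 2 r = arr s 1 r"
    unfolding COPY_def
  proof (rule for_rule[where P = "\<lambda>k t. \<forall>r<k. arr t 2 r = arr s 1 r"])
    fix k and t :: state
    assume P: "\<forall>r<k. arr t 2 r = arr s 1 r" and ti: "reg t 46 = k"
      and af: "\<And>a. a \<notin> aw COPYB \<Longrightarrow> arr t a = arr s a"
    have "arr t 1 = arr s 1" using af[of 1] by (simp add: leaf_frames)
    then show "\<forall>r<Suc k. arr (sem COPYB t) 2 r = arr s 1 r" using P ti by (simp add: COPYB_def less_Suc_eq)
  qed (simp_all add: leaf_frames)
  then show ?thesis by (auto simp: alive_def sem_frame leaf_frames)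
qed

lemma CAND_spec:
  defines "K \<equiv> \<lambda>s. cut (EE s) (alive 1 s) (reg s 20) (reg s 22)"
  shows "alive 2 (sem CAND s) = alive 1 s - K s"
    and "reg (sem CAND s) 43 = card (K s)"
    and "reg (sem CAND s) 45 = reg s 41 - card (K s)"
proof -
  define s0 where "s0 = set_reg 45 (reg s 41) (set_reg 43 0 s)"
  let ?Q = "\<lambda>r. arr s 1 r = 0 \<and> EE s r (reg s 20) \<and> EE s r (reg s 22)"
  let ?P = "\<lambda>k t. (\<forall>r<k. arr t 2 r = 0 \<longleftrightarrow> arr s 1 r = 0 \<and> \<not> ?Q r) \<and> reg t 43 = card {r. r < k \<and> ?Q r}
    \<and> reg t 45 = reg s 41 - card {r. r < k \<and> ?Q r}"
  have "?P (reg s0 0) (sem (CFor 46 55 0 CANDB) s0)"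
  proof (rule for_rule[where P = ?P])
    fix k and t :: state
    assume k: "k < reg s0 0" and P: "?P k t" and ti: "reg t 46 = k"
      and fr: "\<And>x. x \<notin> wr CANDB \<Longrightarrow> x \<noteq> 46 \<Longrightarrow> x \<noteq> 55 \<Longrightarrow> reg t x = reg s0 x"
      and af: "\<And>a. a \<notin> aw CANDB \<Longrightarrow> arr t a = arr s0 a"
    have r: "reg t 1 = reg s 1" "reg t 20 = reg s 20" "reg t 22 = reg s 22"
      using fr[of 1] fr[of 20] fr[of 22] by (simp_all add: leaf_frames s0_def)
    have a: "arr t 0 = arr s 0" "arr t 1 = arr s 1" using af[of 0] af[of 1] by (simp_all add: leaf_frames s0_def)
    have f: "f_cut (reg (sem COPYB t)) (arr (sem COPYB t)) \<longleftrightarrow> ?Q k"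
      by (simp add: f_cut_def COPYB_def r a ti)
    have n: "k \<notin> {r. r < k \<and> ?Q r}" "finite {r. r < k \<and> ?Q r}" by auto
    show "?P (Suc k) (sem CANDB t)"
    proof (cases "?Q k")
      case True
      then have e: "{r. r < Suc k \<and> ?Q r} = insert k {r. r < k \<and> ?Q r}" by (auto simp: less_Suc_eq)
      show ?thesis unfolding e using True P f n by (auto simp: CANDB_def COPYB_def ti a less_Suc_eq)
    next
      case False
      then have e: "{r. r < Suc k \<and> ?Q r} = {r. r < k \<and> ?Q r}" by (auto simp: less_Suc_eq)
      show ?thesis unfolding e using False P f by (auto simp: CANDB_def COPYB_def ti a less_Suc_eq)
    qed
  qed (simp_all add: leaf_frames s0_def)
  moreover have "{r. r < reg s 0 \<and> ?Q r} = K s" by (auto simp: K_def cut_def alive_def)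
  ultimately have P: "(\<forall>r<reg s 0. arr (sem CAND s) 2 r = 0 \<longleftrightarrow> arr s 1 r = 0 \<and> \<not> ?Q r)"
    "reg (sem CAND s) 43 = card (K s)" "reg (sem CAND s) 45 = reg s 41 - card (K s)"
    by (simp_all add: CAND_def s0_def)
  then show "alive 2 (sem CAND s) = alive 1 s - K s" "reg (sem CAND s) 43 = card (K s)"
    "reg (sem CAND s) 45 = reg s 41 - card (K s)"
    by (auto simp: alive_def K_def cut_def sem_frame leaf_frames)
qed

lemma finite_alive [simp]: "finite (alive a s)"
  by (simp add: alive_def)

lemma PICK_spec:
  defines "K \<equiv> \<lambda>s. cut (EE s) (alive 1 s) (reg s 20) (reg s 22)"
  shows "(reg (sem PICK s) 41, reg (sem PICK s) 24, reg (sem PICK s) 26) =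
    (if \<not> on_hole (EE s) (alive 1 s - K s) (VV s) (reg s 4) \<and> card (K s) < reg s 41
     then (card (K s), reg s 20, reg s 22) else (reg s 41, reg s 24, reg s 26))"
proof -
  define s1 where "s1 = sem CAND s"
  define s2 where "s2 = sem CHK s1"
  have "reg s2 57 = of_bool (on_hole (EE s1) (alive 2 s1) (VV s1) (reg s1 4))" unfolding s2_def by (rule CHK_spec)
  moreover have "EE s1 = EE s" "VV s1 = VV s" "reg s1 4 = reg s 4" "alive 2 s1 = alive 1 s - K s"
    unfolding s1_def K_def by (simp_all add: sem_frame sem_aframe leaf_frames CAND_spec)
  moreover have "reg s2 45 = reg s 41 - card (K s)" "reg s2 43 = card (K s)" "reg s2 41 = reg s 41"
      "reg s2 20 = reg s 20" "reg s2 22 = reg s 22" "reg s2 24 = reg s 24" "reg s2 26 = reg s 26"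
    unfolding s2_def s1_def K_def by (simp_all add: sem_frame chk_frames leaf_frames CAND_spec)
  ultimately show ?thesis by (auto simp: PICK_def s1_def[symmetric] s2_def[symmetric])
qed

lemma CSRCH_spec:
  assumes v: "reg s 4 < reg s 1"
  defines "K \<equiv> cut (EE s) (alive 1 s)"
  defines "val \<equiv> \<lambda>c d. \<not> on_hole (EE s) (alive 1 s - K c d) (VV s) (reg s 4)"
  defines "t \<equiv> sem CSRCH s"
  shows "val (reg t 24) (reg t 26)"
    and "c < reg s 1 \<Longrightarrow> d < reg s 1 \<Longrightarrow> val c d \<Longrightarrow> card (K (reg t 24) (reg t 26)) \<le> card (K c d)"
proof -
  let ?C = "reg s 1"
  define s0 where "s0 = set_reg 41 (Suc (reg s 0)) s"
  define I where "I = (\<lambda>(S :: (nat \<times> nat) set) (t :: state). (\<forall>c d. (c, d) \<in> S \<longrightarrow> val c d \<longrightarrow> reg t 41 \<le> card (K c d)) \<and>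
      (reg t 41 = Suc (reg s 0) \<or> val (reg t 24) (reg t 26) \<and> reg t 41 = card (K (reg t 24) (reg t 26))))"
  have Iset: "I S (set_reg x w t) = I S t" if "x \<noteq> 41" "x \<noteq> 24" "x \<noteq> 26" for S x w t using that by (simp add: I_def)
  have pick: "I (insert (c, d) S) (sem PICK t)"
    if "I S t" "reg t 20 = c" "reg t 22 = d" "reg t 4 = reg s 4" "reg t 1 = reg s 1" "reg t 0 = reg s 0" "arr t 0 = arr s 0" "arr t 1 = arr s 1" for S t c d
  proof -
    have a: "alive 1 t = alive 1 s" using that by (simp add: alive_def)
    have p: "(reg (sem PICK t) 41, reg (sem PICK t) 24, reg (sem PICK t) 26) =
      (if val c d \<and> card (K c d) < reg t 41 then (card (K c d), c, d) else (reg t 41, reg t 24, reg t 26))"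
      using PICK_spec[of t] unfolding a that(2-8) K_def val_def .
    have "reg (sem PICK t) 41 \<le> card (K c' d')" if "(c', d') \<in> S" "val c' d'" for c' d'
    proof (rule le_trans)
      show "reg (sem PICK t) 41 \<le> reg t 41" using p by (auto split: if_splits)
      show "reg t 41 \<le> card (K c' d')" using \<open>I S t\<close> that unfolding I_def by blast
    qed
    then show ?thesis using \<open>I S t\<close> p unfolding I_def by (auto split: if_splits)
  qed
  let ?in = "CFor 22 23 1 PICK"
  have "I ({..<reg s0 1} \<times> {..<?C}) (sem (CFor 20 21 1 ?in) s0)"
  proof (rule for_rule[where P = "\<lambda>k t. I ({..<k} \<times> {..<?C}) t"])
    fix k and t :: state
    assume k: "k < reg s0 1" and P: "I ({..<k} \<times> {..<?C}) t" and ti: "reg t 20 = k"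
      and fr: "\<And>x. x \<notin> wr ?in \<Longrightarrow> x \<noteq> 20 \<Longrightarrow> x \<noteq> 21 \<Longrightarrow> reg t x = reg s0 x"
      and af: "\<And>a. a \<notin> aw ?in \<Longrightarrow> arr t a = arr s0 a"
    have r: "reg t 0 = reg s 0" "reg t 1 = reg s 1" "reg t 4 = reg s 4"
      using fr[of 0] fr[of 1] fr[of 4] by (simp_all add: leaf_frames s0_def)
    have a: "arr t 0 = arr s 0" "arr t 1 = arr s 1" using af[of 0] af[of 1] by (simp_all add: leaf_frames s0_def)
    have "I ({..<k} \<times> {..<?C} \<union> {k} \<times> {..<reg t 1}) (sem ?in t)"
    proof (rule for_rule[where P = "\<lambda>i q. I ({..<k} \<times> {..<?C} \<union> {k} \<times> {..<i}) q"])
      fix i and q :: state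
      assume P: "I ({..<k} \<times> {..<?C} \<union> {k} \<times> {..<i}) q" and qi: "reg q 22 = i"
        and fr': "\<And>x. x \<notin> wr PICK \<Longrightarrow> x \<noteq> 22 \<Longrightarrow> x \<noteq> 23 \<Longrightarrow> reg q x = reg t x"
        and af': "\<And>a. a \<notin> aw PICK \<Longrightarrow> arr q a = arr t a"
      have "I (insert (k, i) ({..<k} \<times> {..<?C} \<union> {k} \<times> {..<i})) (sem PICK q)"
        by (rule pick[OF P]) (use fr'[of 0] fr'[of 1] fr'[of 4] fr'[of 20] af'[of 0] af'[of 1] r a ti qi in
          \<open>simp_all add: leaf_frames\<close>)
      moreover have "insert (k, i) ({..<k} \<times> {..<?C} \<union> {k} \<times> {..<i}) = {..<k} \<times> {..<?C} \<union> {k} \<times> {..<Suc i}" by auto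
      ultimately show "I ({..<k} \<times> {..<?C} \<union> {k} \<times> {..<Suc i}) (sem PICK q)" by simp
    qed (use P Iset in \<open>simp_all add: leaf_frames\<close>)
    moreover have "{..<k} \<times> {..<?C} \<union> {k} \<times> {..<reg t 1} = {..<Suc k} \<times> {..<?C}" unfolding r by auto
    ultimately show "I ({..<Suc k} \<times> {..<?C}) (sem ?in t)" by simp
  qed (use Iset in \<open>simp_all add: leaf_frames I_def s0_def\<close>)
  moreover have "sem (CFor 20 21 1 ?in) s0 = t" by (simp add: t_def CSRCH_def s0_def set_reg_def One_nat_def)
  ultimately have I: "I ({..<?C} \<times> {..<?C}) t" by (simp add: s0_def)
  have "\<not> EE s r (reg s 4)" if "r \<in> alive 1 s - K (reg s 4) (reg s 4)" for r using that by (auto simp: K_def cut_def)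
  \<comment> \<open>The pair \<open>v\<close>, \<open>v\<close> cuts all rows through
    \<open>v\<close>, so it always works and the search does not end with infinity.\<close>
  then have "val (reg s 4) (reg s 4)" unfolding val_def on_hole_detour detour_def by blast
  then have "reg t 41 \<le> card (K (reg s 4) (reg s 4))" using I v unfolding I_def by blast
  also have "\<dots> \<le> card {..<reg s 0}" by (intro card_mono) (auto simp: K_def cut_def alive_def)
  finally have "reg t 41 \<noteq> Suc (reg s 0)" by simp
  then show "val (reg t 24) (reg t 26)" and
    "c < reg s 1 \<Longrightarrow> d < reg s 1 \<Longrightarrow> val c d \<Longrightarrow> card (K (reg t 24) (reg t 26)) \<le> card (K c d)"
    using I unfolding I_def by auto
qed

lemma APPLY_spec:
  defines "K \<equiv> \<lambda>s. cut (EE s) (alive 1 s) (reg s 24) (reg s 26)"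
  shows "alive 1 (sem APPLY s) = alive 1 s - K s"
    and "reg (sem APPLY s) 47 = reg s 47 - card (K s)"
    and "reg (sem APPLY s) 49 = 0 \<longleftrightarrow> reg s 49 = 0 \<and> card (K s) \<le> reg s 47"
proof -
  let ?Q = "\<lambda>r. arr s 1 r = 0 \<and> EE s r (reg s 24) \<and> EE s r (reg s 26)"
  \<comment> \<open>The test reads the marks that the loop sets; row \<open>k\<close> is still
    untouched when round \<open>k\<close> comes to it.\<close>
  let ?P = "\<lambda>k t. (\<forall>r. arr t 1 r = 0 \<longleftrightarrow> arr s 1 r = 0 \<and> (k \<le> r \<or> \<not> ?Q r)) \<and> reg t 47 = reg s 47 - card {r. r < k \<and> ?Q r}
    \<and> (reg t 49 = 0 \<longleftrightarrow> reg s 49 = 0 \<and> card {r. r < k \<and> ?Q r} \<le> reg s 47)"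
  have "?P (reg s 0) (sem APPLY s)"
    unfolding APPLY_def
  proof (rule for_rule[where P = ?P])
    fix k and t :: state
    assume k: "k < reg s 0" and P: "?P k t" and ti: "reg t 46 = k"
      and fr: "\<And>x. x \<notin> wr APPLYB \<Longrightarrow> x \<noteq> 46 \<Longrightarrow> x \<noteq> 55 \<Longrightarrow> reg t x = reg s x"
      and af: "\<And>a. a \<notin> aw APPLYB \<Longrightarrow> arr t a = arr s a"
    have r: "reg t 1 = reg s 1" "reg t 24 = reg s 24" "reg t 26 = reg s 26"
      using fr[of 1] fr[of 24] fr[of 26] by (simp_all add: leaf_frames)
    have a: "arr t 0 = arr s 0" using af[of 0] by (simp_all add: leaf_frames)
    have f: "f_del (reg t) (arr t) \<longleftrightarrow> ?Q k" using P by (simp add: f_del_def r a ti)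
    have n: "k \<notin> {r. r < k \<and> ?Q r}" "finite {r. r < k \<and> ?Q r}" by auto
    show "?P (Suc k) (sem APPLYB t)"
    proof (cases "?Q k")
      case True
      then have e: "{r. r < Suc k \<and> ?Q r} = insert k {r. r < k \<and> ?Q r}" by (auto simp: less_Suc_eq)
      show ?thesis unfolding e using True P f n by (auto simp: APPLYB_def ti a)
    next
      case False
      then have e: "{r. r < Suc k \<and> ?Q r} = {r. r < k \<and> ?Q r}" by (auto simp: less_Suc_eq)
      have "Suc k \<le> r \<or> \<not> ?Q r \<longleftrightarrow> k \<le> r \<or> \<not> ?Q r" for r using False by (cases "r = k") auto
      moreover have "sem APPLYB t = sem (cf f_del) t" using f False by (simp add: APPLYB_def)
      ultimately show ?thesis unfolding e using P by (simp only: reg_cf arr_cf cp_f_cut) simp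
    qed
  qed (simp_all add: leaf_frames)
  moreover have "{r. r < reg s 0 \<and> ?Q r} = K s" by (auto simp: K_def cut_def alive_def)
  ultimately have P: "\<forall>r. arr (sem APPLY s) 1 r = 0 \<longleftrightarrow> arr s 1 r = 0 \<and> (reg s 0 \<le> r \<or> \<not> ?Q r)"
    "reg (sem APPLY s) 47 = reg s 47 - card (K s)"
    "reg (sem APPLY s) 49 = 0 \<longleftrightarrow> reg s 49 = 0 \<and> card (K s) \<le> reg s 47"
    by simp_all
  then show "alive 1 (sem APPLY s) = alive 1 s - K s" "reg (sem APPLY s) 47 = reg s 47 - card (K s)"
    "reg (sem APPLY s) 49 = 0 \<longleftrightarrow> reg s 49 = 0 \<and> card (K s) \<le> reg s 47"
    by (auto simp: alive_def K_def cut_def sem_frame leaf_frames)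
qed

lemma alive_eq: "arr s a = arr t a \<Longrightarrow> reg s 0 = reg t 0 \<Longrightarrow> alive a s = alive a t"
  by (simp add: alive_def)

text \<open>By \<open>greedy_cut\<close> a cut keeps the answer, and deletions create no holes, so
  columns already treated stay off all holes. In the end the empty set solves what is left, and only
  the flag for the budget decides.\<close>

lemma LEAF_spec:
  assumes L: "loc8 (EE s) (alive 1 s) (VV s)" and f: "reg s 49 = 0"
  shows "reg (sem LEAF s) 49 = 0 \<longleftrightarrow>
    (\<exists>X\<subseteq>alive 1 s. card X \<le> reg s 47 \<and> no_detour (EE s) (alive 1 s - X) (VV s))"
proof -
  let ?E = "EE s" and ?V = "VV s"
  define sol where "sol = (\<lambda>A b. \<exists>X\<subseteq>A. card X \<le> b \<and> no_detour ?E (A - X) ?V)"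
  let ?P = "\<lambda>k t. alive 1 t \<subseteq> alive 1 s \<and> (\<forall>v<k. \<not> on_hole ?E (alive 1 t) ?V v) \<and>
    (sol (alive 1 s) (reg s 47) \<longleftrightarrow> reg t 49 = 0 \<and> sol (alive 1 t) (reg t 47))"
  have "?P (reg s 1) (sem LEAF s)"
    unfolding LEAF_def
  proof (rule for_rule[where P = ?P])
    fix k and t :: state
    assume k: "k < reg s 1" and P: "?P k t" and ti: "reg t 4 = k"
      and fr: "\<And>x. x \<notin> wr VSTEP \<Longrightarrow> x \<noteq> 4 \<Longrightarrow> x \<noteq> 5 \<Longrightarrow> reg t x = reg s x"
      and af: "\<And>a. a \<notin> aw VSTEP \<Longrightarrow> arr t a = arr s a"
    have r: "reg t 0 = reg s 0" "reg t 1 = reg s 1" using fr[of 0] fr[of 1] by (simp_all add: leaf_frames)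
    have a: "arr t 0 = arr s 0" using af[of 0] by (simp add: leaf_frames)
    define s1 where "s1 = sem COPY t"
    define s2 where "s2 = sem CHK s1"
    have A2: "alive 1 s2 = alive 1 t"
      unfolding s2_def s1_def by (rule alive_eq) (simp_all add: sem_frame sem_aframe leaf_frames chk_frames)
    have fr2: "reg s2 0 = reg s 0" "reg s2 1 = reg s 1" "reg s2 4 = k" "reg s2 47 = reg t 47" "reg s2 49 = reg t 49" "arr s2 0 = arr s 0"
      unfolding s2_def s1_def by (simp_all add: sem_frame sem_aframe leaf_frames chk_frames r a ti)
    have b: "reg s2 57 = of_bool (on_hole ?E (alive 1 t) ?V k)"
    proof -
      have "EE s1 = ?E" "VV s1 = ?V" "reg s1 4 = k" "alive 2 s1 = alive 1 t"
        unfolding s1_def by (simp_all add: sem_frame sem_aframe leaf_frames COPY_spec r a ti)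
      then show ?thesis using CHK_spec[of s1] unfolding s2_def by simp
    qed
    show "?P (Suc k) (sem VSTEP t)"
    proof (cases "on_hole ?E (alive 1 t) ?V k")
      case False
      have e: "sem VSTEP t = s2" using b False by (simp add: VSTEP_def s1_def s2_def)
      show ?thesis unfolding e A2 fr2 using P False by (auto simp: less_Suc_eq)
    next
      case True
      define s3 where "s3 = sem CSRCH s2"
      have e: "sem VSTEP t = sem APPLY s3" using b True by (simp add: VSTEP_def s1_def s2_def s3_def)
      have A3: "alive 1 s3 = alive 1 t"
        using A2 alive_eq[of s3 1 s2] unfolding s3_def by (simp add: sem_frame sem_aframe leaf_frames)
      have fr3: "reg s3 1 = reg s 1" "reg s3 47 = reg t 47" "reg s3 49 = reg t 49" "arr s3 0 = arr s 0"
        unfolding s3_def by (simp_all add: sem_frame sem_aframe leaf_frames fr2)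
      define K where "K = cut ?E (alive 1 t) (reg s3 24) (reg s3 26)"
      have K: "\<not> on_hole ?E (alive 1 t - K) ?V k"
        "\<And>c d. c < reg s 1 \<Longrightarrow> d < reg s 1 \<Longrightarrow> \<not> on_hole ?E (alive 1 t - cut ?E (alive 1 t) c d) ?V k \<Longrightarrow>
          card K \<le> card (cut ?E (alive 1 t) c d)"
        using CSRCH_spec[of s2] k unfolding s3_def[symmetric] fr2 A2 K_def by simp_all
      note ap = APPLY_spec[of s3, unfolded fr3 A3, folded K_def]
      have LA: "loc8 ?E (alive 1 t) ?V" by (rule loc8_subset[OF L]) (use P in simp_all)
      have "sol (alive 1 t) (reg t 47) \<longleftrightarrow> card K \<le> reg t 47 \<and> sol (alive 1 t - K) (reg t 47 - card K)"
        unfolding sol_def by (rule greedy_cut[OF LA _ _ _ True K(1)]) (use k K(2) in \<open>auto simp: K_def cut_def\<close>)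
      moreover have "\<not> on_hole ?E (alive 1 t - K) ?V v" if "v < Suc k" for v
        using that P K(1) on_hole_mono[of ?E "alive 1 t - K" ?V v "alive 1 t"] by (auto simp: less_Suc_eq)
      ultimately show ?thesis unfolding e ap using P by auto
    qed
  qed (auto simp: leaf_frames alive_def f)
  then have P: "\<forall>v<reg s 1. \<not> on_hole ?E (alive 1 (sem LEAF s)) ?V v"
    "sol (alive 1 s) (reg s 47) \<longleftrightarrow> reg (sem LEAF s) 49 = 0 \<and> sol (alive 1 (sem LEAF s)) (reg (sem LEAF s) 47)"
    by blast+
  have "sol (alive 1 (sem LEAF s)) (reg (sem LEAF s) 47)"
    unfolding sol_def using P(1) by (intro exI[of _ "{}"]) (simp add: no_detour_on_hole)
  then show ?thesis using P(2) unfolding sol_def by simp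
qed

section \<open>Branching on small obstructions\<close>

lemma c1p_cong:
  assumes "\<And>r c. r \<in> R \<Longrightarrow> c \<in> V \<Longrightarrow> E r c = E' r c"
  shows "c1p E R V = c1p E' R V"
proof -
  have "cvx E R V lt = cvx E' R V lt" for lt using assms by (auto simp: cvx_def)
  then show ?thesis by (simp add: c1p_def)
qed

text \<open>Repeated columns of a selection are put next to each other.\<close>

lemma c1p_select:
  fixes J :: "nat set"
  assumes C: "c1p E R V" and \<rho>: "\<And>i. i \<in> I \<Longrightarrow> \<rho> i \<in> R" and \<kappa>: "\<And>j. j \<in> J \<Longrightarrow> \<kappa> j \<in> V"
  shows "c1p (\<lambda>i j. E (\<rho> i) (\<kappa> j)) I J"
proof -
  obtain lt where lt: "linord V lt" "cvx E R V lt" using C unfolding c1p_def by blast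
  let ?l = "\<lambda>j k. lt (\<kappa> j) (\<kappa> k) \<or> \<kappa> j = \<kappa> k \<and> j < k"
  have "linord J ?l"
    unfolding linord_def
  proof (intro conjI ballI impI)
    fix a assume "a \<in> J" then show "\<not> ?l a a" using linord_irrefl[OF lt(1) \<kappa>] by simp
  next
    fix a b c assume a: "a \<in> J" "b \<in> J" "c \<in> J" "?l a b" "?l b c"
    then show "?l a c" using linord_trans[OF lt(1) \<kappa>[OF a(1)] \<kappa>[OF a(2)] \<kappa>[OF a(3)]] by auto
  next
    fix a b assume a: "a \<in> J" "b \<in> J" "a \<noteq> b"
    then show "?l a b \<or> ?l b a" using linord_total[OF lt(1) \<kappa>[OF a(1)] \<kappa>[OF a(2)]] by (cases "\<kappa> a = \<kappa> b") auto
  qed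
  moreover have "cvx (\<lambda>i j. E (\<rho> i) (\<kappa> j)) I J ?l"
    unfolding cvx_def
  proof (intro ballI impI)
    fix i a b c assume a: "i \<in> I" "a \<in> J" "b \<in> J" "c \<in> J" "?l a b" "?l b c" "E (\<rho> i) (\<kappa> a)" "E (\<rho> i) (\<kappa> c)"
    then show "E (\<rho> i) (\<kappa> b)" using cvxD[OF lt(2) \<rho>[OF a(1)] \<kappa>[OF a(2)] \<kappa>[OF a(3)] \<kappa>[OF a(4)]] by auto
  qed
  ultimately show ?thesis unfolding c1p_def by blast
qed

definition sc1 :: "(nat \<Rightarrow> nat \<Rightarrow> bool) \<Rightarrow> nat set \<Rightarrow> nat \<Rightarrow> bool" where
  "sc1 E A C \<longleftrightarrow> c1p E A {..<C} \<and> c1p (\<lambda>c r. E r c) {..<C} A"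

definition ill8 :: "(nat \<Rightarrow> nat \<Rightarrow> bool) \<Rightarrow> bool" where
  "ill8 F \<longleftrightarrow> \<not> (c1p F {..<8} {..<8} \<and> c1p (\<lambda>j i. F i j) {..<8} {..<8})"

definition obs :: "(nat \<Rightarrow> nat \<Rightarrow> bool) \<Rightarrow> nat set \<Rightarrow> nat \<Rightarrow> nat list \<Rightarrow> bool" where
  "obs E A C vs \<longleftrightarrow> set vs \<subseteq> A \<and>
     (\<exists>ws. length ws = 8 \<and> (\<forall>w\<in>set ws. w < C) \<and> ill8 (\<lambda>i j. E (vs ! i) (ws ! j)))"

text \<open>This test on prefixes allows an obstruction to be found one row at a time.\<close>

definition ext :: "(nat \<Rightarrow> nat \<Rightarrow> bool) \<Rightarrow> nat set \<Rightarrow> nat \<Rightarrow> nat list \<Rightarrow> bool" where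
  "ext E A C p \<longleftrightarrow> (\<exists>vs. length vs = 8 - length p \<and> obs E A C (p @ vs))"

text \<open>The maximum is what a loop finds that keeps the last suitable row.\<close>

primrec obl :: "(nat \<Rightarrow> nat \<Rightarrow> bool) \<Rightarrow> nat set \<Rightarrow> nat \<Rightarrow> nat \<Rightarrow> nat list" where
  "obl E A C 0 = []"
| "obl E A C (Suc j) = obl E A C j @ [Max {v \<in> A. ext E A C (obl E A C j @ [v])}]"

lemma length_obl [simp]: "length (obl E A C j) = j"
  by (induction j) auto

lemma ext_Cons:
  assumes "length p < 8"
  shows "ext E A C p \<longleftrightarrow> (\<exists>v\<in>A. ext E A C (p @ [v]))"
proof
  assume "ext E A C p"
  then obtain vs where vs: "length vs = 8 - length p" "obs E A C (p @ vs)" unfolding ext_def by blast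
  then obtain v us where "vs = v # us" using assms by (cases vs) auto
  then show "\<exists>v\<in>A. ext E A C (p @ [v])" using vs assms unfolding ext_def obs_def
    by (intro bexI[of _ v] exI[of _ us]) auto
next
  assume "\<exists>v\<in>A. ext E A C (p @ [v])"
  then obtain v us where "length us = 8 - length (p @ [v])" "obs E A C ((p @ [v]) @ us)" unfolding ext_def by blast
  then show "ext E A C p" using assms unfolding ext_def by (intro exI[of _ "v # us"]) auto
qed

lemma obl_ext:
  assumes "ext E A C []" "finite A" "j \<le> 8"
  shows "ext E A C (obl E A C j)"
  using assms(3)
proof (induction j)
  case (Suc j)
  let ?S = "{v \<in> A. ext E A C (obl E A C j @ [v])}"
  have "?S \<noteq> {}" using Suc ext_Cons[of "obl E A C j" E A C] by auto
  moreover have "finite ?S" using assms(2) by simp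
  ultimately have "Max ?S \<in> ?S" by (rule Max_in[rotated])
  then show ?case by simp
qed (simp add: assms)

lemma obl_obs:
  assumes "ext E A C []" "finite A"
  shows "obs E A C (obl E A C 8)"
  using obl_ext[OF assms, of 8] by (simp add: ext_def)

text \<open>The property passes to selections by \<open>c1p_select\<close>. Hence every solution
  deletes one of the 8 rows, which makes the branching complete.\<close>

lemma obs_not_sc1:
  assumes "obs E A C vs" "length vs = 8" "set vs \<subseteq> B"
  shows "\<not> sc1 E B C"
proof
  assume sc: "sc1 E B C"
  obtain ws where ws: "length ws = 8" "\<forall>w\<in>set ws. w < C" "ill8 (\<lambda>i j. E (vs ! i) (ws ! j))"
    using assms(1) unfolding obs_def by blast
  have v: "vs ! i \<in> B" if "i \<in> {..<8}" for i using that assms(2,3) nth_mem[of i vs] by auto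
  have w: "ws ! j \<in> {..<C}" if "j \<in> {..<8}" for j using that ws nth_mem[of j ws] by auto
  have "c1p (\<lambda>i j. E (vs ! i) (ws ! j)) {..<8} {..<8}"
    by (rule c1p_select[of E B "{..<C}"]) (use sc v w in \<open>auto simp: sc1_def\<close>)
  moreover have "c1p (\<lambda>j i. E (vs ! i) (ws ! j)) {..<8} {..<8}"
    by (rule c1p_select[of "\<lambda>c r. E r c" "{..<C}" B]) (use sc v w in \<open>auto simp: sc1_def\<close>)
  ultimately show False using ws(3) by (simp add: ill8_def)
qed

lemma not_ext_loc8:
  assumes "\<not> ext E A C []"
  shows "loc8 E A {..<C}"
proof -
  have "\<not> ill8 (\<lambda>i j. E (\<rho> i) (\<kappa> j))" if \<rho>: "\<forall>i<8. \<rho> i \<in> A" and \<kappa>: "\<forall>j<8. \<kappa> j \<in> {..<C}" for \<rho> \<kappa>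
  proof
    assume i: "ill8 (\<lambda>i j. E (\<rho> i) (\<kappa> j))"
    define vs where "vs = map \<rho> [0..<8]"
    define ws where "ws = map \<kappa> [0..<8]"
    have n: "\<rho> i = vs ! i" "\<kappa> i = ws ! i" if "i < 8" for i using that by (simp_all add: vs_def ws_def)
    have "ill8 (\<lambda>i j. E (vs ! i) (ws ! j))"
      using i c1p_cong[of "{..<8}" "{..<8}" "\<lambda>i j. E (\<rho> i) (\<kappa> j)" "\<lambda>i j. E (vs ! i) (ws ! j)"]
        c1p_cong[of "{..<8}" "{..<8}" "\<lambda>j i. E (\<rho> i) (\<kappa> j)" "\<lambda>j i. E (vs ! i) (ws ! j)"] n
      by (simp add: ill8_def)
    then have "obs E A C vs" unfolding obs_def using \<rho> \<kappa> by (intro conjI exI[of _ ws]) (auto simp: vs_def ws_def)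
    then show False using assms by (auto simp: ext_def vs_def)
  qed
  then show ?thesis unfolding loc8_def ill8_def by blast
qed

definition sol :: "(nat \<Rightarrow> nat \<Rightarrow> bool) \<Rightarrow> nat \<Rightarrow> nat set \<Rightarrow> nat \<Rightarrow> bool" where
  "sol E C A b \<longleftrightarrow> (\<exists>X\<subseteq>A. card X \<le> b \<and> sc1 E (A - X) C)"

lemma sol_loc8:
  assumes "loc8 E A {..<C}" "finite A"
  shows "sol E C A b \<longleftrightarrow> (\<exists>X\<subseteq>A. card X \<le> b \<and> no_detour E (A - X) {..<C})"
proof -
  have "sc1 E (A - X) C \<longleftrightarrow> no_detour E (A - X) {..<C}" for X
    unfolding sc1_def
    using no_detour_sc1p[OF loc8_subset[OF assms(1), of "A - X"]] c1p_no_detour[of E "A - X" "{..<C}"] assms(2) by auto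
  then show ?thesis by (simp add: sol_def)
qed

text \<open>One path in the search tree: a digit names which of the 8 rows is deleted. Without an
  obstruction or without budget the digit is ignored, so a string may be longer than its
  path.\<close>

primrec run :: "(nat \<Rightarrow> nat \<Rightarrow> bool) \<Rightarrow> nat \<Rightarrow> nat list \<Rightarrow> nat set \<times> nat \<Rightarrow> nat set \<times> nat" where
  "run E C [] p = p"
| "run E C (x # xs) p = run E C xs
     (if ext E (fst p) C [] \<and> snd p \<noteq> 0 then (fst p - {obl E (fst p) C 8 ! x}, snd p - 1) else p)"

lemma run_append: "run E C (xs @ ys) p = run E C ys (run E C xs p)"
  by (induction xs arbitrary: p) auto

lemma run_done: "\<not> ext E (fst p) C [] \<Longrightarrow> run E C xs p = p"
  by (induction xs arbitrary: p) auto

lemma run_sound: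
  assumes "finite (fst p)" "\<forall>x\<in>set xs. x < 8" "sol E C (fst (run E C xs p)) (snd (run E C xs p))"
  shows "sol E C (fst p) (snd p)"
  using assms
proof (induction xs arbitrary: p)
  case (Cons x xs)
  let ?o = "obl E (fst p) C 8 ! x"
  show ?case
  proof (cases "ext E (fst p) C [] \<and> snd p \<noteq> 0")
    case True
    have "?o \<in> fst p" using obl_obs[of E "fst p" C] True Cons.prems nth_mem[of x "obl E (fst p) C 8"] by (auto simp: obs_def)
    moreover have "sol E C (fst p - {?o}) (snd p - 1)" using Cons.IH[of "(fst p - {?o}, snd p - 1)"] Cons.prems True by simp
    then obtain X where X: "X \<subseteq> fst p - {?o}" "card X \<le> snd p - 1" "sc1 E (fst p - {?o} - X) C" unfolding sol_def by blast
    moreover have "fst p - {?o} - X = fst p - insert ?o X" by auto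
    moreover have "card (insert ?o X) \<le> snd p" using X(1,2) True Cons.prems(1) finite_subset[OF X(1)] by (subst card_insert_disjoint) auto
    ultimately show ?thesis unfolding sol_def by (intro exI[of _ "insert ?o X"]) auto
  next
    case False
    then show ?thesis using Cons.IH[of p] Cons.prems by (simp only: run.simps if_False) simp
  qed
qed simp

text \<open>At each obstruction the digit points to a row that a given solution deletes. Once the
  budget is 0 the solution is empty, so no obstruction is left and \<open>b\<close> digits
  suffice.\<close>

lemma run_complete:
  assumes "finite A" "sol E C A b"
  shows "\<exists>xs. length xs = b \<and> (\<forall>x\<in>set xs. x < 8) \<and> \<not> ext E (fst (run E C xs (A, b))) C [] \<and>
    sol E C (fst (run E C xs (A, b))) (snd (run E C xs (A, b)))"
  using assms
proof (induction b arbitrary: A)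
  case 0
  then obtain X where X: "X \<subseteq> A" "card X \<le> 0" "sc1 E (A - X) C" unfolding sol_def by blast
  then have "X = {}" using 0 finite_subset by fastforce
  then have "sc1 E A C" using X by simp
  then have "\<not> ext E A C []" using obs_not_sc1[of E A C _ A] by (auto simp: ext_def) (auto simp: obs_def)
  then show ?case using 0 by simp
next
  case (Suc b)
  show ?case
  proof (cases "ext E A C []")
    case False
    then show ?thesis using Suc.prems run_done[of E "(A, Suc b)" C]
      by (intro exI[of _ "replicate (Suc b) 0"]) simp
  next
    case True
    obtain X where X: "X \<subseteq> A" "card X \<le> Suc b" "sc1 E (A - X) C" using Suc.prems unfolding sol_def by blast
    let ?os = "obl E A C 8"
    have o: "obs E A C ?os" by (rule obl_obs[OF True Suc.prems(1)])
    have "\<not> set ?os \<subseteq> A - X" using obs_not_sc1[OF o] X(3) by auto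
    then obtain x where x: "x < 8" "?os ! x \<in> X" using o by (auto simp: obs_def in_set_conv_nth)
    let ?A = "A - {?os ! x}"
    have "card (X - {?os ! x}) \<le> b" using x X finite_subset[OF X(1) Suc.prems(1)] by simp
    moreover have "?A - (X - {?os ! x}) = A - X" using x by auto
    ultimately have "sol E C ?A b" unfolding sol_def using X by (intro exI[of _ "X - {?os ! x}"]) auto
    then obtain xs where "length xs = b" "\<forall>x\<in>set xs. x < 8" "\<not> ext E (fst (run E C xs (?A, b))) C []"
      "sol E C (fst (run E C xs (?A, b))) (snd (run E C xs (?A, b)))" using Suc.IH[of ?A] Suc.prems by auto
    then show ?thesis using x True by (intro exI[of _ "x # xs"]) auto
  qed
qed

section \<open>Obstructions on the machine\<close>

definition obstructs where
  "obstructs e A vs \<longleftrightarrow> (\<forall>v\<in>set vs. A 1 v = 0) \<and> (\<exists>ws. length ws = 8 \<and> (\<forall>w\<in>set ws. w < e 1) \<and>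
     ill8 (\<lambda>i j. EM (A 0) (e 1) (vs ! i) (ws ! j)))"

definition f_pre where
  "f_pre j e A \<longleftrightarrow> (\<exists>vs. length vs = 8 - j \<and> (\<forall>v\<in>set vs. v < e 0) \<and>
     obstructs e A (map (\<lambda>i. e (28 + 2 * i)) [0..<j] @ vs))"

lemma ill8_cong: "(\<And>i j. i < 8 \<Longrightarrow> j < 8 \<Longrightarrow> F i j = G i j) \<Longrightarrow> ill8 F = ill8 G"
  using c1p_cong[of "{..<8}" "{..<8}" F G] c1p_cong[of "{..<8}" "{..<8}" "\<lambda>j i. F i j" "\<lambda>j i. G i j"]
  by (simp add: ill8_def)

text \<open>The 64 entries of the window are tested one by one; \<open>cp_list\<close> does the
  rest.\<close>

lemma cp_ill8:
  assumes k: "60 \<le> k" "even k" and \<rho>: "\<And>i. i < 8 \<Longrightarrow> bnd (\<rho> i) \<and> \<rho> i < k" and \<kappa>: "\<And>i. i < 8 \<Longrightarrow> bnd (\<kappa> i) \<and> \<kappa> i < k"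
  shows "cp k (\<lambda>e A. ill8 (\<lambda>i j. EM (A 0) (e 1) (e (\<rho> i)) (e (\<kappa> j))))"
proof -
  define fs where "fs = map (\<lambda>n (e :: nat \<Rightarrow> nat) A. EM (A (0 :: nat)) (e 1) (e (\<rho> (n div 8))) (e (\<kappa> (n mod 8)))) [0..<64]"
  have fs: "cp k f" if f0: "f \<in> set fs" for f
  proof -
    obtain n where n: "n \<in> {0..<64}" and f: "f = (\<lambda>e A. EM (A 0) (e 1) (e (\<rho> (n div 8))) (e (\<kappa> (n mod 8))))"
      using f0 unfolding fs_def set_map set_upt by (rule imageE)
    show ?thesis unfolding f by (rule cp_EM) (use k \<rho>[of "n div 8"] \<kappa>[of "n mod 8"] n in auto)
  qed
  have "cp k (\<lambda>e A. ill8 (\<lambda>i j. map (\<lambda>f. f e A) fs ! (8 * i + j)))"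
    by (rule cp_list[OF fs k])
  moreover have "ill8 (\<lambda>i j. map (\<lambda>f. f e A) fs ! (8 * i + j)) = ill8 (\<lambda>i j. EM (A 0) (e 1) (e (\<rho> i)) (e (\<kappa> j)))" for e A
    by (rule ill8_cong) (simp add: fs_def)
  ultimately show ?thesis by simp
qed

lemma cp_obstructs:
  assumes k: "60 \<le> k" "even k" and \<rho>: "\<And>i. i < 8 \<Longrightarrow> bnd (\<rho> i) \<and> \<rho> i < k"
  shows "cp k (\<lambda>e A. obstructs e A (map (\<lambda>i. e (\<rho> i)) [0..<8]))"
proof -
  have \<rho>': "\<rho> i < k \<and> \<rho> i \<noteq> 3 \<and> (\<rho> i < 60 \<or> even (\<rho> i))" if "i < 8" for i
    using \<rho>[OF that] by (auto simp: bnd_def)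
  define fs where "fs = map (\<lambda>i (e :: nat \<Rightarrow> nat) (A :: nat \<Rightarrow> nat \<Rightarrow> nat). A 1 (e (\<rho> i)) = 0) [0..<8]"
  have "cp k (\<lambda>e A. \<forall>b\<in>set (map (\<lambda>f. f e A) fs). b)"
  proof (rule cp_list[OF _ k])
    fix f assume "f \<in> set fs"
    then obtain i where "i < 8" "f = (\<lambda>e A. A 1 (e (\<rho> i)) = 0)" by (auto simp: fs_def)
    then show "cp k f" using cp_arr0[OF k, of "\<rho> i" 1] \<rho>'[of i] by simp
  qed
  moreover have "(\<forall>b\<in>set (map (\<lambda>f. f e A) fs). b) \<longleftrightarrow> (\<forall>v\<in>set (map (\<lambda>i. e (\<rho> i)) [0..<8]). A 1 v = 0)" for e A
    by (auto simp: fs_def)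
  ultimately have 1: "cp k (\<lambda>e A. \<forall>v\<in>set (map (\<lambda>i. e (\<rho> i)) [0..<8]). A 1 v = 0)" by simp
  have "cp k (\<lambda>e A. \<exists>ws. length ws = 8 \<and> (\<forall>w\<in>set ws. w < e 1) \<and> ill8 (\<lambda>i j. EM (A 0) (e 1) (map (\<lambda>i. e (\<rho> i)) [0..<8] ! i) (ws ! j)))"
  proof (rule cp_exlist[where \<Phi> = "\<lambda>e ws A. ill8 (\<lambda>i j. EM (A 0) (e 1) (map (\<lambda>i. e (\<rho> i)) [0..<8] ! i) (ws ! j))"])
    have "cp (k + 2 * 8) (\<lambda>e A. ill8 (\<lambda>i j. EM (A 0) (e 1) (e (\<rho> i)) (e (k + 2 * j))))"
      by (rule cp_ill8) (use k \<rho> in \<open>auto intro: trans_less_add1\<close>)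
    moreover have "ill8 (\<lambda>i j. EM (A 0) (e 1) (map (\<lambda>i. e (\<rho> i)) [0..<8] ! i) (map (\<lambda>i. e (k + 2 * i)) [0..<8] ! j)) =
      ill8 (\<lambda>i j. EM (A 0) (e 1) (e (\<rho> i)) (e (k + 2 * j)))" for e :: "nat \<Rightarrow> nat" and A :: "nat \<Rightarrow> nat \<Rightarrow> nat"
      by (rule ill8_cong) simp
    ultimately show "cp (k + 2 * 8) (\<lambda>e A. ill8 (\<lambda>i j. EM (A 0) (e 1) (map (\<lambda>i. e (\<rho> i)) [0..<8] ! i) (map (\<lambda>i. e (k + 2 * i)) [0..<8] ! j)))"
      by simp
  next
    fix e e' :: "nat \<Rightarrow> nat" and ws and A :: "nat \<Rightarrow> nat \<Rightarrow> nat"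
    assume "\<And>x. x < k \<Longrightarrow> e x = e' x"
    then have "e 1 = e' 1" "\<And>i. i < 8 \<Longrightarrow> e (\<rho> i) = e' (\<rho> i)" using k \<rho> by auto
    then show "ill8 (\<lambda>i j. EM (A 0) (e 1) (map (\<lambda>i. e (\<rho> i)) [0..<8] ! i) (ws ! j)) =
      ill8 (\<lambda>i j. EM (A 0) (e' 1) (map (\<lambda>i. e' (\<rho> i)) [0..<8] ! i) (ws ! j))"
      by (intro ill8_cong) simp
  qed (use k in auto)
  then show ?thesis unfolding obstructs_def by (rule cp_and[OF 1])
qed

lemma cp_f_pre [simp]: "j \<le> 8 \<Longrightarrow> cp 60 (f_pre j)"
  unfolding f_pre_def[abs_def]
proof (rule cp_exlist[where \<Phi> = "\<lambda>e vs A. obstructs e A (map (\<lambda>i. e (28 + 2 * i)) [0..<j] @ vs)"])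
  assume j: "j \<le> 8"
  define \<rho> where "\<rho> i = (if i < j then 28 + 2 * i else 60 + 2 * (i - j))" for i
  have "map (\<lambda>i. e (28 + 2 * i)) [0..<j] @ map (\<lambda>i. e (60 + 2 * i)) [0..<8 - j] = map (\<lambda>i. e (\<rho> i)) [0..<8]" for e :: "nat \<Rightarrow> nat"
    by (rule nth_equalityI) (use j in \<open>auto simp: \<rho>_def nth_append\<close>)
  moreover have "cp (60 + 2 * (8 - j)) (\<lambda>e A. obstructs e A (map (\<lambda>i. e (\<rho> i)) [0..<8]))"
    by (rule cp_obstructs) (use j in \<open>auto simp: \<rho>_def\<close>)
  ultimately show "cp (60 + 2 * (8 - j))
     (\<lambda>e A. obstructs e A (map (\<lambda>i. e (28 + 2 * i)) [0..<j] @ map (\<lambda>i. e (60 + 2 * i)) [0..<8 - j]))" by simp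
next
  assume j: "j \<le> 8"
  fix e e' :: "nat \<Rightarrow> nat" and vs and A :: "nat \<Rightarrow> nat \<Rightarrow> nat"
  assume a: "\<And>x. x < 60 \<Longrightarrow> e x = e' x"
  then have "map (\<lambda>i. e (28 + 2 * i)) [0..<j] = map (\<lambda>i. e' (28 + 2 * i)) [0..<j]" using j by auto
  then show "obstructs e A (map (\<lambda>i. e (28 + 2 * i)) [0..<j] @ vs) = obstructs e' A (map (\<lambda>i. e' (28 + 2 * i)) [0..<j] @ vs)"
    using a[of 1] by (simp only: obstructs_def)
qed auto

definition pre :: "nat \<Rightarrow> state \<Rightarrow> nat list" where
  "pre j s = map (\<lambda>i. reg s (28 + 2 * i)) [0..<j]"

abbreviation EXT :: "state \<Rightarrow> nat list \<Rightarrow> bool" where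
  "EXT s \<equiv> ext (EE s) (alive 1 s) (reg s 1)"

lemma f_pre_ext:
  assumes "\<forall>i<j. reg s (28 + 2 * i) < reg s 0"
  shows "f_pre j (reg s) (arr s) \<longleftrightarrow> EXT s (pre j s)"
proof -
  have "(\<forall>v\<in>set vs. v < reg s 0) \<and> obstructs (reg s) (arr s) (pre j s @ vs) \<longleftrightarrow> obs (EE s) (alive 1 s) (reg s 1) (pre j s @ vs)" for vs
    using assms unfolding obstructs_def obs_def by (auto simp: pre_def alive_def)
  then show ?thesis by (simp add: f_pre_def ext_def pre_def)
qed

text \<open>The loop index is the register in which the row will stand in the end, because the
  prefix test reads it there. Register 44 therefore keeps the last suitable value.\<close>

definition FIND where "FIND j = CSeq (CFor (28 + 2 * j) 53 0 (IFF (f_pre (Suc j)) (CMove 44 (28 + 2 * j)) CSkip)) (CMove (28 + 2 * j) 44)"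

primrec FINDS where
  "FINDS 0 = CSkip"
| "FINDS (Suc j) = CSeq (FINDS j) (FIND j)"

lemma find_frames:
  assumes "j < 8"
  shows "aw (FIND j) = {}" "ok (FIND j)" "x < 60 \<Longrightarrow> x \<noteq> 3 \<Longrightarrow> x \<in> wr (FIND j) \<longleftrightarrow> x \<in> {28 + 2 * j, 44, 53}"
proof -
  have c: "cp 60 (f_pre (Suc j))" using assms by simp
  have d: "28 + 2 * j \<noteq> 53" "28 + 2 * j < 44" using assms by presburger+
  show "aw (FIND j) = {}" using c by (simp add: FIND_def)
  show "x < 60 \<Longrightarrow> x \<noteq> 3 \<Longrightarrow> x \<in> wr (FIND j) \<longleftrightarrow> x \<in> {28 + 2 * j, 44, 53}" using c by (auto simp: FIND_def)
  show "ok (FIND j)" using c d assms by (simp add: FIND_def)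
qed

lemma finds_frames:
  assumes "n \<le> 8"
  shows "aw (FINDS n) = {}" "ok (FINDS n)" "x < 60 \<Longrightarrow> x \<noteq> 3 \<Longrightarrow> x \<in> wr (FINDS n) \<Longrightarrow> x \<in> {28, 30, 32, 34, 36, 38, 40, 42, 44, 53}"
proof -
  have *: "aw (FINDS n) = {} \<and> ok (FINDS n) \<and> (x < 60 \<longrightarrow> x \<noteq> 3 \<longrightarrow> x \<in> wr (FINDS n) \<longrightarrow> x \<in> {28, 30, 32, 34, 36, 38, 40, 42, 44, 53})"
    using assms
  proof (induction n)
    case (Suc n)
    then have n: "n \<in> {0, 1, 2, 3, 4, 5, 6, 7}" by auto
    then have "28 + 2 * n \<in> {28, 30, 32, 34, 36, 38, 40, 42}" by auto
    then show ?case using Suc find_frames(1,2)[of n] find_frames(3)[of n x] by auto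
  qed simp
  then show "aw (FINDS n) = {}" "ok (FINDS n)" "x < 60 \<Longrightarrow> x \<noteq> 3 \<Longrightarrow> x \<in> wr (FINDS n) \<Longrightarrow> x \<in> {28, 30, 32, 34, 36, 38, 40, 42, 44, 53}"
    by blast+
qed

lemma FIND_spec:
  assumes j: "j < 8" and lt: "\<forall>i<j. reg s (28 + 2 * i) < reg s 0"
  defines "S \<equiv> {v \<in> alive 1 s. EXT s (pre j s @ [v])}"
  assumes ne: "S \<noteq> {}"
  shows "reg (sem (FIND j) s) (28 + 2 * j) = Max S"
proof -
  let ?c = "IFF (f_pre (Suc j)) (CMove 44 (28 + 2 * j)) CSkip"
  have c: "cp 60 (f_pre (Suc j))" using j by simp
  have d: "28 + 2 * j \<noteq> 53" "28 + 2 * j < 44" using j by presburger+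
  let ?P = "\<lambda>k t. S \<inter> {..<k} \<noteq> {} \<longrightarrow> reg t 44 = Max (S \<inter> {..<k})"
  have "?P (reg s 0) (sem (CFor (28 + 2 * j) 53 0 ?c) s)"
  proof (rule for_rule[where P = ?P])
    fix k and t :: state
    assume k: "k < reg s 0" and P: "?P k t" and ti: "reg t (28 + 2 * j) = k"
      and fr: "\<And>x. x \<notin> wr ?c \<Longrightarrow> x \<noteq> 28 + 2 * j \<Longrightarrow> x \<noteq> 53 \<Longrightarrow> reg t x = reg s x"
      and af: "\<And>a. a \<notin> aw ?c \<Longrightarrow> arr t a = arr s a"
    have r: "reg t 0 = reg s 0" "reg t 1 = reg s 1" using fr[of 0] fr[of 1] c by simp_all
    have ri: "reg t (28 + 2 * i) = reg s (28 + 2 * i)" if "i < j" for i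
      using fr[of "28 + 2 * i"] that c j by (simp; presburger)
    have a: "arr t 0 = arr s 0" "arr t 1 = arr s 1" using af[of 0] af[of 1] c by simp_all
    have al: "alive 1 t = alive 1 s" by (simp add: alive_def r a)
    have p: "pre (Suc j) t = pre j s @ [k]" using ri ti by (auto simp: pre_def)
    have "f_pre (Suc j) (reg t) (arr t) \<longleftrightarrow> EXT s (pre j s @ [k])"
      using f_pre_ext[of "Suc j" t] lt ri ti k unfolding p al r a by (auto simp: less_Suc_eq)
    moreover have "k \<in> alive 1 s" if "EXT s (pre j s @ [k])"
      using that by (auto simp: ext_def obs_def)
    ultimately have f: "f_pre (Suc j) (reg t) (arr t) \<longleftrightarrow> k \<in> S" by (auto simp: S_def)
    show "?P (Suc k) (sem ?c t)"
    proof (cases "k \<in> S")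
      case True
      then have "S \<inter> {..<Suc k} = insert k (S \<inter> {..<k})" by (auto simp: less_Suc_eq)
      moreover have "Max (insert k (S \<inter> {..<k})) = k" by (rule Max_eqI) auto
      ultimately show ?thesis using True f c d ti by simp
    next
      case False
      then have "S \<inter> {..<Suc k} = S \<inter> {..<k}" by (auto simp: less_Suc_eq)
      then show ?thesis using False f c P by simp
    qed
  qed (use c d in auto)
  moreover have "S \<inter> {..<reg s 0} = S" by (auto simp: S_def alive_def)
  ultimately show ?thesis using ne by (simp add: FIND_def)
qed

lemma FINDS_spec:
  assumes "EXT s []" "n \<le> 8"
  shows "pre n (sem (FINDS n) s) = obl (EE s) (alive 1 s) (reg s 1) n"
  using assms(2)
proof (induction n)
  case (Suc n)
  define t where "t = sem (FINDS n) s"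
  let ?o = "obl (EE s) (alive 1 s) (reg s 1)"
  have r: "reg t 0 = reg s 0" "reg t 1 = reg s 1"
    unfolding t_def using finds_frames(3)[of n 0] finds_frames(3)[of n 1] Suc.prems by (auto intro!: sem_frame)
  have a: "arr t 0 = arr s 0" "arr t 1 = arr s 1" unfolding t_def using finds_frames(1)[of n] Suc.prems by (auto intro!: sem_aframe)
  have al: "alive 1 t = alive 1 s" by (simp add: alive_def r a)
  have p: "pre n t = ?o n" using Suc by (simp add: t_def)
  have e: "EXT s (?o n)" using obl_ext[OF assms(1)] Suc.prems by simp
  have sub: "set (?o n) \<subseteq> alive 1 s" using e by (auto simp: ext_def obs_def)
  have lt: "reg t (28 + 2 * i) < reg t 0" if "i < n" for i
  proof -
    have "?o n ! i \<in> alive 1 s" using sub that by auto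
    moreover have "?o n ! i = reg t (28 + 2 * i)" using that unfolding p[symmetric] pre_def by simp
    ultimately show ?thesis by (simp add: alive_def r)
  qed
  have ne: "{v \<in> alive 1 t. EXT t (pre n t @ [v])} \<noteq> {}"
    using ext_Cons[of "?o n" "EE s" "alive 1 s" "reg s 1"] e Suc.prems unfolding p al r a by auto
  have "reg (sem (FIND n) t) (28 + 2 * n) = Max {v \<in> alive 1 s. EXT s (?o n @ [v])}"
    using FIND_spec[of n t] lt ne Suc.prems unfolding p al r a by simp
  moreover have "reg (sem (FIND n) t) (28 + 2 * i) = reg t (28 + 2 * i)" if "i < n" for i
    by (rule sem_frame) (use that find_frames(3)[of n "28 + 2 * i"] Suc.prems in \<open>auto; presburger\<close>)
  ultimately have "pre (Suc n) (sem (FIND n) t) = pre n t @ [Max {v \<in> alive 1 s. EXT s (?o n @ [v])}]"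
    by (auto simp: pre_def)
  then show ?case using p by (simp add: t_def)
qed (simp add: pre_def)

text \<open>Registers cannot be addressed indirectly, so a chain of tests on the digit in 51 selects
  the register of the row to be deleted.\<close>

primrec CHN :: "nat \<Rightarrow> nat \<Rightarrow> com" where
  "CHN 0 i = SET 1 (28 + 2 * i)"
| "CHN (Suc n) i = CIf 51 (CSeq (CDec 51) (CHN n (Suc i))) (SET 1 (28 + 2 * i))"

lemma CHN_frames: "aw (CHN n i) = {1}" "i + n \<le> 7 \<Longrightarrow> ok (CHN n i)" "wr (CHN n i) \<subseteq> {51, 59}"
  by (induction n arbitrary: i) (auto simp: bnd_def)

lemma CHN_spec:
  "reg s 51 \<le> n \<Longrightarrow> i + n \<le> 7 \<Longrightarrow> arr (sem (CHN n i) s) 1 = (arr s 1)(reg s (28 + 2 * (i + reg s 51)) := 1)"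
proof (induction n arbitrary: i s)
  case 0
  have "28 + 2 * i \<noteq> 59" by presburger
  then show ?case using 0 by simp
next
  case (Suc n)
  have c: "28 + 2 * i \<noteq> 59" by presburger
  show ?case
  proof (cases "reg s 51")
    case 0
    then show ?thesis using c by simp
  next
    case (Suc m)
    have "28 + 2 * (Suc i + m) \<noteq> 51" by presburger
    then show ?thesis using Suc.IH[of "set_reg 51 m s" "Suc i"] Suc Suc.prems by simp
  qed
qed

definition SIMSTEP where "SIMSTEP = IFF (f_pre 0)
  (CIf 47 (CSeq (FINDS 8) (CSeq (CLoad 51 4 46) (CSeq (CHN 7 0) (CDec 47)))) CSkip) CSkip"
text \<open>The loop takes as many digits as there are rows, since the budget is in an odd register,
  which may not bound a loop.\<close>

definition SIM where "SIM = CFor 46 55 0 SIMSTEP"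
definition RESET where "RESET = CFor 46 55 0 (CLR 1 46)"
text \<open>Register 33 is only ever set to 1, so it accumulates the answer over all strings. A path
  that ends with an obstruction left contributes nothing.\<close>

definition TRY where "TRY = CSeq RESET (CSeq (CMove 47 37) (CSeq (CConst 49 0) (CSeq SIM
  (IFF (f_pre 0) CSkip (CSeq LEAF (CIf 49 CSkip (CConst 33 1)))))))"

lemma sim_frames:
  "aw SIMSTEP = {1}" "aw SIM = {1}" "aw RESET = {1}" "aw TRY = {1, 2, 3}"
  "ok SIMSTEP" "ok SIM" "ok RESET" "ok TRY"
  "x < 60 \<Longrightarrow> x \<noteq> 3 \<Longrightarrow> x \<in> wr SIMSTEP \<Longrightarrow> x \<in> {28, 30, 32, 34, 36, 38, 40, 42, 44, 47, 51, 53, 59}"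
  "x < 60 \<Longrightarrow> x \<noteq> 3 \<Longrightarrow> x \<in> wr SIM \<Longrightarrow> x \<in> {28, 30, 32, 34, 36, 38, 40, 42, 44, 46, 47, 51, 53, 55, 59}"
  "wr RESET = {46, 55, 59}"
  "x \<in> {0, 1, 35, 37, 39} \<Longrightarrow> x \<notin> wr TRY"
proof -
  have c: "cp 60 (f_pre 0)" by simp
  show s: "aw SIMSTEP = {1}" "ok SIMSTEP"
    using CHN_frames(1)[of 7 0] CHN_frames(2)[of 0 7] finds_frames[of 8] c by (simp_all add: SIMSTEP_def bnd_def)
  show w: "x < 60 \<Longrightarrow> x \<noteq> 3 \<Longrightarrow> x \<in> wr SIMSTEP \<Longrightarrow> x \<in> {28, 30, 32, 34, 36, 38, 40, 42, 44, 47, 51, 53, 59}" for x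
    using CHN_frames(3)[of 7 0] finds_frames(3)[of 8 x] c by (auto simp: SIMSTEP_def)
  show S: "aw SIM = {1}" "ok SIM" using s w[of 46] w[of 55] by (auto simp: SIM_def)
  show W: "x < 60 \<Longrightarrow> x \<noteq> 3 \<Longrightarrow> x \<in> wr SIM \<Longrightarrow> x \<in> {28, 30, 32, 34, 36, 38, 40, 42, 44, 46, 47, 51, 53, 55, 59}" for x
    using w[of x] by (auto simp: SIM_def)
  show R: "aw RESET = {1}" "ok RESET" "wr RESET = {46, 55, 59}" by (auto simp: RESET_def)
  show "aw TRY = {1, 2, 3}" "ok TRY" using S R c leaf_frames by (auto simp: TRY_def bnd_def)
  show "x \<in> {0, 1, 35, 37, 39} \<Longrightarrow> x \<notin> wr TRY"
    using W[of x] R(3) c leaf_frames(30)[of x] by (auto simp: TRY_def)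
qed

lemma SIMSTEP_spec:
  assumes "arr s 4 (reg s 46) < 8"
  shows "run (EE s) (reg s 1) [arr s 4 (reg s 46)] (alive 1 s, reg s 47) = (alive 1 (sem SIMSTEP s), reg (sem SIMSTEP s) 47)"
proof -
  have c: "cp 60 (f_pre 0)" by simp
  define s0 where "s0 = sem (cf (f_pre 0)) s"
  have s0: "reg s0 x = reg s x" if "x < 60" "x \<noteq> 3" for x unfolding s0_def using that c by simp
  have a0: "arr s0 = arr s" unfolding s0_def using c by simp
  have al0: "alive 1 s0 = alive 1 s" by (simp add: alive_def s0 a0)
  have f: "f_pre 0 (reg s) (arr s) \<longleftrightarrow> EXT s []" using f_pre_ext[of 0 s] by (simp add: pre_def)
  show ?thesis
  proof (cases "EXT s [] \<and> reg s 47 \<noteq> 0")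
    case True
    define s1 where "s1 = sem (FINDS 8) s0"
    have e: "sem SIMSTEP s = sem (CSeq (CLoad 51 4 46) (CSeq (CHN 7 0) (CDec 47))) s1"
      using True f c s0[of 47] by (simp add: SIMSTEP_def s0_def[symmetric] s1_def)
    have r1: "reg s1 x = reg s x" if "x \<in> {0, 1, 46, 47}" for x
      using that finds_frames(3)[of 8 x] s0[of x] unfolding s1_def by (subst sem_frame) auto
    have a1: "arr s1 = arr s" unfolding s1_def using finds_frames(1)[of 8] a0 by (intro ext) (simp add: sem_aframe)
    let ?x = "arr s 4 (reg s 46)"
    let ?o = "obl (EE s) (alive 1 s) (reg s 1) 8"
    have "pre 8 s1 = ?o" using FINDS_spec[of s0 8] True unfolding s1_def by (simp add: s0 a0 al0)
    then have o: "reg s1 (28 + 2 * ?x) = ?o ! ?x" using assms by (simp add: pre_def flip: \<open>pre 8 s1 = ?o\<close>)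
    define s2 where "s2 = set_reg 51 ?x s1"
    have "28 + 2 * ?x \<noteq> 51" by presburger
    then have A: "arr (sem (CHN 7 0) s2) 1 = (arr s 1)(?o ! ?x := 1)"
      using CHN_spec[of s2 7 0] assms o by (simp add: s2_def a1)
    have fr: "reg (sem (CHN 7 0) s2) x = reg s x" if "x \<in> {0, 47}" for x
      using that CHN_frames(3)[of 7 0] r1[of x] by (subst sem_frame) (auto simp: s2_def)
    have e2: "sem SIMSTEP s = set_reg 47 (reg s 47 - 1) (sem (CHN 7 0) s2)"
      unfolding e by (simp add: s2_def a1 r1 fr[unfolded s2_def])
    have "alive 1 (sem SIMSTEP s) = alive 1 s - {?o ! ?x}" unfolding e2 by (auto simp: alive_def A fr)
    moreover have "reg (sem SIMSTEP s) 47 = reg s 47 - 1" unfolding e2 by simp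
    ultimately show ?thesis using True by simp
  next
    case False
    then have "sem SIMSTEP s = s0" using f c s0[of 47] by (auto simp: SIMSTEP_def s0_def)
    then show ?thesis using False al0 s0[of 47] by auto
  qed
qed

lemma SIM_spec:
  assumes "\<forall>i<reg s 0. arr s 4 i < 8"
  shows "run (EE s) (reg s 1) (map (arr s 4) [0..<reg s 0]) (alive 1 s, reg s 47) = (alive 1 (sem SIM s), reg (sem SIM s) 47)"
  unfolding SIM_def
proof (rule for_rule[where P = "\<lambda>k t. run (EE s) (reg s 1) (map (arr s 4) [0..<k]) (alive 1 s, reg s 47) = (alive 1 t, reg t 47)"])
  fix k and t :: state
  assume k: "k < reg s 0" and P: "run (EE s) (reg s 1) (map (arr s 4) [0..<k]) (alive 1 s, reg s 47) = (alive 1 t, reg t 47)"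
    and ti: "reg t 46 = k"
    and fr: "\<And>x. x \<notin> wr SIMSTEP \<Longrightarrow> x \<noteq> 46 \<Longrightarrow> x \<noteq> 55 \<Longrightarrow> reg t x = reg s x"
    and af: "\<And>a. a \<notin> aw SIMSTEP \<Longrightarrow> arr t a = arr s a"
  have r: "reg t 1 = reg s 1" using fr[of 1] sim_frames(9)[of 1] by auto
  have a: "arr t 0 = arr s 0" "arr t 4 = arr s 4" using af[of 0] af[of 4] by (simp_all add: sim_frames)
  have "run (EE s) (reg s 1) (map (arr s 4) [0..<Suc k]) (alive 1 s, reg s 47) =
      run (EE s) (reg s 1) [arr s 4 k] (alive 1 t, reg t 47)"
    by (simp only: upt_Suc_append le0 map_append run_append P list.map)
  also have "\<dots> = (alive 1 (sem SIMSTEP t), reg (sem SIMSTEP t) 47)"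
    using SIMSTEP_spec[of t] assms k unfolding ti r a by simp
  finally show "run (EE s) (reg s 1) (map (arr s 4) [0..<Suc k]) (alive 1 s, reg s 47) = (alive 1 (sem SIMSTEP t), reg (sem SIMSTEP t) 47)" .
qed (use sim_frames(9)[of 46] sim_frames(9)[of 55] in \<open>auto simp: alive_def\<close>)

lemma RESET_spec: "alive 1 (sem RESET s) = {..<reg s 0}"
proof -
  have "\<forall>r<reg s 0. arr (sem RESET s) 1 r = 0"
    unfolding RESET_def by (rule for_rule[where P = "\<lambda>k t. \<forall>r<k. arr t 1 r = 0"]) (auto simp: less_Suc_eq)
  then show ?thesis by (auto simp: alive_def sem_frame sim_frames)
qed

definition good where
  "good E C R b xs \<longleftrightarrow> (let p = run E C xs ({..<R}, b) in \<not> ext E (fst p) C [] \<and> sol E C (fst p) (snd p))"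

lemma TRY_spec:
  assumes "\<forall>i<reg s 0. arr s 4 i < 8"
  shows "reg (sem TRY s) 33 = (if good (EE s) (reg s 1) (reg s 0) (reg s 37) (map (arr s 4) [0..<reg s 0]) then 1 else reg s 33)"
proof -
  have c: "cp 60 (f_pre 0)" by simp
  define s1 where "s1 = set_reg 49 0 (set_reg 47 (reg s 37) (sem RESET s))"
  define s2 where "s2 = sem SIM s1"
  define s3 where "s3 = sem (cf (f_pre 0)) s2"
  have r1: "reg s1 x = reg s x" if "x \<in> {0, 1, 33}" for x
    using that by (auto simp: s1_def sem_frame sim_frames)
  have v1: "reg s1 47 = reg s 37" "reg s1 49 = 0" "alive 1 s1 = {..<reg s 0}"
    using RESET_spec[of s] by (simp_all add: s1_def sem_frame sim_frames alive_def)
  have a1: "arr s1 0 = arr s 0" "arr s1 4 = arr s 4" by (simp_all add: s1_def sem_aframe sim_frames)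
  have r2: "reg s2 x = reg s1 x" if "x \<in> {0, 1, 33, 49}" for x
    using that sim_frames(10)[of x] unfolding s2_def by (intro sem_frame) auto
  have a2: "arr s2 0 = arr s 0" by (simp add: s2_def sem_aframe sim_frames a1)
  have S: "run (EE s) (reg s 1) (map (arr s 4) [0..<reg s 0]) ({..<reg s 0}, reg s 37) = (alive 1 s2, reg s2 47)"
    using SIM_spec[of s1] assms unfolding s2_def v1 by (simp add: r1 a1 v1)
  have r3: "reg s3 x = reg s2 x" if "x < 60" "x \<noteq> 3" for x unfolding s3_def using that c by simp
  have a3: "arr s3 = arr s2" unfolding s3_def using c by simp
  have al3: "alive 1 s3 = alive 1 s2" by (simp add: alive_def r3 a3)
  have f: "f_pre 0 (reg s2) (arr s2) \<longleftrightarrow> ext (EE s) (alive 1 s2) (reg s 1) []"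
    using f_pre_ext[of 0 s2] by (simp add: pre_def r2 r1 a2)
  have e: "sem TRY s = (if ext (EE s) (alive 1 s2) (reg s 1) [] then s3 else sem (CIf 49 CSkip (CConst 33 1)) (sem LEAF s3))"
    using c f by (simp add: TRY_def s1_def[symmetric] s2_def[symmetric] s3_def[symmetric] sem_frame sim_frames)
  show ?thesis
  proof (cases "ext (EE s) (alive 1 s2) (reg s 1) []")
    case True
    then show ?thesis unfolding e good_def S by (simp add: r3 r2 r1)
  next
    case False
    have L: "loc8 (EE s) (alive 1 s2) (VV s)" by (rule not_ext_loc8[OF False])
    have "reg (sem LEAF s3) 49 = 0 \<longleftrightarrow> (\<exists>X\<subseteq>alive 1 s2. card X \<le> reg s2 47 \<and> no_detour (EE s) (alive 1 s2 - X) (VV s))"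
      using LEAF_spec[of s3] L v1 by (simp add: r3 r2 r1 a3 a2 al3)
    also have "\<dots> \<longleftrightarrow> sol (EE s) (reg s 1) (alive 1 s2) (reg s2 47)" using sol_loc8[OF L] by simp
    finally have "reg (sem LEAF s3) 49 = 0 \<longleftrightarrow> sol (EE s) (reg s 1) (alive 1 s2) (reg s2 47)" .
    moreover have "reg (sem LEAF s3) 33 = reg s 33" by (simp add: sem_frame leaf_frames r3 r2 r1)
    ultimately show ?thesis using False unfolding e good_def S by simp
  qed
qed

section \<open>Counting through the digit strings\<close>

text \<open>More than \<open>R\<close> deletions are never necessary, so the budget can be cut down
  to \<open>b\<close>. The padding is ignored after a successful path, by \<open>run_done\<close>,
  and is harmless elsewhere, as \<open>run_sound\<close> covers all strings.\<close>

lemma good_sol: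
  assumes b: "b = min d R"
  shows "sol E C {..<R} d \<longleftrightarrow> (\<exists>xs. length xs = b \<and> (\<forall>x\<in>set xs. x < 8) \<and> good E C R b (xs @ replicate (R - b) 7))"
proof
  assume "sol E C {..<R} d"
  then obtain X where X: "X \<subseteq> {..<R}" "card X \<le> d" "sc1 E ({..<R} - X) C" unfolding sol_def by blast
  have "card X \<le> R" using card_mono[OF _ X(1)] by simp
  then have "sol E C {..<R} b" unfolding sol_def b using X by auto
  then obtain xs where xs: "length xs = b" "\<forall>x\<in>set xs. x < 8" "\<not> ext E (fst (run E C xs ({..<R}, b))) C []"
    "sol E C (fst (run E C xs ({..<R}, b))) (snd (run E C xs ({..<R}, b)))"
    using run_complete[of "{..<R}" E C b] by auto
  then have "good E C R b (xs @ replicate (R - b) 7)"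
    by (simp add: good_def run_append run_done Let_def)
  then show "\<exists>xs. length xs = b \<and> (\<forall>x\<in>set xs. x < 8) \<and> good E C R b (xs @ replicate (R - b) 7)" using xs by blast
next
  assume "\<exists>xs. length xs = b \<and> (\<forall>x\<in>set xs. x < 8) \<and> good E C R b (xs @ replicate (R - b) 7)"
  then obtain xs where xs: "\<forall>x\<in>set xs. x < 8" "good E C R b (xs @ replicate (R - b) 7)" by blast
  have "\<forall>x\<in>set (xs @ replicate (R - b) 7). x < 8" using xs(1) by (auto dest: in_set_replicate[THEN iffD1])
  then have "sol E C {..<R} b"
    using run_sound[of "({..<R}, b)" "xs @ replicate (R - b) 7" E C] xs by (auto simp: good_def Let_def)
  then show "sol E C {..<R} d" unfolding sol_def b by auto
qed

text \<open>The digits after the first \<open>b\<close> are never used by a successful path.\<close>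

definition digs :: "nat \<Rightarrow> nat \<Rightarrow> nat \<Rightarrow> nat list" where
  "digs b R n = map (\<lambda>i. n div 8 ^ i mod 8) [0..<b] @ replicate (R - b) 7"

text \<open>Octal notation, by induction with the lowest digit split off.\<close>

lemma digit_sum:
  assumes "\<And>i. i < b \<Longrightarrow> D i < 8"
  shows "(\<Sum>i<b. D i * 8 ^ i) < 8 ^ b \<and> (\<forall>i<b. (\<Sum>i<b. D i * 8 ^ i) div 8 ^ i mod 8 = (D i :: nat))"
  using assms
proof (induction b arbitrary: D)
  case (Suc b)
  let ?S = "\<Sum>i<b. D (Suc i) * 8 ^ i"
  have e: "(\<Sum>i<Suc b. D i * 8 ^ i) = D 0 + 8 * ?S"
    by (simp add: sum.lessThan_Suc_shift sum_distrib_left mult.left_commute mult.assoc del: sum.lessThan_Suc)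
  have IH: "?S < 8 ^ b \<and> (\<forall>i<b. ?S div 8 ^ i mod 8 = D (Suc i))" by (rule Suc.IH) (use Suc.prems in auto)
  have D0: "D 0 < 8" using Suc.prems by simp
  have "(D 0 + 8 * ?S) div 8 ^ i mod 8 = D i" if "i < Suc b" for i
  proof (cases i)
    case 0
    then show ?thesis using D0 by simp
  next
    case (Suc k)
    have "(D 0 + 8 * ?S) div 8 ^ Suc k = ?S div 8 ^ k"
      using D0 by (simp add: div_mult2_eq)
    then show ?thesis using IH Suc that by simp
  qed
  moreover have "D 0 + 8 * ?S < 8 ^ Suc b" using IH D0 by simp
  ultimately show ?case unfolding e by blast
qed simp

lemma digs_surj:
  assumes "length xs = b" "\<forall>x\<in>set xs. x < 8"
  shows "\<exists>n<8 ^ b. digs b R n = xs @ replicate (R - b) 7"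
proof -
  have *: "xs ! i < 8" if "i < b" for i using assms that by simp
  have "map (\<lambda>i. (\<Sum>i<b. xs ! i * 8 ^ i) div 8 ^ i mod 8) [0..<b] = xs"
    by (rule nth_equalityI) (use assms(1) digit_sum[of b "\<lambda>i. xs ! i", OF *] in auto)
  then show ?thesis unfolding digs_def using digit_sum[of b "\<lambda>i. xs ! i", OF *] by auto
qed

section \<open>The odometer and the main loop\<close>

text \<open>Subtraction of one with the borrow in 35: a nonzero digit absorbs the borrow, a zero
  becomes 7 and passes it on. Only places marked in array 5 take part.\<close>

definition NEXTB where "NEXTB = CIf 35 (CSeq (CLoad 51 5 46) (CIf 51 (CSeq (CLoad 51 4 46)
  (CIf 51 (CSeq (CDec 51) (CSeq (CStore 4 46 51) (CConst 35 0))) (CSeq (CConst 51 7) (CStore 4 46 51)))) CSkip)) CSkip"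
definition NEXT where "NEXT = CSeq (CConst 35 1) (CSeq (CFor 46 55 0 NEXTB) (CIf 35 (CConst 39 0) CSkip))"

lemma next_frames:
  "aw NEXTB = {4}" "aw NEXT = {4}" "ok NEXTB" "ok NEXT" "wr NEXTB = {35, 51}" "wr NEXT = {35, 39, 46, 51, 55}"
  by (auto simp: NEXTB_def NEXT_def bnd_def)

lemma NEXT_spec:
  assumes m: "\<forall>i<reg s 0. arr s 5 i \<noteq> 0 \<longleftrightarrow> i < b" and b: "b \<le> reg s 0" and D: "\<forall>i<b. arr s 4 i < 8"
  defines "t \<equiv> sem NEXT s"
  shows "\<forall>i<b. arr t 4 i < 8" "\<forall>i\<ge>b. arr t 4 i = arr s 4 i"
    "(\<Sum>i<b. arr s 4 i * 8 ^ i) = Suc n \<Longrightarrow> (\<Sum>i<b. arr t 4 i * 8 ^ i) = n \<and> reg t 39 = reg s 39"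
    "(\<Sum>i<b. arr s 4 i * 8 ^ i) = 0 \<Longrightarrow> reg t 39 = 0"
proof -
  define s0 where "s0 = set_reg 35 1 s"
  define u where "u = sem (CFor 46 55 0 NEXTB) s0"
  let ?v = "\<lambda>k t. \<Sum>i<min k b. arr t 4 i * 8 ^ i"
  \<comment> \<open>The lowest places, plus one, equal their old value plus the borrow at its place
    value.\<close>
  let ?P = "\<lambda>k t. (reg t 35 = 0 \<or> reg t 35 = 1) \<and> ?v k t + 1 = ?v k s + reg t 35 * 8 ^ min k b \<and>
    (\<forall>i<b. arr t 4 i < 8) \<and> (\<forall>i. i \<ge> min k b \<longrightarrow> arr t 4 i = arr s 4 i)"
  have "?P (reg s0 0) u"
    unfolding u_def
  proof (rule for_rule[where P = ?P])
    fix k and t :: state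
    assume k: "k < reg s0 0" and P: "?P k t" and ti: "reg t 46 = k"
      and af: "\<And>a. a \<notin> aw NEXTB \<Longrightarrow> arr t a = arr s0 a"
    have a: "arr t 5 = arr s 5" using af[of 5] by (simp add: next_frames s0_def)
    have mk: "arr t 5 k \<noteq> 0 \<longleftrightarrow> k < b" using m k by (simp add: a s0_def)
    show "?P (Suc k) (sem NEXTB t)"
    proof (cases "k < b")
      case False
      then have "min (Suc k) b = b" "min k b = b" by auto
      moreover have "arr (sem NEXTB t) = arr t" "reg (sem NEXTB t) 35 = reg t 35" using mk False by (auto simp: NEXTB_def ti)
      ultimately show ?thesis using P by simp
    next
      case True
      then have k: "min (Suc k) b = Suc k" "min k b = k" by auto
      have tk: "arr t 4 k = arr s 4 k" using P k by simp
      have lo: "(\<Sum>i<k. ((arr t 4)(k := x)) i * 8 ^ i) = (\<Sum>i<k. arr t 4 i * 8 ^ i)" for x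
        by (rule sum.cong) auto
      have "reg t 35 = 0 \<or> reg t 35 = 1" using P by (rule conjunct1)
      then consider "reg t 35 = 0" | "reg t 35 = 1" "arr s 4 k \<noteq> 0" | "reg t 35 = 1" "arr s 4 k = 0" by fast
      then show ?thesis
      proof cases
        case 1
        then have "sem NEXTB t = t" by (simp add: NEXTB_def)
        then show ?thesis using 1 P tk unfolding k by simp
      next
        case 2
        then have e: "arr (sem NEXTB t) 4 = (arr t 4)(k := arr s 4 k - 1)" "reg (sem NEXTB t) 35 = 0"
          using mk True tk by (simp_all add: NEXTB_def ti)
        have "(arr s 4 k - 1) * 8 ^ k + 8 ^ k = arr s 4 k * 8 ^ k" using 2 by (simp add: diff_mult_distrib)
        moreover have "arr s 4 k - 1 < 8" using D True by (simp add: less_imp_diff_less)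
        ultimately show ?thesis using P 2 unfolding k e by (auto simp: lo)
      next
        case 3
        then have e: "arr (sem NEXTB t) 4 = (arr t 4)(k := 7)" "reg (sem NEXTB t) 35 = 1"
          using mk True tk by (simp_all add: NEXTB_def ti)
        show ?thesis using P 3 unfolding k e by (auto simp: lo)
      qed
    qed
  qed (use D in \<open>auto simp: next_frames s0_def\<close>)
  moreover have "min (reg s0 0) b = b" using b by (simp add: s0_def)
  ultimately have P: "reg u 35 = 0 \<or> reg u 35 = 1" "(\<Sum>i<b. arr u 4 i * 8 ^ i) + 1 = (\<Sum>i<b. arr s 4 i * 8 ^ i) + reg u 35 * 8 ^ b"
    "\<forall>i<b. arr u 4 i < 8" "\<forall>i\<ge>b. arr u 4 i = arr s 4 i" by simp_all
  have tu: "t = (if reg u 35 = 0 then u else set_reg 39 0 u)" by (simp add: t_def NEXT_def s0_def u_def)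
  have a: "arr t = arr u" by (simp add: tu)
  have ur: "reg u 39 = reg s 39" unfolding u_def by (subst sem_frame) (auto simp: next_frames s0_def)
  have lt: "(\<Sum>i<b. arr u 4 i * 8 ^ i) < 8 ^ b" using digit_sum[of b "arr u 4"] P(3) by blast
  show "\<forall>i<b. arr t 4 i < 8" "\<forall>i\<ge>b. arr t 4 i = arr s 4 i" using P(3,4) by (simp_all add: a)
  show "(\<Sum>i<b. arr t 4 i * 8 ^ i) = n \<and> reg t 39 = reg s 39" if "(\<Sum>i<b. arr s 4 i * 8 ^ i) = Suc n"
  proof -
    have "reg u 35 = 0"
    proof (rule ccontr)
      assume "reg u 35 \<noteq> 0"
      then have "reg u 35 = 1" using P(1) by simp
      then show False using P(2) lt that by simp
    qed
    then show ?thesis using P(2) that ur unfolding a by (simp add: tu)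
  qed
  show "reg t 39 = 0" if "(\<Sum>i<b. arr s 4 i * 8 ^ i) = 0"
  proof -
    have "reg u 35 \<noteq> 0"
    proof
      assume "reg u 35 = 0"
      then show False using P(2) unfolding that by simp
    qed
    then show ?thesis by (simp add: tu)
  qed
qed

text \<open>Counting register 2 down and 37 up while running over the rows computes the minimum of
  \<open>d\<close> and the number of rows without a loop of length \<open>d\<close>.\<close>

definition PREPB where "PREPB = CSeq (CConst 51 7) (CSeq (CStore 4 46 51) (CIf 2 (CSeq (CDec 2) (CSeq (CInc 37) (SET 5 46))) CSkip))"
definition PREP where "PREP = CSeq (CFor 46 55 0 PREPB) (CConst 39 1)"

lemma prep_frames:
  "aw PREPB = {4, 5}" "aw PREP = {4, 5}" "ok PREPB" "ok PREP" "wr PREPB = {2, 37, 51, 59}" "wr PREP = {2, 37, 39, 46, 51, 55, 59}"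
  by (auto simp: PREPB_def PREP_def bnd_def)

lemma PREP_spec:
  assumes "reg s 37 = 0" "arr s 5 = (\<lambda>_. 0)"
  defines "t \<equiv> sem PREP s"
  defines "b \<equiv> min (reg s 2) (reg s 0)"
  shows "\<forall>i<reg s 0. arr t 4 i = 7" "\<forall>i<reg s 0. arr t 5 i \<noteq> 0 \<longleftrightarrow> i < b" "reg t 37 = b" "reg t 39 = 1"
proof -
  let ?P = "\<lambda>k t. (\<forall>i<k. arr t 4 i = 7) \<and> (\<forall>i. arr t 5 i \<noteq> 0 \<longleftrightarrow> i < min (reg s 2) k) \<and> reg t 37 = min (reg s 2) k \<and> reg t 2 = reg s 2 - k"
  have P: "?P (reg s 0) (sem (CFor 46 55 0 PREPB) s)"
  proof (rule for_rule[where P = ?P])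
    fix k and t :: state
    assume P: "?P k t" and ti: "reg t 46 = k"
    show "?P (Suc k) (sem PREPB t)"
    proof (cases "reg s 2 \<le> k")
      case True
      then have "min (reg s 2) (Suc k) = min (reg s 2) k" by simp
      then show ?thesis using P True ti by (auto simp: PREPB_def less_Suc_eq)
    next
      case False
      then have "min (reg s 2) (Suc k) = Suc k" "min (reg s 2) k = k" by auto
      then show ?thesis using P False ti by (auto simp: PREPB_def less_Suc_eq)
    qed
  qed (use assms in \<open>auto simp: prep_frames\<close>)
  then show "\<forall>i<reg s 0. arr t 4 i = 7" "\<forall>i<reg s 0. arr t 5 i \<noteq> 0 \<longleftrightarrow> i < b" "reg t 37 = b" "reg t 39 = 1"
    unfolding t_def PREP_def b_def by auto
qed

definition BODY where "BODY = CSeq TRY NEXT"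
text \<open>The main loop may have exponentially many rounds, so it stays outside of
  \<open>com\<close>, where all running times are polynomial.\<close>

definition SOLVE :: prog where
  "SOLVE = Seq (compile PREP) (Seq (WhileNZ 39 (compile BODY)) (Move 0 33))"

lemma body_frames: "ok BODY" "aw BODY = {1, 2, 3, 4}" "x \<in> {0, 1, 37} \<Longrightarrow> x \<notin> wr BODY"
  using sim_frames(12)[of x] by (auto simp: BODY_def sim_frames next_frames)

definition cstate :: "state \<Rightarrow> nat \<Rightarrow> nat \<Rightarrow> nat \<Rightarrow> state \<Rightarrow> bool" where
  "cstate s B b n t \<longleftrightarrow> arr t 0 = arr s 0 \<and> reg t 0 = reg s 0 \<and> reg t 1 = reg s 1 \<and> reg t 37 = b \<and>
     (\<forall>i<reg s 0. arr t 5 i \<noteq> 0 \<longleftrightarrow> i < b) \<and> (\<forall>i<b. arr t 4 i < 8) \<and> (\<forall>i<reg s 0. i \<ge> b \<longrightarrow> arr t 4 i = 7) \<and>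
     (\<Sum>i<b. arr t 4 i * 8 ^ i) = n \<and> (\<forall>x. bnd x \<longrightarrow> reg t x \<le> B)"

lemma upto_digs:
  assumes "cstate s B b n t" "b \<le> reg s 0"
  shows "map (arr t 4) [0..<reg t 0] = digs b (reg s 0) n"
proof (rule nth_equalityI)
  fix i assume "i < length (map (arr t 4) [0..<reg t 0])"
  then show "map (arr t 4) [0..<reg t 0] ! i = digs b (reg s 0) n ! i"
    using assms digit_sum[of b "arr t 4"] by (auto simp: cstate_def digs_def nth_append)
qed (use assms in \<open>auto simp: cstate_def digs_def\<close>)

lemma loop:
  assumes "cstate s B b n t" "b \<le> reg s 0" "reg t 39 = 1" "reg t 33 = of_bool Q"
  shows "\<exists>T t'. exec (WhileNZ 39 (compile BODY)) t T t' \<and> T \<le> Suc n * (tm BODY B + 1) + 1 \<and>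
    reg t' 33 = of_bool (Q \<or> (\<exists>m\<le>n. good (EE s) (reg s 1) (reg s 0) b (digs b (reg s 0) m)))"
  using assms
proof (induction n arbitrary: t Q rule: less_induct)
  case (less n)
  note I = less.prems(1)[unfolded cstate_def]
  let ?g = "\<lambda>m. good (EE s) (reg s 1) (reg s 0) b (digs b (reg s 0) m)"
  define t1 where "t1 = sem TRY t"
  define t2 where "t2 = sem NEXT t1"
  have BD: "sem BODY t = t2" by (simp add: BODY_def t1_def t2_def)
  have "(\<exists>T\<le>tm BODY B. exec (compile BODY) t T t2) \<and> (\<forall>x. bnd x \<longrightarrow> reg t2 x \<le> B)"
    unfolding BD[symmetric] by (rule sem_exec[OF body_frames(1)]) (use I in blast)
  then obtain T where T: "T \<le> tm BODY B" "exec (compile BODY) t T t2" and bd: "\<forall>x. bnd x \<longrightarrow> reg t2 x \<le> B" by blast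
  have "\<forall>i<reg t 0. arr t 4 i < 8"
  proof (intro allI impI)
    fix i assume "i < reg t 0" then show "arr t 4 i < 8" using I by (cases "i < b") auto
  qed
  from TRY_spec[OF this] have g: "reg t1 33 = of_bool (Q \<or> ?g n)"
    unfolding upto_digs[OF less.prems(1,2)] using I less.prems(4) by (simp add: t1_def)
  have r1: "reg t1 x = reg t x" if "x \<in> {0, 1, 37, 39}" for x
    unfolding t1_def by (rule sem_frame) (use that sim_frames(12)[of x] in auto)
  have a1: "arr t1 a = arr t a" if "a \<in> {0, 4, 5}" for a
    unfolding t1_def by (rule sem_aframe) (use that in \<open>auto simp: sim_frames\<close>)
  have r2: "reg t2 x = reg t x" if "x \<in> {0, 1, 37}" for x
    unfolding BD[symmetric] by (rule sem_frame) (use that body_frames(3)[of x] in auto)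
  have a2: "arr t2 a = arr t a" if "a \<in> {0, 5}" for a
    unfolding BD[symmetric] by (rule sem_aframe) (use that in \<open>auto simp: body_frames\<close>)
  have g2: "reg t2 33 = of_bool (Q \<or> ?g n)" unfolding t2_def g[symmetric] by (rule sem_frame) (simp add: next_frames)
  have N: "\<forall>i<reg t1 0. arr t1 5 i \<noteq> 0 \<longleftrightarrow> i < b" "b \<le> reg t1 0" "\<forall>i<b. arr t1 4 i < 8"
    using I less.prems(2) r1[of 0] a1[of 4] a1[of 5] by auto
  note N2 = NEXT_spec[OF N, folded t2_def]
  have s1: "(\<Sum>i<b. arr t1 4 i * 8 ^ i) = n" using I a1[of 4] by simp
  have go: "exec (WhileNZ 39 (compile BODY)) t (1 + T + u) t'" if "exec (WhileNZ 39 (compile BODY)) t2 u t'" for u t'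
    by (rule exec.While_nonzero[OF _ T(2) that]) (use less.prems(3) in simp)
  show ?case
  proof (cases n)
    case 0
    then have "reg t2 39 = 0" using N2(4) s1 by simp
    from go[OF exec.While_zero[OF this, of "compile BODY"]] show ?thesis
      using T(1) g2 0 by (intro exI[of _ "1 + T + 1"] exI[of _ t2]) simp
  next
    case (Suc m)
    have s2: "(\<Sum>i<b. arr t2 4 i * 8 ^ i) = m \<and> reg t2 39 = 1" using N2(3)[of m] s1 Suc r1[of 39] less.prems(3) by simp
    have "cstate s B b m t2"
      unfolding cstate_def using I r2[of 0] r2[of 1] r2[of 37] a2[of 0] a2[of 5] N2(1,2) a1[of 4] s2 bd by auto
    from less.IH[OF _ this less.prems(2) _ g2] s2 Suc obtain u t' where
      u: "exec (WhileNZ 39 (compile BODY)) t2 u t'" "u \<le> Suc m * (tm BODY B + 1) + 1"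
        "reg t' 33 = of_bool ((Q \<or> ?g n) \<or> (\<exists>i\<le>m. ?g i))" by auto
    have "1 + T + u \<le> Suc n * (tm BODY B + 1) + 1" using u(2) T(1) Suc by simp
    moreover have "((Q \<or> ?g n) \<or> (\<exists>i\<le>m. ?g i)) \<longleftrightarrow> Q \<or> (\<exists>i\<le>n. ?g i)" using Suc by (auto simp: le_Suc_eq)
    ultimately show ?thesis using go[OF u(1)] u(3) by (intro exI[of _ "1 + T + u"] exI[of _ t'] conjI) simp_all
  qed
qed

theorem SOLVE_spec:
  assumes "reg s 37 = 0" "reg s 33 = 0" "arr s 5 = (\<lambda>_. 0)" "\<forall>x. bnd x \<longrightarrow> reg s x \<le> B"
  shows "\<exists>T t. exec SOLVE s T t \<and> T \<le> 8 ^ reg s 2 * (tm BODY B + tm PREP B + 3) \<and>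
    reg t 0 = of_bool (sol (EE s) (reg s 1) {..<reg s 0} (reg s 2))"
proof -
  define b where "b = min (reg s 2) (reg s 0)"
  define t where "t = sem PREP s"
  let ?g = "\<lambda>m. good (EE s) (reg s 1) (reg s 0) b (digs b (reg s 0) m)"
  note P = PREP_spec[OF assms(1,3), folded t_def b_def]
  have "(\<exists>T\<le>tm PREP B. exec (compile PREP) s T t) \<and> (\<forall>x. bnd x \<longrightarrow> reg t x \<le> B)"
    unfolding t_def by (rule sem_exec[OF prep_frames(4)]) (use assms(4) in blast)
  then obtain T0 where T0: "T0 \<le> tm PREP B" "exec (compile PREP) s T0 t" and bd: "\<forall>x. bnd x \<longrightarrow> reg t x \<le> B" by blast
  have r: "reg t 0 = reg s 0" "reg t 1 = reg s 1" "reg t 33 = 0" and a: "arr t 0 = arr s 0"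
    unfolding t_def by (simp_all add: sem_frame sem_aframe prep_frames assms(2))
  have b: "b \<le> reg s 0" by (simp add: b_def)
  have full: "Suc (\<Sum>i<k. 7 * 8 ^ i) = (8 :: nat) ^ k" for k by (induction k) auto
  \<comment> \<open>The starting value of the odometer: all digits are 7.\<close>
  define n where "n = (\<Sum>i<b. 7 * (8::nat) ^ i)"
  have n: "Suc n = 8 ^ b" unfolding n_def by (rule full)
  have s: "(\<Sum>i<b. arr t 4 i * 8 ^ i) = n" unfolding n_def by (rule sum.cong) (use P(1) b in auto)
  have "cstate s B b n t" unfolding cstate_def using r a P s b bd by auto
  from loop[OF this b P(4), of False] r obtain T t' where
    T: "exec (WhileNZ 39 (compile BODY)) t T t'" "T \<le> Suc n * (tm BODY B + 1) + 1" "reg t' 33 = of_bool (\<exists>m\<le>n. ?g m)"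
    by auto
  have "exec SOLVE s (T0 + (T + 1)) (set_reg 0 (reg t' 33) t')"
    unfolding SOLVE_def by (rule exec.Seq[OF T0(2) exec.Seq[OF T(1) exec.Move]])
  moreover have "T0 + (T + 1) \<le> 8 ^ reg s 2 * (tm BODY B + tm PREP B + 3)"
  proof -
    have le: "Suc n \<le> 8 ^ reg s 2" unfolding n b_def by (rule power_increasing) auto
    have "T0 + (T + 1) \<le> Suc n * (tm BODY B + 1) + (tm PREP B + 2)" using T0(1) T(2) by simp
    also have "\<dots> \<le> 8 ^ reg s 2 * (tm BODY B + 1) + 8 ^ reg s 2 * (tm PREP B + 2)"
      by (intro add_mono mult_le_mono1 le) (use mult_le_mono1[of 1 "8 ^ reg s 2" "tm PREP B + 2"] in simp)
    finally show ?thesis by (simp add: algebra_simps)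
  qed
  moreover have "(\<exists>m\<le>n. ?g m) \<longleftrightarrow> sol (EE s) (reg s 1) {..<reg s 0} (reg s 2)"
  proof
    assume "\<exists>m\<le>n. ?g m"
    then obtain m where m: "?g m" by blast
    show "sol (EE s) (reg s 1) {..<reg s 0} (reg s 2)" unfolding good_sol[OF b_def]
      by (rule exI[of _ "map (\<lambda>i. m div 8 ^ i mod 8) [0..<b]"]) (use m in \<open>auto simp: digs_def\<close>)
  next
    assume "sol (EE s) (reg s 1) {..<reg s 0} (reg s 2)"
    then obtain xs where xs: "length xs = b" "\<forall>x\<in>set xs. x < 8" "good (EE s) (reg s 1) (reg s 0) b (xs @ replicate (reg s 0 - b) 7)"
      unfolding good_sol[OF b_def] by blast
    obtain m where m: "m < 8 ^ b" "digs b (reg s 0) m = xs @ replicate (reg s 0 - b) 7" using digs_surj[OF xs(1,2)] by blast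
    have "m \<le> n" using m(1) n by linarith
    then show "\<exists>m\<le>n. ?g m" using xs(3) m(2) by auto
  qed
  ultimately show ?thesis using T(3) by (intro exI[of _ "T0 + (T + 1)"] exI[of _ "set_reg 0 (reg t' 33) t'"]) simp
qed

section \<open>The problem d-SC1S-R\<close>

text \<open>A permutation of the columns and a linear order on them are the same thing; the position of a
  column is the number of smaller columns.\<close>

lemma c1p_permutes:
  fixes n :: nat
  shows "c1p F R {..<n} \<longleftrightarrow> (\<exists>p. p permutes {..<n} \<and>
     (\<forall>r\<in>R. \<forall>a b c. a < b \<and> b < c \<and> c < n \<and> F r (p a) \<and> F r (p c) \<longrightarrow> F r (p b)))"
proof
  assume "c1p F R {..<n}"
  then obtain lt where lt: "linord {..<n} lt" "cvx F R {..<n} lt" unfolding c1p_def by blast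
  define f where "f x = (if x < n then card {y. y < n \<and> lt y x} else x)" for x
  have mono: "f x < f y" if "x < n" "y < n" "lt x y" for x y
  proof -
    have "{z. z < n \<and> lt z x} \<subset> {z. z < n \<and> lt z y}"
    proof (rule psubsetI)
      show "{z. z < n \<and> lt z x} \<subseteq> {z. z < n \<and> lt z y}"
      proof
        fix z assume "z \<in> {z. z < n \<and> lt z x}"
        then show "z \<in> {z. z < n \<and> lt z y}" using linord_trans[OF lt(1), of z x y] that by simp
      qed
      have "x \<in> {z. z < n \<and> lt z y}" "x \<notin> {z. z < n \<and> lt z x}" using linord_irrefl[OF lt(1), of x] that by auto
      then show "{z. z < n \<and> lt z x} \<noteq> {z. z < n \<and> lt z y}" by blast
    qed
    then have "card {z. z < n \<and> lt z x} < card {z. z < n \<and> lt z y}" by (intro psubset_card_mono) auto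
    then show ?thesis using that by (simp add: f_def)
  qed
  have inj: "inj_on f {..<n}"
  proof (rule inj_onI)
    fix x y assume "x \<in> {..<n}" "y \<in> {..<n}" "f x = f y"
    then show "x = y" using linord_total[OF lt(1), of x y] mono[of x y] mono[of y x] by force
  qed
  have "f ` {..<n} \<subseteq> {..<n}"
  proof
    fix y assume "y \<in> f ` {..<n}"
    then obtain x where x: "x < n" "y = f x" by auto
    have "{z. z < n \<and> lt z x} \<subset> {..<n}" using x linord_irrefl[OF lt(1), of x] by auto
    then have "card {z. z < n \<and> lt z x} < card {..<n}" by (intro psubset_card_mono) auto
    then show "y \<in> {..<n}" using x by (simp add: f_def)
  qed
  then have "bij_betw f {..<n} {..<n}" using inj endo_inj_surj[of "{..<n}" f] by (simp add: bij_betw_def)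
  then have f: "f permutes {..<n}" by (rule bij_imp_permutes) (simp add: f_def)
  let ?p = "Hilbert_Choice.inv f"
  have p: "?p permutes {..<n}" by (rule permutes_inv[OF f])
  have pn: "?p a < n" if "a < n" for a using permutes_in_image[OF p, of a] that by simp
  have lt_p: "lt (?p a) (?p b)" if "a < b" "b < n" for a b
  proof -
    have fp: "f (?p a) = a" "f (?p b) = b" using permutes_inverses(1)[OF f] by auto
    then have "?p a \<noteq> ?p b" "\<not> lt (?p b) (?p a)" using that mono[of "?p b" "?p a"] pn[of a] pn[of b] by auto
    then show ?thesis using linord_total[OF lt(1), of "?p a" "?p b"] pn[of a] pn[of b] that by auto
  qed
  have "F r (?p b)" if "r \<in> R" "a < b" "b < c" "c < n" "F r (?p a)" "F r (?p c)" for r a b c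
    using cvxD[OF lt(2) that(1), of "?p a" "?p b" "?p c"] lt_p[of a b] lt_p[of b c] pn that by simp
  then show "\<exists>p. p permutes {..<n} \<and> (\<forall>r\<in>R. \<forall>a b c. a < b \<and> b < c \<and> c < n \<and> F r (p a) \<and> F r (p c) \<longrightarrow> F r (p b))"
    using p by blast
next
  assume "\<exists>p. p permutes {..<n} \<and> (\<forall>r\<in>R. \<forall>a b c. a < b \<and> b < c \<and> c < n \<and> F r (p a) \<and> F r (p c) \<longrightarrow> F r (p b))"
  then obtain p where p: "p permutes {..<n}"
    and c: "\<And>r a b c. r \<in> R \<Longrightarrow> a < b \<Longrightarrow> b < c \<Longrightarrow> c < n \<Longrightarrow> F r (p a) \<Longrightarrow> F r (p c) \<Longrightarrow> F r (p b)" by blast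
  let ?q = "Hilbert_Choice.inv p"
  have q: "?q permutes {..<n}" by (rule permutes_inv[OF p])
  have qn: "?q a < n" if "a < n" for a using permutes_in_image[OF q, of a] that by simp
  have pq: "p (?q x) = x" for x using permutes_inverses(1)[OF p] .
  have "linord {..<n} (\<lambda>x y. ?q x < ?q y)"
    unfolding linord_def
  proof (intro conjI ballI impI)
    fix a b :: nat assume "a \<noteq> b"
    then have "?q a \<noteq> ?q b" using pq[of a] pq[of b] by metis
    then show "?q a < ?q b \<or> ?q b < ?q a" by auto
  qed auto
  moreover have "cvx F R {..<n} (\<lambda>x y. ?q x < ?q y)"
    unfolding cvx_def
  proof (intro ballI impI)
    fix r x y z assume "r \<in> R" "z \<in> {..<n}" "?q x < ?q y" "?q y < ?q z" "F r x" "F r z"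
    then show "F r y" using c[of r "?q x" "?q y" "?q z"] qn[of z] by (simp add: pq)
  qed
  ultimately show "c1p F R {..<n}" unfolding c1p_def by blast
qed

lemma C1P_rows_c1p: "C1P_rows N \<longleftrightarrow> c1p (\<lambda>i j. N $$ (i, j)) {..<dim_row N} {..<dim_col N}"
proof -
  have "ones_consecutive (row (permute_cols p N) i) \<longleftrightarrow>
    (\<forall>a b c. a < b \<and> b < c \<and> c < dim_col N \<and> N $$ (i, p a) \<and> N $$ (i, p c) \<longrightarrow> N $$ (i, p b))"
    if i: "i < dim_row N" for p i
  proof -
    have d: "dim_vec (row (permute_cols p N) i) = dim_col N" by (simp add: permute_cols_def)
    have e: "row (permute_cols p N) i $ x = N $$ (i, p x)" if "x < dim_col N" for x
      using that i by (simp add: permute_cols_def)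
    show ?thesis unfolding ones_consecutive_def d
    proof (intro iff_allI)
      fix a b c
      show "(a < b \<and> b < c \<and> c < dim_col N \<and> row (permute_cols p N) i $ a \<and> row (permute_cols p N) i $ c \<longrightarrow>
          row (permute_cols p N) i $ b) =
        (a < b \<and> b < c \<and> c < dim_col N \<and> N $$ (i, p a) \<and> N $$ (i, p c) \<longrightarrow> N $$ (i, p b))"
        using e[of a] e[of b] e[of c] by (cases "a < b \<and> b < c \<and> c < dim_col N") auto
    qed
  qed
  then show ?thesis unfolding C1P_rows_def c1p_permutes by (simp add: Ball_def)
qed

lemma C1P_cols_c1p: "C1P_cols N \<longleftrightarrow> c1p (\<lambda>j i. N $$ (i, j)) {..<dim_col N} {..<dim_row N}"
proof -
  have "ones_consecutive (col (permute_rows p N) j) \<longleftrightarrow>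
    (\<forall>a b c. a < b \<and> b < c \<and> c < dim_row N \<and> N $$ (p a, j) \<and> N $$ (p c, j) \<longrightarrow> N $$ (p b, j))"
    if j: "j < dim_col N" for p j
  proof -
    have d: "dim_vec (col (permute_rows p N) j) = dim_row N" by (simp add: permute_rows_def)
    have e: "col (permute_rows p N) j $ x = N $$ (p x, j)" if "x < dim_row N" for x
      using that j by (simp add: permute_rows_def)
    show ?thesis unfolding ones_consecutive_def d
    proof (intro iff_allI)
      fix a b c
      show "(a < b \<and> b < c \<and> c < dim_row N \<and> col (permute_rows p N) j $ a \<and> col (permute_rows p N) j $ c \<longrightarrow>
          col (permute_rows p N) j $ b) =
        (a < b \<and> b < c \<and> c < dim_row N \<and> N $$ (p a, j) \<and> N $$ (p c, j) \<longrightarrow> N $$ (p b, j))"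
        using e[of a] e[of b] e[of c] by (cases "a < b \<and> b < c \<and> c < dim_row N") auto
    qed
  qed
  then show ?thesis unfolding C1P_cols_def c1p_permutes by (simp add: Ball_def)
qed

text \<open>\<open>c1p_select\<close> is used twice, along the maps and along right inverses of
  them.\<close>

lemma c1p_reindex:
  fixes \<kappa> :: "nat \<Rightarrow> nat"
  shows "c1p (\<lambda>i j. E (\<rho> i) (\<kappa> j)) I J \<longleftrightarrow> c1p E (\<rho> ` I) (\<kappa> ` J)"
proof
  let ?f = "inv_into I \<rho>" and ?g = "inv_into J \<kappa>"
  assume "c1p (\<lambda>i j. E (\<rho> i) (\<kappa> j)) I J"
  then have "c1p (\<lambda>r c. E (\<rho> (?f r)) (\<kappa> (?g c))) (\<rho> ` I) (\<kappa> ` J)"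
    by (rule c1p_select) (auto intro: inv_into_into)
  moreover have "c1p (\<lambda>r c. E (\<rho> (?f r)) (\<kappa> (?g c))) (\<rho> ` I) (\<kappa> ` J) = c1p E (\<rho> ` I) (\<kappa> ` J)"
    by (rule c1p_cong) (simp add: f_inv_into_f)
  ultimately show "c1p E (\<rho> ` I) (\<kappa> ` J)" by simp
qed (rule c1p_select, assumption, auto)

text \<open>\<open>pick A\<close> enumerates \<open>A\<close> in increasing order, so
  \<open>a\<close> stands at the number of smaller elements.\<close>

lemma pick_image: "finite A \<Longrightarrow> pick A ` {..<card A} = A"
proof
  assume A: "finite A"
  show "pick A ` {..<card A} \<subseteq> A" using pick_in_set[of _ A] by auto
  show "A \<subseteq> pick A ` {..<card A}"
  proof
    fix a assume a: "a \<in> A"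
    have "{x \<in> A. x < a} \<subset> A" using a by auto
    then have "card {x \<in> A. x < a} < card A" using A by (rule psubset_card_mono[rotated])
    then show "a \<in> pick A ` {..<card A}" using pick_card_in_set[OF a] by (intro image_eqI[of a _ "card {x \<in> A. x < a}"]) simp_all
  qed
qed

text \<open>\<open>submatrix\<close> renumbers the remaining rows, which consecutive orders do not
  notice.\<close>

lemma SC1P_delete_rows:
  "SC1P (delete_rows M D) \<longleftrightarrow> sc1 (\<lambda>r c. M $$ (r, c)) ({..<dim_row M} - D) (dim_col M)"
proof -
  let ?A = "{..<dim_row M} - D" and ?C = "{..<dim_col M}"
  let ?N = "delete_rows M D"
  have e: "{i. i < dim_row M \<and> i \<in> ?A} = ?A" "{j. j < dim_col M \<and> j \<in> ?C} = ?C" by auto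
  have d: "dim_row ?N = card ?A" "dim_col ?N = card ?C"
    unfolding delete_rows_def dim_submatrix e by (rule refl)+
  have ent: "?N $$ (i, j) = M $$ (pick ?A i, pick ?C j)" if "i < card ?A" "j < card ?C" for i j
    using submatrix_index[of i M ?A j ?C, unfolded e, OF that] by (simp only: delete_rows_def)
  have 1: "C1P_rows ?N \<longleftrightarrow> c1p (\<lambda>r c. M $$ (r, c)) ?A ?C"
  proof -
    have "C1P_rows ?N \<longleftrightarrow> c1p (\<lambda>i j. M $$ (pick ?A i, pick ?C j)) {..<card ?A} {..<card ?C}"
      unfolding C1P_rows_c1p d by (rule c1p_cong) (simp add: ent)
    also have "\<dots> \<longleftrightarrow> c1p (\<lambda>r c. M $$ (r, c)) (pick ?A ` {..<card ?A}) (pick ?C ` {..<card ?C})" by (rule c1p_reindex)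
    finally show ?thesis by (simp only: pick_image finite_Diff finite_lessThan)
  qed
  have 2: "C1P_cols ?N \<longleftrightarrow> c1p (\<lambda>c r. M $$ (r, c)) ?C ?A"
  proof -
    have "C1P_cols ?N \<longleftrightarrow> c1p (\<lambda>j i. M $$ (pick ?A i, pick ?C j)) {..<card ?C} {..<card ?A}"
      unfolding C1P_cols_c1p d by (rule c1p_cong) (simp add: ent)
    also have "\<dots> \<longleftrightarrow> c1p (\<lambda>c r. M $$ (r, c)) (pick ?C ` {..<card ?C}) (pick ?A ` {..<card ?A})"
      by (rule c1p_reindex[of "\<lambda>c r. M $$ (r, c)"])
    finally show ?thesis by (simp only: pick_image finite_Diff finite_lessThan)
  qed
  show ?thesis unfolding SC1P_def sc1_def 1 2 ..
qed

lemma sc1_cong: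
  assumes "\<And>r c. r \<in> A \<Longrightarrow> c < C \<Longrightarrow> E r c = E' r c"
  shows "sc1 E A C = sc1 E' A C"
  unfolding sc1_def using assms c1p_cong[of A "{..<C}" E E'] c1p_cong[of "{..<C}" A "\<lambda>c r. E r c" "\<lambda>c r. E' r c"] by auto

theorem solvable_SC1S_R: "solvable_in_Ostar SC1S_R (\<lambda>d. 8 ^ d)"
proof -
  obtain p1 p2 :: "nat poly" where p: "\<forall>B. tm BODY B = poly p1 B" "\<forall>B. tm PREP B = poly p2 B"
    using tm_poly[of BODY] tm_poly[of PREP] by blast
  have "\<exists>T t. exec SOLVE (input_state SC1S_R (M, d)) T t \<and>
      reg t 0 = of_bool (yes_instance SC1S_R (M, d)) \<and>
      T \<le> 8 ^ parameter SC1S_R (M, d) * poly (p1 + p2 + [:3:]) (input_size SC1S_R (M, d))" for M d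
  proof -
    define s where "s = input_state SC1S_R (M, d)"
    define B where "B = input_size SC1S_R (M, d)"
    let ?R = "dim_row M" and ?C = "dim_col M"
    have r: "reg s 0 = ?R" "reg s 1 = ?C" "reg s 2 = d" "reg s 37 = 0" "reg s 33 = 0" and a: "arr s 5 = (\<lambda>_. 0)"
      by (simp_all add: s_def SC1S_R_def)
    \<comment> \<open>Only \<open>d\<close> may exceed the input size, which counts its digits, and
      \<open>bnd\<close> leaves out register 2.\<close>
    have bd: "\<forall>x. bnd x \<longrightarrow> reg s x \<le> B"
      by (auto simp: s_def B_def SC1S_R_def bnd_def)
    obtain T t where T: "exec SOLVE s T t" "T \<le> 8 ^ d * (tm BODY B + tm PREP B + 3)"
      "reg t 0 = of_bool (sol (EE s) ?C {..<?R} d)"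
      using SOLVE_spec[OF r(4,5) a bd] unfolding r by blast
    have E: "EE s i j = M $$ (i, j)" if "i < ?R" "j < ?C" for i j
    proof -
      have "i * ?C + j < Suc i * ?C" using that by simp
      also have "\<dots> \<le> ?R * ?C" using that by (intro mult_le_mono1) simp
      finally have "i * ?C + j < ?R * ?C" .
      then show ?thesis using that unfolding EM_def r(2) by (simp add: s_def SC1S_R_def)
    qed
    have y: "sol (EE s) ?C {..<?R} d \<longleftrightarrow> yes_instance SC1S_R (M, d)"
    proof -
      have "sc1 (EE s) ({..<?R} - X) ?C = SC1P (delete_rows M X)" for X
        unfolding SC1P_delete_rows by (rule sc1_cong) (simp add: E)
      then show ?thesis by (simp add: sol_def SC1S_R_def)
    qed
    have par: "parameter SC1S_R (M, d) = d" by (simp add: SC1S_R_def)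
    have pol: "tm BODY B + tm PREP B + 3 = poly (p1 + p2 + [:3:]) B" using p by simp
    show ?thesis unfolding par s_def[symmetric] B_def[symmetric] using T unfolding y pol by blast
  qed
  then show ?thesis unfolding solvable_in_Ostar_def by (intro exI[of _ SOLVE] exI[of _ "p1 + p2 + [:3:]"]) auto
qed

section \<open>Computability of the exponential factor\<close>

primrec INCS :: "nat \<Rightarrow> prog" where
  "INCS 0 = Skip"
| "INCS (Suc k) = Seq (Inc 2) (INCS k)"

lemma exec_INCS: "\<exists>t. exec (INCS k) s t (set_reg 2 (reg s 2 + k) s)"
proof (induction k arbitrary: s)
  case 0
  then show ?case using exec.Skip[of s] by (auto simp: set_reg_def)
next
  case (Suc k)
  obtain t where "exec (INCS k) (set_reg 2 (reg s 2 + 1) s) t (set_reg 2 (reg s 2 + Suc k) s)"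
    using Suc[of "set_reg 2 (reg s 2 + 1) s"] by (auto simp: set_reg_def One_nat_def)
  then show ?case using exec.Seq[OF exec.Inc[of 2 s]] unfolding INCS.simps by blast
qed

lemma exec_times8: "\<exists>t s'. exec (WhileNZ 1 (Seq (Dec 1) (INCS 8))) s t s' \<and> reg s' 0 = reg s 0 \<and> reg s' 1 = 0 \<and>
    reg s' 2 = reg s 2 + 8 * reg s 1"
proof (induction "reg s 1" arbitrary: s)
  case 0
  then show ?case using exec.While_zero[of s 1] by auto
next
  case (Suc m)
  let ?u = "set_reg 1 (reg s 1 - 1) s"
  let ?v = "set_reg 2 (reg s 2 + 8) ?u"
  obtain t where "exec (INCS 8) ?u t ?v" using exec_INCS[of 8 ?u] by auto
  then have b: "exec (Seq (Dec 1) (INCS 8)) s (1 + t) ?v" using exec.Seq[OF exec.Dec[of 1 s]] by blast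
  have "m = reg ?v 1" using Suc(2)[symmetric] by simp
  from Suc(1)[OF this] obtain t' s' where w: "exec (WhileNZ 1 (Seq (Dec 1) (INCS 8))) ?v t' s'" "reg s' 0 = reg ?v 0" "reg s' 1 = 0"
    "reg s' 2 = reg ?v 2 + 8 * reg ?v 1" by blast
  have "reg s 1 \<noteq> 0" using Suc(2) by simp
  from exec.While_nonzero[OF this b w(1)] show ?case using w(2-4) Suc(2)[symmetric] by (intro exI[of _ "1 + (1 + t) + t'"] exI[of _ s']) simp
qed

lemma exec_power8:
  defines "P \<equiv> Seq (Dec 0) (Seq (Const 2 0) (Seq (WhileNZ 1 (Seq (Dec 1) (INCS 8))) (Move 1 2)))"
  shows "\<exists>t s'. exec (WhileNZ 0 P) s t s' \<and> reg s' 1 = reg s 1 * 8 ^ reg s 0"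
proof (induction "reg s 0" arbitrary: s)
  case 0
  then show ?case using exec.While_zero[of s 0 P] by auto
next
  case (Suc m)
  let ?u = "set_reg 2 0 (set_reg 0 (reg s 0 - 1) s)"
  obtain t v where v: "exec (WhileNZ 1 (Seq (Dec 1) (INCS 8))) ?u t v" "reg v 0 = m" "reg v 2 = 8 * reg s 1"
    using exec_times8[of ?u] Suc(2) by auto
  let ?w = "set_reg 1 (reg v 2) v"
  have b: "exec P s (1 + (1 + (t + 1))) ?w"
    unfolding P_def by (rule exec.Seq[OF exec.Dec exec.Seq[OF exec.Const exec.Seq[OF v(1) exec.Move]]])
  obtain t' s' where w: "exec (WhileNZ 0 P) ?w t' s'" "reg s' 1 = reg ?w 1 * 8 ^ reg ?w 0"
    using Suc(1)[of ?w] v(2) by auto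
  have "reg s 0 \<noteq> 0" using Suc(2) by simp
  from exec.While_nonzero[OF this b w(1)] show ?case
    using w(2) v Suc(2)[symmetric] by (intro exI[of _ "1 + (1 + (1 + (t + 1))) + t'"] exI[of _ s']) (auto simp: mult.assoc)
qed

lemma computable_power8: "computable (\<lambda>d. 8 ^ d)"
proof -
  let ?P = "WhileNZ 0 (Seq (Dec 0) (Seq (Const 2 0) (Seq (WhileNZ 1 (Seq (Dec 1) (INCS 8))) (Move 1 2))))"
  have "\<exists>t s'. exec (Seq (Const 1 1) (Seq ?P (Move 0 1))) \<lparr>reg = (\<lambda>_. 0)(0 := d), arr = (\<lambda>_ _. 0)\<rparr> t s' \<and> reg s' 0 = 8 ^ d" for d
  proof -
    let ?s = "\<lparr>reg = (\<lambda>_. 0)(0 := d), arr = (\<lambda>_ _. 0)\<rparr>"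
    obtain t u where u: "exec ?P (set_reg 1 1 ?s) t u" "reg u 1 = 8 ^ d"
      using exec_power8[of "set_reg 1 1 ?s"] by auto
    from exec.Seq[OF exec.Const exec.Seq[OF u(1) exec.Move[of 0 1]]] show ?thesis
      using u(2) by (intro exI conjI) (assumption, simp)
  qed
  then show ?thesis unfolding computable_def by blast
qed

theorem theorem7:
  shows "fixed_parameter_tractable SC1S_R \<and> solvable_in_Ostar SC1S_R (\<lambda>d. 8 ^ d)"
  using solvable_SC1S_R computable_power8 unfolding fixed_parameter_tractable_def by blast

end
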